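(* Let $d\ge 2$, $s\in(0,d)$, and let $\Omega:\mathbb{R}^d\to\mathbb{R}^d$, $\Omega(x)=x$, be the Riesz kernel. Suppose that $\mu$ is a measure on $\mathbb{R}^d$ with $\overline{D}_{\mu,s}(x)<\infty$ for $\mu$-almost every $x\in\mathbb{R}^d$. Then $\Omega$ has small local $s$-action with respect to $\mu$ if and only if one of the following holds: (1) $s\notin\mathbb{Z}$ and $\mu$ has zero density, i.e. $\overline{D}_{\mu,s}(x)=0$ for $\mu$-almost every $x\in\mathbb{R}^d$; (2) $s\in\mathbb{Z}$ and $\lim_{r\to0}\alpha^{\mathrm{flat}}_{\mu,s}(B(x,r))=0$ for $\mu$-almost every $x\in\mathbb{R}^d$.
   Context: Measures are non-negative, locally finite Borel measures on $\mathbb{R}^d$; $B(x,r)$ is the open ball; $\overline{D}_{\mu,s}(x)=\limsup_{r\to0}\mu(B(x,r))/r^s$. Small local action: fix a family of Lipschitz functions $\eta^\tau:[0,\infty)\to\mathbb{R}$, $\tau\in(0,1)$, with $\eta^\tau(t)=1$ for $0\le t\le 1-\tau$, $\eta^\tau(t)=0$ for $t\ge1$, and Lipschitz constant at most $1/\tau$. The kernel $\Omega$ has small local $s$-action with respect to $\mu$ if for every $\tau\in(0,1)$, $$\lim_{r\to0}\frac{1}{r^{s+1}}\int_{\mathbb{R}^d}\Omega(x-y)\,\eta^\tau\Bigl(\frac{|x-y|}{r}\Bigr)\,d\mu(y)=0\quad\text{for }\mu\text{-almost every }x\in\mathbb{R}^d.$$ Flat transportation numbers (for $s\in\mathbb{Z}$):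 fix a smooth function $\varphi:[0,\infty)\to[0,1]$ with $\varphi\equiv1$ on $[0,3]$ and $\operatorname{supp}\varphi$ a compact subset of $[0,4)$. Let $\mathcal{G}(s,d)$ be the collection of $s$-dimensional linear subspaces of $\mathbb{R}^d$, let $\mathcal{H}^s_{x+L}$ denote $s$-dimensional Hausdorff measure restricted to $x+L$, and let $\mathrm{Lip}_0(B(x,4r))$ be the real-valued Lipschitz functions supported in a compact subset of $B(x,4r)$, with $\|f\|_{\mathrm{Lip}}$ the Lipschitz constant of $f$ on $\mathbb{R}^d$. Then $$\alpha^{\mathrm{flat}}_{\mu,s}(B(x,r))=\inf_{L\in\mathcal{G}(s,d)}\ \sup_{\substack{f\in \mathrm{Lip}_0(B(x,4r))\\ \|f\|_{\mathrm{Lip}}\le 1/r}}\Bigl|\frac1{r^s}\int_{\mathbb{R}^d}\varphi\Bigl(\frac{|\cdot-x|}{r}\Bigr)f\,d(\mu-c_{\mu,L}\mathcal{H}^s_{x+L})\Bigr|,$$ where $$c_{\mu,L}=\int_{\mathbb{R}^d}\varphi\bigl(\tfrac{|\cdot-x|}{r}\bigr)\,d\mu\,\Bigl[\int_{\mathbb{R}^d}\varphi\bigl(\tfrac{|\cdot-x|}{r}\bigr)\,d\mathcal{H}^s_{x+L}\Bigr]^{-1}.$$ *)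

theory Defs
  imports "HOL-Analysis.Analysis"
begin

definition locally_finite_borel_measure :: "'a::euclidean_space measure \<Rightarrow> bool" where
  "locally_finite_borel_measure \<mu> \<longleftrightarrow>
     sets \<mu> = sets borel \<and> (\<forall>x. \<exists>r>0. emeasure \<mu> (ball x r) < \<infinity>)"

definition upper_density :: "'a::euclidean_space measure \<Rightarrow> real \<Rightarrow> 'a \<Rightarrow> ennreal" where
  "upper_density \<mu> s x =
     Limsup (at_right 0) (\<lambda>r. emeasure \<mu> (ball x r) / ennreal (r powr s))"

definition cutoff_family :: "(real \<Rightarrow> real \<Rightarrow> real) \<Rightarrow> bool" where
  "cutoff_family \<eta> \<longleftrightarrow>
     (\<forall>\<tau>\<in>{0<..<1}.
        (\<forall>t. 0 \<le> t \<and> t \<le> 1 - \<tau> \<longrightarrow> \<eta> \<tau> t = 1) \<and>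
        (\<forall>t\<ge>1. \<eta> \<tau> t = 0) \<and>
        (1 / \<tau>)-lipschitz_on {0..} (\<eta> \<tau>))"

definition small_local_action ::
  "(real \<Rightarrow> real \<Rightarrow> real) \<Rightarrow> ('a::euclidean_space \<Rightarrow> 'b::euclidean_space) \<Rightarrow> real
     \<Rightarrow> 'a measure \<Rightarrow> bool" where
  "small_local_action \<eta> \<Omega> s \<mu> \<longleftrightarrow>
     (\<forall>\<tau>\<in>{0<..<1}. AE x in \<mu>.
        ((\<lambda>r. (1 / r powr (s + 1)) *\<^sub>R
               (LINT y|\<mu>. \<eta> \<tau> (norm (x - y) / r) *\<^sub>R \<Omega> (x - y))) \<longlongrightarrow> 0) (at_right 0))"

(* Boundedness is required because diameter is unspecified on unbounded sets.  Only s > 0 is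
   intended: 0 powr 0 = 0, so s = 0 would not give counting measure.  The factor in
   hausdorff_outer is the usual normalisation. *)
definition hausdorff_pre :: "real \<Rightarrow> real \<Rightarrow> 'a::euclidean_space set \<Rightarrow> ennreal" where
  "hausdorff_pre s \<delta> A =
     (INF E\<in>{E :: nat \<Rightarrow> 'a set. A \<subseteq> (\<Union>i. E i) \<and> (\<forall>i. bounded (E i) \<and> diameter (E i) \<le> \<delta>)}.
        \<Sum>i. ennreal (diameter (E i) powr s))"

definition hausdorff_outer :: "real \<Rightarrow> 'a::euclidean_space set \<Rightarrow> ennreal" where
  "hausdorff_outer s A =
     ennreal (unit_ball_vol s / 2 powr s) * (SUP \<delta>\<in>{0<..}. hausdorff_pre s \<delta> A)"

definition hausdorff_measure :: "real \<Rightarrow> 'a::euclidean_space measure" where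
  "hausdorff_measure s = measure_of UNIV (sets borel) (hausdorff_outer s)"

lemma ennreal_suminf_tail:
  fixes f :: "nat \<Rightarrow> ennreal"
  assumes "suminf f \<noteq> top"
  shows "(\<lambda>n. \<Sum>k. f (k + n)) \<longlonglongrightarrow> 0"
proof -
  have eq: "(\<Sum>k. f (k + n)) = suminf f - sum f {..<n}" for n
  proof -
    have "sum f {..<n} \<noteq> top"
      using assms sum_le_suminf[of f "{..<n}"] by (metis finite_lessThan summableI top_unique zero_le)
    then show ?thesis
      using suminf_offset[of f n] by (simp add: ennreal_add_diff_cancel_left)
  qed
  have "(\<lambda>n. suminf f - sum f {..<n}) \<longlonglongrightarrow> suminf f - suminf f"
    using assms by (intro tendsto_diff_ennreal_general tendsto_const summable_LIMSEQ) auto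
  then show ?thesis using assms by (simp add: eq diff_eq_0_ennreal)
qed

lemma hausdorff_pre_empty:
  assumes "0 < \<delta>"
  shows "hausdorff_pre s \<delta> {} = 0"
proof -
  have "hausdorff_pre s \<delta> ({}::'a set) \<le> (\<Sum>i::nat. ennreal (diameter ({}::'a set) powr s))"
    unfolding hausdorff_pre_def using assms by (intro INF_lower2[of "\<lambda>_. {}"]) auto
  then show ?thesis by simp
qed

lemma hausdorff_pre_mono: "A \<subseteq> B \<Longrightarrow> hausdorff_pre s \<delta> A \<le> hausdorff_pre s \<delta> B"
  unfolding hausdorff_pre_def by (intro INF_superset_mono) auto

lemma hausdorff_pre_antimono: "\<delta> \<le> \<epsilon> \<Longrightarrow> hausdorff_pre s \<epsilon> A \<le> hausdorff_pre s \<delta> A"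
  unfolding hausdorff_pre_def by (intro INF_superset_mono) (auto intro: order_trans)

lemma hausdorff_pre_UN_le:
  fixes A :: "nat \<Rightarrow> 'a::euclidean_space set"
  shows "hausdorff_pre s \<delta> (\<Union>n. A n) \<le> (\<Sum>n. hausdorff_pre s \<delta> (A n))"
proof (rule ennreal_le_epsilon)
  fix e :: real
  assume fin: "(\<Sum>n. hausdorff_pre s \<delta> (A n)) < top" and e: "0 < e"
  have "\<forall>n. \<exists>E. A n \<subseteq> (\<Union>i. E i) \<and> (\<forall>i. bounded (E i) \<and> diameter (E i) \<le> \<delta>) \<and>
          (\<Sum>i::nat. ennreal (diameter (E i) powr s)) < hausdorff_pre s \<delta> (A n) + e * (1/2) ^ Suc n"
  proof
    fix n
    have "hausdorff_pre s \<delta> (A n) \<noteq> top"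
      using ennreal_suminf_lessD[OF fin] by (simp add: less_top)
    then have "hausdorff_pre s \<delta> (A n) < hausdorff_pre s \<delta> (A n) + e * (1/2) ^ Suc n"
      using e ennreal_add_left_cancel_less[of "hausdorff_pre s \<delta> (A n)" 0 "ennreal (e * (1/2) ^ Suc n)"] by simp
    then show "\<exists>E. A n \<subseteq> (\<Union>i. E i) \<and> (\<forall>i. bounded (E i) \<and> diameter (E i) \<le> \<delta>) \<and>
          (\<Sum>i::nat. ennreal (diameter (E i) powr s)) < hausdorff_pre s \<delta> (A n) + e * (1/2) ^ Suc n"
      unfolding hausdorff_pre_def[of s \<delta> "A n"] INF_less_iff by blast
  qed
  from choice[OF this] obtain E where E: "\<And>n. A n \<subseteq> (\<Union>i. E n i)"
    "\<And>n i. bounded (E n i)" "\<And>n i. diameter (E n i) \<le> \<delta>"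
    "\<And>n. (\<Sum>i::nat. ennreal (diameter (E n i) powr s)) < hausdorff_pre s \<delta> (A n) + e * (1/2) ^ Suc n"
    by blast
  let ?F = "\<lambda>k. case_prod E (prod_decode k)"
  have cover: "(\<Union>n. A n) \<subseteq> (\<Union>k. ?F k)"
  proof
    fix x assume "x \<in> (\<Union>n. A n)"
    then obtain n i where "x \<in> E n i" using E(1) by blast
    then have "x \<in> ?F (prod_encode (n, i))" by simp
    then show "x \<in> (\<Union>k. ?F k)" by (rule UN_I[OF UNIV_I])
  qed
  have "hausdorff_pre s \<delta> (\<Union>n. A n) \<le> (\<Sum>k. ennreal (diameter (?F k) powr s))"
    unfolding hausdorff_pre_def
  proof (rule INF_lower)
    have "bounded (?F k) \<and> diameter (?F k) \<le> \<delta>" for k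
      using E(2,3) by (simp add: case_prod_beta)
    then show "?F \<in> {E. (\<Union>n. A n) \<subseteq> (\<Union>i. E i) \<and> (\<forall>i. bounded (E i) \<and> diameter (E i) \<le> \<delta>)}"
      using cover by simp
  qed
  also have "\<dots> = (\<Sum>k. (\<lambda>(n, i). ennreal (diameter (E n i) powr s)) (prod_decode k))"
    by (simp add: case_prod_beta)
  also have "\<dots> = (\<Sum>n. \<Sum>i. ennreal (diameter (E n i) powr s))"
    by (intro suminf_ennreal_2dimen) auto
  also have "\<dots> \<le> (\<Sum>n. hausdorff_pre s \<delta> (A n) + e * (1/2) ^ Suc n)"
    by (intro suminf_le less_imp_le[OF E(4)] summableI)
  also have "\<dots> = (\<Sum>n. hausdorff_pre s \<delta> (A n)) + (\<Sum>n. ennreal e * ennreal ((1/2) ^ Suc n))"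
    using e by (subst suminf_add[symmetric])
       (auto simp del: ennreal_suminf_cmult simp add: ennreal_mult[symmetric])
  also have "\<dots> = (\<Sum>n. hausdorff_pre s \<delta> (A n)) + e"
    unfolding ennreal_suminf_cmult
    by (subst suminf_ennreal_eq[OF zero_le_power power_half_series]) auto
  finally show "hausdorff_pre s \<delta> (\<Union>n. A n) \<le> (\<Sum>n. hausdorff_pre s \<delta> (A n)) + ennreal e" .
qed

lemma hausdorff_outer_mono: "A \<subseteq> B \<Longrightarrow> hausdorff_outer s A \<le> hausdorff_outer s B"
  unfolding hausdorff_outer_def
  by (intro mult_left_mono SUP_mono' hausdorff_pre_mono) auto

lemma hausdorff_outer_empty: "hausdorff_outer s {} = 0"
proof -
  have "(SUP \<delta>\<in>{0<..}. hausdorff_pre s \<delta> ({}::'a set)) = 0"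
    by (simp add: hausdorff_pre_empty)
  then show ?thesis by (simp only: hausdorff_outer_def mult_zero_right)
qed

lemma hausdorff_outer_UN_le: "hausdorff_outer s (\<Union>n. A n) \<le> (\<Sum>n. hausdorff_outer s (A n))"
proof -
  have "hausdorff_pre s \<delta> (\<Union>n. A n) \<le> (\<Sum>n. SUP \<delta>\<in>{0<..}. hausdorff_pre s \<delta> (A n))"
    if "0 < \<delta>" for \<delta>
    using that
    by (intro order_trans[OF hausdorff_pre_UN_le] suminf_le SUP_upper) auto
  then show ?thesis
    unfolding hausdorff_outer_def ennreal_suminf_cmult
    by (intro mult_left_mono SUP_least) auto
qed

lemma hausdorff_outer_Un_le: "hausdorff_outer s (A \<union> B) \<le> hausdorff_outer s A + hausdorff_outer s B"
proof -
  let ?C = "\<lambda>n::nat. if n = 0 then A else if n = 1 then B else {}"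
  have "hausdorff_outer s (\<Union>n. ?C n) \<le> (\<Sum>n. hausdorff_outer s (?C n))"
    by (rule hausdorff_outer_UN_le)
  also have "(\<Sum>n. hausdorff_outer s (?C n)) = (\<Sum>n<2. hausdorff_outer s (?C n))"
    by (intro suminf_finite) (auto simp: hausdorff_outer_empty)
  also have "\<dots> = hausdorff_outer s A + hausdorff_outer s B"
    by (simp add: numeral_2_eq_2)
  also have "(\<Union>n. ?C n) = A \<union> B"
    by (auto split: if_splits)
  finally show ?thesis .
qed

lemma hausdorff_outer_metric:
  fixes A B :: "'a::euclidean_space set"
  assumes d: "0 < d" and sep: "\<And>x y. x \<in> A \<Longrightarrow> y \<in> B \<Longrightarrow> d \<le> dist x y"
  shows "hausdorff_outer s A + hausdorff_outer s B \<le> hausdorff_outer s (A \<union> B)"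
proof -
  let ?H = "\<lambda>A. SUP \<delta>\<in>{0<..}. hausdorff_pre s \<delta> (A::'a set)"
  have small: "hausdorff_pre s \<delta> A + hausdorff_pre s \<delta> B \<le> hausdorff_pre s \<delta> (A \<union> B)"
    if \<delta>: "0 < \<delta>" "\<delta> < d" for \<delta>
    unfolding hausdorff_pre_def[of s \<delta> "A \<union> B"]
  proof (rule INF_greatest)
    fix E :: "nat \<Rightarrow> 'a set"
    assume "E \<in> {E. A \<union> B \<subseteq> (\<Union>i. E i) \<and> (\<forall>i. bounded (E i) \<and> diameter (E i) \<le> \<delta>)}"
    then have E: "A \<union> B \<subseteq> (\<Union>i. E i)" "\<And>i. bounded (E i)" "\<And>i. diameter (E i) \<le> \<delta>"
      by auto
    define F where "F = (\<lambda>C i. if E i \<inter> C = {} then {} else E i)"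
    have F: "hausdorff_pre s \<delta> C \<le> (\<Sum>i. ennreal (diameter (F C i) powr s))"
      if CAB: "C \<subseteq> A \<union> B" for C
      unfolding hausdorff_pre_def
    proof (rule INF_lower)
      have "C \<subseteq> (\<Union>i. F C i)"
      proof
        fix x assume x: "x \<in> C"
        then obtain i where "x \<in> E i" using E(1) CAB by blast
        with x have "x \<in> F C i" by (auto simp: F_def)
        then show "x \<in> (\<Union>i. F C i)" by blast
      qed
      then show "F C \<in> {E. C \<subseteq> (\<Union>i. E i) \<and> (\<forall>i. bounded (E i) \<and> diameter (E i) \<le> \<delta>)}"
        using E(2,3) \<delta> by (auto simp: F_def)
    qed
    have "E i \<inter> A = {} \<or> E i \<inter> B = {}" for i
    proof (rule ccontr)
      assume "\<not> ?thesis"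
      then obtain x y where "x \<in> E i" "x \<in> A" "y \<in> E i" "y \<in> B" by blast
      then have "d \<le> dist x y" "dist x y \<le> diameter (E i)"
        using sep diameter_bounded_bound[OF E(2)] by auto
      then show False using E(3)[of i] \<delta> by linarith
    qed
    then have le: "ennreal (diameter (F A i) powr s) + ennreal (diameter (F B i) powr s)
                 \<le> ennreal (diameter (E i) powr s)" for i
      unfolding F_def by (cases "E i \<inter> A = {}"; cases "E i \<inter> B = {}") auto
    have "hausdorff_pre s \<delta> A + hausdorff_pre s \<delta> B
        \<le> (\<Sum>i. ennreal (diameter (F A i) powr s)) + (\<Sum>i. ennreal (diameter (F B i) powr s))"
      by (intro add_mono F) auto
    also have "\<dots> = (\<Sum>i. ennreal (diameter (F A i) powr s) + ennreal (diameter (F B i) powr s))"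
      by (intro suminf_add) auto
    also have "\<dots> \<le> (\<Sum>i. ennreal (diameter (E i) powr s))"
      by (intro suminf_le le) auto
    finally show "hausdorff_pre s \<delta> A + hausdorff_pre s \<delta> B \<le> (\<Sum>i. ennreal (diameter (E i) powr s))" .
  qed
  have "hausdorff_pre s \<delta> A + hausdorff_pre s \<epsilon> B \<le> ?H (A \<union> B)" if "0 < \<delta>" "0 < \<epsilon>" for \<delta> \<epsilon>
  proof -
    define \<rho> where "\<rho> = min (min \<delta> \<epsilon>) (d / 2)"
    have \<rho>: "0 < \<rho>" "\<rho> < d" "\<rho> \<le> \<delta>" "\<rho> \<le> \<epsilon>" using that d by (auto simp: \<rho>_def)
    have "hausdorff_pre s \<delta> A + hausdorff_pre s \<epsilon> B \<le> hausdorff_pre s \<rho> A + hausdorff_pre s \<rho> B"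
      using \<rho> by (intro add_mono hausdorff_pre_antimono)
    also have "\<dots> \<le> hausdorff_pre s \<rho> (A \<union> B)" using \<rho> by (intro small)
    also have "\<dots> \<le> ?H (A \<union> B)" using \<rho> by (intro SUP_upper) auto
    finally show ?thesis .
  qed
  then have "?H A + ?H B \<le> ?H (A \<union> B)"
    by (auto simp: ennreal_SUP_add_left[symmetric] ennreal_SUP_add_right intro!: SUP_least)
  then show ?thesis
    unfolding hausdorff_outer_def distrib_left[symmetric] by (rule mult_left_mono) auto
qed

lemma hausdorff_outer_shells:
  fixes R :: "nat \<Rightarrow> 'a::euclidean_space set"
  assumes sep: "\<And>i j. i < j \<Longrightarrow> \<exists>d>0. \<forall>x\<in>\<Union>k\<le>i. R k. \<forall>y\<in>R j. d \<le> dist x y"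
    and sub: "\<And>k. R k \<subseteq> X"
  shows "(\<Sum>k. hausdorff_outer s (R k)) \<le> hausdorff_outer s X"
proof -
  have "(\<Sum>k<n. hausdorff_outer s (R k)) \<le> hausdorff_outer s (\<Union>k<n. R k)" for n
  proof (induction n)
    case (Suc n)
    show ?case
    proof (cases n)
      case (Suc m)
      obtain d where d: "d > 0" "\<forall>x\<in>\<Union>k\<le>m. R k. \<forall>y\<in>R n. d \<le> dist x y"
        using sep[of m n] Suc by auto
      have eq: "(\<Union>k<n. R k) = (\<Union>k\<le>m. R k)" using Suc by (simp add: lessThan_Suc_atMost)
      have "(\<Sum>k<Suc n. hausdorff_outer s (R k)) \<le> hausdorff_outer s (\<Union>k<n. R k) + hausdorff_outer s (R n)"
        using Suc.IH by (auto intro: add_mono)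
      also have "\<dots> \<le> hausdorff_outer s ((\<Union>k<n. R k) \<union> R n)"
        unfolding eq using d by (intro hausdorff_outer_metric) auto
      also have "(\<Union>k<n. R k) \<union> R n = (\<Union>k<Suc n. R k)" by (auto simp: less_Suc_eq)
      finally show ?thesis .
    qed (auto simp: lessThan_Suc)
  qed simp
  moreover have "hausdorff_outer s (\<Union>k<n. R k) \<le> hausdorff_outer s X" for n
    using sub by (intro hausdorff_outer_mono) auto
  ultimately show ?thesis
    by (intro suminf_le_const) (auto intro: order_trans)
qed

lemma hausdorff_outer_closed:
  fixes C X :: "'a::euclidean_space set"
  assumes C: "closed C"
  shows "hausdorff_outer s (X \<inter> C) + hausdorff_outer s (X - C) = hausdorff_outer s X"
proof (rule antisym)
  show "hausdorff_outer s X \<le> hausdorff_outer s (X \<inter> C) + hausdorff_outer s (X - C)"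
    using hausdorff_outer_Un_le[of s "X \<inter> C" "X - C"] by (simp add: Un_Diff_Int Un_commute)
  show "hausdorff_outer s (X \<inter> C) + hausdorff_outer s (X - C) \<le> hausdorff_outer s X"
  proof (cases "C = {} \<or> hausdorff_outer s X = top")
    case True
    then show ?thesis by (auto simp: hausdorff_outer_empty)
  next
    case False
    then have ne: "C \<noteq> {}" and fin: "hausdorff_outer s X < top" by (auto simp: less_top)
    define A where "A = (\<lambda>n::nat. {y\<in>X. 1 / real (Suc n) \<le> infdist y C})"
    define R where "R = (\<lambda>n. A (Suc n) - A n)"
    have lip: "infdist x C \<le> infdist y C + dist x y" for x y :: 'a
      by (rule infdist_triangle)
    have pos: "0 < infdist y C" if "y \<notin> C" for y
      using that C ne by (simp add: infdist_pos_not_in_closed)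
    have AX: "A n \<subseteq> X - C" for n
    proof -
      have "infdist y C = 0" if "y \<in> C" for y using that by simp
      then show ?thesis by (auto simp: A_def)
    qed
    have mono: "A m \<subseteq> A n" if "m \<le> n" for m n
    proof -
      have "1 / real (Suc n) \<le> 1 / real (Suc m)" using that by (intro divide_left_mono) auto
      then show ?thesis by (auto simp: A_def)
    qed
    have UA: "X - C = (\<Union>n. A n)"
    proof
      show "X - C \<subseteq> (\<Union>n. A n)"
      proof
        fix y assume y: "y \<in> X - C"
        then obtain n where "1 / real (Suc n) < infdist y C"
          using reals_Archimedean[of "infdist y C"] pos by (auto simp: inverse_eq_divide)
        then have "y \<in> A n" using y by (auto simp: A_def)
        then show "y \<in> (\<Union>n. A n)" by blast
      qed
    qed (use AX in auto)
    have step: "hausdorff_outer s (X \<inter> C) + hausdorff_outer s (A n) \<le> hausdorff_outer s X" for n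
    proof -
      have "hausdorff_outer s (X \<inter> C) + hausdorff_outer s (A n) \<le> hausdorff_outer s ((X \<inter> C) \<union> A n)"
      proof (rule hausdorff_outer_metric[where d = "1 / real (Suc n)"])
        fix x y assume "x \<in> X \<inter> C" "y \<in> A n"
        then show "1 / real (Suc n) \<le> dist x y"
          using infdist_le[of x C y] by (auto simp: A_def dist_commute)
      qed simp
      also have "\<dots> \<le> hausdorff_outer s X" using AX by (intro hausdorff_outer_mono) auto
      finally show ?thesis .
    qed
    have gap: "\<exists>d>0. \<forall>x\<in>A (Suc i). \<forall>y\<in>R j. d \<le> dist x y" if "Suc i < j" for i j
    proof (intro exI conjI ballI)
      show "0 < 1 / real (Suc (Suc i)) - 1 / real (Suc j)"
        using that by (simp add: divide_strict_left_mono)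
      fix x y assume "x \<in> A (Suc i)" "y \<in> R j"
      then have "1 / real (Suc (Suc i)) \<le> infdist x C" "infdist y C < 1 / real (Suc j)"
        by (auto simp: A_def R_def not_le)
      then show "1 / real (Suc (Suc i)) - 1 / real (Suc j) \<le> dist x y"
        using lip[of x y] by linarith
    qed
    have RX: "R k \<subseteq> X" for k using AX by (auto simp: R_def)
    have RA: "(\<Union>k\<le>i. R (f k)) \<subseteq> A (Suc (f i))" if "mono f" for f and i :: nat
    proof (rule UN_least)
      fix k assume "k \<in> {..i}"
      then have "A (Suc (f k)) \<subseteq> A (Suc (f i))" using monoD[OF that] by (intro mono) simp
      then show "R (f k) \<subseteq> A (Suc (f i))" by (auto simp: R_def)
    qed
    have sumparity: "(\<Sum>k. hausdorff_outer s (R (2 * k + p))) \<le> hausdorff_outer s X" for p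
    proof (rule hausdorff_outer_shells)
      fix i j :: nat assume "i < j"
      then have "Suc (2 * i + p) < 2 * j + p" by linarith
      from gap[OF this] obtain d where d: "d > 0" "\<forall>x\<in>A (Suc (2 * i + p)). \<forall>y\<in>R (2 * j + p). d \<le> dist x y"
        by blast
      moreover have "(\<Union>k\<le>i. R (2 * k + p)) \<subseteq> A (Suc (2 * i + p))"
        by (rule RA) (auto simp: mono_def)
      ultimately show "\<exists>d>0. \<forall>x\<in>\<Union>k\<le>i. R (2 * k + p). \<forall>y\<in>R (2 * j + p). d \<le> dist x y"
        by blast
    qed (rule RX)
    have "(\<Sum>k. hausdorff_outer s (R k)) \<le> hausdorff_outer s X + hausdorff_outer s X"
    proof (rule suminf_le_const)
      fix n
      have "(\<Sum>k<n. hausdorff_outer s (R k)) \<le> (\<Sum>k<2 * n. hausdorff_outer s (R k))"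
        by (intro sum_mono2) auto
      also have "\<dots> = (\<Sum>k<n. hausdorff_outer s (R (2 * k + 0))) + (\<Sum>k<n. hausdorff_outer s (R (2 * k + 1)))"
        by (induction n) (auto simp: algebra_simps)
      also have "\<dots> \<le> hausdorff_outer s X + hausdorff_outer s X"
        by (intro add_mono order_trans[OF sum_le_suminf sumparity]) auto
      finally show "(\<Sum>k<n. hausdorff_outer s (R k)) \<le> hausdorff_outer s X + hausdorff_outer s X" .
    qed simp
    with fin have sumR: "(\<Sum>k. hausdorff_outer s (R k)) \<noteq> top"
      by (auto simp: top_unique)
    have "hausdorff_outer s (X \<inter> C) + hausdorff_outer s (X - C)
        \<le> hausdorff_outer s X + (\<Sum>k. hausdorff_outer s (R (k + n)))" for n
    proof -
      have in_tail: "y \<in> A n \<union> (\<Union>k. R (k + n))" if "y \<in> A m" for y m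
        using that
      proof (induction m)
        case 0
        then show ?case using mono[of 0 n] by auto
      next
        case (Suc m)
        show ?case
        proof (cases "y \<in> A m \<or> Suc m \<le> n")
          case True
          then show ?thesis using Suc mono[of "Suc m" n] by auto
        next
          case False
          then have "y \<in> R (m - n + n)" using Suc by (auto simp: R_def)
          then show ?thesis by blast
        qed
      qed
      have "hausdorff_outer s (X - C) \<le> hausdorff_outer s (A n \<union> (\<Union>k. R (k + n)))"
        unfolding UA by (intro hausdorff_outer_mono UN_least subsetI in_tail)
      also have "\<dots> \<le> hausdorff_outer s (A n) + (\<Sum>k. hausdorff_outer s (R (k + n)))"
        by (rule order_trans[OF hausdorff_outer_Un_le add_left_mono[OF hausdorff_outer_UN_le]])
      finally have "hausdorff_outer s (X \<inter> C) + hausdorff_outer s (X - C)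
          \<le> (hausdorff_outer s (X \<inter> C) + hausdorff_outer s (A n)) + (\<Sum>k. hausdorff_outer s (R (k + n)))"
        by (simp add: add.assoc add_left_mono)
      also have "\<dots> \<le> hausdorff_outer s X + (\<Sum>k. hausdorff_outer s (R (k + n)))"
        by (intro add_right_mono step)
      finally show ?thesis .
    qed
    moreover have "(\<lambda>n. hausdorff_outer s X + (\<Sum>k. hausdorff_outer s (R (k + n)))) \<longlonglongrightarrow> hausdorff_outer s X + 0"
      by (intro tendsto_add tendsto_const ennreal_suminf_tail sumR)
    ultimately have "hausdorff_outer s (X \<inter> C) + hausdorff_outer s (X - C) \<le> hausdorff_outer s X + 0"
      by (intro LIMSEQ_le_const) blast+
    then show ?thesis by simp
  qed
qed

(* Caratheodory's criterion: hausdorff_outer is countably additive on Borel sets, so measure_of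
   does not collapse to the zero measure. *)
theorem emeasure_hausdorff_measure:
  fixes A :: "'a::euclidean_space set"
  assumes "A \<in> sets borel"
  shows "emeasure (hausdorff_measure s) A = hausdorff_outer s A"
proof -
  interpret P: sigma_algebra UNIV "Pow (UNIV :: 'a set)" by (rule sigma_algebra_Pow)
  let ?L = "lambda_system UNIV (Pow UNIV) (hausdorff_outer s :: 'a set \<Rightarrow> ennreal)"
  have "outer_measure_space (Pow UNIV) (hausdorff_outer s :: 'a set \<Rightarrow> ennreal)"
    by (auto simp: outer_measure_space_def positive_def increasing_def countably_subadditive_def
        hausdorff_outer_empty hausdorff_outer_mono hausdorff_outer_UN_le)
  then have L: "measure_space UNIV ?L (hausdorff_outer s)"
    by (rule P.caratheodory_lemma)
  then interpret L: sigma_algebra UNIV ?L by (simp add: measure_space_def)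
  have "C \<in> ?L" if "closed C" for C
    unfolding P.lambda_system_eq using hausdorff_outer_closed[OF that] by simp
  then have sub: "sets borel \<subseteq> ?L"
    unfolding borel_eq_closed sets_measure_of[OF subset_UNIV[of "Collect closed :: 'a set set", folded Pow_UNIV]]
    by (intro L.sigma_sets_subset) blast
  have ca: "countably_additive (sets borel) (hausdorff_outer s :: 'a set \<Rightarrow> ennreal)"
    using L sub by (auto simp: measure_space_def countably_additive_def) 
  show ?thesis
    unfolding hausdorff_measure_def
  proof (rule emeasure_measure_of_sigma)
    show "sigma_algebra UNIV (sets (borel :: 'a measure))"
      using sets.sigma_algebra_axioms[of "borel :: 'a measure"] by simp
    show "positive (sets borel) (hausdorff_outer s :: 'a set \<Rightarrow> ennreal)"
      by (simp add: positive_def hausdorff_outer_empty)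
  qed (fact ca assms)+
qed

(* H^s restricted to the set A, regarded as a measure on the whole space. *)
definition hausdorff_on :: "real \<Rightarrow> 'a::euclidean_space set \<Rightarrow> 'a measure" where
  "hausdorff_on s A = density (hausdorff_measure s) (indicator A)"

definition grassmannian :: "real \<Rightarrow> 'a::euclidean_space set set" where
  "grassmannian s = {L. subspace L \<and> real (dim L) = s}"

definition Lip0 :: "'a::euclidean_space set \<Rightarrow> ('a \<Rightarrow> real) set" where
  "Lip0 U = {f. (\<exists>C. C-lipschitz_on UNIV f) \<and>
                (\<exists>K. compact K \<and> K \<subseteq> U \<and> (\<forall>y. y \<notin> K \<longrightarrow> f y = 0))}"

(* Smoothness on the half-line [0, oo), with one-sided derivatives at 0; D n is the n-th
   derivative. *)
definition smooth_on_halfline :: "(real \<Rightarrow> real) \<Rightarrow> bool" where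
  "smooth_on_halfline \<phi> \<longleftrightarrow>
     (\<exists>D :: nat \<Rightarrow> real \<Rightarrow> real. (\<forall>t\<ge>0. D 0 t = \<phi> t) \<and>
        (\<forall>n. \<forall>t\<ge>0. (D n has_real_derivative D (Suc n) t) (at t within {0..})))"

definition flat_cutoff :: "(real \<Rightarrow> real) \<Rightarrow> bool" where
  "flat_cutoff \<phi> \<longleftrightarrow>
     smooth_on_halfline \<phi> \<and>
     (\<forall>t\<ge>0. 0 \<le> \<phi> t \<and> \<phi> t \<le> 1) \<and>
     (\<forall>t\<in>{0..3}. \<phi> t = 1) \<and>
     compact (closure {t\<in>{0..}. \<phi> t \<noteq> 0}) \<and>
     closure {t\<in>{0..}. \<phi> t \<noteq> 0} \<subseteq> {0..<4}"

definition flat_const ::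
  "(real \<Rightarrow> real) \<Rightarrow> 'a::euclidean_space measure \<Rightarrow> real \<Rightarrow> 'a set \<Rightarrow> 'a \<Rightarrow> real \<Rightarrow> real" where
  "flat_const \<phi> \<mu> s L x r =
     (LINT y|\<mu>. \<phi> (norm (y - x) / r)) *
     inverse (LINT y|hausdorff_on s ((+) x ` L). \<phi> (norm (y - x) / r))"

(* The infimum and supremum are taken in ennreal, where they always exist. *)
definition alpha_flat ::
  "(real \<Rightarrow> real) \<Rightarrow> 'a::euclidean_space measure \<Rightarrow> real \<Rightarrow> 'a \<Rightarrow> real \<Rightarrow> ennreal" where
  "alpha_flat \<phi> \<mu> s x r =
     (INF L\<in>grassmannian s.
        SUP f\<in>{f\<in>Lip0 (ball x (4 * r)). (1 / r)-lipschitz_on UNIV f}.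
          ennreal \<bar>(1 / r powr s) *
            ((LINT y|\<mu>. \<phi> (norm (y - x) / r) * f y) -
             flat_const \<phi> \<mu> s L x r *
               (LINT y|hausdorff_on s ((+) x ` L). \<phi> (norm (y - x) / r) * f y))\<bar>)"

end

theory Submission
  imports Defs "HOL-Probability.Helly_Selection" "HOL-Complex_Analysis.Great_Picard"
begin

text \<open>For the forward direction only the cutoff with \<open>\<tau> = 1 / 2\<close> is used.  Superposing it over
  scales replaces it by the smoother kernel \<open>q\<^sup>2 w\<close> with \<open>q = max 0 (r\<^sup>2 - |w|\<^sup>2)\<close>, so the moments
  \<open>\<integral> q(z - y)\<^sup>2 (z - y) d\<mu>(y)\<close> are \<open>o(r powr (s + 5))\<close> at almost every \<open>z\<close>.  The convergence is uniform on
  closed sets, and almost every point is a density point of these sets in the sense that their complement has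
  mass \<open>o(r powr s)\<close>.  Hence every vague limit \<open>\<nu>\<close> of blow-ups at such a point has growth \<open>C r powr s\<close> and vanishing
  moments, at all scales, at the origin and on its support.

  Such a \<open>\<nu> \<noteq> 0\<close> is a multiple of \<open>H\<^sup>s\<close> on an \<open>s\<close>-dimensional subspace.  Let \<open>V\<close> be the span of the support
  and \<open>m\<close> its dimension.  Differentiating the moment at \<open>0\<close> along \<open>V\<close> and taking the trace shows that
  \<open>r powr -(m + 4) \<integral> q\<^sup>2 d\<nu>\<close> is almost constant in \<open>r\<close>; for \<open>s < m\<close> this lowers the growth exponent again and again until
  \<open>\<nu> = 0\<close>, and \<open>m < s\<close> is excluded since \<open>\<nu>\<close> is absolutely continuous with respect to \<open>H\<^sup>s\<close>.  For
  \<open>s = m\<close>, at a point of positive density the derivative of the moment vanishes on \<open>V\<close>, so the mass \<open>\<integral> q\<^sup>2 d\<nu>\<close> is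
  homogeneous of degree \<open>m + 4\<close>, with the same constant at all points of the support.  A ball touching the support
  from its complement in \<open>V\<close> contradicts this, so the support is \<open>V\<close>, and Fubini's theorem compares \<open>\<nu>\<close> with \<open>H\<^sup>m\<close> on \<open>V\<close>.

  Therefore a nonzero blow-up forces \<open>s\<close> to be an integer, and in that case the flat transportation numbers
  tend to zero, since the test functions form a compact family by Arzela--Ascoli.

  Conversely, zero density bounds the action trivially, while \<open>\<tau> / (2 r) (\<Omega>(x - y) \<bullet> b) \<eta>\<^sup>\<tau>(|x - y| / r)\<close>
  is an admissible test function whose integral over every plane through \<open>x\<close> vanishes by symmetry.\<close>

text \<open>Densities are bounded only from above, so a blow-up may vanish. Blow-ups are therefore
  taken only along radii at which the conclusion fails: a density or a flat number bounded away from
  0 both force a lower bound for the mass of \<open>ball x (4 * r)\<close> relative to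
  \<open>r powr s\<close>, and the limit is nonzero.

  The square in \<open>(qk r w)\<^sup>2 *\<^sub>R w\<close> makes the kernel differentiable with
  Lipschitz derivative. Its Taylor error is of order \<open>r ^ 3 * (norm v)\<^sup>2\<close>,
  smaller than the derivative term by a factor \<open>norm v / r\<close>. The piecewise linear
  cutoff is only Lipschitz and yields no such gain, which is the reason for passing to the smoother
  kernel.

  Compactness of the blow-ups is reduced to Helly's selection theorem on the real line: a measurable
  section of a space-filling curve carries measures to an interval, and the continuous curve carries
  the limit back.\<close>

lemma emeasure_bounded_finite:
  fixes \<mu> :: "'a::euclidean_space measure"
  assumes "locally_finite_borel_measure \<mu>" and "bounded A"
  shows "emeasure \<mu> A < \<infinity>"
proof -
  obtain a R where A: "A \<subseteq> cball a R" using assms(2) bounded_subset_cball by blast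
  have sb: "sets \<mu> = sets borel" using assms(1) by (auto simp: locally_finite_borel_measure_def)
  obtain r where r: "\<And>x. r x > 0" "\<And>x. emeasure \<mu> (ball x (r x)) < \<infinity>"
    using assms(1) unfolding locally_finite_borel_measure_def by metis
  have "compact (cball a R)" by simp
  then obtain F where F: "finite F" "cball a R \<subseteq> (\<Union>x\<in>F. ball x (r x))"
  proof (rule compactE_image[where C=UNIV and f="\<lambda>x. ball x (r x)"])
    show "cball a R \<subseteq> (\<Union>c\<in>UNIV. ball c (r c))" using r(1) centre_in_ball by blast
  qed auto
  have "emeasure \<mu> A \<le> emeasure \<mu> (\<Union>x\<in>F. ball x (r x))"
    using A F(1,2) sb by (intro emeasure_mono) auto
  also have "\<dots> \<le> (\<Sum>x\<in>F. emeasure \<mu> (ball x (r x)))"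
    using F sb by (intro emeasure_subadditive_finite) auto
  also have "\<dots> < \<infinity>" using F r by (auto simp: less_top)
  finally show ?thesis .
qed

lemma locally_finite_sets: "locally_finite_borel_measure \<mu> \<Longrightarrow> sets \<mu> = sets borel"
  by (simp add: locally_finite_borel_measure_def)

lemma locally_finite_measurable:
  "locally_finite_borel_measure \<mu> \<Longrightarrow> f \<in> borel_measurable borel \<Longrightarrow> f \<in> borel_measurable \<mu>"
  using locally_finite_sets measurable_cong_sets by blast

lemma integral_bounded_support:
  fixes \<mu> :: "'a::euclidean_space measure" and f :: "'a \<Rightarrow> 'b::{banach,second_countable_topology}"
  assumes lf: "locally_finite_borel_measure \<mu>" and f: "f \<in> borel_measurable borel"
    and bd: "\<And>y. y \<in> A \<Longrightarrow> norm (f y) \<le> B" and out: "\<And>y. y \<notin> A \<Longrightarrow> f y = 0"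
    and A: "bounded A" "A \<in> sets borel"
  shows "integrable \<mu> f" and "norm (integral\<^sup>L \<mu> f) \<le> B * measure \<mu> A"
proof -
  have fm: "f \<in> borel_measurable \<mu>" using lf f by (rule locally_finite_measurable)
  have fin: "emeasure \<mu> A < \<infinity>" using lf A by (intro emeasure_bounded_finite)
  have Am: "A \<in> sets \<mu>" using lf A by (simp add: locally_finite_sets)
  have ind: "integrable \<mu> (\<lambda>y. indicat_real A y * B)"
    using fin Am by (intro integrable_mult_left integrable_real_indicator) auto
  have le: "norm (f y) \<le> indicat_real A y * B" for y
    using bd out by (cases "y \<in> A") auto
  show int: "integrable \<mu> f"
    by (rule Bochner_Integration.integrable_bound[OF ind fm])
       (use le in \<open>auto intro!: AE_I2 order_trans[OF le] abs_ge_self\<close>)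
  have "norm (integral\<^sup>L \<mu> f) \<le> (LINT y|\<mu>. norm (f y))" by (rule integral_norm_bound)
  also have "\<dots> \<le> (LINT y|\<mu>. indicat_real A y * B)"
    using int ind le by (intro integral_mono) auto
  also have "\<dots> = B * measure \<mu> A" using fin Am lf
    by (simp add: locally_finite_borel_measure_def sets.Int_space_eq2)
  finally show "norm (integral\<^sup>L \<mu> f) \<le> B * measure \<mu> A" .
qed

lemma locally_finite_sigma_finite:
  fixes \<mu> :: "'a::euclidean_space measure"
  assumes lf: "locally_finite_borel_measure \<mu>"
  shows "sigma_finite_measure \<mu>"
proof
  have sb: "sets \<mu> = sets borel" using lf by (rule locally_finite_sets)
  then have sp: "space \<mu> = UNIV" using sets_eq_imp_space_eq by fastforce
  have "\<exists>n. dist 0 x \<le> real n" for x :: 'a by (rule real_arch_simple)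
  then have "(\<Union>n. cball (0::'a) (real n)) = UNIV" by (simp only: set_eq_iff UN_iff mem_cball) simp
  moreover have "emeasure \<mu> (cball 0 (real n)) \<noteq> \<infinity>" for n
    using emeasure_bounded_finite[OF lf bounded_cball[of 0 "real n"]] by simp
  ultimately show "\<exists>A. countable A \<and> A \<subseteq> sets \<mu> \<and> \<Union>A = space \<mu> \<and> (\<forall>a\<in>A. emeasure \<mu> a \<noteq> \<infinity>)"
    using sb sp by (intro exI[of _ "range (\<lambda>n. cball 0 (real n))"]) auto
qed

definition measure_support :: "'a::metric_space measure \<Rightarrow> 'a set" where
  "measure_support \<mu> = {z. \<forall>r>0. emeasure \<mu> (ball z r) > 0}"

lemma closed_measure_support:
  assumes "sets \<mu> = sets borel"
  shows "closed (measure_support \<mu>)"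
  unfolding closed_sequential_limits measure_support_def
proof clarify
  fix x l and r :: real
  assume x: "\<forall>n. x n \<in> {z. \<forall>r>0. 0 < emeasure \<mu> (ball z r)}" "x \<longlonglongrightarrow> l" "0 < r"
  from x(2) x(3) obtain n where n: "dist (x n) l < r/2"
    by (meson half_gt_zero lim_sequentially order_refl)
  have "0 < emeasure \<mu> (ball (x n) (r/2))" using x by auto
  also have "\<dots> \<le> emeasure \<mu> (ball l r)"
    using n assms
    by (intro emeasure_mono) (auto simp: subset_eq dist_commute intro: dist_triangle_half_l)
  finally show "0 < emeasure \<mu> (ball l r)" .
qed

section \<open>The smooth symmetric kernel and its moments\<close>

text \<open>Depends on the square of the norm, so it is smooth inside the ball, also at 0; squaring
  it makes the kernel differentiable across the sphere of radius r as well.\<close>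

definition qk :: "real \<Rightarrow> 'a::real_inner \<Rightarrow> real" where
  "qk r w = max 0 (r\<^sup>2 - (norm w)\<^sup>2)"

lemma qk_nonneg: "0 \<le> qk r w"
  by (simp add: qk_def)

lemma qk_le: "qk r w \<le> r\<^sup>2"
  by (simp add: qk_def)

lemma qk_commute: "qk r (x - y) = qk r (y - x)"
  by (simp add: qk_def norm_minus_commute)

lemma qk_outside: "0 \<le> r \<Longrightarrow> r \<le> norm w \<Longrightarrow> qk r w = 0"
  by (simp add: qk_def)

lemma qk_inside: "norm w \<le> r \<Longrightarrow> qk r w = r\<^sup>2 - (norm w)\<^sup>2"
  using power_mono[of "norm w" r 2] by (simp add: qk_def)

lemma qk_lipschitz:
  assumes "0 \<le> r"
  shows "\<bar>qk r w - qk r w'\<bar> \<le> 2 * r * norm (w - w')"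
proof -
  \<comment> \<open>\<open>qk\<close> sees the norm only through its truncation at r, and truncation
    does not increase distances.\<close>
  define a b where "a = min (norm w) r" and "b = min (norm w') r"
  have q: "qk r w = r\<^sup>2 - a\<^sup>2" "qk r w' = r\<^sup>2 - b\<^sup>2"
    using assms unfolding a_def b_def qk_def by (auto simp: min_def max_def)
  have ab: "0 \<le> a" "a \<le> r" "0 \<le> b" "b \<le> r" using assms by (auto simp: a_def b_def)
  have d: "\<bar>b - a\<bar> \<le> norm (w - w')"
    unfolding a_def b_def using norm_triangle_ineq3[of w w'] by (auto simp: min_def)
  have "\<bar>qk r w - qk r w'\<bar> = \<bar>b - a\<bar> * (b + a)"
  proof -
    have "qk r w - qk r w' = (b - a) * (b + a)" unfolding q by (simp add: power2_eq_square algebra_simps)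
    then show ?thesis using ab by (simp add: abs_mult)
  qed
  also have "\<dots> \<le> norm (w - w') * (2 * r)"
    using ab d by (intro mult_mono) auto
  finally show ?thesis by (simp add: mult_ac)
qed

lemma qk2_le: "(qk r w)\<^sup>2 \<le> r ^ 4"
proof -
  have "(qk r w)\<^sup>2 \<le> (r\<^sup>2)\<^sup>2" by (intro power_mono qk_le qk_nonneg)
  then show ?thesis by (simp add: power_mult[symmetric])
qed

lemma qk2_lipschitz:
  assumes "0 \<le> r"
  shows "\<bar>(qk r w)\<^sup>2 - (qk r w')\<^sup>2\<bar> \<le> 4 * r ^ 3 * norm (w - w')"
proof -
  have "\<bar>(qk r w)\<^sup>2 - (qk r w')\<^sup>2\<bar> = \<bar>qk r w - qk r w'\<bar> * (qk r w + qk r w')"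
    using qk_nonneg[of r w] qk_nonneg[of r w']
    by (simp add: power2_eq_square square_diff_square_factored abs_mult mult.commute)
  also have "\<dots> \<le> (2 * r * norm (w - w')) * (r\<^sup>2 + r\<^sup>2)"
    using assms by (intro mult_mono qk_lipschitz add_mono qk_le add_nonneg_nonneg qk_nonneg) auto
  finally show ?thesis by (simp add: power2_eq_square power3_eq_cube algebra_simps)
qed

lemma continuous_on_qk [continuous_intros]:
  "continuous_on S f \<Longrightarrow> continuous_on S (\<lambda>x. qk r (f x))"
  unfolding qk_def by (intro continuous_intros)

lemma qk_kernel_lipschitz:
  fixes w w' :: "'a::real_inner"
  assumes "0 \<le> r"
  shows "norm ((qk r w)\<^sup>2 *\<^sub>R w - (qk r w')\<^sup>2 *\<^sub>R w') \<le> 5 * r ^ 4 * norm (w - w')"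
proof -
  have main: "norm ((qk r w)\<^sup>2 *\<^sub>R w - (qk r w')\<^sup>2 *\<^sub>R w') \<le> 5 * r ^ 4 * norm (w - w')"
    if w: "norm w \<le> r" for w w' :: 'a
  proof -
    have eq: "(qk r w)\<^sup>2 *\<^sub>R w - (qk r w')\<^sup>2 *\<^sub>R w' = ((qk r w)\<^sup>2 - (qk r w')\<^sup>2) *\<^sub>R w + (qk r w')\<^sup>2 *\<^sub>R (w - w')"
      by (simp add: algebra_simps)
    have "norm ((qk r w)\<^sup>2 *\<^sub>R w - (qk r w')\<^sup>2 *\<^sub>R w')
        \<le> \<bar>(qk r w)\<^sup>2 - (qk r w')\<^sup>2\<bar> * norm w + (qk r w')\<^sup>2 * norm (w - w')"
      unfolding eq by (rule order_trans[OF norm_triangle_ineq]) simp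
    also have "\<dots> \<le> (4 * r ^ 3 * norm (w - w')) * r + r ^ 4 * norm (w - w')"
      using w assms by (intro add_mono mult_mono qk2_lipschitz qk2_le) auto
    finally show ?thesis by (simp add: power_numeral_reduce algebra_simps)
  qed
  \<comment> \<open>The product estimate needs its first point in the ball. By symmetry either point
    will do, and if both lie outside then both kernels vanish.\<close>
  consider "norm w \<le> r" | "norm w' \<le> r" | "r \<le> norm w" "r \<le> norm w'" by linarith
  then show ?thesis
  proof cases
    case 2
    then show ?thesis using main[of w' w] by (simp add: norm_minus_commute)
  qed (use main assms in \<open>auto simp: qk_outside\<close>)
qed

text \<open>The derivative of \<open>(qk r w)\<^sup>2 *\<^sub>R w\<close> in direction v; inside the
  ball \<open>qk\<close> has gradient -2 w.\<close>

definition dkernel :: "real \<Rightarrow> 'a::real_inner \<Rightarrow> 'a \<Rightarrow> 'a" where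
  "dkernel r w v = (qk r w)\<^sup>2 *\<^sub>R v - (4 * qk r w * (w \<bullet> v)) *\<^sub>R w"

text \<open>\<open>qk\<close> is not differentiable on the sphere, so the positions of w and w + v
  relative to the ball are separated. If exactly one of them lies inside, the value of
  \<open>qk\<close> there is at most \<open>3 * r * norm v\<close>, because it drops to 0 within
  distance \<open>norm v\<close>. Its square, and its product with \<open>w \<bullet> v\<close>, are
  then already quadratic in v.\<close>

lemma qk_kernel_taylor:
  fixes w v :: "'a::real_inner"
  assumes r: "norm v \<le> r"
  shows "norm ((qk r (w + v))\<^sup>2 *\<^sub>R (w + v) - (qk r w)\<^sup>2 *\<^sub>R w - dkernel r w v) \<le> 30 * r ^ 3 * (norm v)\<^sup>2"
proof -
  define p p' a n where "p = r\<^sup>2 - (norm w)\<^sup>2" and "p' = r\<^sup>2 - (norm (w + v))\<^sup>2"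
    and "a = w \<bullet> v" and "n = (norm v)\<^sup>2"
  have r0: "0 \<le> r" using r norm_ge_zero[of v] by linarith
  have nn: "0 \<le> n" "n \<le> r * norm v" "n \<le> r\<^sup>2"
    using r r0 power_mono[OF r, of 2] by (auto simp: n_def power2_eq_square mult_right_mono)
  have pp: "p' = p - (2 * a + n)"
    by (simp add: p_def p'_def a_def n_def power2_norm_eq_inner inner_add_left inner_add_right inner_commute)
  have r3n: "0 \<le> r ^ 3 * n" using nn r0 by simp
  have aw: "\<bar>a\<bar> \<le> norm w * norm v" unfolding a_def by (rule Cauchy_Schwarz_ineq2)
  let ?E = "(qk r (w + v))\<^sup>2 *\<^sub>R (w + v) - (qk r w)\<^sup>2 *\<^sub>R w - dkernel r w v"
  have tri: "norm (x + y) \<le> A + B" if "norm x \<le> A" "norm y \<le> B" for x y :: 'a and A B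
    using that norm_triangle_ineq[of x y] by linarith
  consider (in_in) "norm w \<le> r" "norm (w+v) \<le> r" | (in_out) "norm w \<le> r" "r < norm (w+v)"
    | (out_in) "r < norm w" "norm (w+v) \<le> r" | (out_out) "r < norm w" "r < norm (w+v)" by linarith
  then show ?thesis
  proof cases
    case in_in
    have q: "qk r w = p" "qk r (w + v) = p'" using in_in by (auto simp: qk_inside p_def p'_def)
    have p0: "0 \<le> p" "p \<le> r\<^sup>2" using qk_nonneg[of r w] qk_le[of r w] q by auto
    have a: "\<bar>a\<bar> \<le> r * norm v" using aw in_in(1) by (meson mult_right_mono norm_ge_zero order_trans)
    have c: "\<bar>2 * a + n\<bar> \<le> 3 * r * norm v" using a nn by linarith
    have c2: "(2 * a + n)\<^sup>2 \<le> 9 * r\<^sup>2 * n"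
      using power_mono[OF c abs_ge_zero, of 2] by (simp add: n_def power_mult_distrib)
    have r2n: "0 \<le> 11 * r\<^sup>2 * n" using nn by simp
    \<comment> \<open>The linear part of p'^2 - p^2 is -4 p a, which \<open>dkernel\<close> removes;
      each remaining term contains two factors of order \<open>norm v\<close>.\<close>
    have E: "?E = (- (2 * p * n) + (2 * a + n)\<^sup>2) *\<^sub>R w + (- (2 * p * (2 * a + n)) + (2 * a + n)\<^sup>2) *\<^sub>R v"
    proof -
      have "?E = (p'\<^sup>2 - p\<^sup>2 + 4 * p * a) *\<^sub>R w + (p'\<^sup>2 - p\<^sup>2) *\<^sub>R v"
        unfolding q dkernel_def a_def[symmetric] by (simp add: algebra_simps)
      moreover have "p'\<^sup>2 - p\<^sup>2 + 4 * p * a = - (2 * p * n) + (2 * a + n)\<^sup>2"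
        "p'\<^sup>2 - p\<^sup>2 = - (2 * p * (2 * a + n)) + (2 * a + n)\<^sup>2"
        unfolding pp by (simp_all add: power2_eq_square algebra_simps)
      ultimately show ?thesis by simp
    qed
    have "norm ?E \<le> 11 * r\<^sup>2 * n * r + (6 * r * r\<^sup>2 * norm v + 9 * r\<^sup>2 * n) * norm v"
      unfolding E
    proof (rule tri)
      have "p * n \<le> r\<^sup>2 * n" using p0 nn by (intro mult_right_mono) auto
      moreover have "0 \<le> p * n" using p0 nn by simp
      ultimately have "\<bar>- (2 * p * n) + (2 * a + n)\<^sup>2\<bar> \<le> 11 * r\<^sup>2 * n"
        using c2 r2n zero_le_power2[of "2 * a + n"] by linarith
      then show "norm ((- (2 * p * n) + (2 * a + n)\<^sup>2) *\<^sub>R w) \<le> 11 * r\<^sup>2 * n * r"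
        unfolding norm_scaleR real_norm_def using in_in(1) r2n by (intro mult_mono) auto
      have "p * \<bar>2 * a + n\<bar> \<le> r\<^sup>2 * (3 * r * norm v)" using p0 c by (intro mult_mono) auto
      moreover have "\<bar>- (2 * p * (2 * a + n)) + (2 * a + n)\<^sup>2\<bar> \<le> 2 * (p * \<bar>2 * a + n\<bar>) + (2 * a + n)\<^sup>2"
        using p0 abs_triangle_ineq[of "- (2 * p * (2 * a + n))" "(2 * a + n)\<^sup>2"] by (simp add: abs_mult)
      ultimately have "\<bar>- (2 * p * (2 * a + n)) + (2 * a + n)\<^sup>2\<bar> \<le> 6 * r * r\<^sup>2 * norm v + 9 * r\<^sup>2 * n"
        using c2 by (simp add: algebra_simps)
      then show "norm ((- (2 * p * (2 * a + n)) + (2 * a + n)\<^sup>2) *\<^sub>R v) \<le> (6 * r * r\<^sup>2 * norm v + 9 * r\<^sup>2 * n) * norm v"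
        by (simp add: mult_right_mono)
    qed
    also have "\<dots> = 17 * r ^ 3 * n + 9 * r\<^sup>2 * n * norm v" by (simp add: n_def power2_eq_square power3_eq_cube algebra_simps)
    also have "9 * r\<^sup>2 * n * norm v \<le> 9 * r\<^sup>2 * n * r" using r nn r0 by (intro mult_left_mono) auto
    finally have "norm ?E \<le> 26 * (r ^ 3 * n)" by (simp add: power2_eq_square power3_eq_cube mult_ac)
    then show ?thesis using r3n by (simp add: n_def)
  next
    case in_out
    have q: "qk r w = p" "qk r (w + v) = 0" using in_out r0 by (auto simp: qk_inside qk_outside p_def)
    have p0: "0 \<le> p" using qk_nonneg[of r w] q by auto
    have "r\<^sup>2 \<le> (norm (w + v))\<^sup>2" using in_out r0 by (intro power_mono) auto
    then have p': "p' \<le> 0" by (simp add: p'_def)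
    have a: "\<bar>a\<bar> \<le> r * norm v" using aw in_out(1) by (meson mult_right_mono norm_ge_zero order_trans)
    have p3: "p \<le> 3 * r * norm v" using pp p' a nn by linarith
    have p2: "p\<^sup>2 \<le> 9 * r\<^sup>2 * n" using power_mono[OF p3 p0, of 2] by (simp add: n_def power_mult_distrib)
    have E: "?E = (- p\<^sup>2 + 4 * p * a) *\<^sub>R w + (- p\<^sup>2) *\<^sub>R v"
      unfolding q dkernel_def a_def[symmetric] by (simp add: algebra_simps)
    have "norm ?E \<le> (9 * r\<^sup>2 * n + 12 * r * norm v * (r * norm v)) * r + 9 * r\<^sup>2 * n * r"
      unfolding E
    proof (rule tri)
      have "p * \<bar>a\<bar> \<le> 3 * r * norm v * (r * norm v)" using p0 p3 a by (intro mult_mono) auto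
      moreover have "\<bar>- p\<^sup>2 + 4 * p * a\<bar> \<le> p\<^sup>2 + 4 * (p * \<bar>a\<bar>)"
        using p0 abs_triangle_ineq[of "- p\<^sup>2" "4 * p * a"] by (simp add: abs_mult)
      ultimately have "\<bar>- p\<^sup>2 + 4 * p * a\<bar> \<le> 9 * r\<^sup>2 * n + 12 * r * norm v * (r * norm v)" using p2 by (simp add: algebra_simps)
      then show "norm ((- p\<^sup>2 + 4 * p * a) *\<^sub>R w) \<le> (9 * r\<^sup>2 * n + 12 * r * norm v * (r * norm v)) * r"
        using in_out(1) by (simp add: mult_mono)
      show "norm ((- p\<^sup>2) *\<^sub>R v) \<le> 9 * r\<^sup>2 * n * r" using p2 r r0 nn by (simp add: mult_mono)
    qed
    then show ?thesis by (simp add: n_def power2_eq_square power3_eq_cube algebra_simps)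
  next
    case out_in
    have q: "qk r w = 0" "qk r (w + v) = p'" using out_in r0 by (auto simp: qk_inside qk_outside p'_def)
    have p0: "0 \<le> p'" using qk_nonneg[of r "w+v"] q by auto
    have wr: "norm w \<le> 2 * r" using norm_triangle_ineq4[of "w + v" v] out_in r by simp
    have "r\<^sup>2 \<le> (norm w)\<^sup>2" using out_in r0 by (intro power_mono) auto
    then have "p' \<le> (norm w)\<^sup>2 - (norm (w + v))\<^sup>2" by (simp add: p'_def)
    also have "\<dots> = (norm w - norm (w + v)) * (norm w + norm (w + v))"
      by (simp add: power2_eq_square algebra_simps)
    also have "\<dots> \<le> norm v * (3 * r)"
      using norm_triangle_ineq4[of "w + v" v] wr out_in r by (intro mult_mono) auto
    finally have p3: "p' \<le> 3 * r * norm v" by (simp add: mult_ac)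
    have p2: "p'\<^sup>2 \<le> 9 * r\<^sup>2 * n" using power_mono[OF p3 p0, of 2] by (simp add: n_def power_mult_distrib)
    have "norm ?E = p'\<^sup>2 * norm (w + v)" unfolding q dkernel_def by simp
    also have "\<dots> \<le> 9 * r\<^sup>2 * n * r" using p2 out_in nn r0 by (intro mult_mono) auto
    finally have "norm ?E \<le> 9 * (r ^ 3 * n)" by (simp add: power2_eq_square power3_eq_cube mult_ac)
    then show ?thesis using r3n by (simp add: n_def)
  next
    case out_out
    then show ?thesis using r0 by (simp add: qk_outside dkernel_def)
  qed
qed

text \<open>The analogous expansion in the radius. It makes \<open>qmass\<close> differentiable in
  the scale, and this derivative is what the trace of the moment derivative contains.\<close>

lemma qk2_taylor_radius:
  assumes r: "0 \<le> r" and h: "\<bar>h\<bar> \<le> r"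
  shows "\<bar>(qk (r + h) w)\<^sup>2 - (qk r w)\<^sup>2 - h * (4 * r * qk r w)\<bar> \<le> 21 * r\<^sup>2 * h\<^sup>2"
proof -
  define p p' n where "p = r\<^sup>2 - n" and "p' = (r + h)\<^sup>2 - n" and "n = (norm w)\<^sup>2"
  have q: "qk r w = max 0 p" "qk (r + h) w = max 0 p'" by (auto simp: qk_def p_def p'_def n_def)
  define d where "d = 2 * r * h + h\<^sup>2"
  have pp: "p' = p + d" by (simp add: p_def p'_def d_def power2_eq_square algebra_simps)
  have h2: "h\<^sup>2 \<le> r * \<bar>h\<bar>" using h mult_right_mono[OF h abs_ge_zero[of h]] by (metis power2_abs power2_eq_square)
  have "\<bar>2 * r * h\<bar> = 2 * (r * \<bar>h\<bar>)" using r by (simp add: abs_mult)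
  then have d: "\<bar>d\<bar> \<le> 3 * (r * \<bar>h\<bar>)" unfolding d_def using h2 abs_triangle_ineq[of "2 * r * h" "h\<^sup>2"] by simp
  have sq: "x\<^sup>2 \<le> 9 * r\<^sup>2 * h\<^sup>2" if "0 \<le> x" "x \<le> 3 * (r * \<bar>h\<bar>)" for x
    using power_mono[OF that(2,1), of 2] by (simp add: power_mult_distrib)
  have rh: "0 \<le> r\<^sup>2 * h\<^sup>2" by simp
  have n0: "0 \<le> n" by (simp add: n_def)
  consider "0 \<le> p" "0 \<le> p'" | "0 \<le> p" "p' < 0" | "p < 0" "0 \<le> p'" | "p < 0" "p' < 0" by linarith
  then show ?thesis
  proof cases
    case 1
    have e: "p'\<^sup>2 - p\<^sup>2 - h * (4 * r * p) = 2 * (p * h\<^sup>2) + d\<^sup>2"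
      by (simp add: pp d_def power2_eq_square algebra_simps)
    have "p * h\<^sup>2 \<le> r\<^sup>2 * h\<^sup>2" using n0 by (intro mult_right_mono) (auto simp: p_def)
    moreover have "0 \<le> p * h\<^sup>2" using 1 by simp
    moreover have "d\<^sup>2 \<le> 9 * r\<^sup>2 * h\<^sup>2" using sq[of "\<bar>d\<bar>"] d by simp
    ultimately have "\<bar>2 * (p * h\<^sup>2) + d\<^sup>2\<bar> \<le> 21 * r\<^sup>2 * h\<^sup>2" using rh zero_le_power2[of d] by linarith
    then show ?thesis using 1 e unfolding q by simp
  next
    case 2
    have p: "p \<le> 3 * (r * \<bar>h\<bar>)" using 2 pp d by linarith
    have "r * \<bar>h\<bar> * p \<le> r * \<bar>h\<bar> * (3 * (r * \<bar>h\<bar>))" using p r by (intro mult_left_mono) auto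
    moreover have "\<bar>h * (4 * r * p)\<bar> = 4 * (r * \<bar>h\<bar> * p)" using 2 r by (simp add: abs_mult)
    moreover have "r * \<bar>h\<bar> * (3 * (r * \<bar>h\<bar>)) = 3 * r\<^sup>2 * h\<^sup>2"
      by (metis (no_types) mult.assoc mult.left_commute power2_abs power2_eq_square power_mult_distrib)
    ultimately have "\<bar>h * (4 * r * p)\<bar> \<le> 12 * r\<^sup>2 * h\<^sup>2" by linarith
    moreover have "p\<^sup>2 \<le> 9 * r\<^sup>2 * h\<^sup>2" using sq[of p] 2 p by simp
    moreover have "\<bar>- p\<^sup>2 - h * (4 * r * p)\<bar> \<le> p\<^sup>2 + \<bar>h * (4 * r * p)\<bar>"
      using abs_triangle_ineq4[of "- p\<^sup>2" "h * (4 * r * p)"] by simp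
    ultimately have "\<bar>- p\<^sup>2 - h * (4 * r * p)\<bar> \<le> 21 * r\<^sup>2 * h\<^sup>2" by linarith
    then show ?thesis using 2 unfolding q by simp
  next
    case 3
    have "p'\<^sup>2 \<le> 9 * r\<^sup>2 * h\<^sup>2" using sq[of p'] 3 pp d by simp
    then have "p'\<^sup>2 \<le> 21 * r\<^sup>2 * h\<^sup>2" using rh by linarith
    then show ?thesis using 3 unfolding q by simp
  next
    case 4
    then show ?thesis unfolding q by simp
  qed
qed

section \<open>Moments of a locally finite measure\<close>

lemma integrable_continuous_bounded_support:
  fixes \<nu> :: "'a::euclidean_space measure" and f :: "'a \<Rightarrow> 'b::{banach,second_countable_topology}"
  assumes lf: "locally_finite_borel_measure \<nu>" and f: "continuous_on UNIV f"
    and out: "\<And>y. y \<notin> cball z R \<Longrightarrow> f y = 0"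
  shows "integrable \<nu> f"
proof -
  have "compact (f ` cball z R)"
    using f by (intro compact_continuous_image) (auto intro: continuous_on_subset)
  then obtain B where "\<And>y. y \<in> cball z R \<Longrightarrow> norm (f y) \<le> B"
    using compact_imp_bounded bounded_iff by (metis image_eqI)
  then show ?thesis
    using f out by (intro integral_bounded_support(1)[OF lf, where A="cball z R"])
      (auto intro: borel_measurable_continuous_onI)
qed

lemma norm_integral_diff_le:
  fixes \<nu> :: "'a::euclidean_space measure" and f :: "'a \<Rightarrow> 'b::{banach,second_countable_topology}"
  assumes lf: "locally_finite_borel_measure \<nu>" and f: "integrable \<nu> f" "integrable \<nu> g"
    and fm: "f \<in> borel_measurable borel" "g \<in> borel_measurable borel"
    and bd: "\<And>y. y \<in> cball z R \<Longrightarrow> norm (f y - g y) \<le> B"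
    and out: "\<And>y. y \<notin> cball z R \<Longrightarrow> f y = g y"
  shows "norm (integral\<^sup>L \<nu> f - integral\<^sup>L \<nu> g) \<le> B * measure \<nu> (cball z R)"
proof -
  have "integral\<^sup>L \<nu> f - integral\<^sup>L \<nu> g = (LINT y|\<nu>. f y - g y)" using f by simp
  also have "norm \<dots> \<le> B * measure \<nu> (cball z R)"
    using fm bd out by (intro integral_bounded_support(2)[OF lf]) auto
  finally show ?thesis .
qed

definition sym_moment :: "'a::euclidean_space measure \<Rightarrow> 'a \<Rightarrow> real \<Rightarrow> 'a" where
  "sym_moment \<nu> z r = (LINT y|\<nu>. (qk r (z - y))\<^sup>2 *\<^sub>R (z - y))"

text \<open>A smoothed form of \<open>r ^ 4\<close> times the mass of the ball; unlike that mass it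
  is differentiable in r and locally Lipschitz in z.\<close>

definition qmass :: "'a::euclidean_space measure \<Rightarrow> 'a \<Rightarrow> real \<Rightarrow> real" where
  "qmass \<nu> z r = (LINT y|\<nu>. (qk r (z - y))\<^sup>2)"

definition dmoment :: "'a::euclidean_space measure \<Rightarrow> 'a \<Rightarrow> real \<Rightarrow> 'a \<Rightarrow> 'a" where
  "dmoment \<nu> z r v = (LINT y|\<nu>. dkernel r (z - y) v)"

lemma dkernel_outside: "0 \<le> r \<Longrightarrow> r \<le> norm w \<Longrightarrow> dkernel r w v = 0"
  by (simp add: dkernel_def qk_outside)

context
  fixes \<nu> :: "'a::euclidean_space measure"
  assumes lf: "locally_finite_borel_measure \<nu>"
begin

lemma integrable_qk_power: "0 \<le> r \<Longrightarrow> 0 < n \<Longrightarrow> integrable \<nu> (\<lambda>y. (qk r (z - y)) ^ n)"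
  by (intro integrable_continuous_bounded_support[OF lf, of _ z r] continuous_intros)
     (auto simp: qk_outside dist_norm)

lemma integrable_qk_scaleR:
  fixes g :: "'a \<Rightarrow> 'b::{banach,second_countable_topology}"
  shows "0 \<le> r \<Longrightarrow> 0 < n \<Longrightarrow> continuous_on UNIV g \<Longrightarrow> integrable \<nu> (\<lambda>y. (qk r (z - y)) ^ n *\<^sub>R g y)"
  by (intro integrable_continuous_bounded_support[OF lf, of _ z r] continuous_intros)
     (auto simp: qk_outside dist_norm)

lemma integrable_sym_kernel: "0 \<le> r \<Longrightarrow> integrable \<nu> (\<lambda>y. (qk r (z - y))\<^sup>2 *\<^sub>R (z - y))"
  by (intro integrable_qk_scaleR continuous_intros) auto

lemma integrable_dkernel: "0 \<le> r \<Longrightarrow> integrable \<nu> (\<lambda>y. dkernel r (z - y) v)"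
  unfolding dkernel_def
  by (intro Bochner_Integration.integrable_diff integrable_qk_scaleR continuous_intros
      integrable_continuous_bounded_support[OF lf, of "\<lambda>y. (4 * qk r (z - y) * ((z - y) \<bullet> v)) *\<^sub>R (z - y)" z r])
     (auto simp: dist_norm qk_outside)

lemma sym_moment_lipschitz:
  assumes "0 \<le> r"
  shows "norm (sym_moment \<nu> z r - sym_moment \<nu> z' r) \<le> 5 * r ^ 4 * norm (z - z') * measure \<nu> (cball z (r + norm (z - z')))"
  unfolding sym_moment_def
proof (rule norm_integral_diff_le[OF lf])
  fix y assume "y \<notin> cball z (r + norm (z - z'))"
  then have "r \<le> norm (z - y)" "r \<le> norm (z' - y)"
    using assms norm_triangle_ineq[of "z - z'" "z' - y"] norm_ge_zero[of "z - z'"]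
    unfolding mem_cball dist_norm by (linarith, simp)
  then show "(qk r (z - y))\<^sup>2 *\<^sub>R (z - y) = (qk r (z' - y))\<^sup>2 *\<^sub>R (z' - y)" using assms by (simp add: qk_outside)
next
  fix y
  show "norm ((qk r (z - y))\<^sup>2 *\<^sub>R (z - y) - (qk r (z' - y))\<^sup>2 *\<^sub>R (z' - y)) \<le> 5 * r ^ 4 * norm (z - z')"
    using qk_kernel_lipschitz[OF assms, of "z - y" "z' - y"] by simp
qed (auto intro!: integrable_sym_kernel assms borel_measurable_continuous_onI continuous_intros)

lemma qmass_lipschitz:
  assumes "0 \<le> r"
  shows "\<bar>qmass \<nu> z r - qmass \<nu> z' r\<bar> \<le> 4 * r ^ 3 * norm (z - z') * measure \<nu> (cball z (r + norm (z - z')))"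
  unfolding qmass_def real_norm_def[symmetric]
proof (rule norm_integral_diff_le[OF lf])
  fix y assume "y \<notin> cball z (r + norm (z - z'))"
  then have "r \<le> norm (z - y)" "r \<le> norm (z' - y)"
    using assms norm_triangle_ineq[of "z - z'" "z' - y"] norm_ge_zero[of "z - z'"]
    unfolding mem_cball dist_norm by (linarith, simp)
  then show "(qk r (z - y))\<^sup>2 = (qk r (z' - y))\<^sup>2" using assms by (simp add: qk_outside)
next
  fix y
  show "norm ((qk r (z - y))\<^sup>2 - (qk r (z' - y))\<^sup>2) \<le> 4 * r ^ 3 * norm (z - z')"
    using qk2_lipschitz[OF assms, of "z - y" "z' - y"] by simp
qed (auto intro!: integrable_qk_power assms borel_measurable_continuous_onI continuous_intros)

text \<open>When the moments vanish at z and z + v, this bounds the derivative along v by a term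
  quadratic in v. It is used in two regimes: v fixed and r large, where one power of r is gained,
  and r fixed and v small, where a nonzero derivative would confine the support near a
  hyperplane.\<close>

lemma sym_moment_taylor:
  assumes v: "norm v \<le> r"
  shows "norm (sym_moment \<nu> (z + v) r - sym_moment \<nu> z r - dmoment \<nu> z r v)
    \<le> 30 * r ^ 3 * (norm v)\<^sup>2 * measure \<nu> (cball z (2 * r))"
proof -
  have r0: "0 \<le> r" using v norm_ge_zero[of v] by linarith
  let ?f = "\<lambda>y. (qk r (z + v - y))\<^sup>2 *\<^sub>R (z + v - y)"
  let ?g = "\<lambda>y. (qk r (z - y))\<^sup>2 *\<^sub>R (z - y) + dkernel r (z - y) v"
  have "sym_moment \<nu> z r + dmoment \<nu> z r v = integral\<^sup>L \<nu> ?g"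
    unfolding sym_moment_def dmoment_def
    by (intro Bochner_Integration.integral_add[symmetric] integrable_sym_kernel integrable_dkernel r0)
  moreover have "norm (integral\<^sup>L \<nu> ?f - integral\<^sup>L \<nu> ?g) \<le> 30 * r ^ 3 * (norm v)\<^sup>2 * measure \<nu> (cball z (2 * r))"
  proof (rule norm_integral_diff_le[OF lf])
    fix y assume "y \<notin> cball z (2 * r)"
    then have "r \<le> norm (z - y)" "r \<le> norm (z + v - y)"
      using r0 v norm_triangle_ineq4[of "z + v - y" v] by (auto simp: dist_norm)
    then show "?f y = ?g y" using r0 by (simp add: qk_outside dkernel_outside)
  next
    fix y
    show "norm (?f y - ?g y) \<le> 30 * r ^ 3 * (norm v)\<^sup>2"
      using qk_kernel_taylor[OF v, of "z - y"] by (simp add: algebra_simps)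
  qed (auto simp: dkernel_def intro!: integrable_sym_kernel integrable_dkernel[unfolded dkernel_def] r0 borel_measurable_continuous_onI continuous_intros Bochner_Integration.integrable_add)
  ultimately show ?thesis by (simp add: sym_moment_def diff_diff_eq)
qed

text \<open>The expansion in the radius has an error quadratic in h, uniform in y and supported in a
  fixed ball, so it can be integrated directly instead of differentiating under the integral
  sign.\<close>

lemma qmass_has_derivative:
  assumes r: "0 < r"
  shows "((\<lambda>r. qmass \<nu> z r) has_real_derivative 4 * r * (LINT y|\<nu>. qk r (z - y))) (at r)"
proof -
  define M where "M = measure \<nu> (cball z (2 * r))"
  define D where "D = 4 * r * (LINT y|\<nu>. qk r (z - y))"
  have bound: "\<bar>qmass \<nu> z (r + h) - qmass \<nu> z r - h * D\<bar> \<le> 21 * r\<^sup>2 * h\<^sup>2 * M" if h: "\<bar>h\<bar> \<le> r" for h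
  proof -
    have rh: "0 \<le> r + h" "r + h \<le> 2 * r" using h by auto
    have i1: "integrable \<nu> (\<lambda>y. qk r (z - y))" using integrable_qk_power[of r 1 z] r by simp
    have "qmass \<nu> z r + h * D = (LINT y|\<nu>. (qk r (z - y))\<^sup>2 + h * (4 * r * qk r (z - y)))"
      unfolding qmass_def D_def using i1 integrable_qk_power[of r 2 z] r
      by (subst Bochner_Integration.integral_add) auto
    moreover have "norm ((LINT y|\<nu>. (qk (r + h) (z - y))\<^sup>2) - (LINT y|\<nu>. (qk r (z - y))\<^sup>2 + h * (4 * r * qk r (z - y))))
       \<le> 21 * r\<^sup>2 * h\<^sup>2 * M"
      unfolding M_def
    proof (rule norm_integral_diff_le[OF lf])
      fix y assume "y \<notin> cball z (2 * r)"
      then have "r \<le> norm (z - y)" "r + h \<le> norm (z - y)" using rh r by (auto simp: dist_norm)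
      then show "(qk (r + h) (z - y))\<^sup>2 = (qk r (z - y))\<^sup>2 + h * (4 * r * qk r (z - y))"
        using rh r by (simp add: qk_outside)
    next
      fix y
      show "norm ((qk (r + h) (z - y))\<^sup>2 - ((qk r (z - y))\<^sup>2 + h * (4 * r * qk r (z - y)))) \<le> 21 * r\<^sup>2 * h\<^sup>2"
        using qk2_taylor_radius[of r h "z - y"] h r by (simp add: diff_diff_eq)
    qed (use i1 rh r in \<open>auto intro!: integrable_qk_power borel_measurable_continuous_onI continuous_intros Bochner_Integration.integrable_add\<close>)
    ultimately show ?thesis by (simp add: qmass_def diff_diff_eq)
  qed
  have "((\<lambda>h. (qmass \<nu> z (r + h) - qmass \<nu> z r) / h) \<longlongrightarrow> D) (at 0)"
  proof (rule LIM_I)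
    fix e :: real assume e: "0 < e"
    define C where "C = 21 * r\<^sup>2 * M + 1"
    have C: "0 < C" using r by (simp add: C_def M_def add_nonneg_pos)
    show "\<exists>d>0. \<forall>h. h \<noteq> 0 \<and> norm (h - 0) < d \<longrightarrow> norm ((qmass \<nu> z (r + h) - qmass \<nu> z r) / h - D) < e"
    proof (intro exI conjI allI impI)
      show "0 < min r (e / C)" using r e C by simp
      fix h :: real assume h: "h \<noteq> 0 \<and> norm (h - 0) < min r (e / C)"
      then have hC: "\<bar>h\<bar> * C < e" using C by (simp add: field_simps)
      have "(qmass \<nu> z (r + h) - qmass \<nu> z r) / h - D = (qmass \<nu> z (r + h) - qmass \<nu> z r - h * D) / h"
        using h by (simp add: field_simps)
      also have "norm \<dots> \<le> 21 * r\<^sup>2 * h\<^sup>2 * M / \<bar>h\<bar>"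
        using bound[of h] h by (simp add: divide_right_mono)
      also have "\<dots> = \<bar>h\<bar> * (21 * r\<^sup>2 * M)"
        using h by (simp add: field_simps power2_eq_square)
      also have "\<dots> \<le> \<bar>h\<bar> * C" by (intro mult_left_mono) (auto simp: C_def)
      finally show "norm ((qmass \<nu> z (r + h) - qmass \<nu> z r) / h - D) < e" using hC by linarith
    qed
  qed
  then show ?thesis unfolding DERIV_def D_def .
qed

lemma qmass_nonneg: "0 \<le> qmass \<nu> z r"
  unfolding qmass_def by (intro Bochner_Integration.integral_nonneg) auto

lemma qmass_le:
  assumes "0 \<le> r"
  shows "qmass \<nu> z r \<le> r ^ 4 * measure \<nu> (cball z r)"
proof -
  have "norm (qmass \<nu> z r) \<le> r ^ 4 * measure \<nu> (cball z r)"
    unfolding qmass_def using assms qk2_le[of r]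
    by (intro integral_bounded_support(2)[OF lf])
       (auto simp: dist_norm qk_outside intro!: borel_measurable_continuous_onI continuous_intros)
  then show ?thesis using qmass_nonneg[of z r] by simp
qed

text \<open>On the ball of radius r the kernel of radius 2 r is at least
  \<open>3 * r\<^sup>2\<close>; squaring gives the factor 9. Together with \<open>qmass_le\<close>
  this makes growth bounds for \<open>qmass\<close> and for the mass of balls
  interchangeable.\<close>

lemma qmass_ge:
  assumes "0 \<le> r"
  shows "9 * r ^ 4 * measure \<nu> (cball z r) \<le> qmass \<nu> z (2 * r)"
proof -
  have sb: "sets \<nu> = sets borel" using lf by (rule locally_finite_sets)
  have fin: "emeasure \<nu> (cball z r) < \<infinity>" using lf by (intro emeasure_bounded_finite) auto
  have "9 * r ^ 4 * measure \<nu> (cball z r) = (LINT y|\<nu>. indicat_real (cball z r) y * (9 * r ^ 4))"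
    using sb sets_eq_imp_space_eq[OF sb] by simp
  also have "\<dots> \<le> qmass \<nu> z (2 * r)"
    unfolding qmass_def
  proof (rule integral_mono)
    show "integrable \<nu> (\<lambda>y. indicat_real (cball z r) y * (9 * r ^ 4))"
      using fin sb by (intro integrable_mult_left integrable_real_indicator) auto
    show "integrable \<nu> (\<lambda>y. (qk (2 * r) (z - y))\<^sup>2)" using assms by (intro integrable_qk_power) auto
    fix y
    have "9 * r ^ 4 \<le> (qk (2 * r) (z - y))\<^sup>2" if "y \<in> cball z r"
    proof -
      have n: "norm (z - y) \<le> r" using that by (simp add: dist_norm)
      then have "(norm (z - y))\<^sup>2 \<le> r\<^sup>2" by (intro power_mono) auto
      then have "3 * r\<^sup>2 \<le> qk (2 * r) (z - y)" by (simp add: qk_def power_mult_distrib)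
      then have "(3 * r\<^sup>2)\<^sup>2 \<le> (qk (2 * r) (z - y))\<^sup>2" by (intro power_mono) auto
      then show ?thesis by (simp add: power_mult_distrib power_mult[symmetric])
    qed
    then show "indicat_real (cball z r) y * (9 * r ^ 4) \<le> (qk (2 * r) (z - y))\<^sup>2"
      by (auto simp: indicator_def)
  qed
  finally show ?thesis .
qed

end

section \<open>Hausdorff measure\<close>

lemma ennreal_cancel_inverse: "0 < k \<Longrightarrow> ennreal (1 / k) * (ennreal k * x) = x"
  by (simp add: mult.assoc[symmetric] ennreal_mult[symmetric])

text \<open>The mass distribution principle. Replacing each covering set that meets A by a ball
  centred in A, with twice its diameter as radius, costs a factor \<open>2 powr s\<close>; the
  normalisation of \<open>hausdorff_outer\<close> accounts for the other one. Covers of mesh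
  \<open>\<delta> / 4\<close> keep these radii below \<delta>.\<close>

lemma measure_le_hausdorff_outer:
  fixes \<nu> :: "'a::euclidean_space measure"
  assumes sb: "sets \<nu> = sets borel" and A: "A \<in> sets borel" and pos: "0 < \<delta>" "0 < s" "0 < \<epsilon>"
    and dens: "\<And>z r. z \<in> A \<Longrightarrow> 0 < r \<Longrightarrow> r < \<delta> \<Longrightarrow> emeasure \<nu> (ball z r) \<le> ennreal (\<epsilon> * r powr s)"
  shows "emeasure \<nu> A \<le> ennreal (\<epsilon> * 4 powr s / unit_ball_vol s) * hausdorff_outer s A"
proof -
  define k where "k = \<epsilon> * 2 powr s"
  have k: "0 < k" using pos by (simp add: k_def)
  \<comment> \<open>A covering set of diameter 0 contributes \<open>0 powr s = 0\<close> to the sum,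
    so the points of A have to be null.\<close>
  have single: "emeasure \<nu> {z} = 0" if z: "z \<in> A" for z
  proof -
    have "((\<lambda>r. ennreal (\<epsilon> * r powr s)) \<longlongrightarrow> ennreal (\<epsilon> * 0 powr s)) (at_right 0)"
      using pos by (intro tendsto_ennrealI tendsto_mult tendsto_const tendsto_powr')
         (auto simp: eventually_at_right_less intro!: tendsto_ident_at eventually_at_right_less[THEN eventually_mono])
    moreover have "eventually (\<lambda>r. emeasure \<nu> {z} \<le> ennreal (\<epsilon> * r powr s)) (at_right 0)"
      using eventually_at_right_real[OF pos(1)]
    proof eventually_elim
      case (elim r)
      have "emeasure \<nu> {z} \<le> emeasure \<nu> (ball z r)" using elim sb by (intro emeasure_mono) auto
      also have "\<dots> \<le> ennreal (\<epsilon> * r powr s)" using elim z by (intro dens) auto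
      finally show ?case .
    qed
    ultimately have "emeasure \<nu> {z} \<le> ennreal (\<epsilon> * 0 powr s)"
      by (rule tendsto_lowerbound) simp
    then show ?thesis by simp
  qed
  have "ennreal (1 / k) * emeasure \<nu> A \<le> hausdorff_pre s (\<delta> / 4) A"
    unfolding hausdorff_pre_def
  proof (rule INF_greatest)
    fix E :: "nat \<Rightarrow> 'a set"
    assume "E \<in> {E. A \<subseteq> (\<Union>i. E i) \<and> (\<forall>i. bounded (E i) \<and> diameter (E i) \<le> \<delta> / 4)}"
    then have E: "A \<subseteq> (\<Union>i. E i)" "\<And>i. bounded (E i)" "\<And>i. diameter (E i) \<le> \<delta> / 4" by auto
    define p where "p i = (SOME z. z \<in> A \<inter> E i)" for i
    have p: "p i \<in> A \<inter> E i" if "A \<inter> E i \<noteq> {}" for i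
      unfolding p_def using that by (metis ex_in_conv someI_ex)
    define B where "B i = (if A \<inter> E i = {} then {} else if diameter (E i) = 0 then {p i} else ball (p i) (2 * diameter (E i)))" for i
    have dn: "0 \<le> diameter (E i)" for i using E(2) by (intro diameter_ge_0)
    have EB: "A \<inter> E i \<subseteq> B i" for i
    proof
      fix y assume y: "y \<in> A \<inter> E i"
      then have "p i \<in> A \<inter> E i" by (intro p) auto
      then have "dist (p i) y \<le> diameter (E i)" using y E(2) by (intro diameter_bounded_bound) auto
      then show "y \<in> B i" using y dn[of i] by (auto simp: B_def)
    qed
    have Bm: "B i \<in> sets \<nu>" for i by (auto simp: B_def sb)
    have Ble: "emeasure \<nu> (B i) \<le> ennreal k * ennreal (diameter (E i) powr s)" for i
    proof (cases "A \<inter> E i = {} \<or> diameter (E i) = 0")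
      case True
      then show ?thesis using p[of i] single[of "p i"] by (auto simp: B_def)
    next
      case False
      then have "emeasure \<nu> (B i) \<le> ennreal (\<epsilon> * (2 * diameter (E i)) powr s)"
        using p[of i] dn[of i] E(3)[of i] pos(1) by (auto simp: B_def intro!: dens)
      also have "\<dots> = ennreal k * ennreal (diameter (E i) powr s)"
        using dn[of i] pos by (simp add: k_def powr_mult ennreal_mult[symmetric] mult_ac)
      finally show ?thesis .
    qed
    have "emeasure \<nu> A \<le> emeasure \<nu> (\<Union>i. B i)"
    proof (rule emeasure_mono)
      show "A \<subseteq> (\<Union>i. B i)" using E(1) EB by blast
    qed (use Bm in auto)
    also have "\<dots> \<le> (\<Sum>i. emeasure \<nu> (B i))"
      using Bm by (intro emeasure_subadditive_countably) auto
    also have "\<dots> \<le> (\<Sum>i. ennreal k * ennreal (diameter (E i) powr s))"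
      by (intro suminf_le Ble) auto
    finally have "ennreal (1 / k) * emeasure \<nu> A \<le> ennreal (1 / k) * (ennreal k * (\<Sum>i. ennreal (diameter (E i) powr s)))"
      by (intro mult_left_mono) auto
    then show "ennreal (1 / k) * emeasure \<nu> A \<le> (\<Sum>i. ennreal (diameter (E i) powr s))"
      by (simp add: ennreal_cancel_inverse k)
  qed
  also have "\<dots> \<le> (SUP \<delta>\<in>{0<..}. hausdorff_pre s \<delta> A)" using pos by (intro SUP_upper) auto
  finally have "ennreal k * (ennreal (1 / k) * emeasure \<nu> A) \<le> ennreal k * (SUP \<delta>\<in>{0<..}. hausdorff_pre s \<delta> A)"
    by (intro mult_left_mono) auto
  moreover have "ennreal k * (ennreal (1 / k) * emeasure \<nu> A) = emeasure \<nu> A"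
    using ennreal_cancel_inverse[of "1 / k"] k by simp
  moreover have "ennreal (\<epsilon> * 4 powr s / unit_ball_vol s) * hausdorff_outer s A = ennreal k * (SUP \<delta>\<in>{0<..}. hausdorff_pre s \<delta> A)"
  proof -
    have "\<epsilon> * 4 powr s / unit_ball_vol s * (unit_ball_vol s / 2 powr s) = k"
    proof -
      have "(4::real) powr s = 2 powr s * 2 powr s" by (simp add: powr_mult[symmetric])
      moreover have "0 < unit_ball_vol s" using pos by (intro unit_ball_vol_pos) auto
      ultimately show ?thesis by (simp add: k_def field_simps)
    qed
    then show ?thesis
      unfolding hausdorff_outer_def using pos
      by (simp add: mult.assoc[symmetric] ennreal_mult[symmetric] less_imp_le)
  qed
  ultimately show ?thesis by simp
qed

lemma hausdorff_pre_finite_cover: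
  fixes A :: "'a::euclidean_space set"
  assumes F: "finite F" and A: "A \<subseteq> (\<Union>i\<in>F. E i)" and E: "\<And>i. i \<in> F \<Longrightarrow> bounded (E i)"
    "\<And>i. i \<in> F \<Longrightarrow> diameter (E i) \<le> d" and d: "0 < d" "d \<le> \<delta>" and s: "0 < s"
  shows "hausdorff_pre s \<delta> A \<le> ennreal (real (card F) * d powr s)"
proof -
  obtain h where h: "bij_betw h {0..<card F} F" using ex_bij_betw_nat_finite[OF F] by blast
  define E' where "E' n = (if n < card F then E (h n) else {})" for n
  have hF: "h n \<in> F" if "n < card F" for n using h that by (auto simp: bij_betw_def)
  have "hausdorff_pre s \<delta> A \<le> (\<Sum>n. ennreal (diameter (E' n) powr s))"
    unfolding hausdorff_pre_def
  proof (rule INF_lower, safe)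
    fix x assume "x \<in> A"
    then obtain i where i: "i \<in> F" "x \<in> E i" using A by blast
    then obtain n where "n < card F" "h n = i" using h by (force simp: bij_betw_def)
    then have "x \<in> E' n" using i by (simp add: E'_def)
    then show "x \<in> (\<Union>i. E' i)" by blast
  next
    fix n
    show "bounded (E' n)" using E(1) hF by (auto simp: E'_def)
    show "diameter (E' n) \<le> \<delta>" using E(2)[OF hF] d by (force simp: E'_def)
  qed
  also have "\<dots> = (\<Sum>n<card F. ennreal (diameter (E' n) powr s))"
    by (intro suminf_finite) (auto simp: E'_def)
  also have "\<dots> \<le> (\<Sum>n<card F. ennreal (d powr s))"
    using E hF s by (intro sum_mono ennreal_leI powr_mono2) (auto simp: E'_def intro: diameter_ge_0)
  also have "\<dots> = ennreal (real (card F) * d powr s)"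
    by (simp add: ennreal_mult ennreal_of_nat_eq_real_of_nat)
  finally show ?thesis .
qed

lemma norm_span_le_sum_inner:
  fixes B :: "'a::euclidean_space set"
  assumes "pairwise orthogonal B" "\<And>b. b \<in> B \<Longrightarrow> norm b = 1" "finite B" "w \<in> span B"
  shows "norm w \<le> (\<Sum>b\<in>B. \<bar>w \<bullet> b\<bar>)"
proof -
  have "norm w = norm (\<Sum>b\<in>B. (w \<bullet> b) *\<^sub>R b)" using orthonormal_basis_expand[OF assms(1,2,4,3)] by simp
  also have "\<dots> \<le> (\<Sum>b\<in>B. \<bar>w \<bullet> b\<bar>)"
    using assms(2) by (intro order_trans[OF norm_sum] sum_mono) simp
  finally show ?thesis .
qed

text \<open>A cube of half-side \<eta> about a lattice point of the subspace. Cells of half that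
  size would already tile; the overlap lets the floors of the coordinates serve as the
  index.\<close>

definition grid_cell :: "'a::euclidean_space set \<Rightarrow> real \<Rightarrow> ('a \<Rightarrow> int) \<Rightarrow> 'a set" where
  "grid_cell B \<eta> g = {w \<in> span B. \<forall>b\<in>B. \<bar>w \<bullet> b - of_int (g b) * \<eta>\<bar> \<le> \<eta>}"

lemma grid_cell_dist:
  fixes B :: "'a::euclidean_space set"
  assumes B: "pairwise orthogonal B" "\<And>b. b \<in> B \<Longrightarrow> norm b = 1" "finite B"
    and w: "w \<in> grid_cell B \<eta> g" "w' \<in> grid_cell B \<eta> g"
  shows "norm (w - w') \<le> 2 * \<eta> * card B"
proof -
  have "norm (w - w') \<le> (\<Sum>b\<in>B. \<bar>(w - w') \<bullet> b\<bar>)"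
    using w by (intro norm_span_le_sum_inner B) (auto simp: grid_cell_def span_diff)
  also have "\<dots> \<le> (\<Sum>b\<in>B. 2 * \<eta>)"
  proof (rule sum_mono)
    fix b assume "b \<in> B"
    then have "\<bar>w \<bullet> b - of_int (g b) * \<eta>\<bar> \<le> \<eta>" "\<bar>w' \<bullet> b - of_int (g b) * \<eta>\<bar> \<le> \<eta>"
      using w by (auto simp: grid_cell_def)
    then show "\<bar>(w - w') \<bullet> b\<bar> \<le> 2 * \<eta>" by (simp add: inner_diff_left)
  qed
  finally show ?thesis by (simp add: mult_ac)
qed

text \<open>The number of layers may depend on the basis vector, so that a thin slab needs only
  three of them across.\<close>

lemma grid_cover:
  fixes B :: "'a::euclidean_space set"
  assumes \<eta>: "0 < \<eta>" and w: "w \<in> span B" "\<And>b. b \<in> B \<Longrightarrow> \<bar>w \<bullet> b\<bar> \<le> real (N b) * \<eta>"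
  shows "w \<in> (\<Union>g\<in>PiE B (\<lambda>b. {- int (N b)..int (N b)}). grid_cell B \<eta> g)"
proof
  define g where "g = restrict (\<lambda>b. \<lfloor>w \<bullet> b / \<eta>\<rfloor>) B"
  show "g \<in> PiE B (\<lambda>b. {- int (N b)..int (N b)})"
  proof
    fix b assume b: "b \<in> B"
    have "- real (N b) \<le> w \<bullet> b / \<eta>" "w \<bullet> b / \<eta> \<le> real (N b)"
      using w(2)[OF b] \<eta> by (auto simp: field_simps abs_le_iff)
    then show "g b \<in> {- int (N b)..int (N b)}" using b
      by (auto simp: g_def le_floor_iff floor_le_iff)
  qed (auto simp: g_def)
  have "\<bar>w \<bullet> b - of_int (g b) * \<eta>\<bar> \<le> \<eta>" if b: "b \<in> B" for b
  proof -
    have eq: "w \<bullet> b - of_int \<lfloor>w \<bullet> b / \<eta>\<rfloor> * \<eta> = (w \<bullet> b / \<eta> - of_int \<lfloor>w \<bullet> b / \<eta>\<rfloor>) * \<eta>"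
      using \<eta> by (simp add: field_simps)
    have "\<bar>w \<bullet> b / \<eta> - of_int \<lfloor>w \<bullet> b / \<eta>\<rfloor>\<bar> \<le> 1" by linarith
    then have "\<bar>w \<bullet> b / \<eta> - of_int \<lfloor>w \<bullet> b / \<eta>\<rfloor>\<bar> * \<eta> \<le> 1 * \<eta>" using \<eta> by (intro mult_right_mono) auto
    then show ?thesis using b \<eta> eq by (simp add: g_def abs_mult)
  qed
  then show "w \<in> grid_cell B \<eta> g" using w(1) by (auto simp: grid_cell_def)
qed

lemma card_grid:
  assumes "finite B"
  shows "real (card (PiE B (\<lambda>b. {- int (N b)..int (N b)}))) = (\<Prod>b\<in>B. 2 * real (N b) + 1)"
  using assms by (simp add: card_PiE)

lemma finite_grid: "finite B \<Longrightarrow> finite (PiE B (\<lambda>b. {- int (N b)..int (N b)}))"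
  by (rule finite_PiE) auto

text \<open>At most \<open>(3 * real n) ^ m\<close> cells of diameter at most
  \<open>2 * real m * R / real n\<close> cover the ball. For s > m the resulting bound tends to 0 as
  n grows, for s = m it does not depend on n; both cases are used below.\<close>

lemma hausdorff_pre_subspace:
  fixes V :: "'a::euclidean_space set"
  assumes V: "subspace V" "dim V = m" "0 < m" and s: "0 < s" and R: "0 < R" and n: "0 < n" "2 * real m * R / real n \<le> \<delta>"
  shows "hausdorff_pre s \<delta> (V \<inter> cball 0 R) \<le> ennreal ((3 * real n) ^ m * (2 * real m * R / real n) powr s)"
proof -
  obtain B where B: "B \<subseteq> V" "pairwise orthogonal B" "\<And>x. x \<in> B \<Longrightarrow> norm x = 1" "independent B" "card B = dim V" "span B = V"
    using orthonormal_basis_subspace[OF V(1)] by metis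
  have fB: "finite B" using B(4) by (rule independent_imp_finite)
  define \<eta> where "\<eta> = R / real n"
  have \<eta>: "0 < \<eta>" using R n by (simp add: \<eta>_def)
  let ?F = "PiE B (\<lambda>b. {- int n..int n})"
  have d: "2 * \<eta> * card B = 2 * real m * R / real n" using B(5) V by (simp add: \<eta>_def)
  have "hausdorff_pre s \<delta> (V \<inter> cball 0 R) \<le> ennreal (real (card ?F) * (2 * \<eta> * card B) powr s)"
  proof (rule hausdorff_pre_finite_cover)
    show "finite ?F" using finite_grid[OF fB, of "\<lambda>_. n"] by simp
    show "V \<inter> cball 0 R \<subseteq> (\<Union>g\<in>?F. grid_cell B \<eta> g)"
    proof
      fix w assume w: "w \<in> V \<inter> cball 0 R"
      show "w \<in> (\<Union>g\<in>?F. grid_cell B \<eta> g)"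
      proof (rule grid_cover[OF \<eta>, where N="\<lambda>_. n"])
        show "w \<in> span B" using w B by simp
        fix b assume "b \<in> B"
        then have "\<bar>w \<bullet> b\<bar> \<le> norm w" using Cauchy_Schwarz_ineq2[of w b] B(3) by simp
        then show "\<bar>w \<bullet> b\<bar> \<le> real n * \<eta>" using w n by (simp add: \<eta>_def)
      qed
    qed
    fix g
    show "diameter (grid_cell B \<eta> g) \<le> 2 * \<eta> * card B"
      using \<eta> by (intro diameter_le grid_cell_dist B fB) auto
    show "bounded (grid_cell B \<eta> g)"
      using grid_cell_dist[OF B(2,3) fB] unfolding bounded_two_points dist_norm by blast
  qed (use \<eta> B V s n in \<open>auto simp: d\<close>)
  also have "\<dots> \<le> ennreal ((3 * real n) ^ m * (2 * real m * R / real n) powr s)"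
  proof (intro ennreal_leI mult_mono)
    have "real (card ?F) = (2 * real n + 1) ^ m" using card_grid[OF fB, of "\<lambda>_. n"] B(5) V by simp
    also have "\<dots> \<le> (3 * real n) ^ m" using n by (intro power_mono) auto
    finally show "real (card ?F) \<le> (3 * real n) ^ m" .
  qed (simp_all add: d)
  finally show ?thesis .
qed

lemma hausdorff_outer_subspace_zero:
  fixes V :: "'a::euclidean_space set"
  assumes V: "subspace V" "dim V = m" "0 < m" and s: "real m < s" and R: "0 < R"
  shows "hausdorff_outer s (V \<inter> cball 0 R) = 0"
proof -
  have s0: "0 < s" using s V(3) by linarith
  have "hausdorff_pre s \<delta> (V \<inter> cball 0 R) \<le> 0" if \<delta>: "0 < \<delta>" for \<delta>
  proof -
    define K where "K = 3 ^ m * (2 * real m * R) powr s"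
    have "(\<lambda>n. ennreal (K * real n powr (real m - s))) \<longlonglongrightarrow> ennreal (K * 0)"
      using s by (intro tendsto_ennrealI tendsto_mult tendsto_const tendsto_neg_powr filterlim_real_sequentially) auto
    moreover have "eventually (\<lambda>n. hausdorff_pre s \<delta> (V \<inter> cball 0 R) \<le> ennreal (K * real n powr (real m - s))) sequentially"
    proof -
      obtain N where N: "2 * real m * R / \<delta> < real N" using reals_Archimedean2 by blast
      show ?thesis
      proof (rule eventually_sequentiallyI[of "Suc N"])
        fix n assume n: "Suc N \<le> n"
        have "hausdorff_pre s \<delta> (V \<inter> cball 0 R) \<le> ennreal ((3 * real n) ^ m * (2 * real m * R / real n) powr s)"
        proof (rule hausdorff_pre_subspace[OF V s0 R])
          have "2 * real m * R / \<delta> \<le> real n" using N n by linarith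
          then show "2 * real m * R / real n \<le> \<delta>" using \<delta> n by (simp add: field_simps)
        qed (use n in auto)
        also have "(3 * real n) ^ m * (2 * real m * R / real n) powr s = K * real n powr (real m - s)"
          using n R by (simp add: K_def power_mult_distrib powr_divide powr_diff powr_realpow)
        finally show "hausdorff_pre s \<delta> (V \<inter> cball 0 R) \<le> ennreal (K * real n powr (real m - s))" .
      qed
    qed
    ultimately have "hausdorff_pre s \<delta> (V \<inter> cball 0 R) \<le> ennreal (K * 0)"
      by (rule tendsto_lowerbound) simp
    then show ?thesis by simp
  qed
  then have "(SUP \<delta>\<in>{0<..}. hausdorff_pre s \<delta> (V \<inter> cball 0 R)) \<le> 0" by (intro SUP_least) auto
  then show ?thesis by (simp add: hausdorff_outer_def)
qed

lemma hausdorff_outer_subspace_finite: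
  fixes V :: "'a::euclidean_space set"
  assumes V: "subspace V" "dim V = m" "0 < m" and R: "0 < R"
  shows "hausdorff_outer (real m) (V \<inter> cball 0 R) < \<infinity>"
proof -
  have "hausdorff_pre (real m) \<delta> (V \<inter> cball 0 R) \<le> ennreal ((6 * real m * R) ^ m)" if \<delta>: "0 < \<delta>" for \<delta>
  proof -
    obtain n where n: "2 * real m * R / \<delta> < real n" using reals_Archimedean2 by blast
    have "0 < 2 * real m * R / \<delta>" using \<delta> R V by simp
    then have n0: "0 < n" using n by (metis less_trans of_nat_0_less_iff)
    have "hausdorff_pre (real m) \<delta> (V \<inter> cball 0 R) \<le> ennreal ((3 * real n) ^ m * (2 * real m * R / real n) powr real m)"
    proof (rule hausdorff_pre_subspace[OF V _ R])
      show "2 * real m * R / real n \<le> \<delta>" using \<delta> n n0 by (simp add: field_simps)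
    qed (use n0 V in auto)
    also have "(3 * real n) ^ m * (2 * real m * R / real n) powr real m = (6 * real m * R) ^ m"
    proof -
      have "0 < 2 * real m * R / real n" using n0 R V by simp
      then have "(3 * real n) ^ m * (2 * real m * R / real n) powr real m = (3 * real n * (2 * real m * R / real n)) ^ m"
        by (simp only: powr_realpow power_mult_distrib[of "3 * real n"])
      also have "3 * real n * (2 * real m * R / real n) = 6 * real m * R" using n0 by simp
      finally show ?thesis .
    qed
    finally show ?thesis .
  qed
  then have "(SUP \<delta>\<in>{0<..}. hausdorff_pre (real m) \<delta> (V \<inter> cball 0 R)) \<le> ennreal ((6 * real m * R) ^ m)" by (intro SUP_least) auto
  then have "(SUP \<delta>\<in>{0<..}. hausdorff_pre (real m) \<delta> (V \<inter> cball 0 R)) < \<infinity>" by (metis ennreal_less_top infinity_ennreal_def le_less_trans)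
  then show ?thesis unfolding hausdorff_outer_def by (simp add: ennreal_mult_less_top)
qed

section \<open>Hausdorff measure on subspaces and its invariance\<close>

lemma sets_hausdorff_measure [simp, measurable_cong]: "sets (hausdorff_measure s) = sets borel"
  unfolding hausdorff_measure_def by (metis sets.sets_measure_of_eq space_borel)

lemma sets_hausdorff_on [simp, measurable_cong]: "sets (hausdorff_on s A) = sets borel"
  unfolding hausdorff_on_def by simp

lemma emeasure_hausdorff_on:
  assumes "A \<in> sets borel" "X \<in> sets borel"
  shows "emeasure (hausdorff_on s A) X = hausdorff_outer s (A \<inter> X)"
proof -
  have "emeasure (hausdorff_on s A) X = (\<integral>\<^sup>+x. indicator (A \<inter> X) x \<partial>hausdorff_measure s)"
    unfolding hausdorff_on_def using assms
    by (subst emeasure_density) (auto simp del: nn_integral_indicator simp: indicator_inter_arith[abs_def])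
  then show ?thesis using assms by (simp add: emeasure_hausdorff_measure)
qed

lemma locally_finite_hausdorff_on_subspace:
  fixes V :: "'a::euclidean_space set"
  assumes V: "subspace V" "dim V = m" "0 < m"
  shows "locally_finite_borel_measure (hausdorff_on (real m) V)"
  unfolding locally_finite_borel_measure_def
proof (intro conjI allI exI)
  have Vb: "V \<in> sets borel" using closed_subspace[OF V(1)] by auto
  fix x :: 'a
  show "emeasure (hausdorff_on (real m) V) (ball x 1) < \<infinity>"
  proof -
    have "emeasure (hausdorff_on (real m) V) (ball x 1) = hausdorff_outer (real m) (V \<inter> ball x 1)"
      using Vb by (simp add: emeasure_hausdorff_on)
    also have "\<dots> \<le> hausdorff_outer (real m) (V \<inter> cball 0 (norm x + 1))"
    proof (rule hausdorff_outer_mono, safe)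
      fix y assume "y \<in> ball x 1"
      then show "y \<in> cball 0 (norm x + 1)"
        using norm_triangle_ineq[of x "y - x"] by (simp add: dist_norm norm_minus_commute)
    qed
    also have "\<dots> < \<infinity>" by (intro hausdorff_outer_subspace_finite V) (simp add: add_nonneg_pos)
    finally show ?thesis .
  qed
qed auto

lemma hausdorff_pre_lipschitz_image:
  fixes f :: "'a::euclidean_space \<Rightarrow> 'a"
  assumes f: "\<And>x y. dist (f x) (f y) \<le> K * dist x y" and K: "0 < K" and s: "0 < s"
  shows "ennreal (K powr - s) * hausdorff_pre s \<delta> (f ` A) \<le> hausdorff_pre s (\<delta> / K) A"
  unfolding hausdorff_pre_def[of s "\<delta> / K" A]
proof (rule INF_greatest)
  fix E :: "nat \<Rightarrow> 'a set"
  assume "E \<in> {E. A \<subseteq> (\<Union>i. E i) \<and> (\<forall>i. bounded (E i) \<and> diameter (E i) \<le> \<delta> / K)}"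
  then have E: "A \<subseteq> (\<Union>i. E i)" "\<And>i. bounded (E i)" "\<And>i. diameter (E i) \<le> \<delta> / K" by auto
  have b: "dist u v \<le> K * diameter (E i)" if uv: "u \<in> f ` E i" "v \<in> f ` E i" for u v i
  proof -
    obtain x y where xy: "u = f x" "v = f y" "x \<in> E i" "y \<in> E i" using uv by blast
    have "dist (f x) (f y) \<le> K * dist x y" by (rule f)
    also have "\<dots> \<le> K * diameter (E i)" using xy E(2) K by (intro mult_left_mono diameter_bounded_bound) auto
    finally show ?thesis using xy by simp
  qed
  have d: "diameter (f ` E i) \<le> K * diameter (E i)" for i
    using b diameter_ge_0[OF E(2)] K by (intro diameter_le) (auto simp: dist_norm)
  have d': "diameter (f ` E i) \<le> \<delta>" for i
  proof -
    have "K * diameter (E i) \<le> K * (\<delta> / K)" using K by (intro mult_left_mono E(3)) auto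
    then show ?thesis using d[of i] K by simp
  qed
  have bd: "bounded (f ` E i)" for i unfolding bounded_two_points using b by blast
  have "ennreal (K powr - s) * hausdorff_pre s \<delta> (f ` A) \<le> ennreal (K powr - s) * (\<Sum>i. ennreal (diameter (f ` E i) powr s))"
  proof (rule mult_left_mono)
    show "hausdorff_pre s \<delta> (f ` A) \<le> (\<Sum>i. ennreal (diameter (f ` E i) powr s))"
      unfolding hausdorff_pre_def
    proof (rule INF_lower, safe)
      fix x assume "x \<in> A"
      then show "f x \<in> (\<Union>i. f ` E i)" using E(1) by blast
    qed (use bd d' in auto)
  qed simp
  also have "\<dots> = (\<Sum>i. ennreal (K powr - s * diameter (f ` E i) powr s))"
    by (simp add: ennreal_mult)
  also have "\<dots> \<le> (\<Sum>i. ennreal (diameter (E i) powr s))"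
  proof (intro suminf_le ennreal_leI)
    fix i
    have "K powr - s * diameter (f ` E i) powr s \<le> K powr - s * (K * diameter (E i)) powr s"
      using bd d s by (intro mult_left_mono powr_mono2) (auto intro: diameter_ge_0)
    also have "\<dots> = diameter (E i) powr s"
      using K diameter_ge_0[OF E(2)] by (simp add: powr_mult powr_minus)
    finally show "K powr - s * diameter (f ` E i) powr s \<le> diameter (E i) powr s" .
  qed auto
  finally show "ennreal (K powr - s) * hausdorff_pre s \<delta> (f ` A) \<le> (\<Sum>i. ennreal (diameter (E i) powr s))" .
qed

lemma hausdorff_outer_lipschitz_image:
  fixes f :: "'a::euclidean_space \<Rightarrow> 'a"
  assumes f: "\<And>x y. dist (f x) (f y) \<le> K * dist x y" and K: "0 < K" and s: "0 < s"
  shows "ennreal (K powr - s) * hausdorff_outer s (f ` A) \<le> hausdorff_outer s A"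
proof -
  have "(SUP \<delta>\<in>{0<..}. ennreal (K powr - s) * hausdorff_pre s \<delta> (f ` A)) \<le> (SUP \<delta>\<in>{0<..}. hausdorff_pre s \<delta> A)"
  proof (rule SUP_mono)
    fix \<delta> :: real assume "\<delta> \<in> {0<..}"
    then show "\<exists>m\<in>{0<..}. ennreal (K powr - s) * hausdorff_pre s \<delta> (f ` A) \<le> hausdorff_pre s m A"
      using K hausdorff_pre_lipschitz_image[OF f K s] by (intro bexI[of _ "\<delta> / K"]) auto
  qed
  then have "ennreal (K powr - s) * (SUP \<delta>\<in>{0<..}. hausdorff_pre s \<delta> (f ` A)) \<le> (SUP \<delta>\<in>{0<..}. hausdorff_pre s \<delta> A)"
    by (simp only: SUP_mult_left_ennreal)
  then have "ennreal (unit_ball_vol s / 2 powr s) * (ennreal (K powr - s) * (SUP \<delta>\<in>{0<..}. hausdorff_pre s \<delta> (f ` A))) \<le> hausdorff_outer s A"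
    unfolding hausdorff_outer_def by (rule mult_left_mono) simp
  then show ?thesis by (simp only: hausdorff_outer_def mult_ac)
qed

lemma hausdorff_outer_image_le:
  fixes f :: "'a::euclidean_space \<Rightarrow> 'a"
  assumes f: "\<And>x y. dist (f x) (f y) \<le> dist x y" and s: "0 < s"
  shows "hausdorff_outer s (f ` A) \<le> hausdorff_outer s A"
  using hausdorff_outer_lipschitz_image[of f 1 s A] f s by simp

text \<open>Neither an isometry nor its inverse increases Hausdorff measure. Needed for translations
  within a subspace and for the reflection in a point.\<close>

lemma hausdorff_on_distr:
  fixes f g :: "'a::euclidean_space \<Rightarrow> 'a"
  assumes s: "0 < s" and f: "\<And>x y. dist (f x) (f y) = dist x y" and g: "\<And>x. g (f x) = x" "\<And>x. f (g x) = x"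
    and A: "A \<in> sets borel"
  shows "distr (hausdorff_on s A) borel f = hausdorff_on s (f ` A)"
proof (rule measure_eqI)
  have gd: "dist (g x) (g y) = dist x y" for x y using f[of "g x" "g y"] g by simp
  have cont: "continuous_on UNIV f" "continuous_on UNIV g"
    by (auto simp: continuous_on_iff f gd)
  have fm[measurable]: "f \<in> borel_measurable borel" and gm[measurable]: "g \<in> borel_measurable borel"
    using cont by (auto intro: borel_measurable_continuous_onI)
  have im: "f ` X = g -` X" for X
  proof
    show "g -` X \<subseteq> f ` X"
    proof
      fix y assume "y \<in> g -` X"
      then show "y \<in> f ` X" using g(2)[of y] by (intro image_eqI[of _ _ "g y"]) auto
    qed
  qed (use g(1) in auto)
  have fA: "f ` A \<in> sets borel" unfolding im using measurable_sets[OF gm A] by simp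
  have inv: "hausdorff_outer s (f ` X) = hausdorff_outer s X" for X
  proof (rule antisym)
    have "hausdorff_outer s (g ` (f ` X)) \<le> hausdorff_outer s (f ` X)" using gd s by (intro hausdorff_outer_image_le) auto
    then show "hausdorff_outer s X \<le> hausdorff_outer s (f ` X)" using g by (simp add: image_image)
  qed (use f s in \<open>auto intro!: hausdorff_outer_image_le\<close>)
  fix X assume "X \<in> sets (distr (hausdorff_on s A) borel f)"
  then have X: "X \<in> sets borel" by simp
  have fX: "f -` X \<in> sets borel" using measurable_sets[OF fm X] by simp
  have sp: "space (hausdorff_on s A) = UNIV" using sets_eq_imp_space_eq[OF sets_hausdorff_on] by simp
  have "emeasure (distr (hausdorff_on s A) borel f) X = hausdorff_outer s (A \<inter> f -` X)"
    using X fX A by (subst emeasure_distr) (auto simp: sp emeasure_hausdorff_on)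
  also have "\<dots> = hausdorff_outer s (f ` (A \<inter> f -` X))" by (simp add: inv)
  also have "f ` (A \<inter> f -` X) = f ` A \<inter> X" by auto
  finally show "emeasure (distr (hausdorff_on s A) borel f) X = emeasure (hausdorff_on s (f ` A)) X"
    using X fA by (simp add: emeasure_hausdorff_on)
qed simp

section \<open>Measures with vanishing symmetric moments\<close>

text \<open>The bound is asked for at every centre, not only on the support, so that it applies to
  the balls of a grid covering and to shifted centres.\<close>

definition upper_regular :: "'a::euclidean_space measure \<Rightarrow> real \<Rightarrow> real \<Rightarrow> bool" where
  "upper_regular \<nu> s C \<longleftrightarrow> sets \<nu> = sets borel \<and> 0 < C \<and>
     (\<forall>z. \<forall>r>0. emeasure \<nu> (cball z r) \<le> ennreal (C * r powr s))"

lemma upper_regular_sets: "upper_regular \<nu> s C \<Longrightarrow> sets \<nu> = sets borel"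
  by (simp add: upper_regular_def)

lemma upper_regular_locally_finite:
  assumes "upper_regular \<nu> s C"
  shows "locally_finite_borel_measure \<nu>"
  unfolding locally_finite_borel_measure_def
proof (intro conjI allI exI)
  fix x
  have "emeasure \<nu> (ball x 1) \<le> emeasure \<nu> (cball x 1)"
    using assms by (intro emeasure_mono) (auto simp: upper_regular_def)
  also have "\<dots> \<le> ennreal (C * 1 powr s)" using assms unfolding upper_regular_def by (metis zero_less_one)
  finally show "emeasure \<nu> (ball x 1) < \<infinity>" by (metis ennreal_less_top infinity_ennreal_def le_less_trans)
qed (use assms in \<open>auto simp: upper_regular_def\<close>)

lemma upper_regular_measure_le:
  assumes "upper_regular \<nu> s C" "0 < r"
  shows "measure \<nu> (cball z r) \<le> C * r powr s"
  using assms by (auto simp: upper_regular_def measure_def intro!: enn2real_leI)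

text \<open>At the critical exponent m the slab is covered by about \<open>n ^ (m - 1)\<close> cells
  of size r / n, each of mass at most a multiple of (r / n)^m. Compared with the bound for the whole
  ball this gains a factor 1 / n, which excludes concentration near a hyperplane wherever the mass
  is not small.\<close>

lemma measure_slab_le:
  fixes \<nu> :: "'a::euclidean_space measure"
  assumes reg: "upper_regular \<nu> (real m) C" and V: "subspace V" "dim V = m"
    and e: "e \<in> V" "norm e = 1" and n: "0 < n" and r: "0 < r"
    and X: "\<And>y. y \<in> X \<Longrightarrow> y - z0 \<in> V \<and> norm (y - z0) \<le> r \<and> \<bar>(y - z0) \<bullet> e\<bar> \<le> r / real n"
  shows "measure \<nu> X \<le> C * (6 * real m) ^ m * r ^ m / real n"
proof -
  define W where "W = {v \<in> V. v \<bullet> e = 0}"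
  have W: "subspace W" unfolding W_def using V(1)
    by (auto simp: subspace_def inner_add_left)
  obtain B0 where B0: "B0 \<subseteq> W" "pairwise orthogonal B0" "\<And>x. x \<in> B0 \<Longrightarrow> norm x = 1" "independent B0" "span B0 = W"
    using orthonormal_basis_subspace[OF W] by metis
  define B where "B = insert e B0"
  have eB0: "e \<notin> B0" using B0(1) e by (auto simp: W_def norm_eq_1)
  have Bo: "pairwise orthogonal B" unfolding B_def pairwise_insert
    using B0(1,2) by (auto simp: W_def orthogonal_def inner_commute)
  have B1: "\<And>b. b \<in> B \<Longrightarrow> norm b = 1" using B0(3) e by (auto simp: B_def)
  have Bi: "independent B" using Bo B1 by (intro pairwise_orthogonal_independent) (metis norm_zero zero_neq_one)+
  have fB: "finite B" using Bi by (rule independent_imp_finite)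
  have Bspan: "span B = V"
  proof
    show "span B \<subseteq> V" using B0(1) e V(1) by (intro span_minimal) (auto simp: B_def W_def)
    show "V \<subseteq> span B"
    proof
      fix v assume v: "v \<in> V"
      have "v - (v \<bullet> e) *\<^sub>R e \<in> W"
        using v e V(1) by (auto simp: W_def subspace_diff subspace_scale inner_diff_left norm_eq_1)
      then have "v - (v \<bullet> e) *\<^sub>R e \<in> span B" using B0(5) span_mono[of B0 B] by (auto simp: B_def)
      moreover have "(v \<bullet> e) *\<^sub>R e \<in> span B" by (intro span_scale span_base) (simp add: B_def)
      ultimately show "v \<in> span B" using span_add by force
    qed
  qed
  have cB: "card B = m" using Bi Bspan V(2) by (metis dim_span_eq_card_independent)
  have m0: "0 < m" using cB fB by (auto simp: B_def card_gt_0_iff)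
  have card_B0: "card (B - {e}) = m - 1" using cB fB eB0 by (simp add: B_def)
  define \<eta> where "\<eta> = r / real n"
  have \<eta>: "0 < \<eta>" using r n by (simp add: \<eta>_def)
  \<comment> \<open>One layer on each side suffices across e, since the slab has half-width \<eta>;
    the other directions need n.\<close>
  define N where "N b = (if b = e then 1 else n)" for b
  let ?F = "PiE B (\<lambda>b. {- int (N b)..int (N b)})"
  define d where "d = 2 * \<eta> * real m"
  have d: "0 < d" using \<eta> m0 by (simp add: d_def)
  define c where "c g = (SOME w. w \<in> grid_cell B \<eta> g)" for g
  have cell: "grid_cell B \<eta> g \<subseteq> cball (c g) d" for g
  proof
    fix w assume w: "w \<in> grid_cell B \<eta> g"
    then have "c g \<in> grid_cell B \<eta> g" unfolding c_def by (rule someI)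
    then show "w \<in> cball (c g) d"
      using grid_cell_dist[OF Bo B1 fB _ w, of "c g"] by (simp add: dist_norm d_def cB)
  qed
  have sb: "sets \<nu> = sets borel" using reg by (rule upper_regular_sets)
  have cover: "X \<subseteq> (\<Union>g\<in>?F. cball (z0 + c g) d)"
  proof
    fix y assume y: "y \<in> X"
    have "y - z0 \<in> (\<Union>g\<in>?F. grid_cell B \<eta> g)"
    proof (rule grid_cover[OF \<eta>])
      show "y - z0 \<in> span B" using X[OF y] Bspan by simp
      fix b assume b: "b \<in> B"
      show "\<bar>(y - z0) \<bullet> b\<bar> \<le> real (N b) * \<eta>"
      proof (cases "b = e")
        case True then show ?thesis using X[OF y] by (simp add: N_def \<eta>_def)
      next
        case False
        have "\<bar>(y - z0) \<bullet> b\<bar> \<le> norm (y - z0)" using Cauchy_Schwarz_ineq2[of "y - z0" b] B1[OF b] by simp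
        then show ?thesis using X[OF y] n False by (simp add: N_def \<eta>_def)
      qed
    qed
    then obtain g where "g \<in> ?F" "y - z0 \<in> cball (c g) d" using cell by blast
    then show "y \<in> (\<Union>g\<in>?F. cball (z0 + c g) d)"
      by (auto simp: dist_norm algebra_simps intro!: bexI[of _ g])
  qed
  have fF: "finite ?F" by (rule finite_grid[OF fB])
  have lf: "locally_finite_borel_measure \<nu>" using reg by (rule upper_regular_locally_finite)
  have fin: "emeasure \<nu> (cball z d) \<noteq> \<infinity>" for z using emeasure_bounded_finite[OF lf, of "cball z d"] by simp
  have finU: "emeasure \<nu> (\<Union>g\<in>?F. cball (z0 + c g) d) < \<infinity>"
    using fF by (intro emeasure_bounded_finite[OF lf]) auto
  \<comment> \<open>X is arbitrary: for a set outside the sigma-algebra \<open>measure\<close> is 0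
    by convention and the bound is trivial.\<close>
  have "measure \<nu> X \<le> measure \<nu> (\<Union>g\<in>?F. cball (z0 + c g) d)"
  proof (cases "X \<in> sets \<nu>")
    case True
    then show ?thesis using cover finU fF sb unfolding measure_def
      by (intro enn2real_mono emeasure_mono) auto
  next
    case False
    then show ?thesis by (simp add: measure_notin_sets)
  qed
  also have "\<dots> \<le> (\<Sum>g\<in>?F. measure \<nu> (cball (z0 + c g) d))"
    using fF fin sb by (intro measure_subadditive_finite) auto
  also have "\<dots> \<le> (\<Sum>g\<in>?F. C * d powr real m)"
    by (intro sum_mono upper_regular_measure_le[OF reg d])
  also have "\<dots> = real (card ?F) * (C * d ^ m)" using d by (simp add: powr_realpow)
  also have "\<dots> \<le> (3 ^ m * real n ^ (m - 1)) * (C * d ^ m)"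
  proof (rule mult_right_mono)
    have "real (card ?F) = (\<Prod>b\<in>B. 2 * real (N b) + 1)" by (rule card_grid[OF fB])
    also have "\<dots> = 3 * (\<Prod>b\<in>B - {e}. 2 * real (N b) + 1)"
      using fB by (subst prod.remove[of _ e]) (auto simp: B_def N_def)
    also have "(\<Prod>b\<in>B - {e}. 2 * real (N b) + 1) = (\<Prod>b\<in>B - {e}. 2 * real n + 1)"
      by (intro prod.cong) (auto simp: N_def)
    also have "3 * \<dots> = 3 * (2 * real n + 1) ^ (m - 1)" by (simp only: prod_constant card_B0)
    also have "\<dots> \<le> 3 * (3 * real n) ^ (m - 1)" using n by (intro mult_left_mono power_mono) auto
    also have "\<dots> = 3 ^ m * real n ^ (m - 1)" using m0 by (cases m) (simp_all add: power_mult_distrib)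
    finally show "real (card ?F) \<le> 3 ^ m * real n ^ (m - 1)" .
    show "0 \<le> C * d ^ m" using d reg by (simp add: upper_regular_def)
  qed
  also have "\<dots> = C * (6 * real m) ^ m * r ^ m / real n"
  proof -
    have "d ^ m = (2 * real m) ^ m * r ^ m / real n ^ m"
      by (simp add: d_def \<eta>_def power_mult_distrib power_divide mult_ac)
    moreover have "real n ^ m = real n * real n ^ (m - 1)" using m0 by (cases m) simp_all
    moreover have "(6 * real m) ^ m = 3 ^ m * (2 * real m) ^ m"
      by (simp only: power_mult_distrib[of 3 "2 * real m", symmetric]) simp
    moreover have "x * A * (C * (y * z / (real n * A))) = C * (x * y) * z / real n" if "0 < A" for x y z A :: real
      using n that by simp
    ultimately show ?thesis using n by (simp only: zero_less_power of_nat_0_less_iff)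
  qed
  finally show ?thesis .
qed

text \<open>The complement is a union of null balls, of which countably many suffice by Lindelof's
  theorem.\<close>

lemma emeasure_outside_support:
  fixes \<nu> :: "'a::euclidean_space measure"
  assumes sb: "sets \<nu> = sets borel"
  shows "emeasure \<nu> (- measure_support \<nu>) = 0"
proof -
  define F where "F = {ball z r | z r. emeasure \<nu> (ball z r) = 0}"
  have cov: "- measure_support \<nu> = \<Union>F"
  proof
    show "- measure_support \<nu> \<subseteq> \<Union>F"
    proof
      fix x assume "x \<in> - measure_support \<nu>"
      then obtain r where "0 < r" "emeasure \<nu> (ball x r) = 0"
        by (auto simp: measure_support_def zero_less_iff_neq_zero)
      then show "x \<in> \<Union>F" unfolding F_def using centre_in_ball by blast
    qed
    show "\<Union>F \<subseteq> - measure_support \<nu>"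
    proof clarsimp
      fix x X assume X: "X \<in> F" "x \<in> X" "x \<in> measure_support \<nu>"
      then obtain z r where z: "X = ball z r" "emeasure \<nu> (ball z r) = 0" by (auto simp: F_def)
      obtain e where e: "0 < e" "ball x e \<subseteq> ball z r" using X(2) z(1) open_contains_ball by (metis open_ball)
      have "emeasure \<nu> (ball x e) \<le> emeasure \<nu> (ball z r)" using e sb by (intro emeasure_mono) auto
      then show False using X(3) e z by (auto simp: measure_support_def)
    qed
  qed
  obtain F' where F': "F' \<subseteq> F" "countable F'" "\<Union>F' = \<Union>F"
    using Lindelof[of F] by (auto simp: F_def)
  have "\<Union>F' \<in> null_sets \<nu>"
    using F' sb by (intro null_sets_UN'[where N="\<lambda>x. x", simplified]) (auto simp: F_def null_sets_def)
  then show ?thesis using cov F' by (simp add: null_sets_def)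
qed

lemma AE_measure_support:
  assumes sb: "sets \<nu> = sets (borel :: 'a::euclidean_space measure)"
  shows "AE y in \<nu>. y \<in> measure_support \<nu>"
proof (rule AE_I)
  show "{x \<in> space \<nu>. x \<notin> measure_support \<nu>} \<subseteq> - measure_support \<nu>" by auto
  show "emeasure \<nu> (- measure_support \<nu>) = 0" by (rule emeasure_outside_support[OF sb])
  show "- measure_support \<nu> \<in> sets \<nu>" using closed_measure_support[OF sb] sb by auto
qed

section \<open>The trace identity and the dimension of the support\<close>

lemma inner_dkernel: "dkernel r w b \<bullet> b = (qk r w)\<^sup>2 * (b \<bullet> b) - 4 * qk r w * (w \<bullet> b)\<^sup>2"
  by (simp add: dkernel_def inner_diff_left power2_eq_square)

lemma qk_mult_norm: "qk r w * (norm w)\<^sup>2 = r\<^sup>2 * qk r w - (qk r w)\<^sup>2"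
  by (cases "r\<^sup>2 \<le> (norm w)\<^sup>2") (simp_all add: qk_def max_def power2_eq_square algebra_simps)

text \<open>With q for \<open>qk r w\<close>, the diagonal of \<open>dkernel\<close> sums over the
  basis to m q^2 - 4 q |w|^2 when w lies in the span. Writing q |w|^2 as r^2 q - q^2 turns this into
  (m + 4) q^2 - 4 r^2 q. After integration the last term is r times the scale derivative of
  \<open>qmass\<close>, so the trace is an Euler operator applied to \<open>qmass\<close>.\<close>

lemma trace_dmoment:
  fixes \<nu> :: "'a::euclidean_space measure"
  assumes lf: "locally_finite_borel_measure \<nu>" and r: "0 \<le> r"
    and B: "pairwise orthogonal B" "\<And>b. b \<in> B \<Longrightarrow> norm b = 1" "finite B" "card B = m"
    and V: "AE y in \<nu>. z - y \<in> span B"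
  shows "(\<Sum>b\<in>B. dmoment \<nu> z r b \<bullet> b) = (real m + 4) * qmass \<nu> z r - r * (4 * r * (LINT y|\<nu>. qk r (z - y)))"
proof -
  have pt: "(\<Sum>b\<in>B. dkernel r w b \<bullet> b) = (real m + 4) * (qk r w)\<^sup>2 - 4 * r\<^sup>2 * qk r w" if w: "w \<in> span B" for w
  proof -
    have "(\<Sum>b\<in>B. (w \<bullet> b)\<^sup>2) = w \<bullet> (\<Sum>b\<in>B. (w \<bullet> b) *\<^sub>R b)"
      by (simp add: inner_sum_right power2_eq_square)
    also have "(\<Sum>b\<in>B. (w \<bullet> b) *\<^sub>R b) = w" using orthonormal_basis_expand[OF B(1,2) w B(3)] by simp
    finally have sq: "(\<Sum>b\<in>B. (w \<bullet> b)\<^sup>2) = (norm w)\<^sup>2" by (simp add: power2_norm_eq_inner)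
    have "(\<Sum>b\<in>B. dkernel r w b \<bullet> b) = (\<Sum>b\<in>B. (qk r w)\<^sup>2 - 4 * qk r w * (w \<bullet> b)\<^sup>2)"
      using B(2) by (intro sum.cong) (auto simp: inner_dkernel norm_eq_1)
    also have "\<dots> = real m * (qk r w)\<^sup>2 - 4 * qk r w * (\<Sum>b\<in>B. (w \<bullet> b)\<^sup>2)"
      using B(4) by (simp add: sum_subtractf sum_distrib_left)
    also have "4 * qk r w * (\<Sum>b\<in>B. (w \<bullet> b)\<^sup>2) = 4 * (qk r w * (norm w)\<^sup>2)" unfolding sq by simp
    finally show ?thesis unfolding qk_mult_norm by (simp add: algebra_simps)
  qed
  have i: "integrable \<nu> (\<lambda>y. dkernel r (z - y) b)" for b by (rule integrable_dkernel[OF lf r])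
  have i1: "integrable \<nu> (\<lambda>y. qk r (z - y))" using integrable_qk_power[OF lf r, of 1 z] by simp
  have i2: "integrable \<nu> (\<lambda>y. (qk r (z - y))\<^sup>2)" using integrable_qk_power[OF lf r, of 2 z] by simp
  have "(\<Sum>b\<in>B. dmoment \<nu> z r b \<bullet> b) = (LINT y|\<nu>. (\<Sum>b\<in>B. dkernel r (z - y) b \<bullet> b))"
    unfolding dmoment_def using i
    by (subst Bochner_Integration.integral_sum) (auto simp: integral_inner_left)
  also have "\<dots> = (LINT y|\<nu>. (real m + 4) * (qk r (z - y))\<^sup>2 - 4 * r\<^sup>2 * qk r (z - y))"
  proof (rule integral_cong_AE)
    show "AE y in \<nu>. (\<Sum>b\<in>B. dkernel r (z - y) b \<bullet> b) = (real m + 4) * (qk r (z - y))\<^sup>2 - 4 * r\<^sup>2 * qk r (z - y)"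
      using V by eventually_elim (rule pt)
    show "(\<lambda>y. \<Sum>b\<in>B. dkernel r (z - y) b \<bullet> b) \<in> borel_measurable \<nu>"
      using i by (intro borel_measurable_sum borel_measurable_inner) (auto intro: borel_measurable_integrable)
    show "(\<lambda>y. (real m + 4) * (qk r (z - y))\<^sup>2 - 4 * r\<^sup>2 * qk r (z - y)) \<in> borel_measurable \<nu>"
      using i1 i2 by (intro borel_measurable_diff borel_measurable_times) (auto intro: borel_measurable_integrable)
  qed
  also have "\<dots> = (real m + 4) * qmass \<nu> z r - 4 * r\<^sup>2 * (LINT y|\<nu>. qk r (z - y))"
    unfolding qmass_def using i1 i2 by (subst Bochner_Integration.integral_diff) auto
  finally show ?thesis by (simp add: power2_eq_square)
qed

text \<open>\<open>r powr - (real m + 4)\<close> is the integrating factor of that operator: a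
  vanishing trace means exact homogeneity of degree m + 4, a small trace means almost
  homogeneity.\<close>

lemma normalized_qmass_has_derivative:
  fixes \<nu> :: "'a::euclidean_space measure"
  assumes lf: "locally_finite_borel_measure \<nu>" and r: "0 < r"
    and B: "pairwise orthogonal B" "\<And>b. b \<in> B \<Longrightarrow> norm b = 1" "finite B" "card B = m"
    and V: "AE y in \<nu>. z - y \<in> span B"
  shows "((\<lambda>r. qmass \<nu> z r * r powr - (real m + 4)) has_real_derivative
     - ((\<Sum>b\<in>B. dmoment \<nu> z r b \<bullet> b) * r powr - (real m + 5))) (at r)"
proof -
  let ?a' = "4 * r * (LINT y|\<nu>. qk r (z - y))"
  have "((\<lambda>r. qmass \<nu> z r * r powr - (real m + 4)) has_real_derivative
      ?a' * r powr - (real m + 4) + - (real m + 4) * r powr (- (real m + 4) - 1) * qmass \<nu> z r) (at r)"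
    by (rule DERIV_mult[OF qmass_has_derivative[OF lf r] has_real_derivative_powr[OF r]])
  moreover have "r powr - (real m + 4) = r * r powr - (real m + 5)"
  proof -
    have "- (real m + 4) = 1 + - (real m + 5)" by simp
    then show ?thesis using r by (simp only: powr_add) simp
  qed
  moreover have "- (real m + 4) - 1 = - (real m + 5)" by simp
  moreover have "(\<Sum>b\<in>B. dmoment \<nu> z r b \<bullet> b) = (real m + 4) * qmass \<nu> z r - r * ?a'"
    by (rule trace_dmoment[OF lf less_imp_le[OF r] B V])
  ultimately have "((\<lambda>r. qmass \<nu> z r * r powr - (real m + 4)) has_real_derivative
      ?a' * (r * r powr - (real m + 5)) + - (real m + 4) * r powr - (real m + 5) * qmass \<nu> z r) (at r)"
    and tr: "(\<Sum>b\<in>B. dmoment \<nu> z r b \<bullet> b) = (real m + 4) * qmass \<nu> z r - r * ?a'" by (simp_all only:)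
  moreover have "?a' * (r * r powr - (real m + 5)) + - (real m + 4) * r powr - (real m + 5) * qmass \<nu> z r
      = - ((\<Sum>b\<in>B. dmoment \<nu> z r b \<bullet> b) * r powr - (real m + 5))"
    unfolding tr by (simp add: algebra_simps)
  ultimately show ?thesis by (simp only:)
qed

text \<open>With growth exponent p < m the normalised mass G tends to 0 at infinity, while its
  derivative is of order p - m - 2: the trace bound contains \<open>r ^ 3\<close> where a trivial
  estimate would give \<open>r ^ 4\<close>. Integrating from infinity bounds G by a multiple of
  \<open>r powr (p - real m - 1)\<close>, one power better than the assumed growth gives.\<close>

lemma growth_exponent_decrease:
  fixes \<nu> :: "'a::euclidean_space measure"
  assumes lf: "locally_finite_borel_measure \<nu>"
    and B: "pairwise orthogonal B" "\<And>b. b \<in> B \<Longrightarrow> norm b = 1" "finite B" "card B = m"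
    and V: "AE y in \<nu>. - y \<in> span B"
    and tr: "\<And>r. r1 \<le> r \<Longrightarrow> \<bar>\<Sum>b\<in>B. dmoment \<nu> 0 r b \<bullet> b\<bar> \<le> K * r ^ 3 * measure \<nu> (cball 0 (2 * r))"
    and gr: "\<And>r. r1 \<le> r \<Longrightarrow> measure \<nu> (cball 0 r) \<le> D * r powr p"
    and p: "p < real m" and K: "0 \<le> K" and r1: "0 < r1"
  shows "\<exists>D'. \<forall>r\<ge>r1. measure \<nu> (cball 0 r) \<le> D' * r powr (p - 1)"
proof -
  define G where "G r = qmass \<nu> 0 r * r powr - (real m + 4)" for r
  define K' where "K' = K * D * 2 powr p"
  define c where "c = K' / (real m + 1 - p)"
  have G': "(G has_real_derivative - ((\<Sum>b\<in>B. dmoment \<nu> 0 r b \<bullet> b) * r powr - (real m + 5))) (at r)" if "0 < r" for r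
  proof -
    have "AE y in \<nu>. 0 - y \<in> span B" using V by simp
    from normalized_qmass_has_derivative[OF lf that B this] show ?thesis unfolding G_def .
  qed
  have bnd: "\<bar>(\<Sum>b\<in>B. dmoment \<nu> 0 r b \<bullet> b) * r powr - (real m + 5)\<bar> \<le> K' * r powr (p - real m - 2)" if r: "r1 \<le> r" for r
  proof -
    have r0: "0 < r" using r r1 by linarith
    have "\<bar>(\<Sum>b\<in>B. dmoment \<nu> 0 r b \<bullet> b) * r powr - (real m + 5)\<bar> \<le> (K * r ^ 3 * (D * (2 * r) powr p)) * r powr - (real m + 5)"
    proof -
      have "\<bar>\<Sum>b\<in>B. dmoment \<nu> 0 r b \<bullet> b\<bar> \<le> K * r ^ 3 * (D * (2 * r) powr p)"
        using r r0 K r1 by (intro order_trans[OF tr[OF r]] mult_left_mono gr) auto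
      then show ?thesis by (simp add: abs_mult mult_right_mono)
    qed
    also have "\<dots> = K' * (r powr 3 * r powr p * r powr - (real m + 5))"
      using r0 by (simp add: K'_def powr_mult)
    also have "r powr 3 * r powr p * r powr - (real m + 5) = r powr (p - real m - 2)"
    proof -
      have e: "p - real m - 2 = 3 + p + - (real m + 5)" by simp
      show ?thesis by (simp only: e powr_add)
    qed
    finally show ?thesis .
  qed
  \<comment> \<open>The added term has derivative \<open>K' * r powr (p - real m - 2)\<close>, which
    dominates the derivative of G, so H increases. At infinity it is bounded above by a quantity
    tending to 0, hence it is never positive.\<close>
  define H where "H r = G r - c * r powr (p - real m - 1)" for r
  have cK: "c * (real m + 1 - p) = K'" using p by (simp add: c_def)
  have H': "(H has_real_derivative - ((\<Sum>b\<in>B. dmoment \<nu> 0 r b \<bullet> b) * r powr - (real m + 5)) + K' * r powr (p - real m - 2)) (at r)" if r: "0 < r" for r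
  proof -
    have "(H has_real_derivative - ((\<Sum>b\<in>B. dmoment \<nu> 0 r b \<bullet> b) * r powr - (real m + 5)) - c * ((p - real m - 1) * r powr (p - real m - 1 - 1))) (at r)"
      unfolding H_def using r by (intro DERIV_diff G' DERIV_cmult has_real_derivative_powr)
    moreover have "- (c * ((p - real m - 1) * r powr (p - real m - 1 - 1))) = K' * r powr (p - real m - 2)"
      unfolding cK[symmetric] by (simp add: algebra_simps)
    ultimately show ?thesis by (simp only: diff_conv_add_uminus)
  qed
  have mono: "H a \<le> H b" if ab: "r1 \<le> a" "a \<le> b" for a b
  proof (rule DERIV_nonneg_imp_nondecreasing[OF ab(2)])
    fix x assume "a \<le> x" "x \<le> b"
    then have x: "0 < x" "r1 \<le> x" using ab r1 by auto
    have "0 \<le> - ((\<Sum>b\<in>B. dmoment \<nu> 0 x b \<bullet> b) * x powr - (real m + 5)) + K' * x powr (p - real m - 2)"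
      using bnd[OF x(2)] by linarith
    with H'[OF x(1)] show "\<exists>y. (H has_real_derivative y) (at x) \<and> 0 \<le> y" by blast
  qed
  have Hle: "H r \<le> 0" if r: "r1 \<le> r" for r
  proof (rule tendsto_lowerbound)
    have "((\<lambda>r. D * r powr (p - real m) - c * r powr (p - real m - 1)) \<longlongrightarrow> D * 0 - c * 0) at_top"
      using p by (intro tendsto_intros tendsto_neg_powr filterlim_ident) auto
    then show "((\<lambda>r. D * r powr (p - real m) - c * r powr (p - real m - 1)) \<longlongrightarrow> 0) at_top" by simp
    show "\<forall>\<^sub>F x in at_top. H r \<le> D * x powr (p - real m) - c * x powr (p - real m - 1)"
      using eventually_ge_at_top[of r]
    proof eventually_elim
      case (elim x)
      then have x: "r1 \<le> x" "0 < x" using r r1 by auto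
      have "G x \<le> (x ^ 4 * (D * x powr p)) * x powr - (real m + 4)"
        unfolding G_def using x
        by (intro mult_right_mono order_trans[OF qmass_le[OF lf]] mult_left_mono gr) auto
      also have "\<dots> = D * (x powr 4 * x powr p * x powr - (real m + 4))"
        using x by (simp)
      also have "x powr 4 * x powr p * x powr - (real m + 4) = x powr (p - real m)"
      proof -
        have e: "p - real m = 4 + p + - (real m + 4)" by simp
        show ?thesis by (simp only: e powr_add)
      qed
      finally show ?case using mono[OF r elim] by (simp add: H_def)
    qed
  qed simp
  have "measure \<nu> (cball 0 r) \<le> (c * 2 powr (p + 3) / 9) * r powr (p - 1)" if r: "r1 \<le> r" for r
  proof -
    have r0: "0 < r" using r r1 by linarith
    have "G (2 * r) \<le> c * (2 * r) powr (p - real m - 1)" using Hle[of "2 * r"] r r0 by (simp add: H_def)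
    then have "G (2 * r) * (2 * r) powr (real m + 4) \<le> c * (2 * r) powr (p - real m - 1) * (2 * r) powr (real m + 4)"
      by (intro mult_right_mono) auto
    moreover have "G (2 * r) * (2 * r) powr (real m + 4) = qmass \<nu> 0 (2 * r)"
    proof -
      have "(2 * r) powr - (real m + 4) * (2 * r) powr (real m + 4) = 1"
        using r0 by (simp only: powr_add[symmetric]) simp
      then show ?thesis unfolding G_def by (simp only: mult.assoc)
    qed
    moreover have "c * (2 * r) powr (p - real m - 1) * (2 * r) powr (real m + 4) = c * (2 * r) powr (p + 3)"
    proof -
      have e: "p + 3 = (p - real m - 1) + (real m + 4)" by simp
      show ?thesis by (simp only: e powr_add mult.assoc)
    qed
    ultimately have "9 * r ^ 4 * measure \<nu> (cball 0 r) \<le> c * (2 * r) powr (p + 3)"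
      using qmass_ge[OF lf less_imp_le[OF r0], of 0] by linarith
    also have "\<dots> = c * 2 powr (p + 3) * (r powr 4 * r powr (p - 1))"
    proof -
      have e: "p + 3 = 4 + (p - 1)" by simp
      have "r powr (p + 3) = r powr 4 * r powr (p - 1)" by (simp only: e powr_add)
      then show ?thesis using r0 by (simp only: powr_mult mult.assoc)
    qed
    also have "r powr 4 = r ^ 4" using r0 by (simp)
    finally show ?thesis using r0 by (simp add: field_simps)
  qed
  then show ?thesis by blast
qed

lemma linear_dmoment:
  assumes lf: "locally_finite_borel_measure \<nu>" and r: "0 \<le> r"
  shows "linear (dmoment \<nu> z r)"
proof
  have dk: "dkernel r w (v + v') = dkernel r w v + dkernel r w v'" "dkernel r w (c *\<^sub>R v) = c *\<^sub>R dkernel r w v" for w v v' :: 'a and c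
    by (simp_all add: dkernel_def inner_add_right algebra_simps)
  show "dmoment \<nu> z r (v + v') = dmoment \<nu> z r v + dmoment \<nu> z r v'" for v v'
    unfolding dmoment_def dk by (intro Bochner_Integration.integral_add integrable_dkernel lf r)
  show "dmoment \<nu> z r (c *\<^sub>R v) = c *\<^sub>R dmoment \<nu> z r v" for c v
    unfolding dmoment_def dk by simp
qed

text \<open>For a direction x in S the moments vanish at 0 and at x, so the Taylor formula applies
  as soon as r is at least \<open>norm x\<close>; linearity passes to the span. Vanishing at 0 is a
  separate assumption because 0 need not belong to S. The constant and the threshold depend on
  v.\<close>

lemma dmoment_span_bound:
  fixes \<nu> :: "'a::euclidean_space measure"
  assumes lf: "locally_finite_borel_measure \<nu>"
    and sym0: "\<And>r. 0 < r \<Longrightarrow> sym_moment \<nu> 0 r = 0"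
    and symS: "\<And>z r. z \<in> S \<Longrightarrow> 0 < r \<Longrightarrow> sym_moment \<nu> z r = 0"
    and v: "v \<in> span S"
  shows "\<exists>K\<ge>0. \<exists>r0>0. \<forall>r\<ge>r0. norm (dmoment \<nu> 0 r v) \<le> K * r ^ 3 * measure \<nu> (cball 0 (2 * r))"
  using v
proof (induction rule: span_induct_alt)
  case base
  have "dmoment \<nu> 0 r 0 = 0" if "1 \<le> r" for r
    using that by (intro linear_0 linear_dmoment[OF lf]) simp
  then have "\<forall>r\<ge>1. norm (dmoment \<nu> 0 r 0) \<le> 0 * r ^ 3 * measure \<nu> (cball 0 (2 * r))" by simp
  then show ?case by (meson order_refl zero_less_one)
next
  case (step c x y)
  then obtain K r0 where K: "0 \<le> K" "0 < r0"
    "\<And>r. r0 \<le> r \<Longrightarrow> norm (dmoment \<nu> 0 r y) \<le> K * r ^ 3 * measure \<nu> (cball 0 (2 * r))" by blast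
  have "norm (dmoment \<nu> 0 r (c *\<^sub>R x + y)) \<le> (\<bar>c\<bar> * (30 * (norm x)\<^sup>2) + K) * r ^ 3 * measure \<nu> (cball 0 (2 * r))"
    if r: "r0 + norm x \<le> r" for r
  proof -
    have r': "0 < r" "norm x \<le> r" "r0 \<le> r" using r K(2) norm_ge_zero[of x] by linarith+
    have "norm (dmoment \<nu> 0 r x) \<le> 30 * r ^ 3 * (norm x)\<^sup>2 * measure \<nu> (cball 0 (2 * r))"
      using sym_moment_taylor[OF lf r'(2), of 0] sym0[OF r'(1)] symS[OF step(1) r'(1)] by simp
    then have "norm (c *\<^sub>R dmoment \<nu> 0 r x) \<le> \<bar>c\<bar> * (30 * r ^ 3 * (norm x)\<^sup>2 * measure \<nu> (cball 0 (2 * r)))"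
      by (simp add: mult_left_mono)
    moreover have "dmoment \<nu> 0 r (c *\<^sub>R x + y) = c *\<^sub>R dmoment \<nu> 0 r x + dmoment \<nu> 0 r y"
      using linear_dmoment[OF lf less_imp_le[OF r'(1)], of 0] by (simp add: linear_add linear_scale)
    ultimately have "norm (dmoment \<nu> 0 r (c *\<^sub>R x + y)) \<le> \<bar>c\<bar> * (30 * r ^ 3 * (norm x)\<^sup>2 * measure \<nu> (cball 0 (2 * r))) + K * r ^ 3 * measure \<nu> (cball 0 (2 * r))"
      using K(3)[OF r'(3)] by (simp only: order_trans[OF norm_triangle_ineq add_mono])
    then show ?thesis by (simp add: algebra_simps)
  qed
  moreover have "0 \<le> \<bar>c\<bar> * (30 * (norm x)\<^sup>2) + K" "0 < r0 + norm x" using K by (auto intro: add_nonneg_nonneg add_pos_nonneg)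
  ultimately show ?case by blast
qed

theorem dim_measure_support_le:
  fixes \<nu> :: "'a::euclidean_space measure"
  assumes reg: "upper_regular \<nu> s C"
    and sym0: "\<And>r. 0 < r \<Longrightarrow> sym_moment \<nu> 0 r = 0"
    and symS: "\<And>z r. z \<in> measure_support \<nu> \<Longrightarrow> 0 < r \<Longrightarrow> sym_moment \<nu> z r = 0"
    and ne: "measure_support \<nu> \<noteq> {}"
  shows "real (dim (measure_support \<nu>)) \<le> s"
proof (rule ccontr)
  assume asm: "\<not> real (dim (measure_support \<nu>)) \<le> s"
  define V where "V = span (measure_support \<nu>)"
  define m where "m = dim (measure_support \<nu>)"
  have sm: "s < real m" using asm by (simp add: m_def)
  have lf: "locally_finite_borel_measure \<nu>" using reg by (rule upper_regular_locally_finite)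
  have sb: "sets \<nu> = sets borel" using reg by (rule upper_regular_sets)
  obtain B where B: "B \<subseteq> V" "pairwise orthogonal B" "\<And>x. x \<in> B \<Longrightarrow> norm x = 1" "independent B" "card B = dim V" "span B = V"
    using orthonormal_basis_subspace[of V] V_def subspace_span by metis
  have fB: "finite B" using B(4) by (rule independent_imp_finite)
  have cB: "card B = m" using B(5) by (simp add: V_def m_def dim_span)
  have "\<forall>b\<in>B. \<exists>K r0. K \<ge> 0 \<and> r0 > 0 \<and> (\<forall>r\<ge>r0. norm (dmoment \<nu> 0 r b) \<le> K * r ^ 3 * measure \<nu> (cball 0 (2 * r)))"
    using dmoment_span_bound[OF lf sym0 symS] B(1) unfolding V_def by blast
  then obtain K r0 where K: "\<And>b. b \<in> B \<Longrightarrow> 0 \<le> K b" "\<And>b. b \<in> B \<Longrightarrow> 0 < r0 b"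
    "\<And>b r. b \<in> B \<Longrightarrow> r0 b \<le> r \<Longrightarrow> norm (dmoment \<nu> 0 r b) \<le> K b * r ^ 3 * measure \<nu> (cball 0 (2 * r))"
    by metis
  \<comment> \<open>The sum dominates every single threshold, so one radius serves the whole
    basis.\<close>
  define r1 where "r1 = 1 + sum r0 B"
  have r1: "0 < r1" unfolding r1_def using K(2) by (intro add_pos_nonneg sum_nonneg) (auto intro: less_imp_le)
  have r1b: "r0 b \<le> r1" if "b \<in> B" for b
  proof -
    have "r0 b \<le> sum r0 B" using that fB K(2) by (intro member_le_sum) (auto intro: less_imp_le)
    then show ?thesis by (simp add: r1_def)
  qed
  have V': "AE y in \<nu>. - y \<in> span B"
    using AE_measure_support[OF sb] by eventually_elim (auto simp: B(6) V_def intro: span_neg span_base)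
  have tr: "\<bar>\<Sum>b\<in>B. dmoment \<nu> 0 r b \<bullet> b\<bar> \<le> sum K B * r ^ 3 * measure \<nu> (cball 0 (2 * r))" if r: "r1 \<le> r" for r
  proof -
    have "\<bar>\<Sum>b\<in>B. dmoment \<nu> 0 r b \<bullet> b\<bar> \<le> (\<Sum>b\<in>B. K b * r ^ 3 * measure \<nu> (cball 0 (2 * r)))"
    proof (rule order_trans[OF sum_abs sum_mono])
      fix b assume b: "b \<in> B"
      have "\<bar>dmoment \<nu> 0 r b \<bullet> b\<bar> \<le> norm (dmoment \<nu> 0 r b)"
        using Cauchy_Schwarz_ineq2[of "dmoment \<nu> 0 r b" b] B(3)[OF b] by simp
      also have "\<dots> \<le> K b * r ^ 3 * measure \<nu> (cball 0 (2 * r))" using b r r1b[OF b] by (intro K(3)) auto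
      finally show "\<bar>dmoment \<nu> 0 r b \<bullet> b\<bar> \<le> K b * r ^ 3 * measure \<nu> (cball 0 (2 * r))" .
    qed
    then show ?thesis by (simp add: sum_distrib_right)
  qed
  have decay: "\<exists>D. \<forall>r\<ge>r1. measure \<nu> (cball 0 r) \<le> D * r powr (s - real k)" for k
  proof (induction k)
    case 0
    show ?case using upper_regular_measure_le[OF reg] r1 by (intro exI[of _ C]) auto
  next
    case (Suc k)
    then obtain D where D: "\<And>r. r1 \<le> r \<Longrightarrow> measure \<nu> (cball 0 r) \<le> D * r powr (s - real k)" by blast
    have "\<exists>D'. \<forall>r\<ge>r1. measure \<nu> (cball 0 r) \<le> D' * r powr (s - real k - 1)"
      using sm K(1) by (intro growth_exponent_decrease[OF lf B(2,3) fB cB V' tr D _ _ r1]) (auto intro: sum_nonneg)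
    then show ?case by (simp add: algebra_simps)
  qed
  \<comment> \<open>Once the exponent is negative, masses that increase with the radius are bounded
    by a quantity tending to 0.\<close>
  obtain k :: nat where k: "s < real k" using reals_Archimedean2 by blast
  obtain D where D: "\<And>r. r1 \<le> r \<Longrightarrow> measure \<nu> (cball 0 r) \<le> D * r powr (s - real k)" using decay by blast
  have fin: "emeasure \<nu> (cball 0 r) \<noteq> \<infinity>" for r using emeasure_bounded_finite[OF lf, of "cball 0 r"] by simp
  have zero: "measure \<nu> (cball 0 R) \<le> 0" for R
  proof (rule tendsto_lowerbound)
    have "((\<lambda>r. D * r powr (s - real k)) \<longlongrightarrow> D * 0) at_top"
      using k by (intro tendsto_intros tendsto_neg_powr filterlim_ident) auto
    then show "((\<lambda>r. D * r powr (s - real k)) \<longlongrightarrow> 0) at_top" by simp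
    show "\<forall>\<^sub>F r in at_top. measure \<nu> (cball 0 R) \<le> D * r powr (s - real k)"
      using eventually_ge_at_top[of "max R r1"]
    proof eventually_elim
      case (elim r)
      have "measure \<nu> (cball 0 R) \<le> measure \<nu> (cball 0 r)"
        using elim fin sb unfolding measure_def by (intro enn2real_mono emeasure_mono) (auto simp: less_top)
      then show ?case using D[of r] elim by simp
    qed
  qed simp
  obtain z where z: "z \<in> measure_support \<nu>" using ne by blast
  have "emeasure \<nu> (cball 0 (norm z + 1)) = 0"
    using zero[of "norm z + 1"] fin[of "norm z + 1"] measure_nonneg[of \<nu> "cball 0 (norm z + 1)"]
    by (metis antisym emeasure_eq_ennreal_measure ennreal_0 infinity_ennreal_def)
  moreover have "emeasure \<nu> (ball z 1) \<le> emeasure \<nu> (cball 0 (norm z + 1))"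
  proof (rule emeasure_mono)
    show "ball z 1 \<subseteq> cball 0 (norm z + 1)"
    proof
      fix y assume "y \<in> ball z 1"
      then show "y \<in> cball 0 (norm z + 1)"
        using norm_triangle_ineq[of z "y - z"] by (simp add: dist_norm norm_minus_commute)
    qed
  qed (simp add: sb)
  moreover have "0 < emeasure \<nu> (ball z 1)" using z by (simp add: measure_support_def)
  ultimately show False by simp
qed

text \<open>Masses of open balls are lower semicontinuous in the centre, since each slightly smaller
  concentric ball lies in all balls with nearby centres. Sets defined by upper density bounds at
  given radii are therefore closed.\<close>

lemma closed_emeasure_ball_le:
  fixes \<nu> :: "'a::euclidean_space measure"
  assumes sb: "sets \<nu> = sets borel"
  shows "closed {z. emeasure \<nu> (ball z r) \<le> c}"
  unfolding closed_sequential_limits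
proof clarify
  fix x l assume x: "\<forall>n. x n \<in> {z. emeasure \<nu> (ball z r) \<le> c}" "x \<longlonglongrightarrow> l"
  define A where "A n = ball l (r - inverse (real (Suc n)))" for n
  have "ball l r = (\<Union>n. A n)"
  proof
    show "ball l r \<subseteq> (\<Union>n. A n)"
    proof
      fix y assume "y \<in> ball l r"
      then have "0 < r - dist l y" by simp
      then obtain n where "inverse (real (Suc n)) < r - dist l y" using reals_Archimedean by blast
      then have "y \<in> A n" by (simp add: A_def)
      then show "y \<in> (\<Union>n. A n)" by blast
    qed
    have "A n \<subseteq> ball l r" for n unfolding A_def by (intro subset_ball) simp
    then show "(\<Union>n. A n) \<subseteq> ball l r" by blast
  qed
  moreover have "incseq A"
    unfolding A_def by (intro incseq_SucI subset_ball) (simp add: le_imp_inverse_le)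
  ultimately have eq: "emeasure \<nu> (ball l r) = (SUP n. emeasure \<nu> (A n))"
    using sb by (subst SUP_emeasure_incseq) (auto simp: A_def)
  show "emeasure \<nu> (ball l r) \<le> c"
    unfolding eq
  proof (rule SUP_least)
    fix n
    have "0 < inverse (real (Suc n))" by simp
    then obtain k where k: "dist (x k) l < inverse (real (Suc n))"
      using x(2) by (meson lim_sequentially order_refl)
    have "emeasure \<nu> (A n) \<le> emeasure \<nu> (ball (x k) r)"
    proof (rule emeasure_mono)
      show "A n \<subseteq> ball (x k) r"
      proof
        fix y assume "y \<in> A n"
        then show "y \<in> ball (x k) r" using k dist_triangle[of "x k" y l] unfolding A_def mem_ball by linarith
      qed
    qed (simp add: sb)
    also have "\<dots> \<le> c" using x(1) by simp
    finally show "emeasure \<nu> (A n) \<le> c" .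
  qed
qed

lemma upper_regular_singleton:
  assumes reg: "upper_regular \<nu> s C" and s: "0 < s"
  shows "emeasure \<nu> {z} = 0"
proof -
  have C: "0 < C" using reg by (simp add: upper_regular_def)
  have le: "emeasure \<nu> {z} \<le> ennreal (C * r powr s)" if "0 < r" for r
  proof -
    have "emeasure \<nu> {z} \<le> emeasure \<nu> (cball z r)" using that reg by (intro emeasure_mono) (auto simp: upper_regular_def)
    also have "\<dots> \<le> ennreal (C * r powr s)" using that reg by (auto simp: upper_regular_def)
    finally show ?thesis .
  qed
  have "emeasure \<nu> {z} \<le> ennreal e" if e: "0 < e" for e
  proof -
    have "emeasure \<nu> {z} \<le> ennreal (C * ((e / C) powr (1 / s)) powr s)" using e C by (intro le) simp
    also have "C * ((e / C) powr (1 / s)) powr s = e" using e C s by (simp add: powr_powr)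
    finally show ?thesis .
  qed
  then have "emeasure \<nu> {z} \<le> 0 + ennreal e" if "0 < e" for e using that by simp
  then have "emeasure \<nu> {z} \<le> 0" by (rule ennreal_le_epsilon)
  then show ?thesis by simp
qed

lemma emeasure_ball_le_upper_regular:
  assumes reg: "upper_regular \<nu> s C" and r: "0 < r"
  shows "emeasure \<nu> (ball z r) \<le> ennreal (C * r powr s)"
proof -
  have "emeasure \<nu> (ball z r) \<le> emeasure \<nu> (cball z r)" using reg by (intro emeasure_mono) (auto simp: upper_regular_def)
  also have "\<dots> \<le> ennreal (C * r powr s)" using r reg by (auto simp: upper_regular_def)
  finally show ?thesis .
qed

theorem dim_measure_support_eq:
  fixes \<nu> :: "'a::euclidean_space measure"
  assumes reg: "upper_regular \<nu> s C" and s: "0 < s"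
    and sym0: "\<And>r. 0 < r \<Longrightarrow> sym_moment \<nu> 0 r = 0"
    and symS: "\<And>z r. z \<in> measure_support \<nu> \<Longrightarrow> 0 < r \<Longrightarrow> sym_moment \<nu> z r = 0"
    and ne: "measure_support \<nu> \<noteq> {}"
  shows "real (dim (measure_support \<nu>)) = s"
proof (rule ccontr)
  define V where "V = span (measure_support \<nu>)"
  define m where "m = dim (measure_support \<nu>)"
  have V: "subspace V" "dim V = m" by (auto simp: V_def m_def dim_span)
  assume "real (dim (measure_support \<nu>)) \<noteq> s"
  then have ms: "real m < s" using dim_measure_support_le[OF reg sym0 symS ne] by (simp add: m_def)
  have sb: "sets \<nu> = sets borel" using reg by (rule upper_regular_sets)
  have SV: "measure_support \<nu> \<subseteq> V" by (auto simp: V_def span_base)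
  have Vb: "V \<in> sets borel" using closed_subspace[OF V(1)] by auto
  obtain z where z: "z \<in> measure_support \<nu>" using ne by blast
  define R where "R = norm z + 1"
  have R: "0 < R" by (simp add: R_def add_nonneg_pos)
  have "emeasure \<nu> (V \<inter> cball 0 R) = 0"
  proof (cases "m = 0")
    \<comment> \<open>In dimension 0 there is no grid to cover with; instead, the positive growth
      exponent forbids atoms.\<close>
    case True
    then have "V \<subseteq> {0}" using V by (simp add: dim_eq_0)
    then have "emeasure \<nu> (V \<inter> cball 0 R) \<le> emeasure \<nu> {0}" by (intro emeasure_mono) (auto simp: sb)
    then show ?thesis using upper_regular_singleton[OF reg s, of 0] by simp
  next
    case False
    have "emeasure \<nu> (V \<inter> cball 0 R) \<le> ennreal (C * 4 powr s / unit_ball_vol s) * hausdorff_outer s (V \<inter> cball 0 R)"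
      using reg emeasure_ball_le_upper_regular[OF reg] s sb Vb
      by (intro measure_le_hausdorff_outer[where \<delta>=1]) (auto simp: upper_regular_def)
    also have "\<dots> = 0" using hausdorff_outer_subspace_zero[OF V _ ms R] False by simp
    finally show ?thesis by simp
  qed
  moreover have "emeasure \<nu> (ball z 1) \<le> emeasure \<nu> ((V \<inter> cball 0 R) \<union> - measure_support \<nu>)"
  proof (rule emeasure_mono)
    show "ball z 1 \<subseteq> (V \<inter> cball 0 R) \<union> - measure_support \<nu>"
    proof
      fix y assume "y \<in> ball z 1"
      then have "y \<in> cball 0 R"
        using norm_triangle_ineq[of z "y - z"] by (simp add: dist_norm norm_minus_commute R_def)
      then show "y \<in> (V \<inter> cball 0 R) \<union> - measure_support \<nu>" using SV by auto
    qed
    show "(V \<inter> cball 0 R) \<union> - measure_support \<nu> \<in> sets \<nu>" using Vb closed_measure_support[OF sb] sb by auto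
  qed
  moreover have "emeasure \<nu> ((V \<inter> cball 0 R) \<union> - measure_support \<nu>) \<le> emeasure \<nu> (V \<inter> cball 0 R) + emeasure \<nu> (- measure_support \<nu>)"
    using Vb closed_measure_support[OF sb] sb by (intro emeasure_subadditive) auto
  moreover have "0 < emeasure \<nu> (ball z 1)" using z by (simp add: measure_support_def)
  ultimately show False using emeasure_outside_support[OF sb] by simp
qed

section \<open>The critical case: exponent equal to dimension\<close>

lemma emeasure_support_Int:
  assumes sb: "sets \<nu> = sets (borel :: 'a::euclidean_space measure)" and A: "A \<in> sets borel"
  shows "emeasure \<nu> (measure_support \<nu> \<inter> A) = emeasure \<nu> A"
  using AE_measure_support[OF sb] closed_measure_support[OF sb] A sb
  by (intro emeasure_eq_AE) (auto elim: eventually_mono)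

text \<open>If the density tended to 0 at every support point near z, the mass distribution
  principle could be applied with every positive \<epsilon> against the finite Hausdorff measure of
  a bounded piece of V, and the mass near z would vanish.\<close>

lemma positive_density_dense:
  fixes \<nu> :: "'a::euclidean_space measure"
  assumes reg: "upper_regular \<nu> (real m) C" and V: "subspace V" "dim V = m" "0 < m"
    and SV: "measure_support \<nu> \<subseteq> V" and z: "z \<in> measure_support \<nu>" and \<delta>: "0 < \<delta>"
  shows "\<exists>z'\<in>measure_support \<nu>. dist z z' < \<delta> \<and>
     (\<exists>\<epsilon>>0. \<forall>\<rho>>0. \<exists>r. 0 < r \<and> r < \<rho> \<and> ennreal (\<epsilon> * r powr real m) < emeasure \<nu> (ball z' r))"
proof (rule ccontr)
  assume neg: "\<not> ?thesis"
  have sb: "sets \<nu> = sets borel" using reg by (rule upper_regular_sets)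
  define A where "A = measure_support \<nu> \<inter> cball z (\<delta> / 2)"
  define R where "R = norm z + \<delta>"
  have R: "0 < R" using \<delta> by (simp add: R_def add_nonneg_pos)
  have cl: "closed (measure_support \<nu>)" by (rule closed_measure_support[OF sb])
  have Vb: "V \<in> sets borel" using closed_subspace[OF V(1)] by auto
  have AV: "A \<subseteq> V \<inter> cball 0 R"
  proof
    fix y assume y: "y \<in> A"
    then have "norm y \<le> R"
      using norm_triangle_ineq[of z "y - z"] \<delta> by (simp add: A_def dist_norm norm_minus_commute R_def)
    then show "y \<in> V \<inter> cball 0 R" using y SV by (auto simp: A_def)
  qed
  define c where "c = 4 powr real m / unit_ball_vol (real m)"
  have c: "0 \<le> c" by (simp add: c_def unit_ball_vol_nonneg)
  obtain k where k: "0 \<le> k" "hausdorff_outer (real m) (V \<inter> cball 0 R) = ennreal k"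
    using hausdorff_outer_subspace_finite[OF V R] by (cases "hausdorff_outer (real m) (V \<inter> cball 0 R)") auto
  have small: "emeasure \<nu> A \<le> ennreal (\<epsilon> * c * k)" if \<epsilon>: "0 < \<epsilon>" for \<epsilon>
  proof -
    \<comment> \<open>The scale below which the density bound holds varies with the point; the sets
      \<open>N i\<close> make it uniform, are closed, and exhaust A.\<close>
    define N where "N i = A \<inter> (\<Inter>r\<in>{0<..<1 / real (Suc i)}. {y. emeasure \<nu> (ball y r) \<le> ennreal (\<epsilon> * r powr real m)})" for i
    have Ncl: "closed (N i)" for i
      unfolding N_def A_def using cl by (intro closed_Int closed_INT ballI closed_emeasure_ball_le sb closed_cball)
    have inc: "incseq N"
    proof (rule incseq_SucI)
      fix i
      have "1 / real (Suc (Suc i)) \<le> 1 / real (Suc i)" by (intro divide_left_mono) auto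
      then have "{0<..<1 / real (Suc (Suc i))} \<subseteq> {0<..<1 / real (Suc i)}" by auto
      then show "N i \<subseteq> N (Suc i)" unfolding N_def by (intro Int_mono INF_superset_mono) auto
    qed
    have UN: "A = (\<Union>i. N i)"
    proof
      show "A \<subseteq> (\<Union>i. N i)"
      proof
        fix y assume y: "y \<in> A"
        then have "y \<in> measure_support \<nu>" "dist z y < \<delta>" using \<delta> by (auto simp: A_def)
        then obtain \<rho> where \<rho>: "0 < \<rho>" "\<And>r. 0 < r \<Longrightarrow> r < \<rho> \<Longrightarrow> emeasure \<nu> (ball y r) \<le> ennreal (\<epsilon> * r powr real m)"
          using neg \<epsilon> by (metis not_less)
        obtain i where i: "inverse (real (Suc i)) < \<rho>" using reals_Archimedean[OF \<rho>(1)] by blast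
        have "y \<in> N i" using y i \<rho>(2) by (auto simp: N_def inverse_eq_divide)
        then show "y \<in> (\<Union>i. N i)" by blast
      qed
    qed (auto simp: N_def)
    have Nle: "emeasure \<nu> (N i) \<le> ennreal (\<epsilon> * c * k)" for i
    proof -
      have "emeasure \<nu> (N i) \<le> ennreal (\<epsilon> * 4 powr real m / unit_ball_vol (real m)) * hausdorff_outer (real m) (N i)"
        using V \<epsilon> Ncl sb by (intro measure_le_hausdorff_outer[where \<delta>="1 / real (Suc i)"]) (auto simp: N_def)
      also have "\<dots> \<le> ennreal (\<epsilon> * 4 powr real m / unit_ball_vol (real m)) * ennreal k"
        unfolding k(2)[symmetric] using AV by (intro mult_left_mono hausdorff_outer_mono) (auto simp: N_def)
      also have "\<dots> = ennreal (\<epsilon> * c * k)" using k \<epsilon> by (simp add: c_def ennreal_mult[symmetric] unit_ball_vol_nonneg)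
      finally show ?thesis .
    qed
    have "emeasure \<nu> A = (SUP i. emeasure \<nu> (N i))"
      unfolding UN using Ncl sb inc by (intro SUP_emeasure_incseq[symmetric]) auto
    also have "\<dots> \<le> ennreal (\<epsilon> * c * k)" by (intro SUP_least Nle)
    finally show ?thesis .
  qed
  have "emeasure \<nu> A \<le> 0 + ennreal e" if e: "0 < e" for e
  proof -
    have ck: "0 \<le> c * k" using c k by simp
    have "emeasure \<nu> A \<le> ennreal (e / (c * k + 1) * c * k)" using e ck by (intro small) auto
    also have "e / (c * k + 1) * c * k = e * (c * k / (c * k + 1))" by simp
    also have "\<dots> \<le> e * 1" using e ck by (intro mult_left_mono) auto
    finally show ?thesis by (simp add: ennreal_leI)
  qed
  then have "emeasure \<nu> A \<le> 0" by (rule ennreal_le_epsilon)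
  moreover have "emeasure \<nu> (cball z (\<delta> / 2)) = emeasure \<nu> A" unfolding A_def by (rule emeasure_support_Int[OF sb, symmetric]) auto
  moreover have "emeasure \<nu> (ball z (\<delta> / 2)) \<le> emeasure \<nu> (cball z (\<delta> / 2))" by (intro emeasure_mono) (auto simp: sb)
  moreover have "0 < emeasure \<nu> (ball z (\<delta> / 2))" using z \<delta> by (simp add: measure_support_def)
  ultimately show False by simp
qed

text \<open>Up to a constant factor \<open>(qk r w)\<^sup>2 *\<^sub>R w\<close> is the gradient of
  \<open>(qk r w) ^ 3\<close>, so \<open>dkernel\<close> is a Hessian.\<close>

lemma inner_dkernel_commute: "dkernel r w v \<bullet> u = v \<bullet> dkernel r w u"
  by (simp add: dkernel_def inner_diff_left inner_diff_right inner_commute)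

lemma inner_dmoment_commute:
  assumes lf: "locally_finite_borel_measure \<nu>" and r: "0 \<le> r"
  shows "dmoment \<nu> z r v \<bullet> u = v \<bullet> dmoment \<nu> z r u"
  unfolding dmoment_def using integrable_dkernel[OF lf r]
  by (simp add: integral_inner_left[symmetric] integral_inner_right[symmetric] inner_dkernel_commute
      del: integral_inner_left integral_inner_right)

text \<open>A nonzero derivative would confine the support near z to a region |(y - z) \<bullet> e'|
  \<le> K |y - z|^2 for some unit vector e' in V. In small balls this is a slab of arbitrarily small
  relative width, and by \<open>measure_slab_le\<close> it cannot carry a positive density.\<close>

lemma dmoment_zero_at_density_point:
  fixes \<nu> :: "'a::euclidean_space measure"
  assumes reg: "upper_regular \<nu> (real m) C" and V: "subspace V" "dim V = m" "0 < m"
    and SV: "measure_support \<nu> \<subseteq> V"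
    and symS: "\<And>z r. z \<in> measure_support \<nu> \<Longrightarrow> 0 < r \<Longrightarrow> sym_moment \<nu> z r = 0"
    and z: "z \<in> measure_support \<nu>" and \<epsilon>: "0 < \<epsilon>"
    and dens: "\<And>\<rho>. 0 < \<rho> \<Longrightarrow> \<exists>r. 0 < r \<and> r < \<rho> \<and> ennreal (\<epsilon> * r powr real m) < emeasure \<nu> (ball z r)"
    and r: "0 < r" and v: "v \<in> V"
  shows "dmoment \<nu> z r v = 0"
proof (rule ccontr)
  assume u0: "dmoment \<nu> z r v \<noteq> 0"
  define u where "u = dmoment \<nu> z r v"
  have lf: "locally_finite_borel_measure \<nu>" using reg by (rule upper_regular_locally_finite)
  have sb: "sets \<nu> = sets borel" using reg by (rule upper_regular_sets)
  \<comment> \<open>With D for the derivative and u = D v, the vector e1 is the component of D u in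
    V. Symmetry of D gives w \<bullet> e1 = D w \<bullet> u for w in V, so that v \<bullet> e1 =
    |u|^2 is nonzero.\<close>
  obtain e1 e2 where e: "e1 \<in> V" "\<And>w. w \<in> V \<Longrightarrow> orthogonal e2 w" "dmoment \<nu> z r u = e1 + e2"
    using orthogonal_subspace_decomp_exists[of V "dmoment \<nu> z r u"] V(1) span_eq_iff by metis
  have ip: "w \<bullet> e1 = dmoment \<nu> z r w \<bullet> u" if "w \<in> V" for w
  proof -
    have "w \<bullet> e2 = 0" using e(2)[OF that] by (simp add: orthogonal_def inner_commute)
    then show ?thesis using r by (simp add: inner_dmoment_commute[OF lf] e(3) inner_add_right)
  qed
  have "v \<bullet> e1 \<noteq> 0" using ip[OF v] u0 by (simp add: u_def)
  then have e10: "e1 \<noteq> 0" by auto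
  define e' where "e' = e1 /\<^sub>R norm e1"
  have e': "e' \<in> V" "norm e' = 1" using e(1) V(1) e10 by (auto simp: e'_def subspace_scale)
  define K where "K = norm u * (30 * r ^ 3 * measure \<nu> (cball z (2 * r))) / norm e1"
  have K0: "0 \<le> K" using r by (simp add: K_def)
  have quad: "\<bar>(y - z) \<bullet> e'\<bar> \<le> K * (norm (y - z))\<^sup>2" if y: "y \<in> measure_support \<nu>" "norm (y - z) \<le> r" for y
  proof -
    have yV: "y - z \<in> V" using y z SV V(1) by (auto intro: subspace_diff)
    have "norm (dmoment \<nu> z r (y - z)) \<le> 30 * r ^ 3 * (norm (y - z))\<^sup>2 * measure \<nu> (cball z (2 * r))"
      using sym_moment_taylor[OF lf y(2), of z] symS[OF y(1) r] symS[OF z r] by simp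
    then have "norm (dmoment \<nu> z r (y - z)) * norm u \<le> (30 * r ^ 3 * (norm (y - z))\<^sup>2 * measure \<nu> (cball z (2 * r))) * norm u"
      by (intro mult_right_mono) auto
    moreover have "\<bar>(y - z) \<bullet> e1\<bar> \<le> norm (dmoment \<nu> z r (y - z)) * norm u"
      unfolding ip[OF yV] by (rule Cauchy_Schwarz_ineq2)
    ultimately have "\<bar>(y - z) \<bullet> e1\<bar> / norm e1 \<le> (30 * r ^ 3 * (norm (y - z))\<^sup>2 * measure \<nu> (cball z (2 * r))) * norm u / norm e1"
      by (intro divide_right_mono) auto
    then show ?thesis by (simp add: e'_def K_def abs_mult divide_inverse mult_ac)
  qed
  \<comment> \<open>n makes the slab constant k / n smaller than the density \<epsilon>; the radius
    is then taken so small that the quadratic bound K \<rho>^2 is at most \<rho> / n.\<close>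
  define k where "k = C * (6 * real m) ^ m"
  obtain n :: nat where n: "k / \<epsilon> < real n" using reals_Archimedean2 by blast
  have k0: "0 < k" using reg V by (simp add: k_def upper_regular_def)
  have "0 < k / \<epsilon>" using k0 \<epsilon> by simp
  then have n0: "0 < n" using n by (metis less_trans of_nat_0_less_iff)
  have kn: "k / real n < \<epsilon>" using n n0 \<epsilon> by (simp add: field_simps)
  define \<rho>0 where "\<rho>0 = min r (1 / (real n * (K + 1)))"
  have "0 < \<rho>0" using r n0 K0 by (simp add: \<rho>0_def)
  then obtain \<rho> where \<rho>: "0 < \<rho>" "\<rho> < \<rho>0" "ennreal (\<epsilon> * \<rho> powr real m) < emeasure \<nu> (ball z \<rho>)" using dens by blast
  have "\<rho> * (real n * (K + 1)) < 1"
  proof -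
    have "0 < real n * (K + 1)" "\<rho> < 1 / (real n * (K + 1))" using \<rho>(2) n0 K0 by (simp_all add: \<rho>0_def)
    then show ?thesis by (simp only: pos_less_divide_eq)
  qed
  moreover have "\<rho> * (real n * K) \<le> \<rho> * (real n * (K + 1))" using \<rho> by (intro mult_left_mono) auto
  ultimately have "K * \<rho> * real n \<le> 1" by (simp add: mult_ac)
  then have K\<rho>: "K * \<rho> \<le> 1 / real n" using n0 by (simp add: field_simps)
  have "measure \<nu> (measure_support \<nu> \<inter> ball z \<rho>) \<le> C * (6 * real m) ^ m * \<rho> ^ m / real n"
  proof (rule measure_slab_le[OF reg V(1,2) e' n0 \<rho>(1)])
    fix y assume y: "y \<in> measure_support \<nu> \<inter> ball z \<rho>"
    then have ny: "norm (y - z) \<le> \<rho>" by (simp add: dist_norm norm_minus_commute)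
    have "\<bar>(y - z) \<bullet> e'\<bar> \<le> K * (norm (y - z))\<^sup>2" using y ny \<rho>(2) by (intro quad) (auto simp: \<rho>0_def)
    also have "\<dots> \<le> K * (\<rho> * \<rho>)" unfolding power2_eq_square using ny K0 \<rho> by (intro mult_left_mono mult_mono) auto
    also have "\<dots> \<le> \<rho> / real n" using mult_right_mono[OF K\<rho>, of \<rho>] \<rho> by (simp add: mult_ac)
    finally show "y - z \<in> V \<and> norm (y - z) \<le> \<rho> \<and> \<bar>(y - z) \<bullet> e'\<bar> \<le> \<rho> / real n"
      using ny y z SV V(1) by (auto intro: subspace_diff)
  qed
  also have "\<dots> = k / real n * \<rho> powr real m" using \<rho> by (simp add: k_def powr_realpow)
  also have "\<dots> \<le> \<epsilon> * \<rho> powr real m" using kn by (intro mult_right_mono) auto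
  finally have "measure \<nu> (ball z \<rho>) \<le> \<epsilon> * \<rho> powr real m"
    unfolding measure_def by (simp add: emeasure_support_Int[OF sb])
  then have "emeasure \<nu> (ball z \<rho>) \<le> ennreal (\<epsilon> * \<rho> powr real m)"
    using emeasure_bounded_finite[OF lf bounded_ball, of z \<rho>] by (simp add: emeasure_eq_ennreal_measure ennreal_leI)
  then show False using \<rho>(3) by simp
qed

lemma qmass_homogeneous_at_density_point:
  fixes \<nu> :: "'a::euclidean_space measure"
  assumes reg: "upper_regular \<nu> (real m) C" and V: "subspace V" "dim V = m"
    and SV: "measure_support \<nu> \<subseteq> V" and z: "z \<in> V"
    and dm: "\<And>r v. 0 < r \<Longrightarrow> v \<in> V \<Longrightarrow> dmoment \<nu> z r v = 0"
  shows "\<exists>c. \<forall>r>0. qmass \<nu> z r = c * r ^ (m + 4)"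
proof -
  have lf: "locally_finite_borel_measure \<nu>" using reg by (rule upper_regular_locally_finite)
  have sb: "sets \<nu> = sets borel" using reg by (rule upper_regular_sets)
  obtain B where B: "B \<subseteq> V" "pairwise orthogonal B" "\<And>x. x \<in> B \<Longrightarrow> norm x = 1" "independent B" "card B = dim V" "span B = V"
    using orthonormal_basis_subspace[OF V(1)] by metis
  have fB: "finite B" using B(4) by (rule independent_imp_finite)
  have cB: "card B = m" using B(5) V by simp
  have AEV: "AE y in \<nu>. z - y \<in> span B"
    using AE_measure_support[OF sb] by eventually_elim (use z SV V(1) B(6) in \<open>auto intro: subspace_diff\<close>)
  have "\<exists>c. \<forall>r\<in>{0<..}. qmass \<nu> z r * r powr - (real m + 4) = c"
  proof (rule has_field_derivative_zero_constant)
    fix r :: real assume r: "r \<in> {0<..}"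
    have "(\<Sum>b\<in>B. dmoment \<nu> z r b \<bullet> b) = 0" using r B(1) dm by (intro sum.neutral) auto
    then show "((\<lambda>r. qmass \<nu> z r * r powr - (real m + 4)) has_real_derivative 0) (at r within {0<..})"
      using normalized_qmass_has_derivative[OF lf _ B(2,3) fB cB AEV, of r] r
      by (auto intro: has_field_derivative_at_within)
  qed auto
  then obtain c where c: "\<And>r. 0 < r \<Longrightarrow> qmass \<nu> z r * r powr - (real m + 4) = c" by auto
  have "qmass \<nu> z r = c * r ^ (m + 4)" if r: "0 < r" for r
  proof -
    have "r powr - (real m + 4) * r ^ (m + 4) = 1"
    proof -
      have "r ^ (m + 4) = r powr (real m + 4)" using powr_realpow[OF r, of "m + 4"] by simp
      then show ?thesis using r by (simp only: powr_add[symmetric]) simp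
    qed
    then have "qmass \<nu> z r = qmass \<nu> z r * r powr - (real m + 4) * r ^ (m + 4)" by (simp only: mult.assoc mult_1_right)
    also have "\<dots> = c * r ^ (m + 4)" by (simp only: c[OF r])
    finally show ?thesis .
  qed
  then show ?thesis by blast
qed

text \<open>Each point of positive density has its own homogeneity constant. For two such points the
  difference of \<open>qmass\<close> is of order m + 3 at large scales, less than the homogeneity
  degree m + 4, so their constants coincide. These points are dense in the support, and continuity
  in the centre yields the rest.\<close>

theorem qmass_homogeneous_on_support:
  fixes \<nu> :: "'a::euclidean_space measure"
  assumes reg: "upper_regular \<nu> (real m) C" and V: "subspace V" "dim V = m" "0 < m"
    and SV: "measure_support \<nu> \<subseteq> V"
    and symS: "\<And>z r. z \<in> measure_support \<nu> \<Longrightarrow> 0 < r \<Longrightarrow> sym_moment \<nu> z r = 0"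
    and ne: "measure_support \<nu> \<noteq> {}"
  shows "\<exists>c>0. \<forall>z\<in>measure_support \<nu>. \<forall>r>0. qmass \<nu> z r = c * r ^ (m + 4)"
proof -
  let ?S = "measure_support \<nu>"
  have lf: "locally_finite_borel_measure \<nu>" using reg by (rule upper_regular_locally_finite)
  have sb: "sets \<nu> = sets borel" using reg by (rule upper_regular_sets)
  define P where "P z \<longleftrightarrow> (\<exists>c. \<forall>r>0. qmass \<nu> z r = c * r ^ (m + 4))" for z
  have dense: "\<exists>z'\<in>?S. dist z z' < \<delta> \<and> P z'" if z: "z \<in> ?S" and \<delta>: "0 < \<delta>" for z \<delta>
  proof -
    obtain z' \<epsilon> where z': "z' \<in> ?S" "dist z z' < \<delta>" "0 < \<epsilon>"
      and d: "\<And>\<rho>. 0 < \<rho> \<Longrightarrow> \<exists>r. 0 < r \<and> r < \<rho> \<and> ennreal (\<epsilon> * r powr real m) < emeasure \<nu> (ball z' r)"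
      using positive_density_dense[OF reg V SV z \<delta>] by blast
    have "P z'" unfolding P_def
      using dmoment_zero_at_density_point[OF reg V SV symS z'(1,3) d] z' SV
      by (intro qmass_homogeneous_at_density_point[OF reg V(1,2) SV]) auto
    then show ?thesis using z' by blast
  qed
  have lip: "\<bar>qmass \<nu> z r - qmass \<nu> z' r\<bar> \<le> 4 * r ^ 3 * d * (C * (r + d) powr real m)"
    if "0 < r" "dist z z' \<le> d" "0 \<le> d" for z z' r d
  proof -
    have d: "norm (z - z') \<le> d" using that by (simp add: dist_norm)
    have "measure \<nu> (cball z (r + norm (z - z'))) \<le> C * (r + norm (z - z')) powr real m"
      using that by (intro upper_regular_measure_le[OF reg]) (simp add: add_pos_nonneg)
    also have "\<dots> \<le> C * (r + d) powr real m"
      using reg d that by (intro mult_left_mono powr_mono2) (auto simp: upper_regular_def)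
    finally have m: "measure \<nu> (cball z (r + norm (z - z'))) \<le> C * (r + d) powr real m" .
    have "\<bar>qmass \<nu> z r - qmass \<nu> z' r\<bar> \<le> 4 * r ^ 3 * norm (z - z') * measure \<nu> (cball z (r + norm (z - z')))"
      using that by (intro qmass_lipschitz lf) auto
    also have "\<dots> \<le> 4 * r ^ 3 * d * (C * (r + d) powr real m)"
      using that d m by (intro mult_mono) auto
    finally show ?thesis .
  qed
  obtain z0 where z0: "z0 \<in> ?S" "P z0" using ne dense by (metis all_not_in_conv zero_less_one)
  then obtain c where c: "\<And>r. 0 < r \<Longrightarrow> qmass \<nu> z0 r = c * r ^ (m + 4)" unfolding P_def by blast
  have same: "qmass \<nu> z r = c * r ^ (m + 4)" if z: "P z" and r: "0 < r" for z r
  proof -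
    obtain c' where c': "\<And>r. 0 < r \<Longrightarrow> qmass \<nu> z r = c' * r ^ (m + 4)" using z unfolding P_def by blast
    define d where "d = dist z0 z + 1"
    have d: "0 < d" "dist z0 z \<le> d" by (auto simp: d_def add_nonneg_pos)
    define K where "K = 4 * d * (C * 2 powr real m)"
    have "\<bar>c - c'\<bar> \<le> K / \<rho>" if \<rho>: "d \<le> \<rho>" for \<rho>
    proof -
      have \<rho>0: "0 < \<rho>" using d \<rho> by linarith
      have "\<bar>c - c'\<bar> * \<rho> ^ (m + 4) = \<bar>qmass \<nu> z0 \<rho> - qmass \<nu> z \<rho>\<bar>"
        using \<rho>0 by (simp add: c c' left_diff_distrib[symmetric] abs_mult)
      also have "\<dots> \<le> 4 * \<rho> ^ 3 * d * (C * (\<rho> + d) powr real m)" using \<rho>0 d by (intro lip) auto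
      also have "\<dots> \<le> 4 * \<rho> ^ 3 * d * (C * (2 * \<rho>) powr real m)"
        using \<rho> \<rho>0 d reg by (intro mult_left_mono powr_mono2) (auto simp: upper_regular_def)
      also have "\<dots> = K * \<rho> ^ (m + 3)"
        using \<rho>0 by (simp add: K_def powr_mult powr_realpow power_add)
      finally have "\<bar>c - c'\<bar> * \<rho> * \<rho> ^ (m + 3) \<le> K * \<rho> ^ (m + 3)"
        by (simp add: power_add power_numeral_reduce mult_ac)
      then have "\<bar>c - c'\<bar> * \<rho> \<le> K" using \<rho>0 by (simp add: mult_le_cancel_right)
      then show ?thesis using \<rho>0 by (simp add: field_simps)
    qed
    then have "\<forall>\<^sub>F \<rho> in at_top. \<bar>c - c'\<bar> \<le> K / \<rho>"
      by (intro eventually_mono[OF eventually_ge_at_top[of d]])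
    moreover have "((\<lambda>\<rho>. K / \<rho>) \<longlongrightarrow> 0) at_top"
      by (intro real_tendsto_divide_at_top[OF tendsto_const] filterlim_ident)
    ultimately have "\<bar>c - c'\<bar> \<le> 0" by (intro tendsto_lowerbound[where F=at_top]) auto
    then show ?thesis using c'[OF r] by simp
  qed
  have all: "qmass \<nu> z r = c * r ^ (m + 4)" if z: "z \<in> ?S" and r: "0 < r" for z r
  proof -
    define K where "K = 4 * r ^ 3 * (C * (r + 1) powr real m)"
    have "\<bar>qmass \<nu> z r - c * r ^ (m + 4)\<bar> \<le> K * \<delta>" if \<delta>: "\<delta> \<in> {0<..<1}" for \<delta>
    proof -
      obtain z' where z': "z' \<in> ?S" "dist z z' < \<delta>" "P z'" using dense[OF z] \<delta> by auto
      have "\<bar>qmass \<nu> z r - qmass \<nu> z' r\<bar> \<le> 4 * r ^ 3 * \<delta> * (C * (r + \<delta>) powr real m)"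
        using r z' \<delta> by (intro lip) auto
      also have "\<dots> \<le> 4 * r ^ 3 * \<delta> * (C * (r + 1) powr real m)"
        using r \<delta> reg by (intro mult_left_mono powr_mono2) (auto simp: upper_regular_def)
      finally show ?thesis using same[OF z'(3) r] by (simp add: K_def mult_ac)
    qed
    then have "\<forall>\<^sub>F \<delta> in at_right 0. \<bar>qmass \<nu> z r - c * r ^ (m + 4)\<bar> \<le> K * \<delta>"
      by (intro eventually_mono[OF eventually_at_right_real[of 0 1]]) auto
    moreover have "((\<lambda>\<delta>. K * \<delta>) \<longlongrightarrow> K * 0) (at_right 0)"
      by (intro tendsto_mult tendsto_const tendsto_ident_at)
    ultimately have "\<bar>qmass \<nu> z r - c * r ^ (m + 4)\<bar> \<le> K * 0" by (intro tendsto_lowerbound[where F="at_right 0"]) auto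
    then show ?thesis by simp
  qed
  have "0 < c"
  proof -
    have "0 < emeasure \<nu> (ball z0 1)" using z0 by (simp add: measure_support_def)
    also have "\<dots> \<le> emeasure \<nu> (cball z0 1)" by (intro emeasure_mono) (auto simp: sb)
    finally have "0 < measure \<nu> (cball z0 1)"
      using emeasure_bounded_finite[OF lf bounded_cball, of z0 1] by (simp add: measure_def enn2real_positive_iff)
    then have "0 < qmass \<nu> z0 (2 * 1)" using qmass_ge[OF lf, of 1 z0] by simp
    then show ?thesis using c[of 2] by (simp add: zero_less_mult_iff)
  qed
  then show ?thesis using all by blast
qed

lemma fubini_bounded_support:
  fixes g :: "'a::euclidean_space \<Rightarrow> 'b::euclidean_space \<Rightarrow> 'c::{banach,second_countable_topology}"
  assumes M: "locally_finite_borel_measure M" and N: "locally_finite_borel_measure N"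
    and g: "case_prod g \<in> borel_measurable borel"
    and A: "bounded A" "A \<in> sets borel" and B: "bounded B" "B \<in> sets borel"
    and bd: "\<And>x y. x \<in> A \<Longrightarrow> y \<in> B \<Longrightarrow> norm (g x y) \<le> K" and out: "\<And>x y. x \<notin> A \<or> y \<notin> B \<Longrightarrow> g x y = 0"
  shows "(LINT x|M. LINT y|N. g x y) = (LINT y|N. LINT x|M. g x y)"
    and "integrable M (\<lambda>x. LINT y|N. g x y)" and "integrable N (\<lambda>y. LINT x|M. g x y)"
proof -
  interpret M: sigma_finite_measure M using M by (rule locally_finite_sigma_finite)
  interpret N: sigma_finite_measure N using N by (rule locally_finite_sigma_finite)
  interpret P: pair_sigma_finite M N ..
  have sM: "sets M = sets borel" and sN: "sets N = sets borel" by (rule locally_finite_sets[OF M], rule locally_finite_sets[OF N])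
  have sP: "sets (M \<Otimes>\<^sub>M N) = sets (borel :: ('a \<times> 'b) measure)"
    using sets_pair_measure_cong[OF sM sN] by (simp only: borel_prod)
  have AB: "A \<times> B \<in> sets (M \<Otimes>\<^sub>M N)" using A B sM sN by auto
  have fin: "emeasure (M \<Otimes>\<^sub>M N) (A \<times> B) < \<infinity>"
    using A B sM sN emeasure_bounded_finite[OF M A(1)] emeasure_bounded_finite[OF N B(1)]
    by (simp add: N.emeasure_pair_measure_Times ennreal_mult_less_top)
  have int: "integrable (M \<Otimes>\<^sub>M N) (case_prod g)"
  proof (rule Bochner_Integration.integrable_bound)
    show "integrable (M \<Otimes>\<^sub>M N) (\<lambda>p. indicat_real (A \<times> B) p * K)"
      using fin AB by (intro integrable_mult_left integrable_real_indicator) auto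
    show "case_prod g \<in> borel_measurable (M \<Otimes>\<^sub>M N)"
      using g sP measurable_cong_sets by blast
    show "AE p in M \<Otimes>\<^sub>M N. norm (case_prod g p) \<le> norm (indicat_real (A \<times> B) p * K)"
    proof (rule AE_I2)
      fix p
      show "norm (case_prod g p) \<le> norm (indicat_real (A \<times> B) p * K)"
      proof (cases p)
        case (Pair x y)
        then show ?thesis using bd[of x y] out[of x y]
          by (cases "x \<in> A \<and> y \<in> B") (auto intro: order_trans[OF _ abs_ge_self])
      qed
    qed
  qed
  show "(LINT x|M. LINT y|N. g x y) = (LINT y|N. LINT x|M. g x y)" using P.Fubini_integral[OF int] by simp
  show "integrable M (\<lambda>x. LINT y|N. g x y)" using P.integrable_fst[OF int] .
  show "integrable N (\<lambda>y. LINT x|M. g x y)" using P.integrable_snd[OF int] .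
qed

text \<open>Let z0 be the point of the support nearest to a point z1 of V outside it. Near z0 the
  support lies, up to a quadratic error, in the half-space facing away from z1; since the moment in
  the direction e of z1 vanishes, the mass far behind the hyperplane is small too. At small scales
  nearly all mass is then close to the hyperplane orthogonal to e, which contradicts the fixed size
  of \<open>qmass\<close>.\<close>

theorem measure_support_eq_subspace:
  fixes \<nu> :: "'a::euclidean_space measure"
  assumes reg: "upper_regular \<nu> (real m) C" and V: "subspace V" "dim V = m"
    and SV: "measure_support \<nu> \<subseteq> V"
    and symS: "\<And>z r. z \<in> measure_support \<nu> \<Longrightarrow> 0 < r \<Longrightarrow> sym_moment \<nu> z r = 0"
    and ne: "measure_support \<nu> \<noteq> {}"
    and c: "0 < c" "\<And>z r. z \<in> measure_support \<nu> \<Longrightarrow> 0 < r \<Longrightarrow> qmass \<nu> z r = c * r ^ (m + 4)"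
  shows "measure_support \<nu> = V"
proof (rule ccontr)
  let ?S = "measure_support \<nu>"
  assume "?S \<noteq> V"
  then obtain z1 where z1: "z1 \<in> V" "z1 \<notin> ?S" using SV by blast
  have lf: "locally_finite_borel_measure \<nu>" using reg by (rule upper_regular_locally_finite)
  have sb: "sets \<nu> = sets borel" using reg by (rule upper_regular_sets)
  have cl: "closed ?S" by (rule closed_measure_support[OF sb])
  obtain z0 where z0: "z0 \<in> ?S" "\<And>y. y \<in> ?S \<Longrightarrow> dist z1 z0 \<le> dist z1 y"
    using distance_attains_inf[OF cl ne] by blast
  define d where "d = norm (z1 - z0)"
  have d: "0 < d" using z0(1) z1(2) by (auto simp: d_def)
  define e where "e = (z1 - z0) /\<^sub>R d"
  have e: "e \<in> V" "norm e = 1"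
    using z1(1) z0(1) SV V(1) d by (auto simp: e_def d_def subspace_scale subspace_diff)
  have tangent: "(y - z0) \<bullet> e \<le> (norm (y - z0))\<^sup>2 / (2 * d)" if y: "y \<in> ?S" for y
  proof -
    have "d \<le> norm (z1 - y)" using z0(2)[OF y] by (simp add: dist_norm d_def)
    then have "d\<^sup>2 \<le> (norm (z1 - y))\<^sup>2" using d by (intro power_mono) auto
    also have "z1 - y = d *\<^sub>R e - (y - z0)" using d by (simp add: e_def)
    also have "(norm (d *\<^sub>R e - (y - z0)))\<^sup>2 = d\<^sup>2 - 2 * d * ((y - z0) \<bullet> e) + (norm (y - z0))\<^sup>2"
    proof -
      have "(norm (d *\<^sub>R e - w))\<^sup>2 = d\<^sup>2 * (e \<bullet> e) - 2 * d * (w \<bullet> e) + (norm w)\<^sup>2" for w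
        unfolding power2_norm_eq_inner
        by (simp add: inner_diff_left inner_diff_right inner_commute algebra_simps power2_eq_square)
      then show ?thesis using e(2) by (simp add: norm_eq_1)
    qed
    finally show ?thesis using d by (simp add: field_simps)
  qed
  define K where "K = C * (6 * real m) ^ m"
  \<comment> \<open>The first term bounds a slab of relative width 1 / n, the second is Chebyshev's
    inequality off the slab. Taking n large and then r small makes the sum less than c.\<close>
  have main: "c \<le> K / real n + real n * c * r / d" if r: "0 < r" and n: "0 < n" for r and n :: nat
  proof -
    define q where "q y = (qk r (z0 - y))\<^sup>2" for y
    define X where "X = ?S \<inter> cball z0 r \<inter> {y. \<bar>(y - z0) \<bullet> e\<bar> \<le> r / real n}"
    have Xcl: "closed X" unfolding X_def
      by (intro closed_Int cl closed_cball closed_Collect_le continuous_intros)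
    have q0: "0 \<le> q y" for y by (simp add: q_def)
    have iq: "integrable \<nu> (\<lambda>y. q y *\<^sub>R g y)" if "continuous_on UNIV g" for g :: "'a \<Rightarrow> real"
      unfolding q_def using that r by (intro integrable_qk_scaleR[OF lf]) auto
    have iqe: "integrable \<nu> (\<lambda>y. q y * ((y - z0) \<bullet> e))" "integrable \<nu> (\<lambda>y. q y * \<bar>(y - z0) \<bullet> e\<bar>)"
       "integrable \<nu> q"
    proof -
      have "continuous_on UNIV (\<lambda>y. (y - z0) \<bullet> e)" "continuous_on UNIV (\<lambda>y. \<bar>(y - z0) \<bullet> e\<bar>)"
        by (intro continuous_intros)+
      from iq[OF this(1)] iq[OF this(2)] iq[of "\<lambda>_. 1"]
      show "integrable \<nu> (\<lambda>y. q y * ((y - z0) \<bullet> e))" "integrable \<nu> (\<lambda>y. q y * \<bar>(y - z0) \<bullet> e\<bar>)" "integrable \<nu> q"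
        by simp_all
    qed
    have int0: "(LINT y|\<nu>. q y * ((y - z0) \<bullet> e)) = 0"
    proof -
      have "(LINT y|\<nu>. ((qk r (z0 - y))\<^sup>2 *\<^sub>R (z0 - y)) \<bullet> e) = sym_moment \<nu> z0 r \<bullet> e"
        unfolding sym_moment_def using r by (intro integral_inner_left integrable_sym_kernel lf) auto
      also have "\<dots> = 0" using symS[OF z0(1) r] by simp
      finally have "- (LINT y|\<nu>. ((qk r (z0 - y))\<^sup>2 *\<^sub>R (z0 - y)) \<bullet> e) = 0" by simp
      also have "- (LINT y|\<nu>. ((qk r (z0 - y))\<^sup>2 *\<^sub>R (z0 - y)) \<bullet> e) = (LINT y|\<nu>. - (((qk r (z0 - y))\<^sup>2 *\<^sub>R (z0 - y)) \<bullet> e))"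
        by simp
      also have "(\<lambda>y. - (((qk r (z0 - y))\<^sup>2 *\<^sub>R (z0 - y)) \<bullet> e)) = (\<lambda>y. q y * ((y - z0) \<bullet> e))"
        by (auto simp: q_def inner_diff_left algebra_simps)
      finally show ?thesis .
    qed
    have qm: "(LINT y|\<nu>. q y) = c * r ^ (m + 4)" using c(2)[OF z0(1) r] by (simp add: q_def qmass_def)
    \<comment> \<open>|t| is twice the positive part of t, minus t. The positive part is
      quadratically small by \<open>tangent\<close>, and t itself integrates to 0.\<close>
    have "(LINT y|\<nu>. q y * \<bar>(y - z0) \<bullet> e\<bar>) \<le> (LINT y|\<nu>. r\<^sup>2 / d * q y - q y * ((y - z0) \<bullet> e))"
    proof (rule integral_mono_AE)
      show "AE y in \<nu>. q y * \<bar>(y - z0) \<bullet> e\<bar> \<le> r\<^sup>2 / d * q y - q y * ((y - z0) \<bullet> e)"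
        using AE_measure_support[OF sb]
      proof eventually_elim
        case (elim y)
        show ?case
        proof (cases "norm (y - z0) \<le> r")
          case True
          have "(norm (y - z0))\<^sup>2 \<le> r\<^sup>2" using True by (intro power_mono) auto
          then have "(norm (y - z0))\<^sup>2 / d \<le> r\<^sup>2 / d" using d by (intro divide_right_mono) auto
          moreover have "2 * ((y - z0) \<bullet> e) \<le> (norm (y - z0))\<^sup>2 / d" using tangent[OF elim] d by (simp add: field_simps)
          moreover have "0 \<le> (norm (y - z0))\<^sup>2 / d" using d by simp
          ultimately have "\<bar>(y - z0) \<bullet> e\<bar> \<le> r\<^sup>2 / d - (y - z0) \<bullet> e" by linarith
          then have "q y * \<bar>(y - z0) \<bullet> e\<bar> \<le> q y * (r\<^sup>2 / d - (y - z0) \<bullet> e)" using q0 by (intro mult_left_mono) auto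
          then show ?thesis by (simp add: algebra_simps)
        next
          case False
          then have "q y = 0" using r by (simp add: q_def qk_outside norm_minus_commute)
          then show ?thesis by simp
        qed
      qed
    qed (use iqe in auto)
    also have "\<dots> = r\<^sup>2 / d * (c * r ^ (m + 4))"
      using iqe by (subst Bochner_Integration.integral_diff) (auto simp: int0 qm)
    finally have b1: "(LINT y|\<nu>. q y * \<bar>(y - z0) \<bullet> e\<bar>) \<le> r\<^sup>2 / d * (c * r ^ (m + 4))" .
    have fX: "emeasure \<nu> X < \<infinity>" by (rule emeasure_bounded_finite[OF lf]) (auto simp: X_def)
    have iX: "integrable \<nu> (\<lambda>y. indicat_real X y * r ^ 4)"
      using fX Xcl sb by (intro integrable_mult_left integrable_real_indicator) auto
    have "c * r ^ (m + 4) \<le> (LINT y|\<nu>. indicat_real X y * r ^ 4 + real n / r * (q y * \<bar>(y - z0) \<bullet> e\<bar>))"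
      unfolding qm[symmetric]
    proof (rule integral_mono_AE)
      show "AE y in \<nu>. q y \<le> indicat_real X y * r ^ 4 + real n / r * (q y * \<bar>(y - z0) \<bullet> e\<bar>)"
        using AE_measure_support[OF sb]
      proof eventually_elim
        case (elim y)
        have nn: "0 \<le> real n / r * (q y * \<bar>(y - z0) \<bullet> e\<bar>)" using r q0[of y] by simp
        consider "y \<in> X" | "r < norm (y - z0)" | "\<bar>(y - z0) \<bullet> e\<bar> > r / real n"
          using elim by (force simp: X_def dist_norm norm_minus_commute)
        then show ?case
        proof cases
          case 1 then show ?thesis using nn qk2_le[of r "z0 - y"] by (simp add: q_def)
        next
          case 2
          then have "q y = 0" using r by (simp add: q_def qk_outside norm_minus_commute)
          then show ?thesis using r by simp
        next
          case 3
          then have "1 \<le> real n / r * \<bar>(y - z0) \<bullet> e\<bar>" using r n by (simp add: field_simps)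
          then have "q y * 1 \<le> q y * (real n / r * \<bar>(y - z0) \<bullet> e\<bar>)" using q0 by (intro mult_left_mono) auto
          also have "\<dots> = real n / r * (q y * \<bar>(y - z0) \<bullet> e\<bar>)" by simp
          finally have "q y \<le> real n / r * (q y * \<bar>(y - z0) \<bullet> e\<bar>)" by simp
          moreover have "0 \<le> indicat_real X y * r ^ 4" by (intro mult_nonneg_nonneg) (use r in auto)
          ultimately show ?thesis by linarith
        qed
      qed
    qed (use iqe iX in auto)
    also have "\<dots> = measure \<nu> X * r ^ 4 + real n / r * (LINT y|\<nu>. q y * \<bar>(y - z0) \<bullet> e\<bar>)"
      using iqe iX Xcl sb sets_eq_imp_space_eq[OF sb] by (subst Bochner_Integration.integral_add) auto
    also have "\<dots> \<le> (K * r ^ m / real n) * r ^ 4 + real n / r * (r\<^sup>2 / d * (c * r ^ (m + 4)))"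
    proof (intro add_mono mult_right_mono mult_left_mono b1)
      show "measure \<nu> X \<le> K * r ^ m / real n"
        unfolding K_def
      proof (rule measure_slab_le[OF reg V e n r])
        fix y assume "y \<in> X"
        then show "y - z0 \<in> V \<and> norm (y - z0) \<le> r \<and> \<bar>(y - z0) \<bullet> e\<bar> \<le> r / real n"
          using z0(1) SV V(1) by (auto simp: X_def dist_norm norm_minus_commute intro: subspace_diff)
      qed
    qed (use r in auto)
    also have "\<dots> = (K / real n + real n * c * r / d) * r ^ (m + 4)"
      using r d by (simp add: power_add field_simps power2_eq_square)
    finally show ?thesis using r by (simp add: mult_le_cancel_right)
  qed
  obtain n :: nat where n: "2 * \<bar>K\<bar> / c < real n" using reals_Archimedean2 by blast
  have "0 \<le> 2 * \<bar>K\<bar> / c" using c(1) by simp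
  then have n0: "0 < n" using n by (metis le_less_trans of_nat_0_less_iff)
  have "2 * \<bar>K\<bar> < c * real n" using n c(1) by (simp add: field_simps)
  then have "K / real n < c / 2" using n0 by (simp add: field_simps)
  moreover have "c \<le> K / real n + real n * c * (d / (4 * real n)) / d" using d n0 by (intro main) auto
  moreover have "real n * c * (d / (4 * real n)) / d = c / 4" using d n0 by simp
  ultimately show False using c(1) by linarith
qed

section \<open>Comparison with Hausdorff measure on the subspace\<close>

lemma AE_hausdorff_on:
  assumes "A \<in> sets borel"
  shows "AE y in hausdorff_on s A. y \<in> A"
  unfolding hausdorff_on_def using assms
  by (subst AE_density) (auto simp: indicator_def)

lemma hausdorff_on_subspace_translate:
  fixes V :: "'a::euclidean_space set"
  assumes s: "0 < s" and V: "subspace V" and x: "x \<in> V"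
  shows "distr (hausdorff_on s V) borel ((+) x) = hausdorff_on s V"
proof -
  have "(+) x ` V = V"
  proof
    show "V \<subseteq> (+) x ` V"
    proof
      fix y assume "y \<in> V"
      then have "y - x \<in> V" using V x by (intro subspace_diff)
      then show "y \<in> (+) x ` V" by (intro image_eqI[of _ _ "y - x"]) auto
    qed
  qed (use V x in \<open>auto intro: subspace_add\<close>)
  moreover have "distr (hausdorff_on s V) borel ((+) x) = hausdorff_on s ((+) x ` V)"
    using closed_subspace[OF V] by (intro hausdorff_on_distr[where g="\<lambda>y. y - x"] s) auto
  ultimately show ?thesis by simp
qed

lemma qmass_hausdorff_on_subspace:
  fixes V :: "'a::euclidean_space set"
  assumes s: "0 < s" and V: "subspace V" and x: "x \<in> V"
  shows "qmass (hausdorff_on s V) x r = qmass (hausdorff_on s V) 0 r"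
proof -
  have "qmass (hausdorff_on s V) x r = (LINT y|distr (hausdorff_on s V) borel ((+) x). (qk r (x - y))\<^sup>2)"
    unfolding qmass_def by (simp only: hausdorff_on_subspace_translate[OF s V x])
  also have "\<dots> = (LINT y|hausdorff_on s V. (qk r (x - (x + y)))\<^sup>2)"
    by (intro integral_distr) (auto intro!: borel_measurable_continuous_onI continuous_intros)
  finally show ?thesis by (simp add: qmass_def)
qed

text \<open>The uniqueness argument for uniformly distributed measures. Integrate f(z) q(z - y)^2 in
  both orders, q being \<open>qk r\<close>: the integral over y against \<nu> is c r^(m + 4) f(z) by
  homogeneity, and the integral over z against Hausdorff measure is close to
  \<open>A r * f y\<close>, where \<open>A r\<close> is the same for all y in V by translation
  invariance. As r tends to 0 this compares the two integrals of f.\<close>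

theorem homogeneous_measure_eq_hausdorff:
  fixes \<nu> :: "'a::euclidean_space measure"
  assumes lf: "locally_finite_borel_measure \<nu>" and V: "subspace V" "dim V = m" "0 < m"
    and S: "AE y in \<nu>. y \<in> V"
    and c: "\<And>z r. z \<in> V \<Longrightarrow> 0 < r \<Longrightarrow> qmass \<nu> z r = c * r ^ (m + 4)"
    and Hpos: "\<And>r. 0 < r \<Longrightarrow> 0 < qmass (hausdorff_on (real m) V) 0 r"
  shows "\<exists>\<kappa>. \<forall>f R. continuous_on UNIV f \<longrightarrow> (\<forall>y. R < norm y \<longrightarrow> f y = 0) \<longrightarrow>
           (LINT y|\<nu>. f y) = \<kappa> * (LINT y|hausdorff_on (real m) V. (f y :: real))"
proof -
  define H where "H = hausdorff_on (real m) V"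
  define A where "A r = qmass H 0 r" for r
  have lfH: "locally_finite_borel_measure H" unfolding H_def by (rule locally_finite_hausdorff_on_subspace[OF V])
  have Vb: "V \<in> sets borel" using closed_subspace[OF V(1)] by auto
  have HV: "AE y in H. y \<in> V" unfolding H_def by (rule AE_hausdorff_on[OF Vb])
  have Apos: "0 < A r" if "0 < r" for r using Hpos[OF that] by (simp add: A_def H_def)
  have qH: "(LINT z|H. (qk r (z - y))\<^sup>2) = A r" if "y \<in> V" for y r
  proof -
    have "(LINT z|H. (qk r (z - y))\<^sup>2) = qmass H y r" by (simp add: qmass_def qk_commute)
    then show ?thesis using qmass_hausdorff_on_subspace[OF _ V(1) that, of "real m"] V(3) by (simp add: A_def H_def)
  qed
  define t where "t r = c * r ^ (m + 4) / A r" for r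
  have lim: "((\<lambda>r. t r * (LINT y|H. f y)) \<longlongrightarrow> (LINT y|\<nu>. f y)) (at_right 0)"
    if f: "continuous_on UNIV f" and R: "\<And>y. R < norm y \<Longrightarrow> f y = 0" for f :: "'a \<Rightarrow> real" and R
  proof (rule tendstoI)
    fix e :: real assume e: "0 < e"
    define M where "M = measure \<nu> (cball 0 (\<bar>R\<bar> + 1)) + 1"
    have M: "0 < M" by (simp add: M_def add_nonneg_pos)
    have intf: "integrable \<nu> f" "integrable H f"
      using f R by (auto intro!: integrable_continuous_bounded_support[of _ _ 0 R] lf lfH)
    have "uniformly_continuous_on (cball 0 (\<bar>R\<bar> + 2)) f"
      using f by (intro compact_uniformly_continuous) (auto intro: continuous_on_subset)
    then obtain \<delta> where \<delta>: "0 < \<delta>" "\<And>x y. x \<in> cball 0 (\<bar>R\<bar> + 2) \<Longrightarrow> y \<in> cball 0 (\<bar>R\<bar> + 2) \<Longrightarrow> dist y x < \<delta> \<Longrightarrow> dist (f y) (f x) < e / (2 * M)"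
      unfolding uniformly_continuous_on_def using e M by (metis divide_pos_pos mult_pos_pos zero_less_numeral)
    obtain Kf where Kf: "\<And>y. \<bar>f y\<bar> \<le> Kf"
    proof -
      have "compact (f ` cball 0 \<bar>R\<bar>)" using f by (intro compact_continuous_image) (auto intro: continuous_on_subset)
      then obtain B where B: "\<And>y. y \<in> cball 0 \<bar>R\<bar> \<Longrightarrow> \<bar>f y\<bar> \<le> B"
        using compact_imp_bounded bounded_iff by (metis image_eqI real_norm_def)
      have "\<bar>f y\<bar> \<le> \<bar>B\<bar>" for y using B[of y] R[of y] by (cases "norm y \<le> \<bar>R\<bar>") auto
      then show thesis by (rule that)
    qed
    have near: "\<bar>f z - f y\<bar> \<le> e / (2 * M)" if zy: "norm (z - y) < \<delta>" "norm (z - y) < 1" for z y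
    proof (cases "norm y \<le> \<bar>R\<bar> + 1")
      case True
      then have "norm z \<le> \<bar>R\<bar> + 2" using norm_triangle_ineq[of y "z - y"] zy by simp
      then have "dist (f z) (f y) < e / (2 * M)" using True zy by (intro \<delta>(2)) (auto simp: dist_norm norm_minus_commute)
      then show ?thesis by (simp add: dist_norm)
    next
      case False
      then have "R < norm y" "R < norm z" using norm_triangle_ineq[of z "y - z"] zy by (auto simp: norm_minus_commute)
      then show ?thesis using R e M by simp
    qed
    show "\<forall>\<^sub>F r in at_right 0. dist (t r * (LINT y|H. f y)) (LINT y|\<nu>. f y) < e"
    proof (rule eventually_mono[OF eventually_at_right_real[of 0 "min \<delta> 1"]])
      show "0 < min \<delta> 1" using \<delta> by simp
      fix r assume "r \<in> {0<..<min \<delta> 1}"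
      then have r: "0 < r" "r < \<delta>" "r < 1" by auto
      define g where "g y = (LINT z|H. f z * (qk r (z - y))\<^sup>2)" for y
      have iq: "integrable H (\<lambda>z. (qk r (z - y))\<^sup>2)" for y
        using integrable_qk_power[OF lfH, of r 2 y] r by (simp add: qk_commute)
      have ifq: "integrable H (\<lambda>z. f z * (qk r (z - y))\<^sup>2)" for y
        using f R by (intro integrable_continuous_bounded_support[OF lfH, of _ 0 R] continuous_intros) auto
      have fm: "(\<lambda>(z, y). f z * (qk r (z - y))\<^sup>2) \<in> borel_measurable borel"
        by (intro borel_measurable_continuous_onI)
           (auto simp: case_prod_beta intro!: continuous_intros continuous_on_compose2[OF f])
      have fb: "norm (f z * (qk r (z - y))\<^sup>2) \<le> Kf * r ^ 4" for z y
      proof -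
        have "\<bar>f z\<bar> * (qk r (z - y))\<^sup>2 \<le> Kf * r ^ 4"
          using Kf[of z] qk2_le[of r "z - y"] by (intro mult_mono) auto
        then show ?thesis by (simp add: abs_mult)
      qed
      have fo: "f z * (qk r (z - y))\<^sup>2 = 0" if "z \<notin> cball 0 \<bar>R\<bar> \<or> y \<notin> cball 0 (\<bar>R\<bar> + 1)" for z y
      proof (cases "R < norm z")
        case False
        then have "r \<le> norm (z - y)" using that r norm_triangle_ineq[of z "y - z"] by (auto simp: norm_minus_commute)
        then show ?thesis using r by (simp add: qk_outside)
      qed (use R in auto)
      note fub = fubini_bounded_support[where A="cball 0 \<bar>R\<bar>" and B="cball 0 (\<bar>R\<bar> + 1)", OF lfH lf fm bounded_cball borel_closed[OF closed_cball] bounded_cball borel_closed[OF closed_cball] fb fo]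
      have "(LINT z|H. LINT y|\<nu>. f z * (qk r (z - y))\<^sup>2) = (LINT y|\<nu>. LINT z|H. f z * (qk r (z - y))\<^sup>2)"
        by (rule fub(1))
      also have "(LINT z|H. LINT y|\<nu>. f z * (qk r (z - y))\<^sup>2) = (LINT z|H. f z * (c * r ^ (m + 4)))"
      proof (rule integral_cong_AE)
        show "AE z in H. (LINT y|\<nu>. f z * (qk r (z - y))\<^sup>2) = f z * (c * r ^ (m + 4))"
          using HV
        proof eventually_elim
          case (elim z)
          then show ?case using c[OF elim r(1)] by (simp add: qmass_def)
        qed
        show "(\<lambda>z. LINT y|\<nu>. f z * (qk r (z - y))\<^sup>2) \<in> borel_measurable H"
          using fub(2) by (rule borel_measurable_integrable)
      qed (use intf in auto)
      also have "\<dots> = c * r ^ (m + 4) * (LINT z|H. f z)" by simp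
      finally have eq: "c * r ^ (m + 4) * (LINT z|H. f z) = (LINT y|\<nu>. g y)" by (simp add: g_def)
      have gd: "\<bar>g y - A r * f y\<bar> \<le> e / (2 * M) * A r" if y: "y \<in> V" for y
      proof -
        have "g y - A r * f y = (LINT z|H. f z * (qk r (z - y))\<^sup>2) - (LINT z|H. f y * (qk r (z - y))\<^sup>2)"
          using qH[OF y, of r] by (simp add: g_def)
        also have "\<dots> = (LINT z|H. (f z - f y) * (qk r (z - y))\<^sup>2)"
          using ifq iq by (subst Bochner_Integration.integral_diff[symmetric]) (auto simp: algebra_simps)
        also have "norm \<dots> \<le> (LINT z|H. norm ((f z - f y) * (qk r (z - y))\<^sup>2))" by (rule integral_norm_bound)
        also have "\<dots> \<le> (LINT z|H. e / (2 * M) * (qk r (z - y))\<^sup>2)"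
        proof (rule integral_mono)
          show "integrable H (\<lambda>z. norm ((f z - f y) * (qk r (z - y))\<^sup>2))"
            using ifq[of y] iq[of y] by (intro integrable_norm) (simp add: left_diff_distrib)
          fix z
          show "norm ((f z - f y) * (qk r (z - y))\<^sup>2) \<le> e / (2 * M) * (qk r (z - y))\<^sup>2"
          proof (cases "norm (z - y) < r")
            case True
            then have "\<bar>f z - f y\<bar> * (qk r (z - y))\<^sup>2 \<le> e / (2 * M) * (qk r (z - y))\<^sup>2"
              using near[of z y] r by (intro mult_right_mono) auto
            then show ?thesis by (simp add: abs_mult)
          qed (use r in \<open>auto simp: qk_outside\<close>)
        qed (use iq in auto)
        also have "\<dots> = e / (2 * M) * A r" using qH[OF y, of r] by simp
        finally show ?thesis by simp
      qed
      have g0: "g y = 0 \<and> f y = 0" if "y \<notin> cball 0 (\<bar>R\<bar> + 1)" for y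
      proof -
        have z: "f z * (qk r (z - y))\<^sup>2 = 0" for z
        proof (cases "R < norm z")
          case False
          then have "r \<le> norm (z - y)" using that r norm_triangle_ineq[of z "y - z"] by (auto simp: norm_minus_commute)
          then show ?thesis using r by (simp add: qk_outside)
        qed (use R in auto)
        have "g y = 0" unfolding g_def z by simp
        then show ?thesis using that R[of y] by auto
      qed
      have "\<bar>(LINT y|\<nu>. g y) - A r * (LINT y|\<nu>. f y)\<bar> \<le> e / (2 * M) * A r * measure \<nu> (cball 0 (\<bar>R\<bar> + 1))"
      proof -
        have ig: "integrable \<nu> g" using fub(3) by (simp add: g_def[abs_def])
        have iA: "integrable \<nu> (\<lambda>y. A r * f y)" using intf by simp
        have sb: "sets \<nu> = sets borel" using lf by (rule locally_finite_sets)
        have fin: "emeasure \<nu> (cball 0 (\<bar>R\<bar> + 1)) < \<infinity>" using emeasure_bounded_finite[OF lf bounded_cball] .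
        have "(LINT y|\<nu>. g y) - A r * (LINT y|\<nu>. f y) = (LINT y|\<nu>. g y - A r * f y)"
          using ig iA by simp
        also have "norm \<dots> \<le> (LINT y|\<nu>. norm (g y - A r * f y))" by (rule integral_norm_bound)
        also have "\<dots> \<le> (LINT y|\<nu>. indicat_real (cball 0 (\<bar>R\<bar> + 1)) y * (e / (2 * M) * A r))"
        proof (rule integral_mono_AE)
          show "integrable \<nu> (\<lambda>y. norm (g y - A r * f y))" using ig iA by (intro integrable_norm) simp
          show "integrable \<nu> (\<lambda>y. indicat_real (cball 0 (\<bar>R\<bar> + 1)) y * (e / (2 * M) * A r))"
            using fin sb by (intro integrable_mult_left integrable_real_indicator) auto
          show "AE y in \<nu>. norm (g y - A r * f y) \<le> indicat_real (cball 0 (\<bar>R\<bar> + 1)) y * (e / (2 * M) * A r)"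
            using S
          proof eventually_elim
            case (elim y)
            then show ?case using gd[OF elim] g0[of y] by (cases "y \<in> cball 0 (\<bar>R\<bar> + 1)") auto
          qed
        qed
        also have "\<dots> = e / (2 * M) * A r * measure \<nu> (cball 0 (\<bar>R\<bar> + 1))"
          using sb sets_eq_imp_space_eq[OF sb] by simp
        finally show ?thesis by simp
      qed
      also have "\<dots> \<le> e / (2 * M) * A r * M"
        using e M Apos[OF r(1)] by (intro mult_left_mono) (auto simp: M_def)
      finally have "\<bar>c * r ^ (m + 4) * (LINT z|H. f z) - A r * (LINT y|\<nu>. f y)\<bar> \<le> e / 2 * A r"
        using M by (simp add: eq)
      then have "\<bar>c * r ^ (m + 4) * (LINT z|H. f z) - A r * (LINT y|\<nu>. f y)\<bar> / A r \<le> e / 2"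
        using Apos[OF r(1)] by (simp add: pos_divide_le_eq)
      moreover have "t r * (LINT y|H. f y) - (LINT y|\<nu>. f y) = (c * r ^ (m + 4) * (LINT z|H. f z) - A r * (LINT y|\<nu>. f y)) / A r"
        using Apos[OF r(1)] by (simp add: t_def field_simps)
      ultimately have "\<bar>t r * (LINT y|H. f y) - (LINT y|\<nu>. f y)\<bar> \<le> e / 2"
        using Apos[OF r(1)] by (simp add: abs_divide)
      then show "dist (t r * (LINT y|H. f y)) (LINT y|\<nu>. f y) < e"
        using e by (simp add: dist_real_def)
    qed
  qed
  \<comment> \<open>Convergence of the factor \<open>t r\<close> is not known beforehand; one test
    function with positive Hausdorff integral provides it, and the limit \<kappa> then serves for
    every f.\<close>
  define f0 where "f0 y = (qk 1 (0 - y))\<^sup>2" for y :: 'a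
  have f0: "continuous_on UNIV f0" "\<And>y. 1 < norm y \<Longrightarrow> f0 y = 0"
    unfolding f0_def by (auto intro!: continuous_intros simp: qk_outside)
  have I0: "0 < (LINT y|H. f0 y)" using Apos[of 1] by (simp add: A_def qmass_def f0_def)
  define \<kappa> where "\<kappa> = (LINT y|\<nu>. f0 y) / (LINT y|H. f0 y)"
  have "((\<lambda>r. t r * (LINT y|H. f0 y) / (LINT y|H. f0 y)) \<longlongrightarrow> \<kappa>) (at_right 0)"
    unfolding \<kappa>_def using I0 by (intro tendsto_divide lim[OF f0] tendsto_const) auto
  then have t: "(t \<longlongrightarrow> \<kappa>) (at_right 0)" using I0 by simp
  have "(LINT y|\<nu>. f y) = \<kappa> * (LINT y|H. f y)"
    if f: "continuous_on UNIV f" "\<And>y. R < norm y \<Longrightarrow> f y = 0" for f :: "'a \<Rightarrow> real" and R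
  proof (rule tendsto_unique[OF _ lim[OF f]])
    show "((\<lambda>r. t r * (LINT y|H. f y)) \<longlongrightarrow> \<kappa> * (LINT y|H. f y)) (at_right 0)"
      by (intro tendsto_mult t tendsto_const)
  qed auto
  then show ?thesis unfolding H_def by blast
qed

theorem symmetric_measure_flat:
  fixes \<nu> :: "'a::euclidean_space measure"
  assumes reg: "upper_regular \<nu> s C" and s: "0 < s"
    and sym0: "\<And>r. 0 < r \<Longrightarrow> sym_moment \<nu> 0 r = 0"
    and symS: "\<And>z r. z \<in> measure_support \<nu> \<Longrightarrow> 0 < r \<Longrightarrow> sym_moment \<nu> z r = 0"
    and ne: "measure_support \<nu> \<noteq> {}"
  shows "\<exists>V \<kappa>. subspace V \<and> real (dim V) = s \<and> 0 < measure (hausdorff_on s V) (cball 0 1) \<and>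
    (\<forall>f R. continuous_on UNIV f \<longrightarrow> (\<forall>y. R < norm y \<longrightarrow> f y = 0) \<longrightarrow>
       (LINT y|\<nu>. f y) = \<kappa> * (LINT y|hausdorff_on s V. (f y :: real)))"
proof -
  let ?S = "measure_support \<nu>"
  define V where "V = span ?S"
  define m where "m = dim ?S"
  have sm: "s = real m" using dim_measure_support_eq[OF reg s sym0 symS ne] by (simp add: m_def)
  have V: "subspace V" "dim V = m" "0 < m" using s sm by (auto simp: V_def m_def dim_span)
  have reg': "upper_regular \<nu> (real m) C" using reg sm by simp
  have lf: "locally_finite_borel_measure \<nu>" using reg by (rule upper_regular_locally_finite)
  have sb: "sets \<nu> = sets borel" using reg by (rule upper_regular_sets)
  have SV: "?S \<subseteq> V" by (auto simp: V_def span_base)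
  have Vb: "V \<in> sets borel" using closed_subspace[OF V(1)] by auto
  obtain c where c: "0 < c" "\<And>z r. z \<in> ?S \<Longrightarrow> 0 < r \<Longrightarrow> qmass \<nu> z r = c * r ^ (m + 4)"
    using qmass_homogeneous_on_support[OF reg' V SV symS ne] by blast
  have S: "?S = V" by (rule measure_support_eq_subspace[OF reg' V(1,2) SV symS ne c])
  define H where "H = hausdorff_on (real m) V"
  have lfH: "locally_finite_borel_measure H" unfolding H_def by (rule locally_finite_hausdorff_on_subspace[OF V])
  \<comment> \<open>That Hausdorff measure charges V is read off from \<nu>: a ball that is null on
    V would be null for \<nu> by the mass distribution principle, but 0 lies in the support.\<close>
  have Hball: "0 < measure H (cball 0 r)" if r: "0 < r" for r
  proof -
    have "0 \<in> ?S" using S V(1) subspace_0 by simp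
    then have "0 < emeasure \<nu> (ball 0 r)" using r by (simp add: measure_support_def)
    also have "\<dots> = emeasure \<nu> (V \<inter> ball 0 r)" using emeasure_support_Int[OF sb, of "ball 0 r"] S by simp
    also have "\<dots> \<le> ennreal (C * 4 powr real m / unit_ball_vol (real m)) * hausdorff_outer (real m) (V \<inter> ball 0 r)"
      using reg' emeasure_ball_le_upper_regular[OF reg'] V sb Vb
      by (intro measure_le_hausdorff_outer[where \<delta>=1]) (auto simp: upper_regular_def)
    also have "hausdorff_outer (real m) (V \<inter> ball 0 r) = emeasure H (ball 0 r)"
      using Vb by (simp add: H_def emeasure_hausdorff_on)
    finally have "emeasure H (ball 0 r) \<noteq> 0" by (intro notI) simp
    moreover have "emeasure H (ball 0 r) \<le> emeasure H (cball 0 r)" by (intro emeasure_mono) (auto simp: H_def)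
    ultimately have "0 < emeasure H (cball 0 r)" using zero_less_iff_neq_zero by fastforce
    then show ?thesis using emeasure_bounded_finite[OF lfH bounded_cball, of 0 r]
      by (simp add: measure_def enn2real_positive_iff)
  qed
  have Hpos: "0 < qmass (hausdorff_on (real m) V) 0 r" if r: "0 < r" for r
  proof -
    have "0 < 9 * (r / 2) ^ 4 * measure H (cball 0 (r / 2))" using Hball[of "r / 2"] r by simp
    also have "\<dots> \<le> qmass H 0 (2 * (r / 2))" using r by (intro qmass_ge lfH) auto
    finally show ?thesis by (simp add: H_def)
  qed
  have AE: "AE y in \<nu>. y \<in> V" using AE_measure_support[OF sb] S by simp
  have "\<exists>\<kappa>. \<forall>f R. continuous_on UNIV f \<longrightarrow> (\<forall>y. R < norm y \<longrightarrow> f y = 0) \<longrightarrow>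
           (LINT y|\<nu>. f y) = \<kappa> * (LINT y|hausdorff_on (real m) V. (f y :: real))"
    using c(2) S by (intro homogeneous_measure_eq_hausdorff[OF lf V AE _ Hpos]) auto
  then show ?thesis
    using V sm Hball[of 1] by (auto simp: H_def)
qed

section \<open>Vague compactness\<close>

text \<open>Schoenberg's space-filling curve: coordinate \<open>i\<close> reads off the ternary digits of the
  parameter in the places congruent to \<open>i\<close> modulo the dimension.\<close>

definition schoenberg_step :: "real \<Rightarrow> real" where
  "schoenberg_step t = max 0 (min 1 (1 / 2 - cos (pi * t)))"

lemma schoenberg_step_range: "0 \<le> schoenberg_step t" "schoenberg_step t \<le> 1"
  by (auto simp: schoenberg_step_def)

lemma schoenberg_step_periodic: "schoenberg_step (2 * of_int n + t) = schoenberg_step t"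
proof -
  have "pi * (2 * of_int n + t) = pi * t + (2 * pi) * of_int n" by (simp add: algebra_simps)
  then have "cos (pi * (2 * of_int n + t)) = cos (pi * t)" by (simp add: cos_add cos_int_2pin sin_int_2pin)
  then show ?thesis by (simp add: schoenberg_step_def)
qed

lemma schoenberg_step_0: "0 \<le> t \<Longrightarrow> t \<le> 1 / 3 \<Longrightarrow> schoenberg_step t = 0"
proof -
  assume t: "0 \<le> t" "t \<le> 1 / 3"
  have "pi * t \<le> pi * (1 / 3)" using t by (intro mult_left_mono) auto
  then have "cos (pi / 3) \<le> cos (pi * t)" using t by (intro cos_monotone_0_pi_le) auto
  then show ?thesis by (simp add: schoenberg_step_def cos_60)
qed

lemma schoenberg_step_1: "2 / 3 \<le> t \<Longrightarrow> t \<le> 1 \<Longrightarrow> schoenberg_step t = 1"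
proof -
  assume t: "2 / 3 \<le> t" "t \<le> 1"
  have "pi * t \<le> pi * 1" "pi * (2 / 3) \<le> pi * t" using t by (intro mult_left_mono; simp)+
  then have "cos (pi * t) \<le> cos (2 * pi / 3)" by (intro cos_monotone_0_pi_le) auto
  then show ?thesis by (simp add: schoenberg_step_def cos_120)
qed

text \<open>With ternary digits 0 and 2 only, 3^n t is an even integer plus a tail in [0, 1/3] or
  [2/3, 1] according to the digit in place n. Period 2 discards the integer, and
  \<open>schoenberg_step\<close> is constant on both intervals.\<close>

lemma schoenberg_digits:
  fixes a :: "nat \<Rightarrow> bool"
  shows "\<exists>t\<in>{0..1}. \<forall>n. schoenberg_step (3 ^ n * t) = of_bool (a n)"
proof -
  define \<tau> where "\<tau> n = (\<Sum>j. 2 * of_bool (a (n + j)) * (1 / 3) ^ Suc j :: real)" for n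
  have sm: "summable (\<lambda>j. 2 * of_bool (a (n + j)) * (1 / 3) ^ Suc j :: real)" for n
  proof (rule summable_comparison_test'[of _ 0])
    show "summable (\<lambda>j. 2 * (1 / 3) ^ Suc j :: real)" by (intro summable_mult) (simp add: summable_geometric)
    show "norm (2 * of_bool (a (n + j)) * (1 / 3) ^ Suc j :: real) \<le> 2 * (1 / 3) ^ Suc j" for j by (cases "a (n + j)") auto
  qed
  have s3: "(\<Sum>j. 2 * (1 / 3) ^ Suc j :: real) = 1"
    using sums_unique[OF sums_mult[OF geometric_sums[of "1 / 3 :: real"], of "2 / 3"]] by simp
  have \<tau>01: "0 \<le> \<tau> n" "\<tau> n \<le> 1" for n
  proof -
    show "0 \<le> \<tau> n" unfolding \<tau>_def by (intro suminf_nonneg sm) auto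
    have "\<tau> n \<le> (\<Sum>j. 2 * (1 / 3) ^ Suc j)" unfolding \<tau>_def
      by (intro suminf_le sm summable_mult) (simp_all add: summable_geometric)
    then show "\<tau> n \<le> 1" by (simp only: s3)
  qed
  have step: "3 * \<tau> n = 2 * of_bool (a n) + \<tau> (Suc n)" for n
  proof -
    have "\<tau> n = 2 * of_bool (a (n + 0)) * (1 / 3) ^ Suc 0 + (\<Sum>j. 2 * of_bool (a (n + Suc j)) * (1 / 3) ^ Suc (Suc j))"
      unfolding \<tau>_def using suminf_split_head[OF sm, of n] by simp
    also have "(\<Sum>j. 2 * of_bool (a (n + Suc j)) * (1 / 3) ^ Suc (Suc j) :: real) = (1 / 3) * \<tau> (Suc n)"
      unfolding \<tau>_def by (subst suminf_mult[symmetric, OF sm]) (simp add: mult_ac)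
    finally show ?thesis by simp
  qed
  have even: "\<exists>N. 3 ^ n * \<tau> 0 = 2 * of_int N + \<tau> n" for n
  proof (induction n)
    case 0
    show ?case by (intro exI[of _ 0]) simp
  next
    case (Suc n)
    then obtain N where N: "3 ^ n * \<tau> 0 = 2 * of_int N + \<tau> n" by blast
    have "3 ^ Suc n * \<tau> 0 = 2 * of_int (3 * N + of_bool (a n)) + \<tau> (Suc n)"
      using N step[of n] by simp
    then show ?case by blast
  qed
  have "schoenberg_step (3 ^ n * \<tau> 0) = of_bool (a n)" for n
  proof -
    obtain N where N: "3 ^ n * \<tau> 0 = 2 * of_int N + \<tau> n" using even by blast
    have "schoenberg_step (\<tau> n) = of_bool (a n)"
      using step[of n] \<tau>01[of "Suc n"] by (cases "a n") (auto intro!: schoenberg_step_0 schoenberg_step_1)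
    then show ?thesis unfolding N schoenberg_step_periodic .
  qed
  then show ?thesis using \<tau>01[of 0] by (intro bexI[of _ "\<tau> 0"]) auto
qed

text \<open>The digit in place k is the parity of the floor of 2^(k + 1) u, so the partial sums are
  the dyadic truncations of u.\<close>

lemma binary_expansion:
  fixes u :: real
  assumes "0 \<le> u" "u < 1"
  shows "\<exists>a. (\<lambda>k. of_bool (a k) * (1 / 2) ^ Suc k) sums u"
proof -
  define a where "a k \<longleftrightarrow> odd \<lfloor>2 ^ Suc k * u\<rfloor>" for k :: nat
  have fl: "\<lfloor>2 * x\<rfloor> = 2 * \<lfloor>x\<rfloor> + of_bool (odd \<lfloor>2 * x\<rfloor>)" for x :: real
  proof -
    have "\<lfloor>2 * x\<rfloor> = 2 * \<lfloor>x\<rfloor> \<or> \<lfloor>2 * x\<rfloor> = 2 * \<lfloor>x\<rfloor> + 1" by linarith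
    then show ?thesis by auto
  qed
  have part: "(\<Sum>k<n. of_bool (a k) * (1 / 2) ^ Suc k :: real) = of_int \<lfloor>2 ^ n * u\<rfloor> * (1 / 2) ^ n" for n
  proof (induction n)
    case 0
    have "\<lfloor>u\<rfloor> = 0" using assms by linarith
    then show ?case by simp
  next
    case (Suc n)
    have "\<lfloor>2 ^ Suc n * u\<rfloor> = 2 * \<lfloor>2 ^ n * u\<rfloor> + of_bool (a n)"
      using fl[of "2 ^ n * u"] by (simp add: a_def mult.assoc)
    then have "of_int \<lfloor>2 ^ Suc n * u\<rfloor> * (1 / 2) ^ Suc n = (2 * of_int \<lfloor>2 ^ n * u\<rfloor> + of_bool (a n)) * (1 / 2 :: real) ^ Suc n"
      by simp
    then show ?case using Suc by (simp add: algebra_simps)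
  qed
  have "(\<lambda>n. of_int \<lfloor>2 ^ n * u\<rfloor> * (1 / 2) ^ n) \<longlonglongrightarrow> u"
  proof (rule tendsto_sandwich)
    have pw: "(2::real) ^ n * (1 / 2) ^ n = 1" for n by (simp add: power_one_over)
    show "\<forall>\<^sub>F n in sequentially. u - (1 / 2) ^ n \<le> of_int \<lfloor>2 ^ n * u\<rfloor> * (1 / 2) ^ n"
    proof (rule always_eventually, rule allI)
      fix n :: nat
      have "(2 ^ n * u - 1) * (1 / 2) ^ n \<le> of_int \<lfloor>2 ^ n * u\<rfloor> * (1 / 2) ^ n" by (intro mult_right_mono) (linarith, simp)
      moreover have "(2 ^ n * u - 1) * (1 / 2) ^ n = u * (2 ^ n * (1 / 2) ^ n) - (1 / 2) ^ n" by (simp add: algebra_simps)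
      ultimately show "u - (1 / 2) ^ n \<le> of_int \<lfloor>2 ^ n * u\<rfloor> * (1 / 2) ^ n" by (simp only: pw mult_1_right)
    qed
    show "\<forall>\<^sub>F n in sequentially. of_int \<lfloor>2 ^ n * u\<rfloor> * (1 / 2) ^ n \<le> u"
    proof (rule always_eventually, rule allI)
      fix n :: nat
      have "of_int \<lfloor>2 ^ n * u\<rfloor> * (1 / 2) ^ n \<le> (2 ^ n * u) * (1 / 2) ^ n" by (intro mult_right_mono) (linarith, simp)
      moreover have "(2 ^ n * u) * (1 / 2) ^ n = u * (2 ^ n * (1 / 2) ^ n)" by (simp add: mult_ac)
      ultimately show "of_int \<lfloor>2 ^ n * u\<rfloor> * (1 / 2) ^ n \<le> u" by (simp only: pw mult_1_right)
    qed
    show "(\<lambda>n. u - (1 / 2) ^ n) \<longlonglongrightarrow> u"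
      using tendsto_diff[OF tendsto_const LIMSEQ_realpow_zero[of "1 / 2 :: real"]] by simp
  qed simp
  then have "(\<lambda>k. of_bool (a k) * (1 / 2) ^ Suc k) sums u" unfolding sums_def part .
  then show ?thesis by blast
qed

definition schoenberg_coord :: "nat \<Rightarrow> nat \<Rightarrow> real \<Rightarrow> real" where
  "schoenberg_coord d i t = (\<Sum>k. schoenberg_step (3 ^ (d * k + i) * t) * (1 / 2) ^ Suc k)"

lemma continuous_on_schoenberg_coord: "continuous_on UNIV (schoenberg_coord d i)"
proof -
  have "uniform_limit UNIV (\<lambda>n t. \<Sum>k<n. schoenberg_step (3 ^ (d * k + i) * t) * (1 / 2) ^ Suc k)
     (\<lambda>t. \<Sum>k. schoenberg_step (3 ^ (d * k + i) * t) * (1 / 2) ^ Suc k) sequentially"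
  proof (rule Weierstrass_m_test)
    show "norm (schoenberg_step (3 ^ (d * n + i) * t) * (1 / 2) ^ Suc n) \<le> (1 / 2) ^ Suc n" for n t
    proof -
      have "schoenberg_step (3 ^ (d * n + i) * t) * (1 / 2) ^ Suc n \<le> 1 * (1 / 2) ^ Suc n"
        using schoenberg_step_range by (intro mult_right_mono) auto
      then show ?thesis using schoenberg_step_range(1) by (simp add: abs_mult)
    qed
    show "summable (\<lambda>n. (1 / 2 :: real) ^ Suc n)" by (simp add: summable_geometric)
  qed
  then have "continuous_on UNIV (\<lambda>t. \<Sum>k. schoenberg_step (3 ^ (d * k + i) * t) * (1 / 2) ^ Suc k)"
  proof (rule uniform_limit_theorem[rotated])
    show "\<forall>\<^sub>F n in sequentially. continuous_on UNIV (\<lambda>t. \<Sum>k<n. schoenberg_step (3 ^ (d * k + i) * t) * (1 / 2) ^ Suc k)"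
      unfolding schoenberg_step_def by (intro always_eventually allI continuous_intros)
  qed auto
  then show ?thesis by (simp add: schoenberg_coord_def[abs_def])
qed

theorem space_filling_curve:
  "\<exists>\<kappa>::real \<Rightarrow> 'a::euclidean_space. continuous_on UNIV \<kappa> \<and> ball 0 1 \<subseteq> \<kappa> ` {0..1}"
proof -
  define d where "d = DIM('a)"
  obtain idx :: "'a \<Rightarrow> nat" where idx: "bij_betw idx Basis {0..<d}"
    using ex_bij_betw_finite_nat[OF finite_Basis] unfolding d_def by blast
  define \<kappa> :: "real \<Rightarrow> 'a" where "\<kappa> t = (\<Sum>b\<in>Basis. (2 * schoenberg_coord d (idx b) t - 1) *\<^sub>R b)" for t
  have "continuous_on UNIV \<kappa>"
    unfolding \<kappa>_def[abs_def] by (intro continuous_intros continuous_on_schoenberg_coord)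
  moreover have "x \<in> \<kappa> ` {0..1}" if x: "x \<in> ball 0 1" for x
  proof -
    have xb: "\<bar>x \<bullet> b\<bar> < 1" if "b \<in> Basis" for b
      using Basis_le_norm[OF that, of x] x by simp
    have "\<forall>b\<in>Basis. \<exists>a. (\<lambda>k. of_bool (a k) * (1 / 2) ^ Suc k) sums ((x \<bullet> b + 1) / 2)"
    proof
      fix b :: 'a assume "b \<in> Basis"
      then have "- 1 < x \<bullet> b" "x \<bullet> b < 1" using xb by (auto simp: abs_less_iff)
      then show "\<exists>a. (\<lambda>k. of_bool (a k) * (1 / 2) ^ Suc k) sums ((x \<bullet> b + 1) / 2)"
        by (intro binary_expansion) auto
    qed
    then obtain a where a: "\<And>b. b \<in> Basis \<Longrightarrow> (\<lambda>k. of_bool (a b k) * (1 / 2) ^ Suc k) sums ((x \<bullet> b + 1) / 2)"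
      by metis
    \<comment> \<open>Interleaves the binary digits of all coordinates into the one sequence that
      determines t.\<close>
    define A where "A n = a (inv_into Basis idx (n mod d)) (n div d)" for n
    obtain t where t: "t \<in> {0..1}" "\<And>n. schoenberg_step (3 ^ n * t) = of_bool (A n)"
      using schoenberg_digits[of A] by blast
    have "schoenberg_coord d (idx b) t = (x \<bullet> b + 1) / 2" if b: "b \<in> Basis" for b
    proof -
      have ib: "idx b < d" using idx b by (auto simp: bij_betw_def)
      have "inv_into Basis idx (idx b) = b" using idx b by (auto simp: bij_betw_def)
      then have "A (d * k + idx b) = a b k" for k using ib by (simp add: A_def)
      then show ?thesis unfolding schoenberg_coord_def t(2) using a[OF b] by (simp add: sums_iff)
    qed
    then have "\<kappa> t = (\<Sum>b\<in>Basis. (x \<bullet> b) *\<^sub>R b)" unfolding \<kappa>_def by (intro sum.cong) (auto simp: field_simps)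
    then show ?thesis using t(1) euclidean_representation[of x] by (intro image_eqI[of _ _ t]) auto
  qed
  ultimately show ?thesis by blast
qed

section \<open>Vague compactness through Helly's theorem on the line\<close>

definition cont_compact :: "('a::euclidean_space \<Rightarrow> 'b::real_normed_vector) \<Rightarrow> bool" where
  "cont_compact f \<longleftrightarrow> continuous_on UNIV f \<and> (\<exists>R. \<forall>y. R < norm y \<longrightarrow> f y = 0)"

text \<open>Takes the first parameter at which the curve visits u. The sublevel sets are images of
  compact intervals, together with the complement of the curve, where the value is 0.\<close>

lemma measurable_section:
  fixes \<kappa> :: "real \<Rightarrow> 'a::euclidean_space"
  assumes \<kappa>: "continuous_on UNIV \<kappa>"
  shows "\<exists>\<iota>\<in>borel_measurable borel. range \<iota> \<subseteq> {0..1} \<and> (\<forall>u\<in>\<kappa> ` {0..1}. \<kappa> (\<iota> u) = u)"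
proof -
  define K where "K = \<kappa> ` {0..1}"
  define \<iota> where "\<iota> u = (if u \<in> K then Inf ({0..1} \<inter> \<kappa> -` {u}) else 0)" for u
  have \<kappa>i: "continuous_on X \<kappa>" for X by (rule continuous_on_subset[OF \<kappa>]) auto
  have att: "\<iota> u \<in> {0..1} \<inter> \<kappa> -` {u}" "\<And>t. t \<in> {0..1} \<Longrightarrow> \<kappa> t = u \<Longrightarrow> \<iota> u \<le> t" if u: "u \<in> K" for u
  proof -
    let ?F = "{0..1} \<inter> \<kappa> -` {u}"
    have cl: "closed ?F" by (intro continuous_closed_preimage \<kappa>i) auto
    have ne: "?F \<noteq> {}" using u by (auto simp: K_def)
    have bb: "bdd_below ?F" by (rule bdd_belowI[of _ 0]) auto
    have "Inf ?F \<in> ?F" by (rule closed_contains_Inf[OF ne bb cl])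
    then show "\<iota> u \<in> ?F" using u by (simp add: \<iota>_def)
    show "\<iota> u \<le> t" if "t \<in> {0..1}" "\<kappa> t = u" for t
    proof -
      have "Inf ?F \<le> t" using that bb by (intro cInf_lower) auto
      then show ?thesis using u by (simp add: \<iota>_def)
    qed
  qed
  have out: "\<iota> u = 0" if "u \<notin> K" for u using that by (simp add: \<iota>_def)
  have \<iota>01: "\<iota> u \<in> {0..1}" for u using att(1)[of u] out[of u] by (cases "u \<in> K") auto
  have "\<iota> \<in> borel_measurable borel"
    unfolding borel_measurable_iff_le
  proof
    fix a
    have K: "K \<in> sets borel" unfolding K_def by (intro borel_compact compact_continuous_image \<kappa>i) auto
    have Ka: "\<kappa> ` {0..min a 1} \<in> sets borel" by (intro borel_compact compact_continuous_image \<kappa>i) auto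
    have "{w. \<iota> w \<le> a} = (if a < 0 then {} else \<kappa> ` {0..min a 1} \<union> - K)"
    proof (cases "a < 0")
      case True
      have "\<not> \<iota> w \<le> a" for w using \<iota>01[of w] True by auto
      then show ?thesis using True by simp
    next
      case False
      have "\<iota> w \<le> a \<longleftrightarrow> w \<in> \<kappa> ` {0..min a 1}" if w: "w \<in> K" for w
      proof
        assume "\<iota> w \<le> a"
        then show "w \<in> \<kappa> ` {0..min a 1}" using att(1)[OF w] by (intro image_eqI[of _ _ "\<iota> w"]) auto
      next
        assume "w \<in> \<kappa> ` {0..min a 1}"
        then obtain t where "t \<in> {0..min a 1}" "w = \<kappa> t" by blast
        then show "\<iota> w \<le> a" using att(2)[OF w, of t] by auto
      qed
      moreover have "\<kappa> ` {0..min a 1} \<subseteq> K" by (auto simp: K_def)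
      moreover have "\<iota> w \<le> a" if "w \<notin> K" for w using out[OF that] False by simp
      ultimately have "w \<in> {w. \<iota> w \<le> a} \<longleftrightarrow> w \<in> \<kappa> ` {0..min a 1} \<union> - K" for w by blast
      then show ?thesis using False by (simp only: if_False set_eq_iff) blast
    qed
    then show "{w \<in> space borel. \<iota> w \<le> a} \<in> sets borel" using K Ka by (simp add: borel_comp)
  qed
  moreover have "range \<iota> \<subseteq> {0..1}" using \<iota>01 by blast
  moreover have "\<forall>u\<in>\<kappa> ` {0..1}. \<kappa> (\<iota> u) = u" using att(1) by (auto simp: K_def)
  ultimately show ?thesis by blast
qed

text \<open>Space is compressed into the unit ball by h and lifted to [0, 1] by the section, where
  tightness is automatic and Helly's theorem applies. The section is merely measurable, but weak
  convergence is tested only on f composed with \<open>hinv\<close> and \<kappa>, which extends to a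
  continuous function on the line; composing further with the section and h gives back f.\<close>

lemma vague_compactness_prob:
  fixes \<theta> :: "nat \<Rightarrow> 'a::euclidean_space measure" and \<kappa> :: "real \<Rightarrow> 'a"
  assumes \<kappa>: "continuous_on UNIV \<kappa>" "ball 0 1 \<subseteq> \<kappa> ` {0..1}"
    and \<theta>: "\<And>n. prob_space (\<theta> n)" "\<And>n. sets (\<theta> n) = sets borel"
  shows "\<exists>r \<Theta>. strict_mono r \<and> sets \<Theta> = sets borel \<and> emeasure \<Theta> UNIV < \<infinity> \<and>
    (\<forall>f :: 'a \<Rightarrow> real. cont_compact f \<longrightarrow> (\<lambda>n. LINT y|\<theta> (r n). f y) \<longlonglongrightarrow> (LINT y|\<Theta>. f y))"
proof -
  obtain \<iota> where \<iota>[measurable]: "\<iota> \<in> borel_measurable borel" and \<iota>01: "\<And>u. \<iota> u \<in> {0..1}"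
    and \<kappa>\<iota>: "\<And>u. u \<in> \<kappa> ` {0..1} \<Longrightarrow> \<kappa> (\<iota> u) = u"
    using measurable_section[OF \<kappa>(1)] by blast
  have [measurable]: "\<kappa> \<in> borel_measurable borel" using \<kappa>(1) by (rule borel_measurable_continuous_onI)
  define h where "h y = y /\<^sub>R (1 + norm y)" for y :: 'a
  define hinv where "hinv u = u /\<^sub>R (1 - norm u)" for u :: 'a
  have [measurable]: "h \<in> borel_measurable borel" "hinv \<in> borel_measurable borel"
    unfolding h_def[abs_def] hinv_def[abs_def] by measurable
  have np: "0 < 1 + norm y" for y :: 'a by (simp add: add_pos_nonneg)
  have nh: "norm (h y) = norm y / (1 + norm y)" for y using np[of y] by (simp add: h_def divide_inverse mult.commute)
  have hb: "norm (h y) < 1" for y using np[of y] by (simp add: nh)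
  have hh: "hinv (h y) = y" for y
  proof -
    have "1 - norm (h y) = 1 / (1 + norm y)" using np[of y] by (simp add: nh field_simps)
    then have "hinv (h y) = (1 + norm y) *\<^sub>R h y" by (simp add: hinv_def)
    then show ?thesis using np[of y] by (simp add: h_def)
  qed
  define \<pi> where "\<pi> n = distr (\<theta> n) borel (\<lambda>y. \<iota> (h y))" for n
  have mh: "(\<lambda>y. \<iota> (h y)) \<in> borel_measurable (\<theta> n)" for n
  proof -
    have "(\<lambda>y. \<iota> (h y)) \<in> borel_measurable borel" by measurable
    then show ?thesis using measurable_cong_sets[OF \<theta>(2) refl] by blast
  qed
  have rd: "real_distribution (\<pi> n)" for n
    unfolding \<pi>_def using mh by (intro prob_space.real_distribution_distr \<theta>)
  have "tight \<pi>"
    unfolding tight_def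
  proof (intro conjI allI impI rd)
    fix \<epsilon> :: real assume \<epsilon>: "0 < \<epsilon>"
    have "measure (\<pi> n) {-1<..1} = 1" for n
    proof -
      interpret real_distribution "\<pi> n" by (rule rd)
      have "AE t in \<pi> n. t \<in> {-1<..1}"
        unfolding \<pi>_def
      proof (subst AE_distr_iff[OF mh])
        have "\<iota> u \<in> {-1<..1}" for u using \<iota>01[of u] by auto
        then show "AE y in \<theta> n. \<iota> (h y) \<in> {-1<..1}" by simp
      qed simp
      then show ?thesis by (simp add: prob_eq_1)
    qed
    then show "\<exists>a b. a < b \<and> (\<forall>n. 1 - \<epsilon> < measure (\<pi> n) {a<..b})"
      using \<epsilon> by (intro exI[of _ "-1"] exI[of _ 1]) auto
  qed
  from tight_imp_convergent_subsubsequence[OF this, of id]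
  obtain r M where r: "strict_mono (r :: nat \<Rightarrow> nat)" and M: "real_distribution M" and wc: "weak_conv_m (\<pi> \<circ> id \<circ> r) M"
    by (auto simp: strict_mono_id)
  interpret M: real_distribution M by (rule M)
  \<comment> \<open>Mass of M that \<kappa> carries to the unit sphere or beyond has escaped to
    infinity and is discarded, so \<Theta> may have total mass below 1.\<close>
  define \<Theta> where "\<Theta> = distr (density M (indicator {t. norm (\<kappa> t) < 1})) borel (\<lambda>t. hinv (\<kappa> t))"
  have Em: "{t. norm (\<kappa> t) < 1} \<in> sets M" by simp
  have mhk: "(\<lambda>t. hinv (\<kappa> t)) \<in> measurable (density M (indicator {t. norm (\<kappa> t) < 1})) borel" by simp
  have fin: "emeasure \<Theta> UNIV < \<infinity>"
  proof -
    have "emeasure \<Theta> UNIV = emeasure M {t. norm (\<kappa> t) < 1}"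
      unfolding \<Theta>_def using mhk Em by (simp add: emeasure_distr emeasure_density nn_integral_indicator)
    also have "\<dots> < \<infinity>" by (simp add: less_top[symmetric])
    finally show ?thesis .
  qed
  have conv: "(\<lambda>n. LINT y|\<theta> (r n). f y) \<longlonglongrightarrow> (LINT y|\<Theta>. f y)" if cc: "cont_compact f" for f :: "'a \<Rightarrow> real"
  proof -
    obtain R where f: "continuous_on UNIV f" and R: "\<And>y. R < norm y \<Longrightarrow> f y = 0"
      using cc unfolding cont_compact_def by blast
    have [measurable]: "f \<in> borel_measurable borel" using f by (rule borel_measurable_continuous_onI)
    obtain B where B: "\<And>y. \<bar>f y\<bar> \<le> B"
    proof -
      have "compact (f ` cball 0 \<bar>R\<bar>)" using f by (intro compact_continuous_image) (auto intro: continuous_on_subset)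
      then obtain B where B: "\<And>y. y \<in> cball 0 \<bar>R\<bar> \<Longrightarrow> \<bar>f y\<bar> \<le> B"
        using compact_imp_bounded bounded_iff by (metis image_eqI real_norm_def)
      have "\<bar>f y\<bar> \<le> \<bar>B\<bar>" for y using B[of y] R[of y] by (cases "norm y \<le> \<bar>R\<bar>") auto
      then show thesis by (rule that)
    qed
    \<comment> \<open>e bounds the denominator of F away from 0, which makes F continuous on the
      whole line. It is so small that wherever this bound is active the argument of f has norm above
      R and F vanishes.\<close>
    define e where "e = 1 / (2 * (1 + \<bar>R\<bar>))"
    have e: "0 < e" "e \<le> 1 / 2" by (auto simp: e_def divide_simps)
    define F where "F t = f (\<kappa> t /\<^sub>R max (1 - norm (\<kappa> t)) e)" for t
    have Fc: "continuous_on UNIV F"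
    proof -
      have "max (1 - norm (\<kappa> t)) e \<noteq> 0" for t using e by auto
      then have "continuous_on UNIV (\<lambda>t. \<kappa> t /\<^sub>R max (1 - norm (\<kappa> t)) e)"
        by (intro continuous_intros \<kappa>(1)) auto
      from continuous_on_compose2[OF f this] show ?thesis unfolding F_def by simp
    qed
    have Feq: "F t = (if norm (\<kappa> t) < 1 then f (hinv (\<kappa> t)) else 0)" for t
    proof (cases "norm (\<kappa> t) \<le> 1 - e")
      case True
      then have mx: "max (1 - norm (\<kappa> t)) e = 1 - norm (\<kappa> t)" and n1: "norm (\<kappa> t) < 1"
        using e(1) by linarith+
      show ?thesis unfolding F_def hinv_def mx by (simp only: n1 if_True)
    next
      case False
      then have big: "\<bar>R\<bar> < norm (\<kappa> t) / e"
      proof -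
        have "(1 + \<bar>R\<bar>) * e = 1 / 2" unfolding e_def by simp
        then have "\<bar>R\<bar> * e = 1 / 2 - e" by (simp add: distrib_right)
        then have "\<bar>R\<bar> * e < norm (\<kappa> t)" using False e by linarith
        then show ?thesis using e by (simp only: pos_less_divide_eq)
      qed
      have "F t = 0"
      proof -
        have mx: "max (1 - norm (\<kappa> t)) e = e" using False by linarith
        have "norm (\<kappa> t /\<^sub>R e) = norm (\<kappa> t) / e" using e(1) by (simp add: divide_inverse)
        then have "R < norm (\<kappa> t /\<^sub>R e)" using big by linarith
        then show ?thesis unfolding F_def mx by (rule R)
      qed
      moreover have "f (hinv (\<kappa> t)) = 0" if "norm (\<kappa> t) < 1"
      proof (rule R)
        have "norm (\<kappa> t) / e \<le> norm (\<kappa> t) / (1 - norm (\<kappa> t))"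
        proof (rule divide_left_mono)
          show "1 - norm (\<kappa> t) \<le> e" "0 < e * (1 - norm (\<kappa> t))" using False that e by auto
        qed simp
        also have "\<dots> = norm (hinv (\<kappa> t))" using that by (simp add: hinv_def divide_inverse mult.commute)
        finally show "R < norm (hinv (\<kappa> t))" using big by linarith
      qed
      ultimately show ?thesis by simp
    qed
    have [measurable]: "F \<in> borel_measurable borel" using Fc by (rule borel_measurable_continuous_onI)
    have FB: "norm (F t) \<le> B" for t unfolding F_def using B by simp
    have "(\<lambda>n. integral\<^sup>L ((\<pi> \<circ> id \<circ> r) n) F) \<longlonglongrightarrow> integral\<^sup>L M F"
    proof (rule weak_conv_imp_integral_bdd_continuous_conv[OF _ M wc])
      show "real_distribution ((\<pi> \<circ> id \<circ> r) n)" for n using rd by simp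
      show "isCont F x" for x using Fc by (simp add: continuous_on_eq_continuous_at)
    qed (rule FB)
    moreover have "integral\<^sup>L ((\<pi> \<circ> id \<circ> r) n) F = (LINT y|\<theta> (r n). f y)" for n
    proof -
      have "integral\<^sup>L (\<pi> (r n)) F = (LINT y|\<theta> (r n). F (\<iota> (h y)))"
        unfolding \<pi>_def using mh by (intro integral_distr) auto
      also have "\<dots> = (LINT y|\<theta> (r n). f y)"
      proof (rule Bochner_Integration.integral_cong[OF refl])
        fix y
        have "h y \<in> \<kappa> ` {0..1}" using \<kappa>(2) hb[of y] by auto
        then show "F (\<iota> (h y)) = f y" using hb[of y] by (simp add: Feq \<kappa>\<iota> hh)
      qed
      finally show ?thesis by simp
    qed
    moreover have "integral\<^sup>L M F = (LINT y|\<Theta>. f y)"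
    proof -
      have "(LINT y|\<Theta>. f y) = (LINT t|density M (indicator {t. norm (\<kappa> t) < 1}). f (hinv (\<kappa> t)))"
        unfolding \<Theta>_def using mhk by (intro integral_distr) auto
      also have "density M (indicator {t. norm (\<kappa> t) < 1}) = density M (\<lambda>t. ennreal (indicat_real {t. norm (\<kappa> t) < 1} t))"
        by (simp add: ennreal_indicator)
      also have "(LINT t|density M (\<lambda>t. ennreal (indicat_real {t. norm (\<kappa> t) < 1} t)). f (hinv (\<kappa> t)))
          = (LINT t|M. indicat_real {t. norm (\<kappa> t) < 1} t *\<^sub>R f (hinv (\<kappa> t)))"
        by (intro integral_density) auto
      also have "\<dots> = integral\<^sup>L M F"
        by (intro Bochner_Integration.integral_cong[OF refl]) (simp add: Feq indicator_def)
      finally show ?thesis ..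
    qed
    ultimately show ?thesis by simp
  qed
  have "sets \<Theta> = sets borel" by (simp add: \<Theta>_def)
  then show ?thesis using r fin conv by blast
qed

lemma cont_compact_locally_finite_integrable:
  assumes "cont_compact f" "locally_finite_borel_measure \<mu>"
  shows "integrable \<mu> (f :: 'a::euclidean_space \<Rightarrow> real)"
proof -
  obtain R where f: "continuous_on UNIV f" and R: "\<And>y. R < norm y \<Longrightarrow> f y = 0"
    using assms unfolding cont_compact_def by blast
  have "compact (f ` cball 0 R)" using f by (intro compact_continuous_image) (auto intro: continuous_on_subset)
  then obtain B where B: "\<And>y. y \<in> cball 0 R \<Longrightarrow> norm (f y) \<le> B"
    using compact_imp_bounded bounded_iff by (metis image_eqI)
  then show ?thesis
    using f R assms by (intro integral_bounded_support(1)[where A="cball 0 R" and B=B]) (auto intro: borel_measurable_continuous_onI)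
qed

text \<open>Weighting by w turns measures of polynomial growth into finite ones. The growth bound
  keeps their total masses bounded and the lower bound keeps them away from 0, so they can be
  normalised; the weight and the limit of the normalising factors are undone afterwards.\<close>

theorem vague_compactness:
  fixes \<sigma> :: "nat \<Rightarrow> 'a::euclidean_space measure"
  assumes sb: "\<And>n. sets (\<sigma> n) = sets borel"
    and up: "\<And>n R. 1 \<le> R \<Longrightarrow> emeasure (\<sigma> n) (cball 0 R) \<le> ennreal (C * R powr s)" and C: "0 < C" and s: "0 < s"
    and low: "\<And>n. ennreal c \<le> emeasure (\<sigma> n) (cball 0 R0)" and c: "0 < c" and R0: "0 < R0"
  shows "\<exists>r \<nu>. strict_mono r \<and> locally_finite_borel_measure \<nu> \<and>
    (\<forall>f :: 'a \<Rightarrow> real. cont_compact f \<longrightarrow> (\<lambda>n. LINT y|\<sigma> (r n). f y) \<longlonglongrightarrow> (LINT y|\<nu>. f y))"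
proof -
  obtain \<kappa> :: "real \<Rightarrow> 'a" where \<kappa>: "continuous_on UNIV \<kappa>" "ball 0 1 \<subseteq> \<kappa> ` {0..1}"
    using space_filling_curve by blast
  \<comment> \<open>The exponent leaves C / k^2 on the ball of radius k, a convergent
    series.\<close>
  define w where "w y = (1 + norm y) powr - (s + 2)" for y :: 'a
  have np: "0 < 1 + norm y" for y :: 'a by (simp add: add_pos_nonneg)
  have w0: "0 < w y" for y using np[of y] by (simp add: w_def)
  have wc: "continuous_on UNIV w" unfolding w_def[abs_def]
  proof (intro continuous_intros ballI)
    fix y :: 'a
    show "1 + norm y \<noteq> 0" using np[of y] by linarith
  qed
  have wm[measurable]: "w \<in> borel_measurable borel" using wc by (rule borel_measurable_continuous_onI)
  have wms: "w \<in> borel_measurable (\<sigma> n)" for n using wm measurable_cong_sets[OF sb refl] by blast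
  define Z where "Z n = (\<integral>\<^sup>+y. ennreal (w y) \<partial>\<sigma> n)" for n
  define C' where "C' = (\<Sum>k. C * (1 / (real (Suc k))\<^sup>2))"
  have smb: "summable (\<lambda>k. C * (1 / (real (Suc k))\<^sup>2))"
  proof -
    have "summable (\<lambda>n. inverse ((real n)\<^sup>2))" by (rule inverse_power_summable) simp
    then have "summable (\<lambda>n. inverse ((real (Suc n))\<^sup>2))" by (rule summable_Suc_iff[THEN iffD2])
    then show ?thesis unfolding inverse_eq_divide by (rule summable_mult)
  qed
  have Zup: "Z n \<le> ennreal C'" for n
  proof -
    have "Z n \<le> (\<integral>\<^sup>+y. (\<Sum>k. ennreal ((real (Suc k)) powr - (s + 2)) * indicator (cball 0 (real (Suc k))) y) \<partial>\<sigma> n)"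
      unfolding Z_def
    proof (rule nn_integral_mono)
      fix y :: 'a
      define k where "k = nat \<lfloor>norm y\<rfloor>"
      have "real k = of_int \<lfloor>norm y\<rfloor>" by (simp add: k_def)
      then have k: "real k \<le> norm y" "norm y \<le> real (Suc k)" by linarith+
      have "w y \<le> (real (Suc k)) powr - (s + 2)" unfolding w_def using k s by (intro powr_mono2') auto
      then have "ennreal (w y) \<le> ennreal ((real (Suc k)) powr - (s + 2)) * indicator (cball 0 (real (Suc k))) y"
        using k by (simp add: ennreal_leI)
      also have "\<dots> \<le> (\<Sum>k. ennreal ((real (Suc k)) powr - (s + 2)) * indicator (cball 0 (real (Suc k))) y)"
      proof -
        have "F k \<le> suminf F" for F :: "nat \<Rightarrow> ennreal" using sum_le_suminf[of F "{k}"] by simp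
        then show ?thesis .
      qed
      finally show "ennreal (w y) \<le> (\<Sum>k. ennreal ((real (Suc k)) powr - (s + 2)) * indicator (cball 0 (real (Suc k))) y)" .
    qed
    also have "\<dots> = (\<Sum>k. \<integral>\<^sup>+y. ennreal ((real (Suc k)) powr - (s + 2)) * indicator (cball 0 (real (Suc k))) y \<partial>\<sigma> n)"
      by (intro nn_integral_suminf borel_measurable_times_ennreal borel_measurable_const borel_measurable_indicator) (simp add: sb)
    also have "\<dots> = (\<Sum>k. ennreal ((real (Suc k)) powr - (s + 2)) * emeasure (\<sigma> n) (cball 0 (real (Suc k))))"
      using sb by (intro suminf_cong nn_integral_cmult_indicator) auto
    also have "\<dots> \<le> (\<Sum>k. ennreal (C * (1 / (real (Suc k))\<^sup>2)))"
    proof (intro suminf_le)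
      fix k :: nat
      have "ennreal ((real (Suc k)) powr - (s + 2)) * emeasure (\<sigma> n) (cball 0 (real (Suc k)))
        \<le> ennreal ((real (Suc k)) powr - (s + 2)) * ennreal (C * real (Suc k) powr s)"
        by (rule mult_left_mono[OF up]) simp_all
      also have "\<dots> = ennreal (C * (1 / (real (Suc k))\<^sup>2))"
      proof -
        define x where "x = real (Suc k)"
        have x: "0 < x" by (simp add: x_def)
        have e: "- 2 = - (s + 2) + s" by simp
        have p: "x powr - (s + 2) * x powr s = x powr - 2" by (simp only: e powr_add)
        have p2: "x powr - 2 = 1 / x\<^sup>2" using x by (simp add: powr_minus_divide)
        have "ennreal (x powr - (s + 2)) * ennreal (C * x powr s) = ennreal (x powr - (s + 2) * (C * x powr s))"
          using C by (intro ennreal_mult[symmetric]) auto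
        also have "x powr - (s + 2) * (C * x powr s) = C * (x powr - (s + 2) * x powr s)" by (rule mult.left_commute)
        finally show ?thesis unfolding x_def[symmetric] p p2 .
      qed
      finally show "ennreal ((real (Suc k)) powr - (s + 2)) * emeasure (\<sigma> n) (cball 0 (real (Suc k))) \<le> ennreal (C * (1 / (real (Suc k))\<^sup>2))" .
    qed auto
    also have "\<dots> = ennreal C'" unfolding C'_def using C by (intro suminf_ennreal2 smb) auto
    finally show ?thesis .
  qed
  define c' where "c' = (1 + R0) powr - (s + 2) * c"
  have c': "0 < c'" using c R0 by (simp add: c'_def)
  have Zlow: "ennreal c' \<le> Z n" for n
  proof -
    have "ennreal c' \<le> ennreal ((1 + R0) powr - (s + 2)) * emeasure (\<sigma> n) (cball 0 R0)"
    proof -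
      have "ennreal c' = ennreal ((1 + R0) powr - (s + 2)) * ennreal c"
        unfolding c'_def using c by (intro ennreal_mult) auto
      then show ?thesis by (simp only: mult_left_mono[OF low] zero_le)
    qed
    also have "\<dots> = (\<integral>\<^sup>+y. ennreal ((1 + R0) powr - (s + 2)) * indicator (cball 0 R0) y \<partial>\<sigma> n)"
      using sb by (intro nn_integral_cmult_indicator[symmetric]) auto
    also have "\<dots> \<le> Z n" unfolding Z_def
    proof (rule nn_integral_mono)
      fix y
      have "(1 + R0) powr - (s + 2) \<le> w y" if "norm y \<le> R0"
        unfolding w_def using that s np[of y] by (intro powr_mono2') auto
      then show "ennreal ((1 + R0) powr - (s + 2)) * indicator (cball 0 R0) y \<le> ennreal (w y)"
        by (cases "norm y \<le> R0") (auto intro: ennreal_leI)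
    qed
    finally show ?thesis .
  qed
  define z where "z n = enn2real (Z n)" for n
  have Zz: "Z n = ennreal (z n)" for n using Zup[of n] unfolding z_def
    by (metis ennreal_enn2real ennreal_less_top le_less_trans)
  have C'0: "0 \<le> C'" unfolding C'_def using C by (intro suminf_nonneg smb) auto
  have zb: "c' \<le> z n" "z n \<le> C'" for n
  proof -
    have zn: "0 \<le> z n" by (simp add: z_def)
    show "z n \<le> C'" using Zup[of n] C'0 unfolding Zz by (simp only: ennreal_le_iff)
    show "c' \<le> z n" using Zlow[of n] zn unfolding Zz by (simp only: ennreal_le_iff)
  qed
  have z0: "0 < z n" for n using zb(1)[of n] c' by linarith
  define \<theta> where "\<theta> n = density (\<sigma> n) (\<lambda>y. ennreal (w y / z n))" for n
  have \<theta>p: "prob_space (\<theta> n)" for n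
  proof
    have "emeasure (\<theta> n) (space (\<theta> n)) = (\<integral>\<^sup>+y. ennreal (w y / z n) \<partial>\<sigma> n)"
      unfolding \<theta>_def using wms[of n] by (subst emeasure_density) (auto intro!: nn_integral_cong)
    also have "\<dots> = (\<integral>\<^sup>+y. ennreal (1 / z n) * ennreal (w y) \<partial>\<sigma> n)"
    proof (rule nn_integral_cong)
      fix y
      have "ennreal (1 / z n) * ennreal (w y) = ennreal (1 / z n * w y)"
        using w0[of y] z0[of n] by (intro ennreal_mult[symmetric]) auto
      then show "ennreal (w y / z n) = ennreal (1 / z n) * ennreal (w y)" by simp
    qed
    also have "\<dots> = ennreal (1 / z n) * Z n" unfolding Z_def using wms[of n] by (intro nn_integral_cmult) auto
    also have "\<dots> = 1" unfolding Zz using z0[of n] by (simp add: ennreal_mult[symmetric])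
    finally show "emeasure (\<theta> n) (space (\<theta> n)) = 1" .
  qed
  have \<theta>s: "sets (\<theta> n) = sets borel" for n by (simp add: \<theta>_def sb)
  obtain r1 \<Theta> where r1: "strict_mono r1" and \<Theta>: "sets \<Theta> = sets borel" "emeasure \<Theta> UNIV < \<infinity>"
    and conv: "\<And>f :: 'a \<Rightarrow> real. cont_compact f \<Longrightarrow> (\<lambda>n. LINT y|\<theta> (r1 n). f y) \<longlonglongrightarrow> (LINT y|\<Theta>. f y)"
    using vague_compactness_prob[OF \<kappa>, of \<theta>] \<theta>p \<theta>s by blast
  \<comment> \<open>A further subsequence makes the normalising factors converge; the limit is
    positive because c' is.\<close>
  have "seq_compact {c'..C'}" using compact_eq_seq_compact_metric compact_Icc by blast
  then obtain l r2 where l: "l \<in> {c'..C'}" and r2: "strict_mono r2" and zl: "((z \<circ> r1) \<circ> r2) \<longlonglongrightarrow> l"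
    using zb by (auto elim!: seq_compactE[of _ "z \<circ> r1"])
  have l0: "0 < l" using l c' by auto
  define \<nu> where "\<nu> = density \<Theta> (\<lambda>y. ennreal (l / w y))"
  have wm\<Theta>: "w \<in> borel_measurable \<Theta>" using wm measurable_cong_sets[OF \<Theta>(1) refl] by blast
  have "locally_finite_borel_measure \<nu>"
    unfolding locally_finite_borel_measure_def
  proof (intro conjI allI)
    show "sets \<nu> = sets borel" by (simp add: \<nu>_def \<Theta>)
    fix x :: 'a
    define B where "B = l * (2 + norm x) powr (s + 2)"
    have "emeasure \<nu> (ball x 1) = (\<integral>\<^sup>+y. ennreal (l / w y) * indicator (ball x 1) y \<partial>\<Theta>)"
      unfolding \<nu>_def using wm\<Theta> by (intro emeasure_density) (auto simp: \<Theta>)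
    also have "\<dots> \<le> (\<integral>\<^sup>+y. ennreal B * indicator UNIV y \<partial>\<Theta>)"
    proof (rule nn_integral_mono)
      fix y
      have "l / w y \<le> B" if "y \<in> ball x 1"
      proof -
        have "norm y \<le> norm x + 1" using that norm_triangle_ineq[of x "y - x"] by (simp add: dist_norm norm_minus_commute)
        then have "(1 + norm y) powr (s + 2) \<le> (2 + norm x) powr (s + 2)" using s np[of y] by (intro powr_mono2) auto
        moreover have "l / w y = l * (1 + norm y) powr (s + 2)" unfolding w_def powr_minus by (simp add: divide_inverse)
        ultimately show ?thesis using l0 by (simp add: B_def)
      qed
      then show "ennreal (l / w y) * indicator (ball x 1) y \<le> ennreal B * indicator UNIV y"
        by (auto simp: indicator_def intro: ennreal_leI)
    qed
    also have "\<dots> = ennreal B * emeasure \<Theta> UNIV" using \<Theta> by (intro nn_integral_cmult_indicator) auto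
    also have "\<dots> < \<infinity>" using \<Theta>(2) by (simp add: ennreal_mult_less_top)
    finally show "\<exists>r>0. emeasure \<nu> (ball x r) < \<infinity>" by (intro exI[of _ 1]) auto
  qed
  moreover have "(\<lambda>n. LINT y|\<sigma> ((r1 \<circ> r2) n). f y) \<longlonglongrightarrow> (LINT y|\<nu>. f y)" if f: "cont_compact f" for f :: "'a \<Rightarrow> real"
  proof -
    have fc: "continuous_on UNIV f" using f by (simp add: cont_compact_def)
    have fm[measurable]: "f \<in> borel_measurable borel" using fc by (rule borel_measurable_continuous_onI)
    have g: "cont_compact (\<lambda>y. f y / w y)"
      using f w0 unfolding cont_compact_def
      by (auto intro!: continuous_on_divide wc simp: less_imp_neq[symmetric] dest: less_imp_neq)
    have "(\<lambda>n. z (r1 (r2 n)) * (LINT y|\<theta> (r1 (r2 n)). f y / w y)) \<longlonglongrightarrow> l * (LINT y|\<Theta>. f y / w y)"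
      using zl LIMSEQ_subseq_LIMSEQ[OF conv[OF g] r2] by (intro tendsto_mult) (auto simp: o_def)
    moreover have "z n * (LINT y|\<theta> n. f y / w y) = (LINT y|\<sigma> n. f y)" for n
    proof -
      have fms: "f \<in> borel_measurable (\<sigma> n)" using fm measurable_cong_sets[OF sb refl] by blast
      have "(LINT y|\<theta> n. f y / w y) = (LINT y|\<sigma> n. (w y / z n) *\<^sub>R (f y / w y))"
        unfolding \<theta>_def using wms[of n] fms w0 z0[of n] by (intro integral_density) (auto intro!: AE_I2 less_imp_le)
      also have "\<dots> = (LINT y|\<sigma> n. f y / z n)"
        using w0 by (intro Bochner_Integration.integral_cong) (auto simp: less_imp_neq[symmetric])
      also have "\<dots> = (LINT y|\<sigma> n. f y) / z n" by simp
      finally show ?thesis using z0[of n] by simp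
    qed
    moreover have "l * (LINT y|\<Theta>. f y / w y) = (LINT y|\<nu>. f y)"
    proof -
      have fm\<Theta>: "f \<in> borel_measurable \<Theta>" using fm measurable_cong_sets[OF \<Theta>(1) refl] by blast
      have "(LINT y|\<nu>. f y) = (LINT y|\<Theta>. (l / w y) *\<^sub>R f y)"
        unfolding \<nu>_def using wm\<Theta> fm\<Theta> w0 l0 by (intro integral_density) (auto intro!: AE_I2 less_imp_le)
      also have "\<dots> = (LINT y|\<Theta>. l * (f y / w y))" by (intro Bochner_Integration.integral_cong) auto
      also have "\<dots> = l * (LINT y|\<Theta>. f y / w y)" by (rule integral_mult_right_zero)
      finally show ?thesis ..
    qed
    ultimately show ?thesis by (simp add: o_def)
  qed
  moreover have "strict_mono (r1 \<circ> r2)" using r1 r2 by (rule strict_mono_o)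
  ultimately show ?thesis by blast
qed

section \<open>From the cutoff to the smooth kernel\<close>

text \<open>Falling from 1 to 0 over an interval of length \<tau> with Lipschitz constant at most 1
  / \<tau> forces the cutoff to be linear there, so the whole family is determined.\<close>

lemma cutoff_family_eq:
  assumes \<eta>: "cutoff_family \<eta>" and \<tau>: "0 < \<tau>" "\<tau> < 1" and t: "0 \<le> t"
  shows "\<eta> \<tau> t = max 0 (min 1 ((1 - t) / \<tau>))"
proof -
  have h: "\<And>t. 0 \<le> t \<Longrightarrow> t \<le> 1 - \<tau> \<Longrightarrow> \<eta> \<tau> t = 1" "\<And>t. 1 \<le> t \<Longrightarrow> \<eta> \<tau> t = 0" "(1 / \<tau>)-lipschitz_on {0..} (\<eta> \<tau>)"
    using \<eta> \<tau> unfolding cutoff_family_def by (auto simp: greaterThanLessThan_iff)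
  consider "t \<le> 1 - \<tau>" | "1 \<le> t" | "1 - \<tau> < t" "t < 1" by linarith
  then show ?thesis
  proof cases
    case 1
    then have "1 \<le> (1 - t) / \<tau>" using \<tau> by (simp add: field_simps)
    then show ?thesis using h(1)[OF t 1] by simp
  next
    case 2
    then have "(1 - t) / \<tau> \<le> 0" using \<tau> by (simp add: divide_nonpos_pos)
    then show ?thesis using h(2)[OF 2] by simp
  next
    case 3
    have a: "\<bar>\<eta> \<tau> t - 1\<bar> \<le> 1 / \<tau> * \<bar>t - (1 - \<tau>)\<bar>"
      using lipschitz_onD[OF h(3), of t "1 - \<tau>"] t \<tau> h(1)[of "1 - \<tau>"] by (simp add: dist_real_def)
    have b: "\<bar>\<eta> \<tau> t\<bar> \<le> 1 / \<tau> * \<bar>t - 1\<bar>"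
      using lipschitz_onD[OF h(3), of t 1] t h(2)[of 1] by (simp add: dist_real_def)
    have "1 / \<tau> * \<bar>t - (1 - \<tau>)\<bar> = 1 - (1 - t) / \<tau>" using 3 \<tau> by (simp add: field_simps)
    moreover have "1 / \<tau> * \<bar>t - 1\<bar> = (1 - t) / \<tau>" using 3 \<tau> by simp
    ultimately have "\<eta> \<tau> t = (1 - t) / \<tau>" using a b by linarith
    moreover have "0 \<le> (1 - t) / \<tau>" "(1 - t) / \<tau> \<le> 1" using 3 \<tau> by (auto simp: field_simps)
    ultimately show ?thesis by simp
  qed
qed

text \<open>For \<tau> = 1 / 2 the plateau ends at r / 2, so r / 2 times the cutoff is the
  difference of one ramp at the radii r and r / 2; such differences telescope over dyadic
  scales.\<close>

lemma ramp_telescope: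
  fixes n r :: real
  assumes "0 < r" "0 \<le> n"
  shows "r / 2 * max 0 (min 1 ((1 - n / r) / (1 / 2))) = max 0 (r - n) - max 0 (r / 2 - n)"
proof -
  consider "n \<le> r / 2" | "r / 2 < n" "n \<le> r" | "r < n" by linarith
  then show ?thesis
  proof cases
    case 1
    then have "1 \<le> (1 - n / r) / (1 / 2)" using assms by (simp add: field_simps)
    then show ?thesis using 1 assms by simp
  next
    case 2
    then have "(1 - n / r) / (1 / 2) \<le> 1" "0 \<le> (1 - n / r) / (1 / 2)" using assms by (simp_all add: field_simps)
    then have "max 0 (min 1 ((1 - n / r) / (1 / 2))) = (1 - n / r) / (1 / 2)" by simp
    moreover have "r / 2 * ((1 - n / r) / (1 / 2)) = r - n" using assms by (simp add: field_simps)
    ultimately show ?thesis using 2 by simp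
  next
    case 3
    then have "(1 - n / r) / (1 / 2) \<le> 0" using assms by (simp add: field_simps)
    then show ?thesis using 3 assms by simp
  qed
qed

text \<open>Taylor's formula with integral remainder at \<rho>: the function (\<rho>^2 - r^2)^2
  vanishes there together with its first derivative, and its second derivative is 12 r^2 - 4
  \<rho>^2.\<close>

lemma ramp_superposition:
  fixes n \<rho> :: real
  assumes n: "0 \<le> n" and \<rho>: "0 < \<rho>"
  shows "(LINT r|lborel. indicator {0..\<rho>} r *\<^sub>R ((12 * r\<^sup>2 - 4 * \<rho>\<^sup>2) * max 0 (r - n))) = (max 0 (\<rho>\<^sup>2 - n\<^sup>2))\<^sup>2"
proof (cases "n \<le> \<rho>")
  case True
  have "(LINT r|lborel. indicator {0..\<rho>} r *\<^sub>R ((12 * r\<^sup>2 - 4 * \<rho>\<^sup>2) * max 0 (r - n)))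
     = (LINT r|lborel. indicator {n..\<rho>} r *\<^sub>R ((12 * r\<^sup>2 - 4 * \<rho>\<^sup>2) * (r - n)))"
    using n by (intro Bochner_Integration.integral_cong) (auto simp: indicator_def)
  also have "\<dots> = (3 * \<rho> ^ 4 - 4 * n * \<rho> ^ 3 - 2 * \<rho>\<^sup>2 * \<rho>\<^sup>2 + 4 * \<rho>\<^sup>2 * n * \<rho>) - (3 * n ^ 4 - 4 * n * n ^ 3 - 2 * \<rho>\<^sup>2 * n\<^sup>2 + 4 * \<rho>\<^sup>2 * n * n)"
  proof (rule integral_FTC_Icc[OF True])
    fix r :: real
    have "((\<lambda>r. 3 * r ^ 4 - 4 * n * r ^ 3 - 2 * \<rho>\<^sup>2 * r\<^sup>2 + 4 * \<rho>\<^sup>2 * n * r) has_real_derivative (12 * r\<^sup>2 - 4 * \<rho>\<^sup>2) * (r - n)) (at r within {n..\<rho>})"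
      by (auto intro!: derivative_eq_intros simp: algebra_simps power2_eq_square power3_eq_cube)
    then show "((\<lambda>r. 3 * r ^ 4 - 4 * n * r ^ 3 - 2 * \<rho>\<^sup>2 * r\<^sup>2 + 4 * \<rho>\<^sup>2 * n * r) has_vector_derivative (12 * r\<^sup>2 - 4 * \<rho>\<^sup>2) * (r - n)) (at r within {n..\<rho>})"
      by (simp add: has_real_derivative_iff_has_vector_derivative)
  qed (auto intro!: continuous_intros)
  also have "\<dots> = (\<rho>\<^sup>2 - n\<^sup>2)\<^sup>2" by (simp add: power2_eq_square power3_eq_cube power4_eq_xxxx algebra_simps)
  also have "\<rho>\<^sup>2 - n\<^sup>2 = max 0 (\<rho>\<^sup>2 - n\<^sup>2)" using power_mono[OF True n, of 2] by simp
  finally show ?thesis .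
next
  case False
  have "(LINT r|lborel. indicator {0..\<rho>} r *\<^sub>R ((12 * r\<^sup>2 - 4 * \<rho>\<^sup>2) * max 0 (r - n))) = (LINT r|(lborel :: real measure). 0)"
    using False by (intro Bochner_Integration.integral_cong) (auto simp: indicator_def)
  moreover have "\<rho>\<^sup>2 \<le> n\<^sup>2" using False \<rho> by (intro power_mono) auto
  ultimately show ?thesis by simp
qed

lemma locally_finite_lborel: "locally_finite_borel_measure (lborel :: 'a::euclidean_space measure)"
  unfolding locally_finite_borel_measure_def
proof (intro conjI allI)
  fix x :: 'a
  show "\<exists>r>0. emeasure lborel (ball x r) < \<infinity>"
    using emeasure_lborel_ball_finite[of x 1] by (intro exI[of _ 1]) auto
qed simp

definition ramp_moment :: "'a::euclidean_space measure \<Rightarrow> 'a \<Rightarrow> real \<Rightarrow> 'a" where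
  "ramp_moment \<mu> x r = (LINT y|\<mu>. max 0 (r - norm (x - y)) *\<^sub>R (x - y))"

text \<open>Each dyadic step adds at most \<delta> / 2 times \<rho>^(s + 2), and these contributions
  at least halve from one scale to the next, so they sum to \<delta> r^(s + 2). The remaining moment
  at scale r / 2^n tends to 0 since the ramp and the vector are both bounded by the radius.\<close>

lemma ramp_moment_small:
  fixes \<mu> :: "'a::euclidean_space measure"
  assumes lf: "locally_finite_borel_measure \<mu>" and \<eta>: "cutoff_family \<eta>" and s: "0 < s" and \<delta>: "0 \<le> \<delta>"
    and T: "\<And>r. 0 < r \<Longrightarrow> r \<le> r0 \<Longrightarrow> norm (LINT y|\<mu>. \<eta> (1 / 2) (norm (x - y) / r) *\<^sub>R (x - y)) \<le> \<delta> * r powr (s + 1)"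
    and r: "0 < r" "r \<le> r0"
  shows "norm (ramp_moment \<mu> x r) \<le> \<delta> * r powr (s + 2)"
proof -
  have int: "integrable \<mu> (\<lambda>y. max 0 (r - norm (x - y)) *\<^sub>R (x - y))" for r
    by (intro integrable_continuous_bounded_support[OF lf, of _ x r] continuous_intros) (auto simp: dist_norm)
  have tele: "ramp_moment \<mu> x r - ramp_moment \<mu> x (r / 2) = (r / 2) *\<^sub>R (LINT y|\<mu>. \<eta> (1 / 2) (norm (x - y) / r) *\<^sub>R (x - y))"
    if "0 < r" for r
  proof -
    have "(r / 2) *\<^sub>R (LINT y|\<mu>. \<eta> (1 / 2) (norm (x - y) / r) *\<^sub>R (x - y)) = (LINT y|\<mu>. (r / 2) *\<^sub>R \<eta> (1 / 2) (norm (x - y) / r) *\<^sub>R (x - y))"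
      by (simp only: integral_scaleR_right)
    also have "\<dots> = (LINT y|\<mu>. max 0 (r - norm (x - y)) *\<^sub>R (x - y) - max 0 (r / 2 - norm (x - y)) *\<^sub>R (x - y))"
    proof (rule Bochner_Integration.integral_cong[OF refl])
      fix y
      have "r / 2 * \<eta> (1 / 2) (norm (x - y) / r) = max 0 (r - norm (x - y)) - max 0 (r / 2 - norm (x - y))"
        using that cutoff_family_eq[OF \<eta>, of "1/2" "norm (x - y) / r"] ramp_telescope[OF that, of "norm (x - y)"] by simp
      then show "(r / 2) *\<^sub>R \<eta> (1 / 2) (norm (x - y) / r) *\<^sub>R (x - y) = max 0 (r - norm (x - y)) *\<^sub>R (x - y) - max 0 (r / 2 - norm (x - y)) *\<^sub>R (x - y)"
        by (simp only: scaleR_scaleR scaleR_left_diff_distrib)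
    qed
    also have "\<dots> = ramp_moment \<mu> x r - ramp_moment \<mu> x (r / 2)"
      unfolding ramp_moment_def by (intro Bochner_Integration.integral_diff int)
    finally show ?thesis by simp
  qed
  have step: "norm (ramp_moment \<mu> x \<rho>) \<le> norm (ramp_moment \<mu> x (\<rho> / 2)) + \<delta> / 2 * \<rho> powr (s + 2)" if \<rho>: "0 < \<rho>" "\<rho> \<le> r0" for \<rho>
  proof -
    have "ramp_moment \<mu> x \<rho> = ramp_moment \<mu> x (\<rho> / 2) + (\<rho> / 2) *\<^sub>R (LINT y|\<mu>. \<eta> (1 / 2) (norm (x - y) / \<rho>) *\<^sub>R (x - y))"
      using tele[OF \<rho>(1)] by (simp add: algebra_simps)
    then have "norm (ramp_moment \<mu> x \<rho>) \<le> norm (ramp_moment \<mu> x (\<rho> / 2)) + norm ((\<rho> / 2) *\<^sub>R (LINT y|\<mu>. \<eta> (1 / 2) (norm (x - y) / \<rho>) *\<^sub>R (x - y)))"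
      by (metis norm_triangle_ineq)
    also have "norm ((\<rho> / 2) *\<^sub>R (LINT y|\<mu>. \<eta> (1 / 2) (norm (x - y) / \<rho>) *\<^sub>R (x - y))) \<le> (\<rho> / 2) * (\<delta> * \<rho> powr (s + 1))"
      unfolding norm_scaleR using \<rho> by (intro mult_mono T) auto
    also have "(\<rho> / 2) * (\<delta> * \<rho> powr (s + 1)) = \<delta> / 2 * \<rho> powr (s + 2)"
    proof -
      have e: "s + 2 = 1 + (s + 1)" by simp
      have "\<rho> powr (s + 2) = \<rho> * \<rho> powr (s + 1)" unfolding e powr_add using \<rho> by simp
      then show ?thesis by simp
    qed
    finally show ?thesis by simp
  qed
  have iter: "norm (ramp_moment \<mu> x r) \<le> norm (ramp_moment \<mu> x (r / 2 ^ n)) + \<delta> * r powr (s + 2) * (1 - (1 / 2) ^ n)" for n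
  proof (induction n)
    case (Suc n)
    define \<rho> where "\<rho> = r / 2 ^ n"
    have "(1::real) \<le> 2 ^ n" by simp
    then have \<rho>: "0 < \<rho>" "\<rho> \<le> r" using r by (auto simp: \<rho>_def field_simps)
    have "\<rho> powr (s + 2) = r powr (s + 2) * (1 / 2 ^ n) powr (s + 2)"
      using r by (simp add: \<rho>_def powr_divide)
    also have "(1 / 2 ^ n :: real) powr (s + 2) \<le> (1 / 2 ^ n) powr 1"
      using s by (intro powr_mono') auto
    finally have p: "\<rho> powr (s + 2) \<le> r powr (s + 2) * (1 / 2) ^ n" by (simp add: power_one_over mult_left_mono)
    have "norm (ramp_moment \<mu> x \<rho>) \<le> norm (ramp_moment \<mu> x (\<rho> / 2)) + \<delta> / 2 * \<rho> powr (s + 2)"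
      using \<rho> r by (intro step) auto
    also have "\<dots> \<le> norm (ramp_moment \<mu> x (\<rho> / 2)) + \<delta> / 2 * (r powr (s + 2) * (1 / 2) ^ n)"
      using \<delta> p by (intro add_left_mono mult_left_mono) auto
    finally have "norm (ramp_moment \<mu> x r) \<le> norm (ramp_moment \<mu> x (\<rho> / 2)) + \<delta> / 2 * (r powr (s + 2) * (1 / 2) ^ n) + \<delta> * r powr (s + 2) * (1 - (1 / 2) ^ n)"
      using Suc unfolding \<rho>_def by linarith
    moreover have "\<rho> / 2 = r / 2 ^ Suc n" by (simp add: \<rho>_def)
    ultimately show ?case by (simp add: algebra_simps)
  qed simp
  have "(\<lambda>n. norm (ramp_moment \<mu> x (r / 2 ^ n)) + \<delta> * r powr (s + 2) * (1 - (1 / 2) ^ n)) \<longlonglongrightarrow> 0 + \<delta> * r powr (s + 2) * (1 - 0)"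
  proof (intro tendsto_add tendsto_mult tendsto_diff tendsto_const LIMSEQ_realpow_zero)
    define M where "M = measure \<mu> (cball x r)"
    have bd: "norm (ramp_moment \<mu> x (r / 2 ^ n)) \<le> (r * r * M) * (1 / 2) ^ n" for n
    proof -
      define \<rho> where "\<rho> = r / 2 ^ n"
      have "(1::real) \<le> 2 ^ n" by simp
      then have \<rho>: "0 < \<rho>" "\<rho> \<le> r" using r by (auto simp: \<rho>_def field_simps)
      have "norm (ramp_moment \<mu> x \<rho>) \<le> (\<rho> * \<rho>) * measure \<mu> (cball x \<rho>)"
        unfolding ramp_moment_def
      proof (rule integral_bounded_support(2)[OF lf])
        fix y assume "y \<in> cball x \<rho>"
        then show "norm (max 0 (\<rho> - norm (x - y)) *\<^sub>R (x - y)) \<le> \<rho> * \<rho>"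
          unfolding norm_scaleR using \<rho> by (intro mult_mono) (auto simp: dist_norm)
      qed (auto simp: dist_norm intro!: borel_measurable_continuous_onI continuous_intros)
      also have "\<dots> \<le> (\<rho> * r) * M"
        unfolding M_def measure_def using \<rho> r lf emeasure_bounded_finite[OF lf bounded_cball, of x r]
        by (intro mult_mono enn2real_mono emeasure_mono) (auto simp: locally_finite_sets)
      finally show ?thesis by (simp add: \<rho>_def power_one_over field_simps)
    qed
    have "(\<lambda>n. (r * r * M) * (1 / 2) ^ n) \<longlonglongrightarrow> (r * r * M) * 0"
      by (intro tendsto_mult tendsto_const LIMSEQ_realpow_zero) auto
    then show "(\<lambda>n. norm (ramp_moment \<mu> x (r / 2 ^ n))) \<longlonglongrightarrow> 0"
      by (intro tendsto_norm_zero Lim_null_comparison[OF always_eventually[OF allI[OF bd]]]) simp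
  qed auto
  then have "norm (ramp_moment \<mu> x r) \<le> 0 + \<delta> * r powr (s + 2) * (1 - 0)"
    by (rule LIMSEQ_le_const) (use iter in blast)
  then show ?thesis by simp
qed

text \<open>By Fubini's theorem the superposition of ramps in the radius passes from the kernels to
  the moments.\<close>

lemma sym_moment_eq_ramp:
  fixes \<mu> :: "'a::euclidean_space measure"
  assumes lf: "locally_finite_borel_measure \<mu>" and \<rho>: "0 < \<rho>"
  shows "sym_moment \<mu> x \<rho> = (LINT r|lborel. indicator {0..\<rho>} r *\<^sub>R ((12 * r\<^sup>2 - 4 * \<rho>\<^sup>2) *\<^sub>R ramp_moment \<mu> x r))"
proof -
  let ?g = "\<lambda>r y. indicat_real {0..\<rho>} r *\<^sub>R ((12 * r\<^sup>2 - 4 * \<rho>\<^sup>2) *\<^sub>R (max 0 (r - norm (x - y)) *\<^sub>R (x - y)))"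
  have "(LINT r|lborel. LINT y|\<mu>. ?g r y) = (LINT y|\<mu>. LINT r|lborel. ?g r y)"
  proof (rule fubini_bounded_support(1)[OF locally_finite_lborel lf, where A="{0..\<rho>}" and B="cball x \<rho>" and K="12 * \<rho>\<^sup>2 * (\<rho> * \<rho>)"])
    have "(\<lambda>p. indicat_real {0..\<rho>} (fst p) *\<^sub>R ((12 * (fst p)\<^sup>2 - 4 * \<rho>\<^sup>2) *\<^sub>R (max 0 (fst p - norm (x - snd p)) *\<^sub>R (x - snd p)))) \<in> borel_measurable (borel \<Otimes>\<^sub>M (borel :: 'a measure))"
      by measurable
    then show "(\<lambda>(r, y). ?g r y) \<in> borel_measurable borel" by (simp add: borel_prod case_prod_beta)
    fix r y
    show "norm (?g r y) \<le> 12 * \<rho>\<^sup>2 * (\<rho> * \<rho>)" if "r \<in> {0..\<rho>}" "y \<in> cball x \<rho>"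
    proof -
      have "r\<^sup>2 \<le> \<rho>\<^sup>2" using that by (intro power_mono) auto
      then have "\<bar>12 * r\<^sup>2 - 4 * \<rho>\<^sup>2\<bar> \<le> 12 * \<rho>\<^sup>2" using zero_le_power2[of r] zero_le_power2[of \<rho>] by linarith
      then have "\<bar>12 * r\<^sup>2 - 4 * \<rho>\<^sup>2\<bar> * (\<bar>max 0 (r - norm (x - y))\<bar> * norm (x - y)) \<le> 12 * \<rho>\<^sup>2 * (\<rho> * \<rho>)"
      proof (intro mult_mono)
        show "\<bar>max 0 (r - norm (x - y))\<bar> \<le> \<rho>"
        proof -
          have "r \<le> \<rho>" using that by simp
          then have "r - norm (x - y) \<le> \<rho>" using norm_ge_zero[of "x - y"] by linarith
          then show ?thesis using \<rho> by simp
        qed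
      qed (use that in \<open>auto simp: dist_norm\<close>)
      then show ?thesis using that by (simp add: abs_mult mult.assoc)
    qed
    show "?g r y = 0" if "r \<notin> {0..\<rho>} \<or> y \<notin> cball x \<rho>"
      using that by (auto simp: dist_norm indicator_def)
  qed auto
  also have "(LINT y|\<mu>. LINT r|lborel. ?g r y) = (LINT y|\<mu>. (qk \<rho> (x - y))\<^sup>2 *\<^sub>R (x - y))"
  proof (rule Bochner_Integration.integral_cong[OF refl])
    fix y
    have "(LINT r|lborel. ?g r y) = (LINT r|lborel. (indicat_real {0..\<rho>} r *\<^sub>R ((12 * r\<^sup>2 - 4 * \<rho>\<^sup>2) * max 0 (r - norm (x - y)))) *\<^sub>R (x - y))"
      by (intro Bochner_Integration.integral_cong[OF refl]) (simp add: mult_ac)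
    also have "\<dots> = (LINT r|lborel. indicat_real {0..\<rho>} r *\<^sub>R ((12 * r\<^sup>2 - 4 * \<rho>\<^sup>2) * max 0 (r - norm (x - y)))) *\<^sub>R (x - y)"
      by (rule integral_scaleR_left)
         (rule borel_integrable_atLeastAtMost'[unfolded set_integrable_def], intro continuous_intros)
    also have "\<dots> = (qk \<rho> (x - y))\<^sup>2 *\<^sub>R (x - y)"
      using ramp_superposition[OF norm_ge_zero \<rho>, of "x - y"] by (simp add: qk_def)
    finally show "(LINT r|lborel. ?g r y) = (qk \<rho> (x - y))\<^sup>2 *\<^sub>R (x - y)" .
  qed
  finally have "(LINT r|lborel. LINT y|\<mu>. ?g r y) = sym_moment \<mu> x \<rho>" by (simp only: sym_moment_def)
  moreover have "(LINT y|\<mu>. ?g r y) = indicat_real {0..\<rho>} r *\<^sub>R ((12 * r\<^sup>2 - 4 * \<rho>\<^sup>2) *\<^sub>R ramp_moment \<mu> x r)" for r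
    by (simp only: integral_scaleR_right ramp_moment_def)
  ultimately show ?thesis by simp
qed

theorem sym_moment_small:
  fixes \<mu> :: "'a::euclidean_space measure"
  assumes lf: "locally_finite_borel_measure \<mu>" and \<eta>: "cutoff_family \<eta>" and s: "0 < s" and \<delta>: "0 \<le> \<delta>"
    and T: "\<And>r. 0 < r \<Longrightarrow> r \<le> r0 \<Longrightarrow> norm (LINT y|\<mu>. \<eta> (1 / 2) (norm (x - y) / r) *\<^sub>R (x - y)) \<le> \<delta> * r powr (s + 1)"
    and \<rho>: "0 < \<rho>" "\<rho> \<le> r0"
  shows "norm (sym_moment \<mu> x \<rho>) \<le> 12 * \<delta> * \<rho> powr (s + 5)"
proof -
  define B where "B = 12 * \<rho>\<^sup>2 * (\<delta> * \<rho> powr (s + 2))"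
  have "norm (sym_moment \<mu> x \<rho>) \<le> B * measure lborel {0..\<rho>}"
    unfolding sym_moment_eq_ramp[OF lf \<rho>(1)]
  proof (cases "integrable lborel (\<lambda>r. indicat_real {0..\<rho>} r *\<^sub>R ((12 * r\<^sup>2 - 4 * \<rho>\<^sup>2) *\<^sub>R ramp_moment \<mu> x r))")
    \<comment> \<open>A non-integrable function has integral 0 by convention, so only the integrable
      case needs the estimate, with the weight bounded by
      \<open>12 * \<rho>\<^sup>2\<close>.\<close>
    case False
    then show "norm (LINT r|lborel. indicat_real {0..\<rho>} r *\<^sub>R ((12 * r\<^sup>2 - 4 * \<rho>\<^sup>2) *\<^sub>R ramp_moment \<mu> x r)) \<le> B * measure lborel {0..\<rho>}"
      using \<delta> \<rho> by (simp add: not_integrable_integral_eq B_def)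
  next
    case True
    have "norm (LINT r|lborel. indicat_real {0..\<rho>} r *\<^sub>R ((12 * r\<^sup>2 - 4 * \<rho>\<^sup>2) *\<^sub>R ramp_moment \<mu> x r)) \<le> (LINT r|lborel. norm (indicat_real {0..\<rho>} r *\<^sub>R ((12 * r\<^sup>2 - 4 * \<rho>\<^sup>2) *\<^sub>R ramp_moment \<mu> x r)))"
      by (rule integral_norm_bound)
    also have "\<dots> \<le> (LINT r|lborel. indicat_real {0..\<rho>} r * B)"
    proof (rule integral_mono)
      show "integrable lborel (\<lambda>r. norm (indicat_real {0..\<rho>} r *\<^sub>R ((12 * r\<^sup>2 - 4 * \<rho>\<^sup>2) *\<^sub>R ramp_moment \<mu> x r)))"
        using True by (rule integrable_norm)
      show "integrable lborel (\<lambda>r. indicat_real {0..\<rho>} r * B)"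
        using \<rho> by (intro integrable_mult_left integrable_real_indicator) auto
      fix r
      show "norm (indicat_real {0..\<rho>} r *\<^sub>R ((12 * r\<^sup>2 - 4 * \<rho>\<^sup>2) *\<^sub>R ramp_moment \<mu> x r)) \<le> indicat_real {0..\<rho>} r * B"
      proof (cases "r \<in> {0..\<rho>}")
        case True
        then have "r\<^sup>2 \<le> \<rho>\<^sup>2" by (intro power_mono) auto
        then have p: "\<bar>12 * r\<^sup>2 - 4 * \<rho>\<^sup>2\<bar> \<le> 12 * \<rho>\<^sup>2" using zero_le_power2[of r] zero_le_power2[of \<rho>] by linarith
        have q: "norm (ramp_moment \<mu> x r) \<le> \<delta> * \<rho> powr (s + 2)"
        proof (cases "r = 0")
          case True
          have "(\<lambda>y. max 0 (0 - norm (x - y)) *\<^sub>R (x - y)) = (\<lambda>y. 0)" by auto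
          then show ?thesis using \<delta> True by (simp add: ramp_moment_def)
        next
          case False
          then have r: "0 < r" "r \<le> \<rho>" using \<open>r \<in> {0..\<rho>}\<close> by auto
          have "norm (ramp_moment \<mu> x r) \<le> \<delta> * r powr (s + 2)"
            using r \<rho> by (intro ramp_moment_small[OF lf \<eta> s \<delta> T]) auto
          also have "\<dots> \<le> \<delta> * \<rho> powr (s + 2)" using r s \<delta> by (intro mult_left_mono powr_mono2) auto
          finally show ?thesis .
        qed
        have "\<bar>12 * r\<^sup>2 - 4 * \<rho>\<^sup>2\<bar> * norm (ramp_moment \<mu> x r) \<le> B"
          unfolding B_def using p q by (intro mult_mono) auto
        then show ?thesis using True by simp
      qed simp
    qed
    also have "\<dots> = B * measure lborel {0..\<rho>}" by simp
    finally show "norm (LINT r|lborel. indicat_real {0..\<rho>} r *\<^sub>R ((12 * r\<^sup>2 - 4 * \<rho>\<^sup>2) *\<^sub>R ramp_moment \<mu> x r)) \<le> B * measure lborel {0..\<rho>}" .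
  qed
  also have "\<dots> = 12 * \<delta> * \<rho> powr (s + 5)"
  proof -
    have e: "s + 5 = (s + 2) + 3" by simp
    have "\<rho> powr (s + 5) = \<rho> powr (s + 2) * \<rho> ^ 3" unfolding e powr_add using \<rho> by simp
    then show ?thesis using \<rho> by (simp add: B_def power2_eq_square power3_eq_cube)
  qed
  finally show ?thesis .
qed

section \<open>Density points\<close>

text \<open>The exceptional sets below are not known to be measurable, so they are enclosed in
  measurable sets of small measure.\<close>

lemma null_setI_small_cover:
  fixes \<mu> :: "'a measure"
  assumes "\<And>e. 0 < e \<Longrightarrow> \<exists>U\<in>sets \<mu>. A \<subseteq> U \<and> emeasure \<mu> U \<le> ennreal e"
  shows "\<exists>N\<in>null_sets \<mu>. A \<subseteq> N"
proof -
  have "\<forall>n. \<exists>U\<in>sets \<mu>. A \<subseteq> U \<and> emeasure \<mu> U \<le> ennreal (1 / real (Suc n))" using assms by simp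
  then obtain U where U: "\<And>n. U n \<in> sets \<mu>" "\<And>n. A \<subseteq> U n" "\<And>n. emeasure \<mu> (U n) \<le> ennreal (1 / real (Suc n))" by metis
  define N where "N = (\<Inter>n. U n)"
  have N: "N \<in> sets \<mu>" unfolding N_def using U(1) by (intro sets.countable_INT) auto
  have "emeasure \<mu> N \<le> 0 + ennreal e" if e: "0 < e" for e
  proof -
    obtain n where n: "inverse (real (Suc n)) < e" using reals_Archimedean[OF e] by blast
    have "emeasure \<mu> N \<le> emeasure \<mu> (U n)" using U(1) by (intro emeasure_mono) (auto simp: N_def)
    also have "\<dots> \<le> ennreal (1 / real (Suc n))" by (rule U(3))
    also have "\<dots> \<le> ennreal e" using n by (intro ennreal_leI) (simp add: inverse_eq_divide)
    finally show ?thesis by simp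
  qed
  then have "emeasure \<mu> N \<le> 0" by (rule ennreal_le_epsilon)
  then have "N \<in> null_sets \<mu>" using N by (simp add: null_sets_def)
  moreover have "A \<subseteq> N" using U(2) by (auto simp: N_def)
  ultimately show ?thesis by blast
qed

lemma emeasure_countable_UN_le:
  assumes D: "countable D" and E: "\<And>x. x \<in> D \<Longrightarrow> E x \<in> sets \<mu>" and F: "\<And>x. x \<in> D \<Longrightarrow> F x \<in> sets \<mu>"
    and disj: "disjoint_family_on F D" and le: "\<And>x. x \<in> D \<Longrightarrow> emeasure \<mu> (E x) \<le> k * emeasure \<mu> (F x)"
  shows "emeasure \<mu> (\<Union>x\<in>D. E x) \<le> k * emeasure \<mu> (\<Union>x\<in>D. F x)"
proof -
  define g where "g X i = (if i \<in> to_nat_on D ` D then X (from_nat_into D i) else {})" for X :: "'a \<Rightarrow> 'b set" and i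
  have UN: "(\<Union>i. g X i) = (\<Union>x\<in>D. X x)" for X
    unfolding g_def using D by (auto split: if_splits)
  have gs: "g X i \<in> sets \<mu>" if "\<And>x. x \<in> D \<Longrightarrow> X x \<in> sets \<mu>" for X i
    unfolding g_def using that D by (auto simp: image_iff)
  have "emeasure \<mu> (\<Union>x\<in>D. E x) \<le> (\<Sum>i. emeasure \<mu> (g E i))"
    unfolding UN[symmetric] using gs[of E] E by (intro emeasure_subadditive_countably) auto
  also have "\<dots> \<le> (\<Sum>i. k * emeasure \<mu> (g F i))"
    using le D by (intro suminf_le) (auto simp: g_def)
  also have "\<dots> = k * (\<Sum>i. emeasure \<mu> (g F i))" by simp
  also have "(\<Sum>i. emeasure \<mu> (g F i)) = emeasure \<mu> (\<Union>i. g F i)"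
  proof (rule suminf_emeasure)
    show "range (g F) \<subseteq> sets \<mu>" using gs[of F] F by auto
    show "disjoint_family (g F)"
      unfolding disjoint_family_on_def
    proof (intro ballI impI)
      fix m n :: nat assume mn: "m \<noteq> n"
      show "g F m \<inter> g F n = {}"
      proof (cases "m \<in> to_nat_on D ` D \<and> n \<in> to_nat_on D ` D")
        case True
        then obtain x y where xy: "x \<in> D" "y \<in> D" "m = to_nat_on D x" "n = to_nat_on D y" by blast
        then have "x \<noteq> y" using mn by auto
        then have "F x \<inter> F y = {}" using disj xy unfolding disjoint_family_on_def by blast
        then show ?thesis using xy D by (simp add: g_def)
      qed (auto simp: g_def)
    qed
  qed
  finally show ?thesis by (simp add: UN)
qed

text \<open>Density is measured against \<open>r powr s\<close>, not against the mass of the ball,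
  which may be much smaller. At a bad point with radius \<rho> the ball of radius 5 \<rho> has mass
  at most a constant times that of \<open>ball x \<rho> - G\<close>. A disjoint Vitali family sums
  these to the mass of the part of the complement within a small distance of G and in a bounded
  region, which tends to 0 because G is closed.\<close>

theorem density_point_closed_set:
  fixes \<mu> :: "'a::euclidean_space measure"
  assumes lf: "locally_finite_borel_measure \<mu>" and G: "closed G" and C: "0 < C" and s: "0 < s" and \<delta>0: "0 < \<delta>0"
    and reg: "\<And>z r. z \<in> G \<Longrightarrow> 0 < r \<Longrightarrow> r < \<delta>0 \<Longrightarrow> emeasure \<mu> (ball z r) \<le> ennreal (C * r powr s)"
  shows "AE x in \<mu>. x \<in> G \<longrightarrow> (\<forall>c>0. \<forall>\<^sub>F r in at_right 0. emeasure \<mu> (ball x r - G) \<le> ennreal (c * r powr s))"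
proof -
  have sb: "sets \<mu> = sets borel" using lf by (rule locally_finite_sets)
  have Gb: "G \<in> sets borel" using G by auto
  define A where "A c R = {x \<in> G \<inter> ball 0 R. \<forall>\<delta>>0. \<exists>r. 0 < r \<and> r < \<delta> \<and> ennreal (c * r powr s) < emeasure \<mu> (ball x r - G)}" for c R
  have null: "\<exists>N\<in>null_sets \<mu>. A c R \<subseteq> N" if c: "0 < c" for c R
  proof (rule null_setI_small_cover)
    fix e :: real assume e: "0 < e"
    show "\<exists>U\<in>sets \<mu>. A c R \<subseteq> U \<and> emeasure \<mu> U \<le> ennreal e"
    proof (cases "G = {}")
      case True
      then show ?thesis by (intro bexI[of _ "{}"]) (auto simp: A_def)
    next
      case ne: False
    define k where "k = C * 5 powr s / c"
    have k: "0 < k" using C c by (simp add: k_def)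
    define W where "W n = {y \<in> cball 0 (\<bar>R\<bar> + 1). y \<notin> G \<and> infdist y G < 1 / real (Suc n)}" for n
    have Wb: "W n \<in> sets \<mu>" for n
    proof -
      have "W n = cball 0 (\<bar>R\<bar> + 1) \<inter> - G \<inter> {y. infdist y G < 1 / real (Suc n)}" by (auto simp: W_def)
      moreover have "open {y. infdist y G < 1 / real (Suc n)}" by (intro open_Collect_less continuous_intros)
      ultimately show ?thesis using Gb sb by auto
    qed
    have "(\<lambda>n. emeasure \<mu> (W n)) \<longlonglongrightarrow> 0"
    proof -
      have "decseq W" unfolding W_def
      proof (rule decseq_SucI)
        fix n
        have "1 / real (Suc (Suc n)) \<le> 1 / real (Suc n)" by (intro divide_left_mono) auto
        then show "{y \<in> cball 0 (\<bar>R\<bar> + 1). y \<notin> G \<and> infdist y G < 1 / real (Suc (Suc n))} \<subseteq> {y \<in> cball 0 (\<bar>R\<bar> + 1). y \<notin> G \<and> infdist y G < 1 / real (Suc n)}" by auto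
      qed
      moreover have "(\<Inter>n. W n) = {}"
      proof (rule ccontr)
        assume "(\<Inter>n. W n) \<noteq> {}"
        then obtain y where y: "\<And>n. y \<in> W n" by blast
        then have "y \<notin> G" by (auto simp: W_def)
        then have "0 < infdist y G" using G ne by (simp add: infdist_pos_not_in_closed)
        then obtain n where "inverse (real (Suc n)) < infdist y G" using reals_Archimedean by blast
        then show False using y[of n] by (simp add: W_def inverse_eq_divide)
      qed
      moreover have "emeasure \<mu> (W n) \<noteq> \<infinity>" for n
      proof -
        have "W n \<subseteq> cball 0 (\<bar>R\<bar> + 1)" unfolding W_def by blast
        then have "bounded (W n)" by (rule bounded_subset[OF bounded_cball])
        then show ?thesis using emeasure_bounded_finite[OF lf] by (simp add: less_top)
      qed
      ultimately show ?thesis using Lim_emeasure_decseq[of W \<mu>] Wb by auto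
    qed
    then have "\<forall>\<^sub>F n in sequentially. emeasure \<mu> (W n) < ennreal (e / k)"
      using e k by (intro order_tendstoD) auto
    then obtain n where n: "emeasure \<mu> (W n) < ennreal (e / k)" by (auto simp: eventually_sequentially)
    \<comment> \<open>The three bounds keep \<open>ball x (\<rho> x) - G\<close> within distance 1 /
      (n + 1) of G, the fivefold balls in the range of the density bound, and everything inside the
      bounded region of \<open>W n\<close>.\<close>
    define \<delta> where "\<delta> = min (min (1 / real (Suc n)) (\<delta>0 / 5)) 1"
    have \<delta>: "0 < \<delta>" "\<delta> \<le> 1 / real (Suc n)" "\<delta> \<le> \<delta>0 / 5" "\<delta> \<le> 1" using \<delta>0 by (auto simp: \<delta>_def)
    have "\<forall>x\<in>A c R. \<exists>r. 0 < r \<and> r < \<delta> \<and> ennreal (c * r powr s) < emeasure \<mu> (ball x r - G)"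
      using \<delta>(1) by (auto simp: A_def)
    then obtain \<rho> where \<rho>: "\<And>x. x \<in> A c R \<Longrightarrow> 0 < \<rho> x" "\<And>x. x \<in> A c R \<Longrightarrow> \<rho> x < \<delta>"
      "\<And>x. x \<in> A c R \<Longrightarrow> ennreal (c * \<rho> x powr s) < emeasure \<mu> (ball x (\<rho> x) - G)" by metis
    have "A c R \<subseteq> (\<Union>x\<in>A c R. ball x (\<rho> x))" using \<rho>(1) centre_in_ball by blast
    then obtain D where D: "countable D" "D \<subseteq> A c R" "pairwise (\<lambda>x y. disjnt (ball x (\<rho> x)) (ball y (\<rho> y))) D"
      "A c R \<subseteq> (\<Union>x\<in>D. ball x (5 * \<rho> x))"
    proof (rule Vitali_covering_lemma_balls[where S="A c R" and K="A c R" and a="\<lambda>x. x" and r=\<rho> and B=\<delta>])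
      show "0 < \<rho> x \<and> \<rho> x \<le> \<delta>" if "x \<in> A c R" for x using \<rho>(1,2)[OF that] by simp
    qed
    let ?U = "\<Union>x\<in>D. ball x (5 * \<rho> x)"
    have "emeasure \<mu> ?U \<le> ennreal k * emeasure \<mu> (\<Union>x\<in>D. ball x (\<rho> x) - G)"
    proof (rule emeasure_countable_UN_le[OF D(1)])
      show "disjoint_family_on (\<lambda>x. ball x (\<rho> x) - G) D"
        using D(3) unfolding disjoint_family_on_def pairwise_def disjnt_def by blast
      fix x assume x: "x \<in> D"
      then have xA: "x \<in> A c R" using D(2) by blast
      have "emeasure \<mu> (ball x (5 * \<rho> x)) \<le> ennreal (C * (5 * \<rho> x) powr s)"
        using xA \<rho>(1,2)[OF xA] \<delta> by (intro reg) (auto simp: A_def)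
      also have "C * (5 * \<rho> x) powr s = k * (c * \<rho> x powr s)"
        using \<rho>(1)[OF xA] c by (simp add: k_def powr_mult)
      also have "ennreal \<dots> = ennreal k * ennreal (c * \<rho> x powr s)" using k c by (intro ennreal_mult) auto
      also have "\<dots> \<le> ennreal k * emeasure \<mu> (ball x (\<rho> x) - G)"
        using \<rho>(3)[OF xA] by (intro mult_left_mono) auto
      finally show "emeasure \<mu> (ball x (5 * \<rho> x)) \<le> ennreal k * emeasure \<mu> (ball x (\<rho> x) - G)" .
    qed (auto simp: sb Gb)
    also have "\<dots> \<le> ennreal k * emeasure \<mu> (W n)"
    proof (intro mult_left_mono emeasure_mono Wb)
      show "(\<Union>x\<in>D. ball x (\<rho> x) - G) \<subseteq> W n"
      proof (intro UN_least subsetI)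
        fix x y assume x: "x \<in> D" and y: "y \<in> ball x (\<rho> x) - G"
        have xA: "x \<in> A c R" using x D(2) by blast
        have d: "dist x y < \<rho> x" using y by simp
        have "norm y \<le> norm x + dist x y" using norm_triangle_ineq[of x "y - x"] by (simp add: dist_norm norm_minus_commute)
        moreover have "norm x < R" "x \<in> G" using xA by (auto simp: A_def)
        moreover have "infdist y G \<le> dist y x" using \<open>x \<in> G\<close> by (rule infdist_le)
        ultimately show "y \<in> W n" using y d \<rho>(2)[OF xA] \<delta> by (auto simp: W_def dist_commute)
      qed
    qed auto
    also have "\<dots> \<le> ennreal k * ennreal (e / k)" using n by (intro mult_left_mono) auto
    also have "\<dots> = ennreal e" using k e by (simp add: ennreal_mult[symmetric])
    finally show ?thesis
    proof (intro bexI[of _ ?U] conjI D(4))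
      have "open ?U" by (intro open_UN) auto
      then show "?U \<in> sets \<mu>" using sb by auto
    qed
    qed
  qed
  have "\<forall>n. \<exists>N\<in>null_sets \<mu>. A (1 / real (Suc n)) (real n) \<subseteq> N" using null by simp
  have ae: "AE x in \<mu>. \<forall>n R. x \<notin> A (1 / real (Suc n)) (real R)"
    unfolding AE_all_countable
  proof (intro allI)
    fix n R :: nat
    obtain N where "N \<in> null_sets \<mu>" "A (1 / real (Suc n)) (real R) \<subseteq> N" using null[of "1 / real (Suc n)" "real R"] by auto
    then show "AE x in \<mu>. x \<notin> A (1 / real (Suc n)) (real R)" by (intro AE_I'[of N]) auto
  qed
  then show ?thesis
  proof eventually_elim
    case (elim x)
    show ?case
    proof (intro impI allI)
      fix c :: real assume x: "x \<in> G" and c: "0 < c"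
      obtain n where n: "inverse (real (Suc n)) < c" using reals_Archimedean[OF c] by blast
      obtain R where R: "norm x < real R" using reals_Archimedean2 by blast
      have "x \<notin> A (1 / real (Suc n)) (real R)" using elim by blast
      then have "\<not> (\<forall>\<delta>>0. \<exists>r. 0 < r \<and> r < \<delta> \<and> ennreal (1 / real (Suc n) * r powr s) < emeasure \<mu> (ball x r - G))"
        using x R unfolding A_def by auto
      then obtain \<delta> where \<delta>: "0 < \<delta>" "\<And>r. 0 < r \<Longrightarrow> r < \<delta> \<Longrightarrow> emeasure \<mu> (ball x r - G) \<le> ennreal (1 / real (Suc n) * r powr s)"
        by (meson not_less)
      show "\<forall>\<^sub>F r in at_right 0. emeasure \<mu> (ball x r - G) \<le> ennreal (c * r powr s)"
      proof (rule eventually_mono[OF eventually_at_right_real[OF \<delta>(1)]])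
        fix r assume r: "r \<in> {0<..<\<delta>}"
        have "emeasure \<mu> (ball x r - G) \<le> ennreal (1 / real (Suc n) * r powr s)" using r by (intro \<delta>) auto
        also have "\<dots> \<le> ennreal (c * r powr s)" using n by (intro ennreal_leI mult_right_mono) (auto simp: inverse_eq_divide)
        finally show "emeasure \<mu> (ball x r - G) \<le> ennreal (c * r powr s)" .
      qed
    qed
  qed
qed

section \<open>Blow-ups\<close>

text \<open>A continuous substitute for the indicator of a ball, through which mass bounds pass to
  vague limits.\<close>

definition tent :: "'a::metric_space \<Rightarrow> real \<Rightarrow> real \<Rightarrow> 'a \<Rightarrow> real" where
  "tent z R R' y = max 0 (min 1 ((R' - dist z y) / (R' - R)))"

lemma tent_range: "0 \<le> tent z R R' y" "tent z R R' y \<le> 1"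
  by (auto simp: tent_def)

lemma tent_inside: "R < R' \<Longrightarrow> dist z y \<le> R \<Longrightarrow> tent z R R' y = 1"
  by (simp add: tent_def field_simps)

lemma tent_outside: "R < R' \<Longrightarrow> R' \<le> dist z y \<Longrightarrow> tent z R R' y = 0"
  by (simp add: tent_def divide_nonpos_pos)

lemma cont_compact_tent:
  fixes z :: "'a::euclidean_space"
  assumes "R < R'"
  shows "cont_compact (tent z R R')"
  unfolding cont_compact_def
proof (intro conjI exI allI impI)
  show "continuous_on UNIV (tent z R R')"
    unfolding tent_def[abs_def] using assms by (intro continuous_intros) auto
  fix y :: 'a assume "norm z + R' < norm y"
  then have "R' \<le> dist z y" using norm_triangle_ineq[of z "y - z"] by (simp add: dist_norm norm_minus_commute)
  then show "tent z R R' y = 0" by (rule tent_outside[OF assms])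
qed

lemma tent_integral_ge:
  fixes \<nu> :: "'a::euclidean_space measure"
  assumes lf: "locally_finite_borel_measure \<nu>" and R: "R < R'"
  shows "measure \<nu> (cball z R) \<le> (LINT y|\<nu>. tent z R R' y)"
proof -
  have sb: "sets \<nu> = sets borel" using lf by (rule locally_finite_sets)
  have fin: "emeasure \<nu> (cball z R) < \<infinity>" using emeasure_bounded_finite[OF lf bounded_cball] .
  have "measure \<nu> (cball z R) = (LINT y|\<nu>. indicat_real (cball z R) y)"
    using sets_eq_imp_space_eq[OF sb] by simp
  also have "\<dots> \<le> (LINT y|\<nu>. tent z R R' y)"
  proof (rule integral_mono)
    show "integrable \<nu> (indicat_real (cball z R))" using fin sb by (intro integrable_real_indicator) auto
    show "integrable \<nu> (tent z R R')" by (intro cont_compact_locally_finite_integrable cont_compact_tent R lf)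
    show "indicat_real (cball z R) y \<le> tent z R R' y" for y
      using tent_inside[OF R, of z y] tent_range(1)[of z R R' y] by (auto simp: indicator_def)
  qed
  finally show ?thesis .
qed

lemma tent_integral_le:
  fixes \<nu> :: "'a::euclidean_space measure"
  assumes lf: "locally_finite_borel_measure \<nu>" and R: "R < R'"
  shows "(LINT y|\<nu>. tent z R R' y) \<le> measure \<nu> (cball z R')"
proof -
  have "norm (LINT y|\<nu>. tent z R R' y) \<le> 1 * measure \<nu> (cball z R')"
    using tent_range[of z R R'] tent_outside[OF R, of z] cont_compact_tent[OF R, of z]
    by (intro integral_bounded_support(2)[OF lf]) (auto simp: cont_compact_def intro: borel_measurable_continuous_onI)
  then show ?thesis by simp
qed

text \<open>The restriction to A is what makes all blow-ups upper regular with one constant: near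
  points outside A the density of \<mu> is not controlled.\<close>

definition blowup :: "'a::euclidean_space measure \<Rightarrow> real \<Rightarrow> 'a set \<Rightarrow> 'a \<Rightarrow> real \<Rightarrow> 'a measure" where
  "blowup \<mu> s A x r = distr (density \<mu> (\<lambda>y. ennreal (r powr - s * indicat_real A y))) borel (\<lambda>y. (y - x) /\<^sub>R r)"

lemma sets_blowup [simp]: "sets (blowup \<mu> s A x r) = sets borel"
  by (simp add: blowup_def)

lemma measurable_rescale: "sets \<mu> = sets borel \<Longrightarrow> (\<lambda>y. (y - x) /\<^sub>R r) \<in> borel_measurable (\<mu> :: 'a::euclidean_space measure)"
  using measurable_cong_sets[of \<mu> borel borel borel]
  by (auto intro!: borel_measurable_continuous_onI continuous_intros)

lemma emeasure_blowup:
  fixes \<mu> :: "'a::euclidean_space measure"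
  assumes sb: "sets \<mu> = sets borel" and A: "A \<in> sets borel" and X: "X \<in> sets borel" and r: "0 < r"
  shows "emeasure (blowup \<mu> s A x r) X = ennreal (r powr - s) * emeasure \<mu> (A \<inter> {y. (y - x) /\<^sub>R r \<in> X})"
proof -
  have pre: "{y. (y - x) /\<^sub>R r \<in> X} \<in> sets \<mu>"
    using measurable_sets[OF measurable_rescale[where \<mu>=borel and x=x and r=r] X] sb by (simp add: vimage_def)
  have sp: "space \<mu> = UNIV" using sets_eq_imp_space_eq[OF sb] by simp
  have Am: "A \<in> sets \<mu>" using A sb by simp
  have im: "(\<lambda>y. ennreal (r powr - s * indicat_real A y)) \<in> borel_measurable \<mu>" using Am by measurable
  have "emeasure (blowup \<mu> s A x r) X = emeasure (density \<mu> (\<lambda>y. ennreal (r powr - s * indicat_real A y))) {y. (y - x) /\<^sub>R r \<in> X}"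
    unfolding blowup_def using X measurable_rescale[where \<mu>="density \<mu> (\<lambda>y. ennreal (r powr - s * indicat_real A y))" and x=x and r=r] sb
    by (subst emeasure_distr) (auto simp: sp vimage_def)
  also have "\<dots> = (\<integral>\<^sup>+y. ennreal (r powr - s * indicat_real A y) * indicator {y. (y - x) /\<^sub>R r \<in> X} y \<partial>\<mu>)"
    by (rule emeasure_density[OF im pre])
  also have "\<dots> = (\<integral>\<^sup>+y. ennreal (r powr - s) * indicator (A \<inter> {y. (y - x) /\<^sub>R r \<in> X}) y \<partial>\<mu>)"
    by (intro nn_integral_cong) (auto simp: indicator_def)
  also have "\<dots> = ennreal (r powr - s) * emeasure \<mu> (A \<inter> {y. (y - x) /\<^sub>R r \<in> X})"
    by (rule nn_integral_cmult_indicator) (rule sets.Int[OF Am pre])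
  finally show ?thesis .
qed

lemma integral_blowup:
  fixes \<mu> :: "'a::euclidean_space measure" and f :: "'a \<Rightarrow> 'b::{banach,second_countable_topology}"
  assumes sb: "sets \<mu> = sets borel" and A: "A \<in> sets borel" and f: "f \<in> borel_measurable borel"
  shows "(LINT y|blowup \<mu> s A x r. f y) = r powr - s *\<^sub>R (LINT y|\<mu>. indicat_real A y *\<^sub>R f ((y - x) /\<^sub>R r))"
proof -
  have Am: "A \<in> sets \<mu>" using A sb by simp
  have im: "(\<lambda>y. r powr - s * indicat_real A y) \<in> borel_measurable \<mu>" using Am by measurable
  have fm: "(\<lambda>y. f ((y - x) /\<^sub>R r)) \<in> borel_measurable \<mu>"
    by (rule measurable_compose[OF measurable_rescale[OF sb] f])
  have "(LINT y|blowup \<mu> s A x r. f y) = (LINT y|density \<mu> (\<lambda>y. ennreal (r powr - s * indicat_real A y)). f ((y - x) /\<^sub>R r))"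
    unfolding blowup_def using measurable_rescale[where \<mu>="density \<mu> (\<lambda>y. ennreal (r powr - s * indicat_real A y))" and x=x and r=r] sb f
    by (intro integral_distr) auto
  also have "\<dots> = (LINT y|\<mu>. (r powr - s * indicat_real A y) *\<^sub>R f ((y - x) /\<^sub>R r))"
    by (rule integral_density[OF fm im]) (intro AE_I2 mult_nonneg_nonneg powr_ge_zero indicator_pos_le)
  also have "\<dots> = (LINT y|\<mu>. r powr - s *\<^sub>R (indicat_real A y *\<^sub>R f ((y - x) /\<^sub>R r)))"
    by (simp only: scaleR_scaleR)
  also have "\<dots> = r powr - s *\<^sub>R (LINT y|\<mu>. indicat_real A y *\<^sub>R f ((y - x) /\<^sub>R r))" by (rule integral_scaleR_right)
  finally show ?thesis .
qed

lemma rescale_cball: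
  fixes x z :: "'a::euclidean_space"
  shows "0 < r \<Longrightarrow> {y. (y - x) /\<^sub>R r \<in> cball z R} = cball (x + r *\<^sub>R z) (r * R)"
proof (intro set_eqI)
  fix y :: 'a assume r: "0 < r"
  have "dist z ((y - x) /\<^sub>R r) = dist (x + r *\<^sub>R z) y / r"
  proof -
    have "(x + r *\<^sub>R z) - y = r *\<^sub>R z - (y - x)" by simp
    then have "((x + r *\<^sub>R z) - y) /\<^sub>R r = (r *\<^sub>R z) /\<^sub>R r - (y - x) /\<^sub>R r"
      by (simp only: scaleR_right_diff_distrib)
    also have "(r *\<^sub>R z) /\<^sub>R r = z" using r by simp
    finally have "z - (y - x) /\<^sub>R r = ((x + r *\<^sub>R z) - y) /\<^sub>R r" by simp
    then show ?thesis using r by (simp add: dist_norm divide_inverse mult.commute)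
  qed
  then show "y \<in> {y. (y - x) /\<^sub>R r \<in> cball z R} \<longleftrightarrow> y \<in> cball (x + r *\<^sub>R z) (r * R)"
    using r by (simp add: pos_divide_le_eq mult.commute)
qed

text \<open>The growth bound is known only for small balls centred in E. A closed ball of radius t
  meeting E lies in an open one centred in E of radius 3 t; once 3 t reaches \<delta>0 the total
  mass of \<open>cball x 1\<close> suffices.\<close>

lemma upper_regular_restriction:
  fixes \<mu> :: "'a::euclidean_space measure"
  assumes lf: "locally_finite_borel_measure \<mu>" and C: "0 < C" and s: "0 < s" and \<delta>0: "0 < \<delta>0"
    and reg: "\<And>z r. z \<in> E \<Longrightarrow> 0 < r \<Longrightarrow> r < \<delta>0 \<Longrightarrow> emeasure \<mu> (ball z r) \<le> ennreal (C * r powr s)"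
  shows "\<exists>C1>0. \<forall>w. \<forall>t>0. emeasure \<mu> ((E \<inter> cball x 1) \<inter> cball w t) \<le> ennreal (C1 * t powr s)"
proof -
  have sb: "sets \<mu> = sets borel" using lf by (rule locally_finite_sets)
  define M where "M = measure \<mu> (cball x 1)"
  have M: "emeasure \<mu> (cball x 1) = ennreal M"
    using emeasure_bounded_finite[OF lf bounded_cball, of x 1] by (simp add: M_def emeasure_eq_ennreal_measure less_top)
  have M0: "0 \<le> M" by (simp add: M_def)
  define C1 where "C1 = C * 3 powr s + M * (3 / \<delta>0) powr s"
  have C1: "0 < C1" using C M0 by (simp add: C1_def add_pos_nonneg)
  have "emeasure \<mu> ((E \<inter> cball x 1) \<inter> cball w t) \<le> ennreal (C1 * t powr s)" if t: "0 < t" for w t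
  proof (cases "(E \<inter> cball x 1) \<inter> cball w t = {}")
    case False
    then obtain w' where w': "w' \<in> E" "dist w w' \<le> t" by auto
    show ?thesis
    proof (cases "3 * t < \<delta>0")
      case True
      have "cball w t \<subseteq> ball w' (3 * t)"
      proof
        fix y assume "y \<in> cball w t"
        then show "y \<in> ball w' (3 * t)" using w'(2) t dist_triangle[of w' y w] by (simp add: dist_commute)
      qed
      then have "emeasure \<mu> ((E \<inter> cball x 1) \<inter> cball w t) \<le> emeasure \<mu> (ball w' (3 * t))"
        by (intro emeasure_mono) (auto simp: sb)
      also have "\<dots> \<le> ennreal (C * (3 * t) powr s)" using True t w' by (intro reg) auto
      also have "C * (3 * t) powr s = C * 3 powr s * t powr s" using t by (simp add: powr_mult)
      also have "ennreal \<dots> \<le> ennreal (C1 * t powr s)"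
        using M0 by (intro ennreal_leI mult_right_mono) (auto simp: C1_def)
      finally show ?thesis .
    next
      case False
      have "emeasure \<mu> ((E \<inter> cball x 1) \<inter> cball w t) \<le> emeasure \<mu> (cball x 1)"
        by (intro emeasure_mono) (auto simp: sb)
      also have "\<dots> = ennreal (M * 1)" using M by simp
      also have "\<dots> \<le> ennreal (M * ((3 / \<delta>0) powr s * t powr s))"
      proof (intro ennreal_leI mult_left_mono M0)
        have "1 \<le> 3 / \<delta>0 * t" using False \<delta>0 by (simp add: field_simps)
        then have "1 powr s \<le> (3 / \<delta>0 * t) powr s" using s by (intro powr_mono2) auto
        then show "1 \<le> (3 / \<delta>0) powr s * t powr s" using t \<delta>0 by (simp only: powr_mult) simp
      qed
      also have "\<dots> \<le> ennreal (C1 * t powr s)"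
      proof (rule ennreal_leI)
        have "C1 * t powr s = C * 3 powr s * t powr s + M * ((3 / \<delta>0) powr s * t powr s)"
          by (simp add: C1_def distrib_right)
        then show "M * ((3 / \<delta>0) powr s * t powr s) \<le> C1 * t powr s" using C by simp
      qed
      finally show ?thesis .
    qed
  qed simp
  then show ?thesis using C1 by blast
qed

lemma qk_scale: "0 < r \<Longrightarrow> qk (r * \<rho>) (r *\<^sub>R v) = r\<^sup>2 * qk \<rho> v"
  by (simp add: qk_def power_mult_distrib max_mult_distrib_left right_diff_distrib)

lemma emeasure_blowup_cball:
  fixes \<mu> :: "'a::euclidean_space measure"
  assumes "sets \<mu> = sets borel" "A \<in> sets borel" "0 < r"
  shows "emeasure (blowup \<mu> s A x r) (cball z R) = ennreal (r powr - s) * emeasure \<mu> (A \<inter> cball (x + r *\<^sub>R z) (r * R))"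
  by (simp only: emeasure_blowup[OF assms(1,2) borel_closed[OF closed_cball] assms(3)] rescale_cball[OF assms(3)])

text \<open>The exponent consists of s from the normalisation, 4 from the squared kernel and 1 from
  the vector.\<close>

lemma sym_moment_blowup:
  fixes \<mu> :: "'a::euclidean_space measure"
  assumes sb: "sets \<mu> = sets borel" and A: "A \<in> sets borel" and r: "0 < r"
  shows "sym_moment (blowup \<mu> s A x r) z \<rho> =
    r powr - (s + 5) *\<^sub>R (LINT y|\<mu>. indicat_real A y *\<^sub>R ((qk (r * \<rho>) (x + r *\<^sub>R z - y))\<^sup>2 *\<^sub>R (x + r *\<^sub>R z - y)))"
proof -
  have "sym_moment (blowup \<mu> s A x r) z \<rho> = r powr - s *\<^sub>R (LINT y|\<mu>. indicat_real A y *\<^sub>R ((qk \<rho> (z - (y - x) /\<^sub>R r))\<^sup>2 *\<^sub>R (z - (y - x) /\<^sub>R r)))"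
    unfolding sym_moment_def
    by (rule integral_blowup[OF sb A]) (intro borel_measurable_continuous_onI continuous_intros)
  also have "(\<lambda>y. indicat_real A y *\<^sub>R ((qk \<rho> (z - (y - x) /\<^sub>R r))\<^sup>2 *\<^sub>R (z - (y - x) /\<^sub>R r)))
     = (\<lambda>y. r powr - 5 *\<^sub>R (indicat_real A y *\<^sub>R ((qk (r * \<rho>) (x + r *\<^sub>R z - y))\<^sup>2 *\<^sub>R (x + r *\<^sub>R z - y))))"
  proof
    fix y
    define v where "v = z - (y - x) /\<^sub>R r"
    have rv: "x + r *\<^sub>R z - y = r *\<^sub>R v" using r by (simp add: v_def scaleR_right_diff_distrib)
    have p5: "r powr - 5 * (r ^ 4 * r) = 1"
    proof -
      have "r ^ 4 * r = r ^ 5" by (simp add: power_numeral_reduce)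
      then show ?thesis using r by (simp add: powr_minus powr_numeral)
    qed
    have q2: "(qk (r * \<rho>) (r *\<^sub>R v))\<^sup>2 = r ^ 4 * (qk \<rho> v)\<^sup>2"
      unfolding qk_scale[OF r] by (simp add: power_mult_distrib power_mult[symmetric])
    have "r powr - 5 *\<^sub>R (indicat_real A y *\<^sub>R ((qk (r * \<rho>) (r *\<^sub>R v))\<^sup>2 *\<^sub>R (r *\<^sub>R v)))
       = (r powr - 5 * (r ^ 4 * r)) *\<^sub>R (indicat_real A y *\<^sub>R ((qk \<rho> v)\<^sup>2 *\<^sub>R v))"
      unfolding q2 by (simp add: mult_ac)
    then show "indicat_real A y *\<^sub>R ((qk \<rho> (z - (y - x) /\<^sub>R r))\<^sup>2 *\<^sub>R (z - (y - x) /\<^sub>R r))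
       = r powr - 5 *\<^sub>R (indicat_real A y *\<^sub>R ((qk (r * \<rho>) (x + r *\<^sub>R z - y))\<^sup>2 *\<^sub>R (x + r *\<^sub>R z - y)))"
      unfolding rv v_def[symmetric] by (simp only: p5 scaleR_one)
  qed
  also have "(LINT y|\<mu>. r powr - 5 *\<^sub>R (indicat_real A y *\<^sub>R ((qk (r * \<rho>) (x + r *\<^sub>R z - y))\<^sup>2 *\<^sub>R (x + r *\<^sub>R z - y))))
     = r powr - 5 *\<^sub>R (LINT y|\<mu>. indicat_real A y *\<^sub>R ((qk (r * \<rho>) (x + r *\<^sub>R z - y))\<^sup>2 *\<^sub>R (x + r *\<^sub>R z - y)))"
    by (rule integral_scaleR_right)
  also have "r powr - s *\<^sub>R (r powr - 5 *\<^sub>R X) = r powr - (s + 5) *\<^sub>R X" for X :: 'a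
  proof -
    have e: "- (s + 5) = - s + - 5" by simp
    show ?thesis by (simp only: e powr_add scaleR_scaleR)
  qed
  finally show ?thesis .
qed

lemma sym_moment_tendsto:
  fixes \<sigma> :: "nat \<Rightarrow> 'a::euclidean_space measure"
  assumes lf: "\<And>n. locally_finite_borel_measure (\<sigma> n)" "locally_finite_borel_measure \<nu>"
    and conv: "\<And>f :: 'a \<Rightarrow> real. cont_compact f \<Longrightarrow> (\<lambda>n. LINT y|\<sigma> n. f y) \<longlonglongrightarrow> (LINT y|\<nu>. f y)"
    and \<rho>: "0 < \<rho>"
  shows "(\<lambda>n. sym_moment (\<sigma> n) z \<rho>) \<longlonglongrightarrow> sym_moment \<nu> z \<rho>"
proof (subst tendsto_componentwise_iff, intro ballI)
  fix b :: 'a assume "b \<in> Basis"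
  have eq: "sym_moment \<mu> z \<rho> \<bullet> b = (LINT y|\<mu>. (qk \<rho> (z - y))\<^sup>2 * ((z - y) \<bullet> b))" if "locally_finite_borel_measure \<mu>" for \<mu>
  proof -
    have "(LINT y|\<mu>. ((qk \<rho> (z - y))\<^sup>2 *\<^sub>R (z - y)) \<bullet> b) = sym_moment \<mu> z \<rho> \<bullet> b"
      unfolding sym_moment_def using \<rho> by (intro integral_inner_left integrable_sym_kernel that) auto
    then show ?thesis by simp
  qed
  have "cont_compact (\<lambda>y. (qk \<rho> (z - y))\<^sup>2 * ((z - y) \<bullet> b))"
    unfolding cont_compact_def
  proof (intro conjI exI allI impI)
    show "continuous_on UNIV (\<lambda>y. (qk \<rho> (z - y))\<^sup>2 * ((z - y) \<bullet> b))" by (intro continuous_intros)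
    fix y :: 'a assume "norm z + \<rho> < norm y"
    then have "\<rho> \<le> norm (z - y)" using norm_triangle_ineq[of z "y - z"] by (simp add: norm_minus_commute)
    then show "(qk \<rho> (z - y))\<^sup>2 * ((z - y) \<bullet> b) = 0" using \<rho> by (simp add: qk_outside)
  qed
  from conv[OF this] show "(\<lambda>n. sym_moment (\<sigma> n) z \<rho> \<bullet> b) \<longlonglongrightarrow> sym_moment \<nu> z \<rho> \<bullet> b"
    by (simp only: eq[OF lf(1)] eq[OF lf(2)])
qed

text \<open>Tents of slightly larger radius transfer the bound to the limit; that radius then
  decreases to R.\<close>

lemma upper_regular_limit:
  fixes \<sigma> :: "nat \<Rightarrow> 'a::euclidean_space measure"
  assumes reg: "\<And>n. upper_regular (\<sigma> n) s C" and lf: "locally_finite_borel_measure \<nu>" and s: "0 < s"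
    and conv: "\<And>f :: 'a \<Rightarrow> real. cont_compact f \<Longrightarrow> (\<lambda>n. LINT y|\<sigma> n. f y) \<longlonglongrightarrow> (LINT y|\<nu>. f y)"
  shows "upper_regular \<nu> s C"
  unfolding upper_regular_def
proof (intro conjI allI impI)
  show "sets \<nu> = sets borel" using lf by (rule locally_finite_sets)
  show C: "0 < C" using reg[of 0] by (simp add: upper_regular_def)
  fix z :: 'a and R :: real assume R: "0 < R"
  have le: "measure \<nu> (cball z R) \<le> C * R' powr s" if R': "R < R'" for R'
  proof -
    have "(LINT y|\<nu>. tent z R R' y) \<le> C * R' powr s"
    proof (rule LIMSEQ_le_const2[OF conv[OF cont_compact_tent[OF R']]], intro exI allI impI)
      fix n :: nat
      have "(LINT y|\<sigma> n. tent z R R' y) \<le> measure (\<sigma> n) (cball z R')"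
        by (rule tent_integral_le[OF upper_regular_locally_finite[OF reg] R'])
      also have "\<dots> \<le> C * R' powr s" using R R' by (intro upper_regular_measure_le[OF reg]) auto
      finally show "(LINT y|\<sigma> n. tent z R R' y) \<le> C * R' powr s" .
    qed
    then show ?thesis using tent_integral_ge[OF lf R', of z] by linarith
  qed
  have "measure \<nu> (cball z R) \<le> C * R powr s"
  proof (rule tendsto_lowerbound)
    show "((\<lambda>R'. C * R' powr s) \<longlongrightarrow> C * R powr s) (at_right R)"
      using R by (intro tendsto_intros) auto
    show "\<forall>\<^sub>F R' in at_right R. measure \<nu> (cball z R) \<le> C * R' powr s"
      using le by (rule eventually_mono[OF eventually_at_right_less])
  qed simp
  then show "emeasure \<nu> (cball z R) \<le> ennreal (C * R powr s)"
    using emeasure_bounded_finite[OF lf bounded_cball, of z R]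
    by (simp add: emeasure_eq_ennreal_measure less_top ennreal_leI)
qed

text \<open>E carries uniform density bounds, \<open>G n\<close> uniform moment bounds of accuracy 1
  / (n + 1), and x is a density point of each \<open>G n\<close>. Restricting \<mu> to E near x
  makes the blow-ups upper regular and, since E contains the sets \<open>G n\<close>, removes only
  mass that vanishes in the limit.\<close>

theorem tangent_measure_flat:
  fixes \<mu> :: "'a::euclidean_space measure" and G :: "nat \<Rightarrow> 'a set"
  assumes lf: "locally_finite_borel_measure \<mu>" and s: "0 < s" and E: "closed E" and C: "0 < C" and \<delta>0: "0 < \<delta>0"
    and reg: "\<And>z r. z \<in> E \<Longrightarrow> 0 < r \<Longrightarrow> r < \<delta>0 \<Longrightarrow> emeasure \<mu> (ball z r) \<le> ennreal (C * r powr s)"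
    and G: "\<And>n. G n \<subseteq> E" "\<And>n. x \<in> G n" "\<And>n. G n \<in> sets borel"
    and dens: "\<And>n c. 0 < c \<Longrightarrow> \<forall>\<^sub>F r in at_right 0. emeasure \<mu> (ball x r - G n) \<le> ennreal (c * r powr s)"
    and small: "\<And>n. \<exists>\<delta>>0. \<forall>z\<in>G n. \<forall>r. 0 < r \<and> r < \<delta> \<longrightarrow> norm (sym_moment \<mu> z r) \<le> 1 / real (Suc n) * r powr (s + 5)"
    and rr: "\<And>n. 0 < rr n" "rr \<longlonglongrightarrow> 0" and c: "0 < c"
    and low: "\<And>n. ennreal (c * rr n powr s) \<le> emeasure \<mu> (ball x (4 * rr n))"
  shows "\<exists>k V \<kappa>. strict_mono k \<and> subspace V \<and> real (dim V) = s \<and> 0 < measure (hausdorff_on s V) (cball 0 1) \<and>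
    (\<forall>f :: 'a \<Rightarrow> real. cont_compact f \<longrightarrow>
      (\<lambda>n. rr (k n) powr - s * (LINT y|\<mu>. f ((y - x) /\<^sub>R rr (k n)))) \<longlonglongrightarrow> \<kappa> * (LINT y|hausdorff_on s V. f y))"
proof -
  have sb: "sets \<mu> = sets borel" using lf by (rule locally_finite_sets)
  have Eb: "E \<in> sets borel" using E by auto
  define A where "A = E \<inter> cball x 1"
  have Ab: "A \<in> sets borel" using Eb by (auto simp: A_def)
  obtain C1 where C1: "0 < C1" "\<And>w t. 0 < t \<Longrightarrow> emeasure \<mu> (A \<inter> cball w t) \<le> ennreal (C1 * t powr s)"
    using upper_regular_restriction[where x=x, OF lf C s \<delta>0 reg] unfolding A_def by metis
  define \<sigma> where "\<sigma> n = blowup \<mu> s A x (rr n)" for n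
  have \<sigma>reg: "upper_regular (\<sigma> n) s C1" for n
    unfolding upper_regular_def
  proof (intro conjI allI impI)
    fix z R assume R: "0 < (R::real)"
    have "emeasure (\<sigma> n) (cball z R) = ennreal (rr n powr - s) * emeasure \<mu> (A \<inter> cball (x + rr n *\<^sub>R z) (rr n * R))"
      unfolding \<sigma>_def by (rule emeasure_blowup_cball[OF sb Ab rr(1)])
    also have "\<dots> \<le> ennreal (rr n powr - s) * ennreal (C1 * (rr n * R) powr s)"
      using rr(1)[of n] R by (intro mult_left_mono C1) auto
    also have "\<dots> = ennreal (rr n powr - s * (C1 * (rr n * R) powr s))" using C1 by (intro ennreal_mult[symmetric]) auto
    also have "rr n powr - s * (C1 * (rr n * R) powr s) = C1 * R powr s"
      using rr(1)[of n] R by (simp add: powr_mult powr_minus)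
    finally show "emeasure (\<sigma> n) (cball z R) \<le> ennreal (C1 * R powr s)" .
  qed (auto simp: \<sigma>_def C1(1))
  have \<sigma>lf: "locally_finite_borel_measure (\<sigma> n)" for n by (rule upper_regular_locally_finite[OF \<sigma>reg])
  have rrK: "\<forall>\<^sub>F n in sequentially. rr n * K < e" if "0 < e" for K e
  proof -
    have "(\<lambda>n. rr n * K) \<longlonglongrightarrow> 0 * K" by (intro tendsto_mult rr(2) tendsto_const)
    then show ?thesis using that by (intro order_tendstoD) auto
  qed
  have densn: "\<forall>\<^sub>F n in sequentially. emeasure \<mu> (ball x (rr n * K) - G m) \<le> ennreal (e * rr n powr s)"
    if K: "0 < K" and e: "0 < e" for K e m
  proof -
    have "filterlim (\<lambda>n. rr n * K) (at_right 0) sequentially"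
    proof -
      have "rr n * K \<in> {0<..} \<and> rr n * K \<noteq> 0" for n
        using mult_pos_pos[OF rr(1)[of n] K] K rr(1)[of n] by (auto dest: less_imp_neq)
      moreover have "(\<lambda>n. rr n * K) \<longlonglongrightarrow> 0" using tendsto_mult[OF rr(2) tendsto_const[of K]] by simp
      ultimately show ?thesis by (simp add: filterlim_at)
    qed
    moreover have "0 < e / K powr s" using e K by simp
    ultimately have "\<forall>\<^sub>F n in sequentially. emeasure \<mu> (ball x (rr n * K) - G m) \<le> ennreal (e / K powr s * (rr n * K) powr s)"
      using dens[of "e / K powr s" m] by (auto simp: filterlim_iff)
    then show ?thesis
    proof eventually_elim
      case (elim n)
      have "e / K powr s * (rr n * K) powr s = e * rr n powr s" using rr(1)[of n] K by (simp add: powr_mult)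
      then show ?case using elim by simp
    qed
  qed
  \<comment> \<open>The part of the ball outside A lies outside \<open>G 0\<close> and so has mass
    below half of the assumed lower bound at small scales.\<close>
  have lowA: "\<forall>\<^sub>F n in sequentially. ennreal (c / 2) \<le> emeasure (\<sigma> n) (cball 0 4)"
  proof -
    have "\<forall>\<^sub>F n in sequentially. emeasure \<mu> (ball x (rr n * 4) - G 0) \<le> ennreal (c / 2 * rr n powr s)"
      by (rule densn) (use c in auto)
    moreover have "\<forall>\<^sub>F n in sequentially. rr n * 4 < 1" by (rule rrK) simp
    ultimately show ?thesis
    proof eventually_elim
      case n: (elim n)
    have sub: "ball x (4 * rr n) \<subseteq> (A \<inter> cball x (rr n * 4)) \<union> (ball x (rr n * 4) - G 0)"
      using n(2) G(1)[of 0] by (auto simp: A_def mult.commute)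
    have "ennreal (c * rr n powr s) \<le> emeasure \<mu> ((A \<inter> cball x (rr n * 4)) \<union> (ball x (rr n * 4) - G 0))"
      using Ab G(3)[of 0] by (intro order_trans[OF low emeasure_mono[OF sub]]) (auto simp: sb)
    also have "\<dots> \<le> emeasure \<mu> (A \<inter> cball x (rr n * 4)) + emeasure \<mu> (ball x (rr n * 4) - G 0)"
      using Ab G(3)[of 0] by (intro emeasure_subadditive) (auto simp: sb)
    also have "\<dots> \<le> emeasure \<mu> (A \<inter> cball x (rr n * 4)) + ennreal (c / 2 * rr n powr s)"
      by (intro add_left_mono n)
    finally have "ennreal (c * rr n powr s) \<le> emeasure \<mu> (A \<inter> cball x (rr n * 4)) + ennreal (c / 2 * rr n powr s)" .
    moreover have "ennreal (c * rr n powr s) = ennreal (c / 2 * rr n powr s) + ennreal (c / 2 * rr n powr s)"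
      using c by (subst ennreal_plus[symmetric]) (auto simp: field_simps)
    ultimately have uX: "ennreal (c / 2 * rr n powr s) + ennreal (c / 2 * rr n powr s) \<le> emeasure \<mu> (A \<inter> cball x (rr n * 4)) + ennreal (c / 2 * rr n powr s)"
      by (simp only:)
    have h: "ennreal (c / 2 * rr n powr s) \<le> emeasure \<mu> (A \<inter> cball x (rr n * 4))"
    proof -
      have "u \<le> X" if "u + u \<le> X + u" "u \<noteq> top" for u X :: ennreal
        using that by (simp add: add.commute[of X] ennreal_add_left_cancel_le)
      then show ?thesis using uX ennreal_neq_top by blast
    qed
    have "ennreal (c / 2) = ennreal (rr n powr - s) * ennreal (c / 2 * rr n powr s)"
      using c rr(1)[of n] by (simp add: ennreal_mult[symmetric] powr_minus)
    also have "\<dots> \<le> ennreal (rr n powr - s) * emeasure \<mu> (A \<inter> cball x (rr n * 4))" by (intro mult_left_mono h) auto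
    also have "\<dots> = emeasure (\<sigma> n) (cball 0 4)"
      unfolding \<sigma>_def emeasure_blowup_cball[OF sb Ab rr(1)] by simp
    finally show "ennreal (c / 2) \<le> emeasure (\<sigma> n) (cball 0 4)" .
    qed
  qed
  then obtain N where N: "\<And>n. N \<le> n \<Longrightarrow> ennreal (c / 2) \<le> emeasure (\<sigma> n) (cball 0 4)"
    by (auto simp: eventually_sequentially)
  \<comment> \<open>The compactness theorem asks for the lower bound at every index, whereas it
    holds only from N on; hence the shift.\<close>
  have h1: "sets (\<sigma> (n + N)) = sets borel" for n by (simp add: \<sigma>_def)
  have h2: "emeasure (\<sigma> (n + N)) (cball 0 R) \<le> ennreal (C1 * R powr s)" if "1 \<le> R" for n R
    using \<sigma>reg[of "n + N"] that unfolding upper_regular_def by simp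
  have h3: "ennreal (c / 2) \<le> emeasure (\<sigma> (n + N)) (cball 0 4)" for n by (rule N) simp
  have c2: "0 < c / 2" using c by simp
  note ex = vague_compactness[of "\<lambda>n. \<sigma> (n + N)", OF h1 h2 C1(1) s h3 c2 zero_less_numeral, simplified]
  from ex obtain k0 \<nu> where k0: "strict_mono (k0 :: nat \<Rightarrow> nat)" and \<nu>lf: "locally_finite_borel_measure \<nu>"
    and conv0': "\<forall>f :: 'a \<Rightarrow> real. cont_compact f \<longrightarrow> (\<lambda>n. LINT y|\<sigma> (k0 n + N). f y) \<longlonglongrightarrow> (LINT y|\<nu>. f y)"
    by (elim exE conjE)
  note conv0 = conv0'[rule_format]
  define k where "k n = k0 n + N" for n
  have k: "strict_mono k" using k0 by (auto simp: k_def strict_mono_def)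
  have kinf: "filterlim k sequentially sequentially" using k by (rule filterlim_subseq)
  have evk: "\<forall>\<^sub>F n in sequentially. P (k n)" if "\<forall>\<^sub>F n in sequentially. P n" for P
    using kinf that by (auto simp: filterlim_iff)
  have conv: "(\<lambda>n. LINT y|\<sigma> (k n). f y) \<longlonglongrightarrow> (LINT y|\<nu>. f y)" if "cont_compact f" for f :: "'a \<Rightarrow> real"
    using conv0[OF that] by (simp add: k_def)
  have \<nu>reg: "upper_regular \<nu> s C1" by (rule upper_regular_limit[OF \<sigma>reg \<nu>lf s conv])
  have symlim: "(\<lambda>n. sym_moment (\<sigma> (k n)) z \<rho>) \<longlonglongrightarrow> sym_moment \<nu> z \<rho>" if "0 < \<rho>" for z \<rho>
    by (rule sym_moment_tendsto[OF \<sigma>lf \<nu>lf conv that])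
  \<comment> \<open>The moment of the blow-up at z' is that of \<mu> at the corresponding point of
    \<open>G m\<close>, minus the contribution from outside A. The first is small because 1 / (m +
    1) is, the second because x is a density point of \<open>G m\<close>; each gets half of
    e.\<close>
  have near: "\<exists>m. \<forall>\<^sub>F n in sequentially. \<forall>z'. norm z' \<le> L \<and> x + rr n *\<^sub>R z' \<in> G m \<longrightarrow> norm (sym_moment (\<sigma> n) z' \<rho>) \<le> e"
    if \<rho>: "0 < \<rho>" and e: "0 < e" and L: "0 \<le> L" for \<rho> e L
  proof -
    obtain m where m: "inverse (real (Suc m)) < e / (2 * \<rho> powr (s + 5))"
      using reals_Archimedean[of "e / (2 * \<rho> powr (s + 5))"] e \<rho> by auto
    obtain \<delta> where \<delta>: "0 < \<delta>" "\<And>z r. z \<in> G m \<Longrightarrow> 0 < r \<Longrightarrow> r < \<delta> \<Longrightarrow> norm (sym_moment \<mu> z r) \<le> 1 / real (Suc m) * r powr (s + 5)"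
      using small[of m] by blast
    have "0 < L + \<rho> + 1" "0 < e / (2 * \<rho> ^ 5)" using L \<rho> e by auto
    from densn[OF this, of m] rrK[OF \<delta>(1), of \<rho>] rrK[OF zero_less_one, of "L + \<rho> + 1"]
    have "\<forall>\<^sub>F n in sequentially. \<forall>z'. norm z' \<le> L \<and> x + rr n *\<^sub>R z' \<in> G m \<longrightarrow> norm (sym_moment (\<sigma> n) z' \<rho>) \<le> e"
    proof eventually_elim
      case (elim n)
      define r where "r = rr n"
      have r: "0 < r" using rr(1) by (simp add: r_def)
      show ?case
      proof (intro allI impI, elim conjE)
        fix z' :: 'a assume z': "norm z' \<le> L" "x + rr n *\<^sub>R z' \<in> G m"
        define w where "w = x + r *\<^sub>R z'"
        define K where "K y = (qk (r * \<rho>) (w - y))\<^sup>2 *\<^sub>R (w - y)" for y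
        have wG: "w \<in> G m" using z' by (simp add: w_def r_def)
        have Ki: "integrable \<mu> K" unfolding K_def using r \<rho> by (intro integrable_sym_kernel lf) auto
        have KA: "integrable \<mu> (\<lambda>y. indicat_real A y *\<^sub>R K y)" "integrable \<mu> (\<lambda>y. indicat_real (- A) y *\<^sub>R K y)"
        proof -
          have "A \<in> sets \<mu>" "- A \<in> sets \<mu>" using Ab sb by auto
          then show "integrable \<mu> (\<lambda>y. indicat_real A y *\<^sub>R K y)" "integrable \<mu> (\<lambda>y. indicat_real (- A) y *\<^sub>R K y)"
            using Ki by (simp_all only: integrable_mult_indicator)
        qed
        have "integral\<^sup>L \<mu> K = (LINT y|\<mu>. indicat_real A y *\<^sub>R K y + indicat_real (- A) y *\<^sub>R K y)"
          by (intro Bochner_Integration.integral_cong) (auto simp: indicator_def)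
        also have "\<dots> = (LINT y|\<mu>. indicat_real A y *\<^sub>R K y) + (LINT y|\<mu>. indicat_real (- A) y *\<^sub>R K y)"
          using KA by (rule Bochner_Integration.integral_add)
        finally have sum: "integral\<^sup>L \<mu> K = (LINT y|\<mu>. indicat_real A y *\<^sub>R K y) + (LINT y|\<mu>. indicat_real (- A) y *\<^sub>R K y)" .
        have sK: "sym_moment \<mu> w (r * \<rho>) = integral\<^sup>L \<mu> K" unfolding sym_moment_def K_def[abs_def] ..
        have split: "(LINT y|\<mu>. indicat_real A y *\<^sub>R K y) = sym_moment \<mu> w (r * \<rho>) - (LINT y|\<mu>. indicat_real (- A) y *\<^sub>R K y)"
          unfolding sK sum by (rule add_diff_cancel_right'[symmetric])
        have b1: "norm (sym_moment \<mu> w (r * \<rho>)) \<le> e / 2 * r powr (s + 5)"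
        proof -
          have "norm (sym_moment \<mu> w (r * \<rho>)) \<le> 1 / real (Suc m) * (r * \<rho>) powr (s + 5)"
            using wG r \<rho> elim(2) by (intro \<delta>(2)) (auto simp: r_def)
          also have "\<dots> \<le> e / (2 * \<rho> powr (s + 5)) * (r * \<rho>) powr (s + 5)"
            using m by (intro mult_right_mono) (auto simp: inverse_eq_divide)
          also have "\<dots> = e / 2 * r powr (s + 5)" using r \<rho> by (simp add: powr_mult)
          finally show ?thesis .
        qed
        have sub: "cball w (r * \<rho>) \<inter> - A \<subseteq> ball x (r * (L + \<rho> + 1)) - G m"
        proof
          fix y assume y: "y \<in> cball w (r * \<rho>) \<inter> - A"
          have "norm (y - x) \<le> norm (y - w) + norm (r *\<^sub>R z')"
            using norm_triangle_ineq[of "y - w" "r *\<^sub>R z'"] by (simp add: w_def)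
          also have "\<dots> \<le> r * \<rho> + r * L"
            using y z' r by (intro add_mono) (auto simp: dist_norm norm_minus_commute)
          also have "\<dots> < r * (L + \<rho> + 1)" using r by (simp add: algebra_simps)
          finally have d: "dist x y < r * (L + \<rho> + 1)" by (simp add: dist_norm norm_minus_commute)
          then have "y \<in> cball x 1" using elim(3) by (simp add: r_def)
          then have "y \<notin> E" using y by (auto simp: A_def)
          then show "y \<in> ball x (r * (L + \<rho> + 1)) - G m" using d G(1)[of m] by auto
        qed
        have Bb: "cball w (r * \<rho>) \<inter> - A \<in> sets borel" using Ab by auto
        have "norm (LINT y|\<mu>. indicat_real (- A) y *\<^sub>R K y) \<le> (r * \<rho>) ^ 5 * measure \<mu> (cball w (r * \<rho>) \<inter> - A)"
        proof (rule integral_bounded_support(2)[OF lf])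
          have "K \<in> borel_measurable borel" unfolding K_def by (intro borel_measurable_continuous_onI continuous_intros)
          then show "(\<lambda>y. indicat_real (- A) y *\<^sub>R K y) \<in> borel_measurable borel"
            using Ab by (intro borel_measurable_scaleR borel_measurable_indicator) auto
          show "norm (indicat_real (- A) y *\<^sub>R K y) \<le> (r * \<rho>) ^ 5" if "y \<in> cball w (r * \<rho>) \<inter> - A" for y
          proof -
            have "norm (K y) \<le> (r * \<rho>) ^ 4 * (r * \<rho>)"
              unfolding K_def norm_scaleR using that r \<rho> qk2_le[of "r * \<rho>" "w - y"]
              by (intro mult_mono) (auto simp: dist_norm)
            also have "\<dots> = (r * \<rho>) ^ 5" by (simp add: power_numeral_reduce)
            finally show ?thesis using that by simp
          qed
          show "indicat_real (- A) y *\<^sub>R K y = 0" if "y \<notin> cball w (r * \<rho>) \<inter> - A" for y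
            using that r \<rho> by (auto simp: K_def qk_outside dist_norm indicator_def)
          show "bounded (cball w (r * \<rho>) \<inter> - A)" by (rule bounded_Int) auto
        qed (rule Bb)
        also have "measure \<mu> (cball w (r * \<rho>) \<inter> - A) \<le> e / (2 * \<rho> ^ 5) * r powr s"
          unfolding measure_def
        proof (rule enn2real_leI)
          have "emeasure \<mu> (cball w (r * \<rho>) \<inter> - A) \<le> emeasure \<mu> (ball x (r * (L + \<rho> + 1)) - G m)"
            using sub G(3) by (intro emeasure_mono) (auto simp: sb)
          then show "emeasure \<mu> (cball w (r * \<rho>) \<inter> - A) \<le> ennreal (e / (2 * \<rho> ^ 5) * r powr s)"
            using elim(1) unfolding r_def by (rule order_trans)
        qed (use e \<rho> in auto)
        finally have b2: "norm (LINT y|\<mu>. indicat_real (- A) y *\<^sub>R K y) \<le> (r * \<rho>) ^ 5 * (e / (2 * \<rho> ^ 5) * r powr s)"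
          using r \<rho> by (simp add: mult_left_mono)
        have rs5: "r powr (s + 5) = r powr s * r ^ 5" unfolding powr_add using r by (simp add: powr_numeral)
        have rs: "(r * \<rho>) ^ 5 * (e / (2 * \<rho> ^ 5) * r powr s) = e / 2 * r powr (s + 5)"
          using \<rho> unfolding rs5 by (simp add: power_mult_distrib)
        have b2: "norm (LINT y|\<mu>. indicat_real (- A) y *\<^sub>R K y) \<le> e / 2 * r powr (s + 5)" using b2 unfolding rs .
        have "norm (LINT y|\<mu>. indicat_real A y *\<^sub>R K y) \<le> e * r powr (s + 5)"
          unfolding split using b1 b2 norm_triangle_ineq4[of "sym_moment \<mu> w (r * \<rho>)" "LINT y|\<mu>. indicat_real (- A) y *\<^sub>R K y"] by simp
        then have "r powr - (s + 5) * norm (LINT y|\<mu>. indicat_real A y *\<^sub>R K y) \<le> r powr - (s + 5) * (e * r powr (s + 5))"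
          by (intro mult_left_mono) auto
        also have "r powr - (s + 5) * (e * r powr (s + 5)) = e" using r by (simp only: powr_minus) simp
        finally show "norm (sym_moment (\<sigma> n) z' \<rho>) \<le> e"
          unfolding \<sigma>_def r_def[symmetric] sym_moment_blowup[OF sb Ab r] by (simp add: K_def w_def)
      qed
    qed
    then show ?thesis by blast
  qed
  have sym0: "sym_moment \<nu> 0 \<rho> = 0" if \<rho>: "0 < \<rho>" for \<rho>
  proof -
    have "norm (sym_moment \<nu> 0 \<rho>) \<le> e" if e: "0 < e" for e
    proof -
      obtain m where "\<forall>\<^sub>F n in sequentially. \<forall>z'. norm z' \<le> 0 \<and> x + rr n *\<^sub>R z' \<in> G m \<longrightarrow> norm (sym_moment (\<sigma> n) z' \<rho>) \<le> e"
        using near[OF \<rho> e order_refl] by blast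
      then have "\<forall>\<^sub>F n in sequentially. norm (sym_moment (\<sigma> n) 0 \<rho>) \<le> e" by eventually_elim (use G(2) in auto)
      from evk[OF this] show ?thesis
        by (intro tendsto_upperbound[OF tendsto_norm[OF symlim[OF \<rho>]]]) auto
    qed
    then show ?thesis using field_le_epsilon[of "norm (sym_moment \<nu> 0 \<rho>)" 0] by simp
  qed
  \<comment> \<open>The point of \<mu> corresponding to z need not lie in any \<open>G m\<close>. If
    the limit moment at z were nonzero, the Lipschitz bound in the centre would keep the moments of
    the blow-ups large on a whole ball about z, so this ball would eventually contain no rescaled
    point of \<open>G m\<close>. Its mass would then tend to 0, and z would not be in the
    support.\<close>
  have symS: "sym_moment \<nu> z \<rho> = 0" if z: "z \<in> measure_support \<nu>" and \<rho>: "0 < \<rho>" for z \<rho>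
  proof (rule ccontr)
    assume "sym_moment \<nu> z \<rho> \<noteq> 0"
    define e where "e = norm (sym_moment \<nu> z \<rho>) / 3"
    have e: "0 < e" using \<open>sym_moment \<nu> z \<rho> \<noteq> 0\<close> by (simp add: e_def)
    define Q where "Q = 5 * \<rho> ^ 4 * (C1 * (\<rho> + 1) powr s) + 1"
    have Q: "0 < Q" using \<rho> C1 by (simp add: Q_def add_nonneg_pos)
    define d where "d = min 1 (e / Q)"
    have d: "0 < d" "d \<le> 1" "d * Q \<le> e" using e Q by (auto simp: d_def min_def field_simps)
    obtain m where m: "\<forall>\<^sub>F n in sequentially. \<forall>z'. norm z' \<le> norm z + 1 \<and> x + rr n *\<^sub>R z' \<in> G m \<longrightarrow> norm (sym_moment (\<sigma> n) z' \<rho>) \<le> e"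
      using near[OF \<rho> e, of "norm z + 1"] by auto
    have big: "\<forall>\<^sub>F n in sequentially. 2 * e < norm (sym_moment (\<sigma> (k n)) z \<rho>)"
      using tendsto_norm[OF symlim[OF \<rho>, of z]] by (rule order_tendstoD) (use e in \<open>simp add: e_def\<close>)
    have empty: "\<forall>\<^sub>F n in sequentially. \<forall>z'\<in>cball z d. x + rr (k n) *\<^sub>R z' \<notin> G m"
      using big evk[OF m]
    proof eventually_elim
      case (elim n)
      show ?case
      proof (intro ballI notI)
        fix z' assume z': "z' \<in> cball z d" "x + rr (k n) *\<^sub>R z' \<in> G m"
        have dz: "norm (z - z') \<le> d" using z' by (simp add: dist_norm)
        have "norm z' \<le> norm z + 1" using dz d(2) norm_triangle_ineq[of z "z' - z"] by (simp add: norm_minus_commute)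
        then have "norm (sym_moment (\<sigma> (k n)) z' \<rho>) \<le> e" using elim(2) z' by blast
        moreover have "norm (sym_moment (\<sigma> (k n)) z \<rho> - sym_moment (\<sigma> (k n)) z' \<rho>) \<le> e"
        proof -
          have "measure (\<sigma> (k n)) (cball z (\<rho> + norm (z - z'))) \<le> C1 * (\<rho> + norm (z - z')) powr s"
            using \<rho> by (intro upper_regular_measure_le[OF \<sigma>reg]) (simp add: add_pos_nonneg)
          also have "\<dots> \<le> C1 * (\<rho> + 1) powr s" using C1 dz d \<rho> s by (intro mult_left_mono powr_mono2) auto
          finally have "norm (sym_moment (\<sigma> (k n)) z \<rho> - sym_moment (\<sigma> (k n)) z' \<rho>) \<le> 5 * \<rho> ^ 4 * norm (z - z') * (C1 * (\<rho> + 1) powr s)"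
            using \<rho> by (intro order_trans[OF sym_moment_lipschitz[OF \<sigma>lf]] mult_left_mono) auto
          also have "\<dots> = norm (z - z') * (Q - 1)" by (simp add: Q_def)
          also have "\<dots> \<le> d * Q" using dz d Q \<rho> C1 by (intro mult_mono) (auto simp: Q_def)
          finally show ?thesis using d(3) by linarith
        qed
        ultimately have "norm (sym_moment (\<sigma> (k n)) z \<rho>) \<le> 2 * e"
          using norm_triangle_ineq[of "sym_moment (\<sigma> (k n)) z \<rho> - sym_moment (\<sigma> (k n)) z' \<rho>" "sym_moment (\<sigma> (k n)) z' \<rho>"] by simp
        then show False using elim(1) by simp
      qed
    qed
    have half: "d / 2 < d" using d by simp
    have "(LINT y|\<nu>. tent z (d / 2) d y) \<le> e'" if e': "0 < e'" for e'
    proof (rule tendsto_upperbound[OF conv[OF cont_compact_tent[OF half]]])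
      have "0 < norm z + d + 1" using d by (simp add: add_nonneg_pos)
      from evk[OF densn[OF this e', of m]] empty
      show "\<forall>\<^sub>F n in sequentially. (LINT y|\<sigma> (k n). tent z (d / 2) d y) \<le> e'"
      proof eventually_elim
        case (elim n)
        define r where "r = rr (k n)"
        have r: "0 < r" using rr(1) by (simp add: r_def)
        have "A \<inter> cball (x + r *\<^sub>R z) (r * d) \<subseteq> ball x (r * (norm z + d + 1)) - G m"
        proof
          fix y assume y: "y \<in> A \<inter> cball (x + r *\<^sub>R z) (r * d)"
          have "norm (y - x) \<le> norm (y - (x + r *\<^sub>R z)) + norm (r *\<^sub>R z)"
            using norm_triangle_ineq[of "y - (x + r *\<^sub>R z)" "r *\<^sub>R z"] by simp
          also have "\<dots> \<le> r * d + r * norm z"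
            using y r by (intro add_mono) (auto simp: dist_norm norm_minus_commute)
          also have "\<dots> < r * (norm z + d + 1)" using r by (simp add: algebra_simps)
          finally have 1: "y \<in> ball x (r * (norm z + d + 1))" by (simp add: dist_norm norm_minus_commute)
          have "y \<in> {y. (y - x) /\<^sub>R r \<in> cball z d}" unfolding rescale_cball[OF r] using y by blast
          then have "(y - x) /\<^sub>R r \<in> cball z d" by (rule CollectD)
          then have "x + r *\<^sub>R ((y - x) /\<^sub>R r) \<notin> G m" using elim(2) unfolding r_def by blast
          then show "y \<in> ball x (r * (norm z + d + 1)) - G m" using 1 r by simp
        qed
        then have "emeasure \<mu> (A \<inter> cball (x + r *\<^sub>R z) (r * d)) \<le> emeasure \<mu> (ball x (r * (norm z + d + 1)) - G m)"
          using G(3) by (intro emeasure_mono) (auto simp: sb)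
        also have "\<dots> \<le> ennreal (e' * r powr s)" using elim(1) unfolding r_def .
        finally have "ennreal (r powr - s) * emeasure \<mu> (A \<inter> cball (x + r *\<^sub>R z) (r * d)) \<le> ennreal (r powr - s) * ennreal (e' * r powr s)"
          by (intro mult_left_mono) auto
        also have "\<dots> = ennreal e'" using e' r by (simp add: ennreal_mult[symmetric] powr_minus)
        finally have "emeasure (\<sigma> (k n)) (cball z d) \<le> ennreal e'"
          unfolding \<sigma>_def r_def[symmetric] emeasure_blowup_cball[OF sb Ab r] .
        then have "measure (\<sigma> (k n)) (cball z d) \<le> e'" unfolding measure_def using e' by (intro enn2real_leI) auto
        then show ?case using tent_integral_le[OF \<sigma>lf half, of "k n" z] by linarith
      qed
    qed simp
    then have "(LINT y|\<nu>. tent z (d / 2) d y) \<le> 0" using field_le_epsilon[of "LINT y|\<nu>. tent z (d / 2) d y" 0] by simp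
    then have "measure \<nu> (cball z (d / 2)) \<le> 0" using tent_integral_ge[OF \<nu>lf half, of z] by linarith
    then have "emeasure \<nu> (cball z (d / 2)) = 0"
      using emeasure_bounded_finite[OF \<nu>lf bounded_cball, of z "d / 2"] measure_nonneg[of \<nu> "cball z (d / 2)"]
      by (simp add: emeasure_eq_ennreal_measure less_top)
    moreover have "emeasure \<nu> (ball z (d / 2)) \<le> emeasure \<nu> (cball z (d / 2))"
      using locally_finite_sets[OF \<nu>lf] by (intro emeasure_mono) auto
    moreover have "0 < emeasure \<nu> (ball z (d / 2))" using z d by (simp add: measure_support_def)
    ultimately show False by simp
  qed
  have ne: "measure_support \<nu> \<noteq> {}"
  proof
    assume "measure_support \<nu> = {}"
    then have z: "AE y in \<nu>. tent 0 4 5 y = 0"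
      using AE_measure_support[OF locally_finite_sets[OF \<nu>lf]] by auto
    have "(LINT y|\<nu>. tent (0::'a) 4 5 y) = 0"
      using integral_eq_zero_AE[OF z] .
    moreover have "c / 2 \<le> (LINT y|\<nu>. tent (0::'a) 4 5 y)"
    proof (rule LIMSEQ_le_const[OF conv[OF cont_compact_tent]], simp, intro exI allI impI)
      fix n :: nat
      have "ennreal (c / 2) \<le> emeasure (\<sigma> (k n)) (cball 0 4)" by (rule N) (simp add: k_def)
      also have "\<dots> = ennreal (measure (\<sigma> (k n)) (cball 0 4))"
        using emeasure_bounded_finite[OF \<sigma>lf bounded_cball, of "k n" 0 4] by (simp add: emeasure_eq_ennreal_measure less_top)
      finally have "c / 2 \<le> measure (\<sigma> (k n)) (cball 0 4)" by (simp add: ennreal_le_iff)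
      also have "\<dots> \<le> (LINT y|\<sigma> (k n). tent 0 4 5 y)" by (rule tent_integral_ge[OF \<sigma>lf]) simp
      finally show "c / 2 \<le> (LINT y|\<sigma> (k n). tent 0 4 5 y)" .
    qed
    ultimately show False using c by simp
  qed
  obtain V \<kappa> where V: "subspace V" "real (dim V) = s" "0 < measure (hausdorff_on s V) (cball 0 1)"
    and \<kappa>: "\<And>f R. continuous_on UNIV f \<Longrightarrow> (\<And>y. R < norm y \<Longrightarrow> f y = 0) \<Longrightarrow> (LINT y|\<nu>. f y) = \<kappa> * (LINT y|hausdorff_on s V. (f y :: real))"
    using symmetric_measure_flat[OF \<nu>reg s sym0 symS ne] by blast
  have "(\<lambda>n. rr (k n) powr - s * (LINT y|\<mu>. f ((y - x) /\<^sub>R rr (k n)))) \<longlonglongrightarrow> \<kappa> * (LINT y|hausdorff_on s V. f y)"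
    if f: "cont_compact f" for f :: "'a \<Rightarrow> real"
  proof -
    obtain R where fc: "continuous_on UNIV f" and R: "\<And>y. R < norm y \<Longrightarrow> f y = 0"
      using f unfolding cont_compact_def by blast
    have fm: "f \<in> borel_measurable borel" using fc by (rule borel_measurable_continuous_onI)
    obtain B where B: "0 < B" "\<And>y. \<bar>f y\<bar> \<le> B"
    proof -
      have "compact (f ` cball 0 \<bar>R\<bar>)" using fc by (intro compact_continuous_image) (auto intro: continuous_on_subset)
      then obtain B where B: "\<And>y. y \<in> cball 0 \<bar>R\<bar> \<Longrightarrow> \<bar>f y\<bar> \<le> B"
        using compact_imp_bounded bounded_iff by (metis image_eqI real_norm_def)
      have "\<bar>f y\<bar> \<le> \<bar>B\<bar> + 1" for y using B[of y] R[of y] by (cases "norm y \<le> \<bar>R\<bar>") auto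
      then show thesis by (intro that[of "\<bar>B\<bar> + 1"]) auto
    qed
    define L where "L = \<bar>R\<bar> + 1"
    have L: "0 < L" "\<bar>R\<bar> < L" by (auto simp: L_def)
    \<comment> \<open>The limits so far concern the restricted blow-ups; for a bounded test function
      of bounded support the removed mass is negligible, so the full \<mu> has the same
      limit.\<close>
    have diff: "(\<lambda>n. rr n powr - s * (LINT y|\<mu>. f ((y - x) /\<^sub>R rr n)) - (LINT y|\<sigma> n. f y)) \<longlonglongrightarrow> 0"
    proof (rule tendstoI)
      fix e :: real assume e: "0 < e"
      have "0 < e / (2 * B)" using e B by simp
      from densn[OF L(1) this, of 0] rrK[OF zero_less_one, of L]
      show "\<forall>\<^sub>F n in sequentially. dist (rr n powr - s * (LINT y|\<mu>. f ((y - x) /\<^sub>R rr n)) - (LINT y|\<sigma> n. f y)) 0 < e"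
      proof eventually_elim
        case (elim n)
        define r where "r = rr n"
        have r: "0 < r" using rr(1) by (simp add: r_def)
        define g where "g y = f ((y - x) /\<^sub>R r)" for y
        have gc: "continuous_on UNIV g" unfolding g_def
          by (rule continuous_on_compose2[OF fc]) (auto intro!: continuous_intros)
        have g0: "g y = 0" if "y \<notin> ball x (r * L)" for y
        proof -
          have "r * L \<le> norm (y - x)" using that by (simp add: dist_norm norm_minus_commute)
          then have "L \<le> norm (y - x) / r" using r by (simp add: pos_le_divide_eq mult.commute)
          also have "\<dots> = norm ((y - x) /\<^sub>R r)" using r by (simp add: divide_inverse mult.commute)
          finally show ?thesis unfolding g_def using L by (intro R) linarith
        qed
        have gi: "integrable \<mu> g"
          using gc g0 by (intro integrable_continuous_bounded_support[OF lf, of _ x "r * L"]) auto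
        have gA: "integrable \<mu> (\<lambda>y. indicat_real A y *\<^sub>R g y)"
          using gi Ab sb by (intro integrable_mult_indicator) auto
        have \<sigma>f: "(LINT y|\<sigma> n. f y) = r powr - s * (LINT y|\<mu>. indicat_real A y *\<^sub>R g y)"
          unfolding \<sigma>_def g_def r_def using integral_blowup[where s=s and x=x and r="rr n", OF sb Ab fm] by simp
        have "(LINT y|\<mu>. g y) - (LINT y|\<mu>. indicat_real A y *\<^sub>R g y) = (LINT y|\<mu>. g y - indicat_real A y *\<^sub>R g y)"
          using gi gA by simp
        also have "norm \<dots> \<le> B * measure \<mu> (ball x (r * L) - G 0)"
        proof (rule integral_bounded_support(2)[OF lf])
          have "g \<in> borel_measurable borel" using gc by (rule borel_measurable_continuous_onI)
          then show "(\<lambda>y. g y - indicat_real A y *\<^sub>R g y) \<in> borel_measurable borel"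
            using Ab by (intro borel_measurable_diff borel_measurable_scaleR borel_measurable_indicator) auto
          show "norm (g y - indicat_real A y *\<^sub>R g y) \<le> B" for y
            using B(2)[of "(y - x) /\<^sub>R r"] B(1) by (auto simp: g_def indicator_def)
          show "g y - indicat_real A y *\<^sub>R g y = 0" if "y \<notin> ball x (r * L) - G 0" for y
          proof (cases "y \<in> ball x (r * L)")
            case True
            then have "y \<in> A" using that G(1)[of 0] elim(2) by (auto simp: A_def r_def)
            then show ?thesis by simp
          qed (simp add: g0)
          show "bounded (ball x (r * L) - G 0)" by (rule bounded_diff) simp
          show "ball x (r * L) - G 0 \<in> sets borel" using G(3) by auto
        qed
        also have "\<dots> \<le> B * (e / (2 * B) * r powr s)"
          unfolding measure_def using elim(1) B e
          by (intro mult_left_mono enn2real_leI) (auto simp: r_def)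
        finally have "\<bar>(LINT y|\<mu>. g y) - (LINT y|\<mu>. indicat_real A y *\<^sub>R g y)\<bar> \<le> e / 2 * r powr s" using B by simp
        then have "r powr - s * \<bar>(LINT y|\<mu>. g y) - (LINT y|\<mu>. indicat_real A y *\<^sub>R g y)\<bar> \<le> r powr - s * (e / 2 * r powr s)"
          by (intro mult_left_mono) auto
        also have "\<dots> = e / 2" using r by (simp add: powr_minus)
        finally have "\<bar>r powr - s * ((LINT y|\<mu>. g y) - (LINT y|\<mu>. indicat_real A y *\<^sub>R g y))\<bar> \<le> e / 2"
          by (simp add: abs_mult)
        then show ?case using e unfolding \<sigma>f by (simp add: g_def r_def right_diff_distrib dist_real_def)
      qed
    qed
    have "(\<lambda>n. (rr (k n) powr - s * (LINT y|\<mu>. f ((y - x) /\<^sub>R rr (k n))) - (LINT y|\<sigma> (k n). f y)) + (LINT y|\<sigma> (k n). f y)) \<longlonglongrightarrow> 0 + (LINT y|\<nu>. f y)"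
      using LIMSEQ_subseq_LIMSEQ[OF diff k] by (intro tendsto_add conv[OF f]) (simp add: o_def)
    then show ?thesis using \<kappa>[OF fc R] by simp
  qed
  then show ?thesis using k V by blast
qed

section \<open>Flat transportation numbers\<close>

text \<open>The bound for Lipschitz images, applied to the homothety and to its inverse, gives the
  two inequalities.\<close>

lemma hausdorff_outer_homothety:
  fixes x :: "'a::euclidean_space"
  assumes r: "0 < r" and s: "0 < s"
  shows "ennreal (r powr - s) * hausdorff_outer s ((\<lambda>z. x + r *\<^sub>R z) ` A) = hausdorff_outer s A"
proof (rule antisym)
  show "ennreal (r powr - s) * hausdorff_outer s ((\<lambda>z. x + r *\<^sub>R z) ` A) \<le> hausdorff_outer s A"
    using r s by (intro hausdorff_outer_lipschitz_image) (auto simp: dist_norm simp flip: scaleR_right_diff_distrib)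
  let ?B = "(\<lambda>z. x + r *\<^sub>R z) ` A"
  have "ennreal ((1 / r) powr - s) * hausdorff_outer s ((\<lambda>y. (y - x) /\<^sub>R r) ` ?B) \<le> hausdorff_outer s ?B"
    using r s by (intro hausdorff_outer_lipschitz_image) (auto simp: dist_norm inverse_eq_divide simp flip: scaleR_right_diff_distrib)
  also have "(\<lambda>y. (y - x) /\<^sub>R r) ` ?B = A" using r by (simp add: image_image)
  finally have "ennreal (r powr - s) * (ennreal ((1 / r) powr - s) * hausdorff_outer s A) \<le> ennreal (r powr - s) * hausdorff_outer s ?B"
    by (intro mult_left_mono) auto
  also have "ennreal (r powr - s) * (ennreal ((1 / r) powr - s) * hausdorff_outer s A) = ennreal (r powr - s * (1 / r) powr - s) * hausdorff_outer s A"
    by (simp add: ennreal_mult mult.assoc)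
  also have "r powr - s * (1 / r) powr - s = 1" using r by (simp add: powr_minus powr_divide)
  finally show "hausdorff_outer s A \<le> ennreal (r powr - s) * hausdorff_outer s ?B" by simp
qed

lemma closed_subspace_translation: "subspace (L :: 'a::euclidean_space set) \<Longrightarrow> closed ((+) x ` L)"
  by (simp add: closed_translation closed_subspace)

text \<open>A plane through x is mapped to its linear part by the blow-up at x, at every scale; thus
  \<open>integral_blowup\<close> also supplies the change of variables on planes.\<close>

lemma blowup_hausdorff_on:
  fixes L :: "'a::euclidean_space set"
  assumes L: "subspace L" and r: "0 < r" and s: "0 < s"
  shows "blowup (hausdorff_on s ((+) x ` L)) s UNIV x r = hausdorff_on s L"
proof (rule measure_eqI)
  fix X assume "X \<in> sets (blowup (hausdorff_on s ((+) x ` L)) s UNIV x r)"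
  then have X: "X \<in> sets borel" by simp
  have Lb: "L \<in> sets borel" "(+) x ` L \<in> sets borel"
    using closed_subspace[OF L] closed_subspace_translation[OF L] by (auto intro: borel_closed)
  have pre: "{y. (y - x) /\<^sub>R r \<in> X} \<in> sets borel"
    using measurable_sets[OF measurable_rescale[where \<mu>=borel and x=x and r=r] X] by (simp add: vimage_def)
  have eq: "(+) x ` L \<inter> {y. (y - x) /\<^sub>R r \<in> X} = (\<lambda>z. x + r *\<^sub>R z) ` (L \<inter> X)"
  proof (intro set_eqI iffI)
    fix y assume y: "y \<in> (+) x ` L \<inter> {y. (y - x) /\<^sub>R r \<in> X}"
    then have "(y - x) /\<^sub>R r \<in> L" using L by (auto intro: subspace_scale)
    then show "y \<in> (\<lambda>z. x + r *\<^sub>R z) ` (L \<inter> X)" using y r by (intro image_eqI[of _ _ "(y - x) /\<^sub>R r"]) auto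
  qed (use L r in \<open>auto intro: subspace_scale\<close>)
  show "emeasure (blowup (hausdorff_on s ((+) x ` L)) s UNIV x r) X = emeasure (hausdorff_on s L) X"
    using X pre Lb hausdorff_outer_homothety[OF r s, of x "L \<inter> X"]
    by (simp add: emeasure_blowup[OF sets_hausdorff_on _ X r] emeasure_hausdorff_on eq)
qed (simp add: sets_hausdorff_on)

lemma integral_hausdorff_on_rescale:
  fixes L :: "'a::euclidean_space set" and F :: "'a \<Rightarrow> real"
  assumes "subspace L" "0 < r" "0 < s" "F \<in> borel_measurable borel"
  shows "(LINT y|hausdorff_on s ((+) x ` L). F ((y - x) /\<^sub>R r)) = r powr s * (LINT y|hausdorff_on s L. F y)"
proof -
  have "(LINT y|hausdorff_on s L. F y) = r powr - s *\<^sub>R (LINT y|hausdorff_on s ((+) x ` L). indicat_real UNIV y *\<^sub>R F ((y - x) /\<^sub>R r))"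
    unfolding blowup_hausdorff_on[OF assms(1,2,3), of x, symmetric]
    by (rule integral_blowup[OF sets_hausdorff_on _ assms(4)]) simp
  also have "\<dots> = r powr - s * (LINT y|hausdorff_on s ((+) x ` L). F ((y - x) /\<^sub>R r))" by simp
  finally show ?thesis using assms(2) by (simp only: powr_minus) simp
qed

text \<open>The reflection in x preserves the plane and its Hausdorff measure, so the integral
  equals its own negative.\<close>

lemma integral_hausdorff_on_odd:
  fixes L :: "'a::euclidean_space set" and F :: "'a \<Rightarrow> real"
  assumes L: "subspace L" and s: "0 < s" and F: "F \<in> borel_measurable borel"
    and odd: "\<And>y. F (2 *\<^sub>R x - y) = - F y"
  shows "(LINT y|hausdorff_on s ((+) x ` L). F y) = 0"
proof -
  have Lb: "(+) x ` L \<in> sets borel"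
    using closed_subspace_translation[OF L] by (auto intro: borel_closed)
  have im: "(\<lambda>y. 2 *\<^sub>R x - y) ` (+) x ` L = (+) x ` L"
  proof (intro set_eqI iffI)
    fix y assume "y \<in> (+) x ` L"
    then obtain z where z: "z \<in> L" "y = x + z" by blast
    have "y = 2 *\<^sub>R x - (x + - z)" using z by (simp add: scaleR_2)
    then show "y \<in> (\<lambda>y. 2 *\<^sub>R x - y) ` (+) x ` L" using subspace_neg[OF L z(1)] by blast
  next
    fix y assume "y \<in> (\<lambda>y. 2 *\<^sub>R x - y) ` (+) x ` L"
    then obtain z where z: "z \<in> L" "y = 2 *\<^sub>R x - (x + z)" by blast
    have "y = x + - z" using z by (simp add: scaleR_2)
    then show "y \<in> (+) x ` L" using subspace_neg[OF L z(1)] by blast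
  qed
  have "distr (hausdorff_on s ((+) x ` L)) borel (\<lambda>y. 2 *\<^sub>R x - y) = hausdorff_on s ((+) x ` L)"
    using hausdorff_on_distr[OF s _ _ _ Lb, of "\<lambda>y. 2 *\<^sub>R x - y" "\<lambda>y. 2 *\<^sub>R x - y"]
    by (simp add: im dist_norm norm_minus_commute)
  then have "(LINT y|hausdorff_on s ((+) x ` L). F y) = (LINT y|distr (hausdorff_on s ((+) x ` L)) borel (\<lambda>y. 2 *\<^sub>R x - y). F y)"
    by simp
  also have "\<dots> = (LINT y|hausdorff_on s ((+) x ` L). F (2 *\<^sub>R x - y))"
  proof (rule integral_distr[OF _ F])
    have "(\<lambda>y. 2 *\<^sub>R x - y) \<in> borel_measurable borel"
      by (intro borel_measurable_continuous_onI continuous_intros)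
    then show "(\<lambda>y. 2 *\<^sub>R x - y) \<in> borel_measurable (hausdorff_on s ((+) x ` L))"
      using measurable_cong_sets[OF sets_hausdorff_on refl] by blast
  qed
  also have "\<dots> = - (LINT y|hausdorff_on s ((+) x ` L). F y)" by (simp add: odd)
  finally show ?thesis by simp
qed

lemma not_eventually_at_right_sequence:
  assumes "\<not> (\<forall>\<^sub>F r in at_right (0::real). P r)"
  obtains rr where "\<And>n::nat. 0 < rr n" "rr \<longlonglongrightarrow> 0" "\<And>n. \<not> P (rr n)"
proof -
  have "\<exists>r. 0 < r \<and> r < 1 / real (Suc n) \<and> \<not> P r" for n
  proof (rule ccontr)
    assume "\<not> ?thesis"
    then have "\<forall>\<^sub>F r in at_right 0. P r"
      unfolding eventually_at_right_field by (intro exI[of _ "1 / real (Suc n)"]) auto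
    with assms show False by blast
  qed
  then obtain rr where rr: "\<And>n. 0 < rr n \<and> rr n < 1 / real (Suc n) \<and> \<not> P (rr n)" by metis
  have "rr \<longlonglongrightarrow> 0"
  proof (rule tendsto_sandwich[OF _ _ tendsto_const LIMSEQ_inverse_real_of_nat])
    show "\<forall>\<^sub>F n in sequentially. 0 \<le> rr n" using rr by (simp add: less_imp_le)
    have "rr n \<le> inverse (real (Suc n))" for n using rr[of n] unfolding inverse_eq_divide by linarith
    then show "\<forall>\<^sub>F n in sequentially. rr n \<le> inverse (real (Suc n))" by simp
  qed
  then show ?thesis using rr that by blast
qed

lemma tendsto_0_ennrealI:
  fixes f :: "'b \<Rightarrow> ennreal"
  assumes "\<And>e::real. 0 < e \<Longrightarrow> \<forall>\<^sub>F x in F. f x \<le> ennreal e"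
  shows "(f \<longlongrightarrow> 0) F"
proof (rule order_tendstoI)
  fix a :: ennreal assume a: "0 < a"
  obtain e :: real where e: "0 < e" "ennreal e < a"
  proof (cases a rule: ennreal_cases)
    case (real t)
    have "0 < t / 2" using a real by simp
    moreover have "ennreal (t / 2) < a" unfolding real(2) using \<open>0 < t / 2\<close> by (simp add: ennreal_less_iff)
    ultimately show ?thesis by (rule that)
  next
    case top
    then have "ennreal 1 < a" by simp
    from that[OF zero_less_one this] show ?thesis .
  qed
  show "\<forall>\<^sub>F x in F. f x < a"
    using assms[OF e(1)] by (rule eventually_mono) (rule order.strict_trans1[OF _ e(2)])
qed simp

lemma upper_density_eq_0I:
  assumes "\<And>c. 0 < c \<Longrightarrow> \<forall>\<^sub>F r in at_right 0. emeasure \<mu> (ball x r) \<le> ennreal (c * r powr s)"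
  shows "upper_density \<mu> s x = 0"
proof -
  have "upper_density \<mu> s x \<le> 0 + ennreal c" if c: "0 < c" for c
    unfolding upper_density_def add_0_left
  proof (rule Limsup_bounded)
    have "\<forall>\<^sub>F r in at_right 0. (0::real) < r" by (rule eventually_at_right_less)
    with assms[OF c] show "\<forall>\<^sub>F r in at_right 0. emeasure \<mu> (ball x r) / ennreal (r powr s) \<le> ennreal c"
    proof eventually_elim
      case (elim r)
      have "emeasure \<mu> (ball x r) / ennreal (r powr s) \<le> ennreal (c * r powr s) / ennreal (r powr s)"
        using elim(1) by (rule divide_right_mono_ennreal)
      also have "\<dots> = ennreal c" using c elim(2) by (simp add: divide_ennreal)
      finally show ?case .
    qed
  qed
  then have "upper_density \<mu> s x \<le> 0" by (rule ennreal_le_epsilon)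
  then show ?thesis by simp
qed

lemma upper_density_lessD:
  assumes "upper_density \<mu> s x < ennreal c"
  shows "\<forall>\<^sub>F r in at_right 0. emeasure \<mu> (ball x r) \<le> ennreal (c * r powr s)"
proof -
  have "\<forall>\<^sub>F r in at_right 0. (0::real) < r" by (rule eventually_at_right_less)
  with Limsup_lessD[OF assms[unfolded upper_density_def]] show ?thesis
  proof eventually_elim
    case (elim r)
    have c: "0 \<le> c" using elim(1) by (cases "0 \<le> c") (auto simp: ennreal_neg)
    have "ennreal (r powr s) / ennreal (r powr s) = 1" using elim(2) by (intro ennreal_divide_self) auto
    then have "emeasure \<mu> (ball x r) = emeasure \<mu> (ball x r) / ennreal (r powr s) * ennreal (r powr s)"
      by (simp only: ennreal_divide_times mult_1_right)
    also have "\<dots> \<le> ennreal c * ennreal (r powr s)" using elim(1) by (intro mult_right_mono) auto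
    also have "\<dots> = ennreal (c * r powr s)" using c by (simp add: ennreal_mult)
    finally show ?case .
  qed
qed

section \<open>Flat numbers in rescaled coordinates\<close>

lemma cont_compact_rescale:
  fixes F :: "'a::euclidean_space \<Rightarrow> real"
  assumes F: "cont_compact F" and r: "0 < r"
  shows "cont_compact (\<lambda>y. F ((y - x) /\<^sub>R r))"
proof -
  obtain R where R: "\<And>y. R < norm y \<Longrightarrow> F y = 0" using F unfolding cont_compact_def by blast
  have cF: "continuous_on UNIV F" using F unfolding cont_compact_def by blast
  have "F ((y - x) /\<^sub>R r) = 0" if "norm x + r * R < norm y" for y
  proof (rule R)
    have "r * R < norm (y - x)" using that norm_triangle_ineq[of x "y - x"] by simp
    then have "R < norm (y - x) / r" using r by (simp add: pos_less_divide_eq mult.commute)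
    also have "\<dots> = norm ((y - x) /\<^sub>R r)" using r by (simp add: divide_inverse mult.commute)
    finally show "R < norm ((y - x) /\<^sub>R r)" .
  qed
  moreover have "continuous_on UNIV (\<lambda>y. F ((y - x) /\<^sub>R r))"
    by (rule continuous_on_compose2[OF cF]) (auto intro!: continuous_intros)
  ultimately show ?thesis unfolding cont_compact_def by blast
qed

lemma cont_compact_integral_diff_le:
  fixes \<nu> :: "'a::euclidean_space measure" and F F' \<psi> :: "'a \<Rightarrow> real"
  assumes lf: "locally_finite_borel_measure \<nu>" and F: "cont_compact F" "cont_compact F'" "cont_compact \<psi>"
    and le: "\<And>y. \<bar>F y - F' y\<bar> \<le> \<delta> * \<psi> y"
  shows "\<bar>(LINT y|\<nu>. F y) - (LINT y|\<nu>. F' y)\<bar> \<le> \<delta> * (LINT y|\<nu>. \<psi> y)"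
proof -
  note i = F[THEN cont_compact_locally_finite_integrable, OF lf]
  have "\<bar>(LINT y|\<nu>. F y) - (LINT y|\<nu>. F' y)\<bar> = \<bar>LINT y|\<nu>. F y - F' y\<bar>"
    using i by simp
  also have "\<dots> \<le> (LINT y|\<nu>. \<bar>F y - F' y\<bar>)" by (rule integral_abs_bound)
  also have "\<dots> \<le> (LINT y|\<nu>. \<delta> * \<psi> y)"
    using i le by (intro integral_mono) auto
  finally show ?thesis by simp
qed

lemma flat_cutoff_range: "flat_cutoff \<phi> \<Longrightarrow> 0 \<le> t \<Longrightarrow> 0 \<le> \<phi> t" "flat_cutoff \<phi> \<Longrightarrow> 0 \<le> t \<Longrightarrow> \<phi> t \<le> 1"
  by (auto simp: flat_cutoff_def)

lemma flat_cutoff_inside: "flat_cutoff \<phi> \<Longrightarrow> 0 \<le> t \<Longrightarrow> t \<le> 3 \<Longrightarrow> \<phi> t = 1"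
  by (auto simp: flat_cutoff_def)

lemma flat_cutoff_outside:
  assumes \<phi>: "flat_cutoff \<phi>" and t: "4 \<le> t"
  shows "\<phi> t = 0"
proof (rule ccontr)
  assume "\<phi> t \<noteq> 0"
  then have "t \<in> closure {t\<in>{0..}. \<phi> t \<noteq> 0}" using t by (intro subsetD[OF closure_subset]) auto
  moreover have "closure {t\<in>{0..}. \<phi> t \<noteq> 0} \<subseteq> {0..<4}" using \<phi> by (simp add: flat_cutoff_def)
  ultimately show False using t by auto
qed

lemma cont_compact_flat_cutoff:
  assumes \<phi>: "flat_cutoff \<phi>"
  shows "cont_compact (\<lambda>y::'a::euclidean_space. \<phi> (norm y))"
proof -
  obtain D :: "nat \<Rightarrow> real \<Rightarrow> real" where D: "\<And>t. 0 \<le> t \<Longrightarrow> D 0 t = \<phi> t"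
    "\<And>n t. 0 \<le> t \<Longrightarrow> (D n has_real_derivative D (Suc n) t) (at t within {0..})"
    using \<phi> unfolding flat_cutoff_def smooth_on_halfline_def by auto
  have "continuous_on {0..} (D 0)"
    by (rule DERIV_continuous_on[OF D(2)]) auto
  then have c: "continuous_on {0..} \<phi>" using D(1) by (subst continuous_on_cong[OF refl, of _ _ "D 0"]) auto
  have "continuous_on UNIV (\<lambda>y::'a. \<phi> (norm y))"
    by (rule continuous_on_compose2[OF c]) (auto intro!: continuous_intros)
  then show ?thesis
    unfolding cont_compact_def using flat_cutoff_outside[OF \<phi>] by (intro conjI exI[of _ 4]) auto
qed

lemma cont_compact_cutoff_mult:
  fixes g :: "'a::euclidean_space \<Rightarrow> real"
  assumes \<phi>: "flat_cutoff \<phi>" and g: "continuous_on UNIV g"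
  shows "cont_compact (\<lambda>y. \<phi> (norm y) * g y)"
proof -
  have "cont_compact (\<lambda>y::'a. \<phi> (norm y))" by (rule cont_compact_flat_cutoff[OF \<phi>])
  then have "continuous_on UNIV (\<lambda>y::'a. \<phi> (norm y))" by (simp add: cont_compact_def)
  then show ?thesis
    unfolding cont_compact_def using g flat_cutoff_outside[OF \<phi>]
    by (intro conjI exI[of _ 4] continuous_on_mult) auto
qed

text \<open>At unit scale the test functions live on a fixed ball and the plane becomes the linear
  subspace L, so the dependence on r remains only in the blow-up of \<mu>.\<close>

lemma alpha_flat_value:
  fixes \<mu> :: "'a::euclidean_space measure" and x :: 'a
  assumes \<phi>: "flat_cutoff \<phi>" and L: "subspace L" and r: "0 < r" and s: "0 < s" and f: "continuous_on UNIV f"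
  defines "\<psi> \<equiv> \<lambda>y::'a. \<phi> (norm y)" and "g \<equiv> \<lambda>z. f (x + r *\<^sub>R z)"
  shows "(1 / r powr s) * ((LINT y|\<mu>. \<phi> (norm (y - x) / r) * f y) -
      flat_const \<phi> \<mu> s L x r * (LINT y|hausdorff_on s ((+) x ` L). \<phi> (norm (y - x) / r) * f y)) =
    r powr - s * (LINT y|\<mu>. \<psi> ((y - x) /\<^sub>R r) * g ((y - x) /\<^sub>R r)) -
    r powr - s * (LINT y|\<mu>. \<psi> ((y - x) /\<^sub>R r)) * inverse (LINT y|hausdorff_on s L. \<psi> y) * (LINT y|hausdorff_on s L. \<psi> y * g y)"
proof -
  have e1: "\<phi> (norm (y - x) / r) = \<psi> ((y - x) /\<^sub>R r)" for y
    using r by (simp add: \<psi>_def divide_inverse mult.commute)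
  have e2: "f y = g ((y - x) /\<^sub>R r)" for y
    using r by (simp add: g_def)
  have gc: "continuous_on UNIV g" unfolding g_def
    by (rule continuous_on_compose2[OF f]) (auto intro!: continuous_intros)
  have m: "\<psi> \<in> borel_measurable borel" "(\<lambda>y. \<psi> y * g y) \<in> borel_measurable borel"
    using cont_compact_flat_cutoff[OF \<phi>, where 'a='a] cont_compact_cutoff_mult[OF \<phi> gc]
    by (auto simp: \<psi>_def cont_compact_def intro: borel_measurable_continuous_onI)
  have i1: "(LINT y|hausdorff_on s ((+) x ` L). \<phi> (norm (y - x) / r)) = r powr s * (LINT y|hausdorff_on s L. \<psi> y)"
    unfolding e1 by (rule integral_hausdorff_on_rescale[OF L r s m(1)])
  have i2: "(LINT y|hausdorff_on s ((+) x ` L). \<phi> (norm (y - x) / r) * f y) = r powr s * (LINT y|hausdorff_on s L. \<psi> y * g y)"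
    unfolding e1 e2 by (rule integral_hausdorff_on_rescale[OF L r s m(2)])
  \<comment> \<open>Holds for i = 0 as well, because then both inverses are 0.\<close>
  have alg: "1 / p * (a - b * inverse (p * i) * (p * j)) = inverse p * a - inverse p * b * inverse i * j" if "p \<noteq> 0" for p a b i j :: real
    using that by (simp add: divide_inverse algebra_simps)
  have "r powr s \<noteq> 0" using r by simp
  from alg[OF this] show ?thesis
    unfolding flat_const_def i1 i2 powr_minus by (simp only: e1 e2)
qed

lemma Lip0_rescaled:
  fixes x :: "'a::euclidean_space"
  assumes r: "0 < r" and f: "f \<in> Lip0 (ball x (4 * r))" "(1 / r)-lipschitz_on UNIV f"
  defines "g \<equiv> \<lambda>z. f (x + r *\<^sub>R z)"
  shows "1-lipschitz_on UNIV g" "4 \<le> norm z \<Longrightarrow> g z = 0" "\<bar>g z\<bar> \<le> 8"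
proof -
  show l: "1-lipschitz_on UNIV g"
  proof (rule lipschitz_onI)
    fix z w :: 'a
    have "dist (g z) (g w) \<le> 1 / r * dist (x + r *\<^sub>R z) (x + r *\<^sub>R w)"
      unfolding g_def by (rule lipschitz_onD[OF f(2)]) auto
    also have "\<dots> = dist z w" using r by (simp add: dist_norm flip: scaleR_right_diff_distrib)
    finally show "dist (g z) (g w) \<le> 1 * dist z w" by simp
  qed simp
  have z0: "g z = 0" if "4 \<le> norm z" for z
  proof -
    obtain K where "K \<subseteq> ball x (4 * r)" "\<And>y. y \<notin> K \<Longrightarrow> f y = 0" using f(1) unfolding Lip0_def by auto
    moreover have "x + r *\<^sub>R z \<notin> ball x (4 * r)" using that r by (simp add: dist_norm)
    ultimately show ?thesis unfolding g_def by blast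
  qed
  then show "4 \<le> norm z \<Longrightarrow> g z = 0" .
  show "\<bar>g z\<bar> \<le> 8"
  proof (cases "4 \<le> norm z")
    case False
    \<comment> \<open>The point 4 b lies where g vanishes, and no point of the ball of radius 4 is
      farther from it than 8.\<close>
    obtain b :: 'a where b: "b \<in> Basis" using nonempty_Basis by blast
    have "g (4 *\<^sub>R b) = 0" using b by (intro z0) simp
    then have "\<bar>g z\<bar> \<le> dist z (4 *\<^sub>R b)"
      using lipschitz_onD[OF l UNIV_I UNIV_I, of z "4 *\<^sub>R b"] by (simp add: dist_real_def)
    also have "\<dots> \<le> norm z + norm (4 *\<^sub>R b)" unfolding dist_norm by (rule norm_triangle_ineq4)
    also have "\<dots> \<le> 8" using False b by simp
    finally show ?thesis .
  qed (simp add: z0)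
qed

text \<open>Read backwards: a flat number bounded below forces mass in the ball of radius 4 r, so
  the blow-ups there do not vanish. Any plane L serves. The constant 16 is 8 for \<mu> and 8 for the
  plane, both from the bound for the test functions.\<close>

lemma alpha_flat_le_density:
  fixes \<mu> :: "'a::euclidean_space measure" and L :: "'a set"
  assumes lf: "locally_finite_borel_measure \<mu>" and \<phi>: "flat_cutoff \<phi>" and L: "L \<in> grassmannian s" and r: "0 < r" and s: "0 < s"
  shows "alpha_flat \<phi> \<mu> s x r \<le> ennreal (16 * (r powr - s * measure \<mu> (ball x (4 * r))))"
  unfolding alpha_flat_def
proof (rule INF_lower2[OF L], rule SUP_least)
  fix f assume "f \<in> {f \<in> Lip0 (ball x (4 * r)). (1 / r)-lipschitz_on UNIV f}"
  then have f: "f \<in> Lip0 (ball x (4 * r))" "(1 / r)-lipschitz_on UNIV f" by auto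
  define \<psi> where "\<psi> = (\<lambda>y::'a. \<phi> (norm y))"
  define g where "g = (\<lambda>z. f (x + r *\<^sub>R z))"
  define H where "H = hausdorff_on s L"
  have Ls: "subspace L" "real (dim L) = s" using L by (auto simp: grassmannian_def)
  have lfH: "locally_finite_borel_measure H"
    using locally_finite_hausdorff_on_subspace[OF Ls(1) refl] Ls(2) s unfolding H_def by auto
  have g: "1-lipschitz_on UNIV g" "\<bar>g z\<bar> \<le> 8" for z
    using Lip0_rescaled(1,3)[OF r f] by (simp_all add: g_def)
  have gc: "continuous_on UNIV g" using g(1) by (rule lipschitz_on_continuous_on)
  have fc: "continuous_on UNIV f" using f(2) by (rule lipschitz_on_continuous_on)
  have \<psi>c: "cont_compact \<psi>" unfolding \<psi>_def by (rule cont_compact_flat_cutoff[OF \<phi>])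
  have \<psi>gc: "cont_compact (\<lambda>y. \<psi> y * g y)" unfolding \<psi>_def by (rule cont_compact_cutoff_mult[OF \<phi> gc])
  have z: "cont_compact (\<lambda>y::'a. 0::real)" by (simp add: cont_compact_def)
  have \<psi>r: "0 \<le> \<psi> y" "\<psi> y \<le> 1" for y using flat_cutoff_range[OF \<phi>, of "norm y"] by (auto simp: \<psi>_def)
  have \<psi>g: "\<bar>\<psi> y * g y - 0\<bar> \<le> 8 * \<psi> y" for y
    using mult_left_mono[OF g(2)[of y] \<psi>r(1)[of y]] \<psi>r(1)[of y] by (simp add: abs_mult mult.commute)
  define a where "a = (LINT y|\<mu>. \<psi> ((y - x) /\<^sub>R r))"
  define b where "b = (LINT y|\<mu>. \<psi> ((y - x) /\<^sub>R r) * g ((y - x) /\<^sub>R r))"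
  define I where "I = (LINT y|H. \<psi> y)"
  define J where "J = (LINT y|H. \<psi> y * g y)"
  have a0: "0 \<le> a" unfolding a_def using \<psi>r by (intro integral_nonneg_AE) auto
  have I0: "0 \<le> I" unfolding I_def using \<psi>r by (intro integral_nonneg_AE) auto
  have aM: "a \<le> measure \<mu> (ball x (4 * r))"
  proof -
    have "norm a \<le> 1 * measure \<mu> (ball x (4 * r))"
      unfolding a_def
    proof (rule integral_bounded_support(2)[OF lf])
      show "(\<lambda>y. \<psi> ((y - x) /\<^sub>R r)) \<in> borel_measurable borel"
        using cont_compact_rescale[OF \<psi>c r] by (auto simp: cont_compact_def intro: borel_measurable_continuous_onI)
      show "norm (\<psi> ((y - x) /\<^sub>R r)) \<le> 1" for y using \<psi>r by simp
      show "\<psi> ((y - x) /\<^sub>R r) = 0" if "y \<notin> ball x (4 * r)" for y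
      proof -
        have "4 \<le> norm (y - x) / r" using that r by (simp add: dist_norm norm_minus_commute pos_le_divide_eq)
        also have "\<dots> = norm ((y - x) /\<^sub>R r)" using r by (simp add: divide_inverse mult.commute)
        finally show ?thesis unfolding \<psi>_def by (rule flat_cutoff_outside[OF \<phi>])
      qed
    qed auto
    then show ?thesis using a0 by simp
  qed
  have b8: "\<bar>b\<bar> \<le> 8 * a"
    using cont_compact_integral_diff_le[OF lf cont_compact_rescale[OF \<psi>gc r] cont_compact_rescale[OF z r] cont_compact_rescale[OF \<psi>c r] \<psi>g]
    by (simp add: a_def b_def)
  have J8: "\<bar>J\<bar> \<le> 8 * I"
    using cont_compact_integral_diff_le[OF lfH \<psi>gc z \<psi>c \<psi>g] by (simp add: I_def J_def)
  \<comment> \<open>If I = 0 its inverse is 0 and so is the product.\<close>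
  have IJ: "\<bar>inverse I * J\<bar> \<le> 8"
  proof (cases "I = 0")
    case False
    have "\<bar>inverse I * J\<bar> = inverse I * \<bar>J\<bar>" using I0 by (simp add: abs_mult)
    also have "\<dots> \<le> inverse I * (8 * I)" using I0 J8 by (intro mult_left_mono) auto
    also have "\<dots> = 8" using False by simp
    finally show ?thesis .
  qed simp
  have "\<bar>r powr - s * b - r powr - s * a * inverse I * J\<bar> = \<bar>r powr - s * (b - a * (inverse I * J))\<bar>"
    by (simp only: right_diff_distrib mult.assoc)
  also have "\<dots> = r powr - s * \<bar>b - a * (inverse I * J)\<bar>" by (simp add: abs_mult)
  also have "\<dots> \<le> r powr - s * (\<bar>b\<bar> + \<bar>a * (inverse I * J)\<bar>)"
    by (intro mult_left_mono abs_triangle_ineq4) simp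
  also have "\<dots> \<le> r powr - s * (\<bar>b\<bar> + a * 8)"
  proof (intro mult_left_mono add_left_mono)
    show "\<bar>a * (inverse I * J)\<bar> \<le> a * 8"
      using mult_left_mono[OF IJ a0] a0 by (simp only: abs_mult abs_of_nonneg)
  qed simp
  finally have "\<bar>r powr - s * b - r powr - s * a * inverse I * J\<bar> \<le> r powr - s * (\<bar>b\<bar> + a * 8)"
    .
  also have "\<dots> \<le> r powr - s * (16 * measure \<mu> (ball x (4 * r)))"
    using b8 aM by (intro mult_left_mono) auto
  finally have bound: "\<bar>r powr - s * b - r powr - s * a * inverse I * J\<bar> \<le> 16 * (r powr - s * measure \<mu> (ball x (4 * r)))"
    by (simp only: mult.left_commute)
  show "ennreal \<bar>(1 / r powr s) * ((LINT y|\<mu>. \<phi> (norm (y - x) / r) * f y) -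
      flat_const \<phi> \<mu> s L x r * (LINT y|hausdorff_on s ((+) x ` L). \<phi> (norm (y - x) / r) * f y))\<bar>
    \<le> ennreal (16 * (r powr - s * measure \<mu> (ball x (4 * r))))"
    unfolding alpha_flat_value[OF \<phi> Ls(1) r s fc]
    using bound unfolding a_def b_def I_def J_def H_def \<psi>_def g_def by (rule ennreal_leI)
qed

text \<open>The limit plane V is a competitor in the infimum. For a fixed test function the
  difference of integrals tends to 0, because the constant that matches the cutoff integrals tends
  to \<kappa>. Compactness of the test functions upgrades this from single functions to the
  supremum.\<close>

lemma alpha_flat_small_along_blowups:
  fixes \<mu> :: "'a::euclidean_space measure" and x :: 'a
  assumes lf: "locally_finite_borel_measure \<mu>" and \<phi>: "flat_cutoff \<phi>" and s: "0 < s" and V: "V \<in> grassmannian s"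
    and pos: "0 < measure (hausdorff_on s V) (cball 0 1)"
    and rr: "\<And>n. 0 < rr n"
    and lim: "\<And>f :: 'a \<Rightarrow> real. cont_compact f \<Longrightarrow>
      (\<lambda>n. rr n powr - s * (LINT y|\<mu>. f ((y - x) /\<^sub>R rr n))) \<longlonglongrightarrow> \<kappa> * (LINT y|hausdorff_on s V. f y)"
    and \<epsilon>: "0 < \<epsilon>"
  shows "\<exists>n. alpha_flat \<phi> \<mu> s x (rr n) < ennreal \<epsilon>"
proof (rule ccontr)
  assume no: "\<not> ?thesis"
  define H where "H = hausdorff_on s V"
  define \<psi> where "\<psi> = (\<lambda>y::'a. \<phi> (norm y))"
  define A where "A = (\<lambda>n F. rr n powr - s * (LINT y|\<mu>. F ((y - x) /\<^sub>R rr n)))"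
  define I where "I = (LINT y|H. \<psi> y)"
  have Vs: "subspace V" "real (dim V) = s" using V by (auto simp: grassmannian_def)
  have lfH: "locally_finite_borel_measure H"
    using locally_finite_hausdorff_on_subspace[OF Vs(1) refl] Vs(2) s unfolding H_def by auto
  have \<psi>c: "cont_compact \<psi>" unfolding \<psi>_def by (rule cont_compact_flat_cutoff[OF \<phi>])
  have \<psi>r: "0 \<le> \<psi> y" for y using flat_cutoff_range[OF \<phi>, of "norm y"] by (auto simp: \<psi>_def)
  have I: "0 < I"
  proof -
    have "measure H (cball 0 1) = (LINT y|H. indicat_real (cball 0 1) y)"
      using sets_eq_imp_space_eq[OF locally_finite_sets[OF lfH]] by simp
    also have "\<dots> \<le> I"
      unfolding I_def
    proof (rule integral_mono)
      show "integrable H (indicat_real (cball 0 1))"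
        using emeasure_bounded_finite[OF lfH bounded_cball, of 0 1] locally_finite_sets[OF lfH]
        by (intro integrable_real_indicator) auto
      show "integrable H \<psi>" by (rule cont_compact_locally_finite_integrable[OF \<psi>c lfH])
      show "indicat_real (cball 0 1) y \<le> \<psi> y" for y
        using \<psi>r[of y] flat_cutoff_inside[OF \<phi>, of "norm y"] by (auto simp: indicator_def \<psi>_def)
    qed
    finally show ?thesis using pos by (simp add: H_def)
  qed
  have diff: "\<bar>A n F - A n F'\<bar> \<le> \<delta> * A n \<psi>"
    if F: "cont_compact F" "cont_compact F'" "\<And>y. \<bar>F y - F' y\<bar> \<le> \<delta> * \<psi> y" for n F F' \<delta>
  proof -
    have "\<bar>A n F - A n F'\<bar> = rr n powr - s * \<bar>(LINT y|\<mu>. F ((y - x) /\<^sub>R rr n)) - (LINT y|\<mu>. F' ((y - x) /\<^sub>R rr n))\<bar>"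
      unfolding A_def right_diff_distrib[symmetric] by (simp only: abs_mult abs_of_nonneg[OF powr_ge_zero])
    also have "\<dots> \<le> rr n powr - s * (\<delta> * (LINT y|\<mu>. \<psi> ((y - x) /\<^sub>R rr n)))"
      by (intro mult_left_mono powr_ge_zero cont_compact_integral_diff_le[OF lf] cont_compact_rescale F \<psi>c rr)
    finally show ?thesis by (simp only: A_def mult.left_commute)
  qed
  have "\<exists>g. 1-lipschitz_on UNIV g \<and> (\<forall>z. 4 \<le> norm z \<longrightarrow> g z = 0) \<and> (\<forall>z. \<bar>g z\<bar> \<le> 8) \<and>
      \<epsilon> / 2 < \<bar>A n (\<lambda>y. \<psi> y * g y) - A n \<psi> * inverse I * (LINT y|H. \<psi> y * g y)\<bar>" for n
  proof -
    \<comment> \<open>The supremum need not be attained; the gap between \<epsilon> / 2 and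
      \<epsilon> leaves room for a test function that nearly attains it.\<close>
    have "ennreal (\<epsilon> / 2) < ennreal \<epsilon>" using \<epsilon> by (simp add: ennreal_less_iff)
    also have "\<dots> \<le> alpha_flat \<phi> \<mu> s x (rr n)" using no by (auto simp: not_less)
    also have "\<dots> \<le> (SUP f\<in>{f \<in> Lip0 (ball x (4 * rr n)). (1 / rr n)-lipschitz_on UNIV f}.
          ennreal \<bar>(1 / rr n powr s) *
            ((LINT y|\<mu>. \<phi> (norm (y - x) / rr n) * f y) -
             flat_const \<phi> \<mu> s V x (rr n) *
               (LINT y|hausdorff_on s ((+) x ` V). \<phi> (norm (y - x) / rr n) * f y))\<bar>)"
      unfolding alpha_flat_def by (rule INF_lower[OF V])
    finally obtain f where f: "f \<in> Lip0 (ball x (4 * rr n))" "(1 / rr n)-lipschitz_on UNIV f"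
      and big: "ennreal (\<epsilon> / 2) < ennreal \<bar>(1 / rr n powr s) *
            ((LINT y|\<mu>. \<phi> (norm (y - x) / rr n) * f y) -
             flat_const \<phi> \<mu> s V x (rr n) *
               (LINT y|hausdorff_on s ((+) x ` V). \<phi> (norm (y - x) / rr n) * f y))\<bar>"
      unfolding less_SUP_iff by blast
    have fc: "continuous_on UNIV f" using f(2) by (rule lipschitz_on_continuous_on)
    define g where "g = (\<lambda>z. f (x + rr n *\<^sub>R z))"
    have "\<epsilon> / 2 < \<bar>A n (\<lambda>y. \<psi> y * g y) - A n \<psi> * inverse I * (LINT y|H. \<psi> y * g y)\<bar>"
      using big \<epsilon> unfolding alpha_flat_value[OF \<phi> Vs(1) rr s fc] A_def I_def H_def \<psi>_def g_def
      by (simp only: ennreal_less_iff)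
    moreover have "1-lipschitz_on UNIV g" "\<forall>z. 4 \<le> norm z \<longrightarrow> g z = 0" "\<forall>z. \<bar>g z\<bar> \<le> 8"
      unfolding g_def using Lip0_rescaled[OF rr f] by simp_all
    ultimately show ?thesis by (intro exI[of _ g] conjI)
  qed
  then have "\<forall>n. \<exists>g. 1-lipschitz_on UNIV g \<and> (\<forall>z. 4 \<le> norm z \<longrightarrow> g z = 0) \<and> (\<forall>z. \<bar>g z\<bar> \<le> 8) \<and>
      \<epsilon> / 2 < \<bar>A n (\<lambda>y. \<psi> y * g y) - A n \<psi> * inverse I * (LINT y|H. \<psi> y * g y)\<bar>" ..
  from choice[OF this] obtain g where gg: "\<forall>n. 1-lipschitz_on UNIV (g n) \<and> (\<forall>z. 4 \<le> norm z \<longrightarrow> g n z = 0) \<and> (\<forall>z. \<bar>g n z\<bar> \<le> 8) \<and>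
      \<epsilon> / 2 < \<bar>A n (\<lambda>y. \<psi> y * g n y) - A n \<psi> * inverse I * (LINT y|H. \<psi> y * g n y)\<bar>" ..
  have g: "\<And>n. 1-lipschitz_on UNIV (g n)" "\<And>n z. 4 \<le> norm z \<Longrightarrow> g n z = 0" "\<And>n z. \<bar>g n z\<bar> \<le> 8"
    using gg by simp_all
  have big: "\<And>n. \<epsilon> / 2 < \<bar>A n (\<lambda>y. \<psi> y * g n y) - A n \<psi> * inverse I * (LINT y|H. \<psi> y * g n y)\<bar>"
    using gg by simp
  have equi: "\<exists>d>0. \<forall>n y. y \<in> cball 0 4 \<and> norm (z - y) < d \<longrightarrow> norm (g n z - g n y) < e" if "0 < e" for z :: 'a and e :: real
  proof -
    have "norm (g n z - g n y) < e" if "norm (z - y) < e" for n y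
      using lipschitz_onD[OF g(1) UNIV_I UNIV_I, of n z y] that by (simp add: dist_norm)
    then show ?thesis using that by (intro exI[of _ e]) simp
  qed
  have g8: "norm (g n z) \<le> 8" for n z using g(3)[of n z] by simp
  obtain h j where "continuous_on (cball (0::'a) 4) h" and j: "strict_mono (j :: nat \<Rightarrow> nat)"
    and h: "\<And>e. 0 < e \<Longrightarrow> \<exists>N. \<forall>n z. N \<le> n \<and> z \<in> cball (0::'a) 4 \<longrightarrow> norm (g (j n) z - h z) < e"
  proof (rule Arzela_Ascoli[OF compact_cball[of "0::'a" 4] g8 equi])
    fix h and j :: "nat \<Rightarrow> nat"
    assume h: "continuous_on (cball (0::'a) 4) h" "strict_mono j"
      "\<And>e. 0 < e \<Longrightarrow> \<exists>N. \<forall>n z. N \<le> n \<and> z \<in> cball (0::'a) 4 \<longrightarrow> norm (g (j n) z - h z) < e"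
    show thesis by (rule that[OF h])
  qed
  \<comment> \<open>Arzela--Ascoli yields a limit on the closed ball only; extension by 0 keeps the
    convergence uniform, since every \<open>g n\<close> vanishes outside.\<close>
  define G where "G z = (if norm z \<le> 4 then h z else 0)" for z
  have unif: "\<exists>N. \<forall>n\<ge>N. \<forall>z. \<bar>g (j n) z - G z\<bar> < e" if e: "0 < e" for e
  proof -
    from h[OF e] obtain N where "\<forall>n z. N \<le> n \<and> z \<in> cball (0::'a) 4 \<longrightarrow> norm (g (j n) z - h z) < e" ..
    then have N: "\<bar>g (j n) z - h z\<bar> < e" if "N \<le> n" "norm z \<le> 4" for n z
      using that by simp
    have "\<bar>g (j n) z - G z\<bar> < e" if "N \<le> n" for n z
    proof (cases "norm z \<le> 4")
      case True
      then show ?thesis using N[OF that True] by (simp add: G_def)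
    next
      case False
      then have "g (j n) z = 0" by (intro g(2)) simp
      then show ?thesis using False e by (simp add: G_def)
    qed
    then show ?thesis by (intro exI[of _ N] allI impI)
  qed
  have ptw: "(\<lambda>n. g (j n) z) \<longlonglongrightarrow> G z" for z
  proof (rule LIMSEQ_I)
    fix e :: real assume "0 < e"
    from unif[OF this] obtain N where "\<forall>n\<ge>N. \<forall>z. \<bar>g (j n) z - G z\<bar> < e" ..
    then show "\<exists>N. \<forall>n\<ge>N. norm (g (j n) z - G z) < e" by (intro exI[of _ N]) simp
  qed
  have "1-lipschitz_on UNIV G"
  proof (rule lipschitz_onI)
    fix z w :: 'a
    have "(\<lambda>n. dist (g (j n) z) (g (j n) w)) \<longlonglongrightarrow> dist (G z) (G w)" by (intro tendsto_dist ptw)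
    then show "dist (G z) (G w) \<le> 1 * dist z w"
    proof (rule tendsto_upperbound)
      show "\<forall>\<^sub>F n in sequentially. dist (g (j n) z) (g (j n) w) \<le> 1 * dist z w"
        by (intro always_eventually allI lipschitz_onD[OF g(1)]) auto
    qed simp
  qed simp
  then have Gc: "continuous_on UNIV G" by (rule lipschitz_on_continuous_on)
  have gc: "continuous_on UNIV (g n)" for n using g(1) by (rule lipschitz_on_continuous_on)
  have \<psi>Gc: "cont_compact (\<lambda>y. \<psi> y * G y)" "cont_compact (\<lambda>y. \<psi> y * g n y)" for n
    unfolding \<psi>_def by (rule cont_compact_cutoff_mult[OF \<phi> Gc], rule cont_compact_cutoff_mult[OF \<phi> gc])
  define J where "J = (LINT y|H. \<psi> y * G y)"
  have limA: "(\<lambda>n. A (j n) F) \<longlonglongrightarrow> \<kappa> * (LINT y|H. F y)" if "cont_compact F" for F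
    using LIMSEQ_subseq_LIMSEQ[OF lim[OF that] j] by (simp only: A_def H_def o_def)
  have l1: "(\<lambda>n. A (j n) \<psi>) \<longlonglongrightarrow> \<kappa> * I" unfolding I_def by (rule limA[OF \<psi>c])
  have "(\<lambda>n. \<bar>A (j n) (\<lambda>y. \<psi> y * G y) - A (j n) \<psi> * inverse I * J\<bar>) \<longlonglongrightarrow> \<bar>\<kappa> * J - \<kappa> * I * inverse I * J\<bar>"
    unfolding J_def by (intro tendsto_intros l1 limA[OF \<psi>Gc(1)])
  also have "\<bar>\<kappa> * J - \<kappa> * I * inverse I * J\<bar> = 0" using I by simp
  finally have l2: "(\<lambda>n. \<bar>A (j n) (\<lambda>y. \<psi> y * G y) - A (j n) \<psi> * inverse I * J\<bar>) \<longlonglongrightarrow> 0" .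
  define K where "K = \<bar>\<kappa> * I\<bar> + 1"
  have K: "0 < K" "\<kappa> * I < K" by (auto simp: K_def)
  \<comment> \<open>Replacing \<open>g (j n)\<close> by its limit costs at most \<delta> K =
    \<epsilon> / 8 in each of the two integrals; with the value at the limit below \<epsilon> / 4
    the total stays below \<epsilon> / 2.\<close>
  define \<delta> where "\<delta> = \<epsilon> / (8 * K)"
  have \<delta>: "0 < \<delta>" using \<epsilon> K by (simp add: \<delta>_def)
  have "\<forall>\<^sub>F n in sequentially. \<bar>A (j n) (\<lambda>y. \<psi> y * G y) - A (j n) \<psi> * inverse I * J\<bar> < \<epsilon> / 4"
    using \<epsilon> by (intro order_tendstoD(2)[OF l2]) auto
  moreover have "\<forall>\<^sub>F n in sequentially. A (j n) \<psi> < K" by (rule order_tendstoD(2)[OF l1 K(2)])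
  moreover have "\<forall>\<^sub>F n in sequentially. \<forall>z. \<bar>g (j n) z - G z\<bar> < \<delta>"
    using unif[OF \<delta>] unfolding eventually_sequentially .
  ultimately have "\<forall>\<^sub>F n in sequentially. False"
  proof eventually_elim
    case (elim n)
    define a where "a = A (j n) \<psi>"
    define u where "u = A (j n) (\<lambda>y. \<psi> y * G y)"
    define v where "v = A (j n) (\<lambda>y. \<psi> y * g (j n) y)"
    define w where "w = (LINT y|H. \<psi> y * g (j n) y)"
    have le: "\<bar>\<psi> y * g (j n) y - \<psi> y * G y\<bar> \<le> \<delta> * \<psi> y" for y
    proof -
      have "\<bar>\<psi> y * g (j n) y - \<psi> y * G y\<bar> = \<psi> y * \<bar>g (j n) y - G y\<bar>"
        unfolding right_diff_distrib[symmetric] by (simp only: abs_mult abs_of_nonneg[OF \<psi>r])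
      also have "\<dots> \<le> \<psi> y * \<delta>" using elim(3) by (intro mult_left_mono \<psi>r) (simp add: less_imp_le)
      finally show ?thesis by (simp only: mult.commute)
    qed
    have a0: "0 \<le> a" unfolding a_def A_def using \<psi>r by (intro mult_nonneg_nonneg integral_nonneg_AE) auto
    have d1: "\<bar>v - u\<bar> \<le> \<delta> * a" unfolding v_def u_def a_def by (rule diff[OF \<psi>Gc(2,1) le])
    have d2: "\<bar>w - J\<bar> \<le> \<delta> * I" unfolding w_def J_def I_def
      by (rule cont_compact_integral_diff_le[OF lfH \<psi>Gc(2,1) \<psi>c le])
    have "\<bar>a * inverse I * w - a * inverse I * J\<bar> = a * inverse I * \<bar>w - J\<bar>"
      unfolding right_diff_distrib[symmetric] using a0 I by (simp add: abs_mult)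
    also have "\<dots> \<le> a * inverse I * (\<delta> * I)" using a0 I d2 by (intro mult_left_mono) auto
    also have "\<dots> = \<delta> * a" using I by simp
    finally have d3: "\<bar>a * inverse I * w - a * inverse I * J\<bar> \<le> \<delta> * a" .
    have "\<delta> * a \<le> \<delta> * K" using elim(2) \<delta> by (intro mult_left_mono) (auto simp: a_def)
    also have "\<delta> * K = \<epsilon> / 8" using K by (simp add: \<delta>_def)
    finally have "\<delta> * a \<le> \<epsilon> / 8" .
    moreover have "\<epsilon> / 2 < \<bar>v - a * inverse I * w\<bar>" using big[of "j n"] by (simp only: v_def a_def w_def)
    moreover have "\<bar>u - a * inverse I * J\<bar> < \<epsilon> / 4" using elim(1) by (simp only: u_def a_def)
    ultimately show False using d1 d3 by linarith
  qed
  then show False by simp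
qed

section \<open>Points with flat blow-ups\<close>

text \<open>One index bounds both the constant and the scale, so the sets increase with k and cover
  all points of finite upper density.\<close>

definition regular_set :: "'a::euclidean_space measure \<Rightarrow> real \<Rightarrow> nat \<Rightarrow> 'a set" where
  "regular_set \<mu> s k = {z. \<forall>r\<in>{0<..<1 / real (Suc k)}. emeasure \<mu> (ball z r) \<le> ennreal (real (Suc k) * r powr s)}"

text \<open>n is the accuracy and i the scale below which it is reached. This countable family of
  closed sets takes the place of Egorov's theorem: on each of them the bound is uniform.\<close>

definition small_moment_set :: "'a::euclidean_space measure \<Rightarrow> real \<Rightarrow> nat \<Rightarrow> nat \<Rightarrow> 'a set" where
  "small_moment_set \<mu> s n i =
     {z. \<forall>r\<in>{0<..<1 / real (Suc i)}. norm (sym_moment \<mu> z r) \<le> 1 / real (Suc n) * r powr (s + 5)}"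

lemma closed_regular_set:
  fixes \<mu> :: "'a::euclidean_space measure"
  assumes "sets \<mu> = sets borel"
  shows "closed (regular_set \<mu> s k)"
proof -
  have "regular_set \<mu> s k = (\<Inter>r\<in>{0<..<1 / real (Suc k)}. {z. emeasure \<mu> (ball z r) \<le> ennreal (real (Suc k) * r powr s)})"
    by (auto simp: regular_set_def)
  then show ?thesis by (simp only:) (intro closed_INT ballI closed_emeasure_ball_le assms)
qed

lemma continuous_on_sym_moment:
  fixes \<mu> :: "'a::euclidean_space measure"
  assumes lf: "locally_finite_borel_measure \<mu>" and r: "0 \<le> r"
  shows "continuous_on UNIV (\<lambda>z. sym_moment \<mu> z r)"
  unfolding continuous_on_iff
proof (intro ballI allI impI)
  fix z :: 'a and e :: real assume e: "0 < e"
  have sb: "sets \<mu> = sets borel" by (rule locally_finite_sets[OF lf])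
  define M where "M = 5 * r ^ 4 * measure \<mu> (cball z (r + 1))"
  have M: "0 \<le> M" using r by (simp add: M_def)
  define d where "d = min 1 (e / (M + 1))"
  have d: "0 < d" using M e by (simp add: d_def)
  show "\<exists>d>0. \<forall>z'\<in>UNIV. dist z' z < d \<longrightarrow> dist (sym_moment \<mu> z' r) (sym_moment \<mu> z r) < e"
  proof (intro exI[of _ d] conjI ballI impI d)
    fix z' assume z': "dist z' z < d"
    have n: "norm (z - z') < d" using z' by (simp add: dist_norm norm_minus_commute)
    have n1: "norm (z - z') \<le> 1" using n by (simp add: d_def)
    have "dist (sym_moment \<mu> z' r) (sym_moment \<mu> z r) \<le> 5 * r ^ 4 * norm (z - z') * measure \<mu> (cball z (r + norm (z - z')))"
      using sym_moment_lipschitz[OF lf r, of z z'] by (simp add: dist_norm norm_minus_commute)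
    also have "\<dots> \<le> 5 * r ^ 4 * norm (z - z') * measure \<mu> (cball z (r + 1))"
    proof (intro mult_left_mono measure_mono_fmeasurable)
      show "cball z (r + norm (z - z')) \<subseteq> cball z (r + 1)" using n1 by auto
      show "cball z (r + norm (z - z')) \<in> sets \<mu>" by (simp add: sb)
      show "cball z (r + 1) \<in> fmeasurable \<mu>"
        using emeasure_bounded_finite[OF lf bounded_cball, of z "r + 1"] by (intro fmeasurableI) (simp_all add: sb)
    qed (use r in simp)
    also have "\<dots> = M * norm (z - z')" by (simp add: M_def)
    also have "\<dots> \<le> M * d" using n M by (intro mult_left_mono) auto
    also have "\<dots> \<le> M * (e / (M + 1))" using M by (intro mult_left_mono) (auto simp: d_def)
    also have "\<dots> < e" using M e by (simp add: field_simps)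
    finally show "dist (sym_moment \<mu> z' r) (sym_moment \<mu> z r) < e" .
  qed
qed

lemma closed_small_moment_set:
  fixes \<mu> :: "'a::euclidean_space measure"
  assumes lf: "locally_finite_borel_measure \<mu>"
  shows "closed (small_moment_set \<mu> s n i)"
proof -
  have "small_moment_set \<mu> s n i =
      (\<Inter>r\<in>{0<..<1 / real (Suc i)}. {z. norm (sym_moment \<mu> z r) \<le> 1 / real (Suc n) * r powr (s + 5)})"
    by (auto simp: small_moment_set_def)
  moreover have "closed {z. norm (sym_moment \<mu> z r) \<le> 1 / real (Suc n) * r powr (s + 5)}" if "r \<in> {0<..<1 / real (Suc i)}" for r
    by (intro closed_Collect_le continuous_on_norm continuous_on_sym_moment[OF lf] continuous_on_const) (use that in simp)
  ultimately show ?thesis by (simp only:) (intro closed_INT ballI)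
qed

lemma mem_regular_setI:
  assumes "upper_density \<mu> s x < \<infinity>"
  shows "\<exists>k. x \<in> regular_set \<mu> s k"
proof -
  obtain c :: real where c: "0 \<le> c" "upper_density \<mu> s x = ennreal c"
    using assms by (cases "upper_density \<mu> s x" rule: ennreal_cases) auto
  then have "upper_density \<mu> s x < ennreal (c + 1)" by (simp add: ennreal_less_iff)
  from upper_density_lessD[OF this] obtain b where b: "0 < b"
    "\<And>r. 0 < r \<Longrightarrow> r < b \<Longrightarrow> emeasure \<mu> (ball x r) \<le> ennreal ((c + 1) * r powr s)"
    unfolding eventually_at_right_field by blast
  obtain k1 :: nat where k1: "c + 1 \<le> real k1" using real_arch_simple by blast
  obtain k2 :: nat where k2: "1 / real (Suc k2) < b" using nat_approx_posE[OF b(1)] by blast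
  define k where "k = max k1 k2"
  have k: "c + 1 \<le> real (Suc k)" using k1 by (simp add: k_def)
  have "1 / real (Suc k) \<le> 1 / real (Suc k2)" by (simp add: k_def frac_le)
  then have kb: "1 / real (Suc k) < b" using k2 by linarith
  have "emeasure \<mu> (ball x r) \<le> ennreal (real (Suc k) * r powr s)" if "r \<in> {0<..<1 / real (Suc k)}" for r
  proof -
    have "emeasure \<mu> (ball x r) \<le> ennreal ((c + 1) * r powr s)" using that kb by (intro b(2)) auto
    also have "\<dots> \<le> ennreal (real (Suc k) * r powr s)" using k by (intro ennreal_leI mult_right_mono) auto
    finally show ?thesis .
  qed
  then show ?thesis unfolding regular_set_def by blast
qed

lemma mem_small_moment_setI:
  fixes \<mu> :: "'a::euclidean_space measure" and x :: 'a
  assumes lf: "locally_finite_borel_measure \<mu>" and \<eta>: "cutoff_family \<eta>" and s: "0 < s"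
    and lim: "((\<lambda>r. (1 / r powr (s + 1)) *\<^sub>R (LINT y|\<mu>. \<eta> (1 / 2) (norm (x - y) / r) *\<^sub>R (x - y))) \<longlongrightarrow> 0) (at_right 0)"
  shows "\<exists>i. x \<in> small_moment_set \<mu> s n i"
proof -
  define T where "T r = (LINT y|\<mu>. \<eta> (1 / 2) (norm (x - y) / r) *\<^sub>R (x - y))" for r
  \<comment> \<open>The 12 cancels the constant lost in passing from the cutoff to the smooth
    kernel.\<close>
  define \<delta> where "\<delta> = 1 / (12 * real (Suc n))"
  have \<delta>: "0 < \<delta>" "12 * \<delta> = 1 / real (Suc n)" unfolding \<delta>_def by (simp_all del: of_nat_Suc)
  from tendstoD[OF lim \<delta>(1)] obtain b where b: "0 < b"
    "\<And>r. 0 < r \<Longrightarrow> r < b \<Longrightarrow> norm ((1 / r powr (s + 1)) *\<^sub>R T r) < \<delta>"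
    unfolding eventually_at_right_field T_def[symmetric] dist_norm diff_zero by blast
  obtain i :: nat where i: "1 / real (Suc i) < b" using nat_approx_posE[OF b(1)] by blast
  have T: "norm (T r) \<le> \<delta> * r powr (s + 1)" if "0 < r" "r \<le> 1 / real (Suc i)" for r
  proof -
    have "norm (T r) / r powr (s + 1) < \<delta>" using b(2)[of r] that i by simp
    then show ?thesis using that by (simp add: divide_less_eq)
  qed
  have "norm (sym_moment \<mu> x r) \<le> 1 / real (Suc n) * r powr (s + 5)" if "r \<in> {0<..<1 / real (Suc i)}" for r
    unfolding \<delta>(2)[symmetric]
    using that \<delta>(1) by (intro sym_moment_small[OF lf \<eta> s _ T[unfolded T_def], where ?r0.0 = "1 / real (Suc i)"]) auto
  then show ?thesis unfolding small_moment_set_def by blast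
qed

text \<open>Speaks only about sequences of scales with a lower mass bound, along which blow-ups
  cannot vanish. The radius \<open>4 * rr n\<close> is that of the ball containing the supports of
  the test functions of the flat numbers.\<close>

definition flat_point :: "'a::euclidean_space measure \<Rightarrow> real \<Rightarrow> 'a \<Rightarrow> bool" where
  "flat_point \<mu> s x \<longleftrightarrow> (\<forall>rr c. (\<forall>n. 0 < rr n) \<and> rr \<longlonglongrightarrow> 0 \<and> 0 < c \<and>
      (\<forall>n::nat. ennreal (c * rr n powr s) \<le> emeasure \<mu> (ball x (4 * rr n))) \<longrightarrow>
    (\<exists>k V \<kappa>. strict_mono k \<and> subspace V \<and> real (dim V) = s \<and> 0 < measure (hausdorff_on s V) (cball 0 1) \<and>
      (\<forall>f :: 'a \<Rightarrow> real. cont_compact f \<longrightarrow>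
        (\<lambda>n. rr (k n) powr - s * (LINT y|\<mu>. f ((y - x) /\<^sub>R rr (k n)))) \<longlonglongrightarrow> \<kappa> * (LINT y|hausdorff_on s V. f y))))"

lemma flat_pointI:
  fixes \<mu> :: "'a::euclidean_space measure"
  assumes lf: "locally_finite_borel_measure \<mu>" and s: "0 < s"
    and reg: "x \<in> regular_set \<mu> s k" and small: "\<And>n. \<exists>i. x \<in> small_moment_set \<mu> s n i"
    and dens: "\<And>n i. x \<in> regular_set \<mu> s k \<inter> small_moment_set \<mu> s n i \<Longrightarrow>
      \<forall>c>0. \<forall>\<^sub>F r in at_right 0. emeasure \<mu> (ball x r - (regular_set \<mu> s k \<inter> small_moment_set \<mu> s n i)) \<le> ennreal (c * r powr s)"
  shows "flat_point \<mu> s x"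
proof -
  have sb: "sets \<mu> = sets borel" by (rule locally_finite_sets[OF lf])
  have "\<forall>n. \<exists>i. x \<in> small_moment_set \<mu> s n i" using small by blast
  from choice[OF this] obtain i where i: "\<And>n. x \<in> small_moment_set \<mu> s n (i n)" by blast
  define G where "G n = regular_set \<mu> s k \<inter> small_moment_set \<mu> s n (i n)" for n
  have xG: "x \<in> G n" for n using reg i by (simp add: G_def)
  show ?thesis
    unfolding flat_point_def
  proof (intro allI impI, elim conjE)
    fix rr :: "nat \<Rightarrow> real" and c :: real
    assume rr: "\<forall>n. 0 < rr n" "rr \<longlonglongrightarrow> 0" and c: "0 < c"
      and low: "\<forall>n. ennreal (c * rr n powr s) \<le> emeasure \<mu> (ball x (4 * rr n))"
    show "\<exists>k V \<kappa>. strict_mono k \<and> subspace V \<and> real (dim V) = s \<and> 0 < measure (hausdorff_on s V) (cball 0 1) \<and>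
      (\<forall>f :: 'a \<Rightarrow> real. cont_compact f \<longrightarrow>
        (\<lambda>n. rr (k n) powr - s * (LINT y|\<mu>. f ((y - x) /\<^sub>R rr (k n)))) \<longlonglongrightarrow> \<kappa> * (LINT y|hausdorff_on s V. f y))"
    proof (rule tangent_measure_flat[OF lf s closed_regular_set[OF sb, of s k], where G=G and C="real (Suc k)" and ?\<delta>0.0="1 / real (Suc k)"])
      show "emeasure \<mu> (ball z r) \<le> ennreal (real (Suc k) * r powr s)"
        if "z \<in> regular_set \<mu> s k" "0 < r" "r < 1 / real (Suc k)" for z r
        using that by (simp add: regular_set_def)
      show "G n \<subseteq> regular_set \<mu> s k" for n by (simp add: G_def)
      show "x \<in> G n" for n by (rule xG)
      show "G n \<in> sets borel" for n
        unfolding G_def by (intro borel_closed closed_Int closed_regular_set closed_small_moment_set lf sb)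
      show "\<forall>\<^sub>F r in at_right 0. emeasure \<mu> (ball x r - G n) \<le> ennreal (c * r powr s)" if "0 < c" for n c
        using dens[of n "i n"] xG[of n] that unfolding G_def by blast
      show "\<exists>\<delta>>0. \<forall>z\<in>G n. \<forall>r. 0 < r \<and> r < \<delta> \<longrightarrow> norm (sym_moment \<mu> z r) \<le> 1 / real (Suc n) * r powr (s + 5)" for n
        by (intro exI[of _ "1 / real (Suc (i n))"]) (simp add: G_def small_moment_set_def)
      show "0 < rr n" for n using rr(1) by blast
      show "rr \<longlonglongrightarrow> 0" by (rule rr(2))
      show "0 < c" by (rule c)
      show "ennreal (c * rr n powr s) \<le> emeasure \<mu> (ball x (4 * rr n))" for n using low by blast
    qed simp_all
  qed
qed

lemma AE_flat_point:
  fixes \<mu> :: "'a::euclidean_space measure"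
  assumes lf: "locally_finite_borel_measure \<mu>" and \<eta>: "cutoff_family \<eta>" and s: "0 < s"
    and fin: "AE x in \<mu>. upper_density \<mu> s x < \<infinity>" and sla: "small_local_action \<eta> (\<lambda>x::'a. x) s \<mu>"
  shows "AE x in \<mu>. flat_point \<mu> s x"
proof -
  have sb: "sets \<mu> = sets borel" by (rule locally_finite_sets[OF lf])
  \<comment> \<open>There are only countably many such sets, so almost every point is a density
    point of each of them that contains it.\<close>
  have "AE x in \<mu>. x \<in> regular_set \<mu> s k \<inter> small_moment_set \<mu> s n i \<longrightarrow>
      (\<forall>c>0. \<forall>\<^sub>F r in at_right 0. emeasure \<mu> (ball x r - (regular_set \<mu> s k \<inter> small_moment_set \<mu> s n i)) \<le> ennreal (c * r powr s))" for k n i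
  proof (rule density_point_closed_set[OF lf _ _ s, where C="real (Suc k)" and ?\<delta>0.0="1 / real (Suc k)"])
    show "closed (regular_set \<mu> s k \<inter> small_moment_set \<mu> s n i)"
      by (intro closed_Int closed_regular_set closed_small_moment_set lf sb)
    show "emeasure \<mu> (ball z r) \<le> ennreal (real (Suc k) * r powr s)"
      if "z \<in> regular_set \<mu> s k \<inter> small_moment_set \<mu> s n i" "0 < r" "r < 1 / real (Suc k)" for z r
      using that by (simp add: regular_set_def)
  qed simp_all
  then have dens: "AE x in \<mu>. \<forall>k n i. x \<in> regular_set \<mu> s k \<inter> small_moment_set \<mu> s n i \<longrightarrow>
      (\<forall>c>0. \<forall>\<^sub>F r in at_right 0. emeasure \<mu> (ball x r - (regular_set \<mu> s k \<inter> small_moment_set \<mu> s n i)) \<le> ennreal (c * r powr s))"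
    unfolding AE_all_countable by blast
  have half: "(1 / 2 :: real) \<in> {0<..<1}" by simp
  have lim: "AE x in \<mu>. ((\<lambda>r. (1 / r powr (s + 1)) *\<^sub>R (LINT y|\<mu>. \<eta> (1 / 2) (norm (x - y) / r) *\<^sub>R (x - y))) \<longlongrightarrow> 0) (at_right 0)"
    using sla half unfolding small_local_action_def by blast
  from dens lim fin show ?thesis
  proof eventually_elim
    case (elim x)
    obtain k where "x \<in> regular_set \<mu> s k" using mem_regular_setI[OF elim(3)] by blast
    then show ?case
      by (rule flat_pointI[OF lf s]) (use mem_small_moment_setI[OF lf \<eta> s elim(2)] elim(1) in blast)+
  qed
qed

lemma flat_point_non_integer:
  fixes \<mu> :: "'a::euclidean_space measure"
  assumes x: "flat_point \<mu> s x" and s: "s \<notin> \<int>"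
  shows "upper_density \<mu> s x = 0"
proof (rule upper_density_eq_0I, rule ccontr)
  fix c :: real assume c: "0 < c"
    and no: "\<not> (\<forall>\<^sub>F r in at_right 0. emeasure \<mu> (ball x r) \<le> ennreal (c * r powr s))"
  obtain rr where rr: "\<And>n::nat. 0 < rr n" "rr \<longlonglongrightarrow> 0" "\<And>n. \<not> emeasure \<mu> (ball x (rr n)) \<le> ennreal (c * rr n powr s)"
    using not_eventually_at_right_sequence[OF no] by blast
  \<comment> \<open>Compensates the factor 4 in the radius of the mass bound of
    \<open>flat_point\<close>.\<close>
  define rr' where "rr' n = rr n / 4" for n
  have "rr' \<longlonglongrightarrow> 0 / 4" unfolding rr'_def by (intro tendsto_divide rr(2) tendsto_const) simp
  moreover have "ennreal (c * 4 powr s * rr' n powr s) \<le> emeasure \<mu> (ball x (4 * rr' n))" for n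
  proof -
    have "4 powr s * rr' n powr s = rr n powr s" using rr(1)[of n] by (simp add: rr'_def flip: powr_mult)
    then have eq: "c * 4 powr s * rr' n powr s = c * rr n powr s" by (simp only: mult.assoc)
    have "4 * rr' n = rr n" by (simp add: rr'_def)
    then show ?thesis unfolding eq using rr(3)[of n] by simp
  qed
  moreover have "0 < rr' n" for n using rr(1) by (simp add: rr'_def)
  moreover have "0 < c * 4 powr s" using c by simp
  ultimately obtain V :: "'a set" where V: "real (dim V) = s"
    using x[unfolded flat_point_def, THEN spec[of _ rr'], THEN spec[of _ "c * 4 powr s"]] by auto
  have "s \<in> \<int>" unfolding V[symmetric] by (rule Ints_of_nat)
  then show False using s by simp
qed

lemma flat_point_integer:
  fixes \<mu> :: "'a::euclidean_space measure"
  assumes lf: "locally_finite_borel_measure \<mu>" and \<phi>: "flat_cutoff \<phi>" and s: "0 < s" "s < real DIM('a)" "s \<in> \<int>"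
    and x: "flat_point \<mu> s x"
  shows "((\<lambda>r. alpha_flat \<phi> \<mu> s x r) \<longlongrightarrow> 0) (at_right 0)"
proof (rule tendsto_0_ennrealI, rule ccontr)
  fix \<epsilon> :: real assume \<epsilon>: "0 < \<epsilon>"
    and no: "\<not> (\<forall>\<^sub>F r in at_right 0. alpha_flat \<phi> \<mu> s x r \<le> ennreal \<epsilon>)"
  obtain rr where rr: "\<And>n::nat. 0 < rr n" "rr \<longlonglongrightarrow> 0" "\<And>n. \<not> alpha_flat \<phi> \<mu> s x (rr n) \<le> ennreal \<epsilon>"
    using not_eventually_at_right_sequence[OF no] by blast
  \<comment> \<open>Comparing the flat number with the density needs at least one plane of dimension
    s; for an integer s between 0 and the dimension of the space there is one.\<close>
  obtain L :: "'a set" where L: "L \<in> grassmannian s"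
  proof -
    obtain m :: int where m: "s = of_int m" using s(3) by (auto elim: Ints_cases)
    then have "nat m \<le> dim (UNIV :: 'a set)" using s(1,2) by (simp add: dim_UNIV)
    then obtain T :: "'a set" where "subspace T" "dim T = nat m" using choose_subspace_of_subspace[of "nat m" "UNIV :: 'a set"] by auto
    then have "T \<in> grassmannian s" using m s(1) by (simp add: grassmannian_def)
    then show ?thesis by (rule that)
  qed
  have low: "ennreal (\<epsilon> / 16 * rr n powr s) \<le> emeasure \<mu> (ball x (4 * rr n))" for n
  proof -
    have r: "0 < rr n" by (rule rr(1))
    have "ennreal \<epsilon> \<le> alpha_flat \<phi> \<mu> s x (rr n)" using rr(3)[of n] by simp
    also have "\<dots> \<le> ennreal (16 * (rr n powr - s * measure \<mu> (ball x (4 * rr n))))"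
      by (rule alpha_flat_le_density[OF lf \<phi> L r s(1)])
    finally have "\<epsilon> \<le> 16 * (rr n powr - s * measure \<mu> (ball x (4 * rr n)))"
      using \<epsilon> by (subst (asm) ennreal_le_iff) simp_all
    then have "rr n powr s * \<epsilon> \<le> rr n powr s * (16 * (rr n powr - s * measure \<mu> (ball x (4 * rr n))))"
      by (intro mult_left_mono) auto
    also have "\<dots> = 16 * measure \<mu> (ball x (4 * rr n))" using r by (simp add: powr_minus)
    finally have "ennreal (\<epsilon> / 16 * rr n powr s) \<le> ennreal (measure \<mu> (ball x (4 * rr n)))"
      by (intro ennreal_leI) (simp add: mult.commute)
    also have "\<dots> = emeasure \<mu> (ball x (4 * rr n))"
      using emeasure_bounded_finite[OF lf bounded_ball, of x "4 * rr n"] by (simp add: emeasure_eq_ennreal_measure less_top)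
    finally show ?thesis .
  qed
  have "0 < \<epsilon> / 16" using \<epsilon> by simp
  with x[unfolded flat_point_def, THEN spec[of _ rr], THEN spec[of _ "\<epsilon> / 16"]] rr(1,2) low
  obtain k V \<kappa> where V: "subspace V" "real (dim V) = s" "0 < measure (hausdorff_on s V) (cball 0 1)"
    and lim: "\<And>f :: 'a \<Rightarrow> real. cont_compact f \<Longrightarrow>
        (\<lambda>n. rr (k n) powr - s * (LINT y|\<mu>. f ((y - x) /\<^sub>R rr (k n)))) \<longlonglongrightarrow> \<kappa> * (LINT y|hausdorff_on s V. f y)"
    by blast
  have "V \<in> grassmannian s" using V by (simp add: grassmannian_def)
  from alpha_flat_small_along_blowups[OF lf \<phi> s(1) this V(3) rr(1) lim \<epsilon>]
  obtain n where "alpha_flat \<phi> \<mu> s x (rr (k n)) < ennreal \<epsilon>" by blast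
  then show False using rr(3)[of "k n"] by simp
qed

section \<open>The converse\<close>

lemma cutoff_kernel:
  fixes x :: "'a::euclidean_space"
  assumes \<eta>: "cutoff_family \<eta>" and \<tau>: "0 < \<tau>" "\<tau> < 1" and r: "0 < r"
  shows "continuous_on UNIV (\<lambda>y. \<eta> \<tau> (norm (x - y) / r) *\<^sub>R (x - y))"
    and "\<bar>\<eta> \<tau> (norm (x - y) / r)\<bar> \<le> 1"
    and "r \<le> norm (x - y) \<Longrightarrow> \<eta> \<tau> (norm (x - y) / r) = 0"
proof -
  have eq: "\<eta> \<tau> (norm (x - y) / r) = max 0 (min 1 ((1 - norm (x - y) / r) / \<tau>))" for y
    using r by (intro cutoff_family_eq[OF \<eta> \<tau>]) simp
  show "continuous_on UNIV (\<lambda>y. \<eta> \<tau> (norm (x - y) / r) *\<^sub>R (x - y))"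
    unfolding eq using \<tau> r by (intro continuous_intros) auto
  show "\<bar>\<eta> \<tau> (norm (x - y) / r)\<bar> \<le> 1" unfolding eq by linarith
  show "\<eta> \<tau> (norm (x - y) / r) = 0" if "r \<le> norm (x - y)"
  proof -
    have "1 \<le> norm (x - y) / r" using that r by (simp add: pos_le_divide_eq)
    then show ?thesis using \<eta> \<tau> unfolding cutoff_family_def by auto
  qed
qed

lemma kernel_integral_bound:
  fixes \<mu> :: "'a::euclidean_space measure" and x :: 'a
  assumes lf: "locally_finite_borel_measure \<mu>" and \<eta>: "cutoff_family \<eta>" and \<tau>: "0 < \<tau>" "\<tau> < 1" and r: "0 < r"
  shows "integrable \<mu> (\<lambda>y. \<eta> \<tau> (norm (x - y) / r) *\<^sub>R (x - y))"
    and "norm (LINT y|\<mu>. \<eta> \<tau> (norm (x - y) / r) *\<^sub>R (x - y)) \<le> r * measure \<mu> (ball x r)"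
proof -
  have m: "(\<lambda>y. \<eta> \<tau> (norm (x - y) / r) *\<^sub>R (x - y)) \<in> borel_measurable borel"
    by (rule borel_measurable_continuous_onI[OF cutoff_kernel(1)[OF \<eta> \<tau> r]])
  have bd: "norm (\<eta> \<tau> (norm (x - y) / r) *\<^sub>R (x - y)) \<le> r" if "y \<in> ball x r" for y
  proof -
    have "\<bar>\<eta> \<tau> (norm (x - y) / r)\<bar> * norm (x - y) \<le> 1 * r"
      using that r by (intro mult_mono cutoff_kernel(2)[OF \<eta> \<tau> r]) (auto simp: dist_norm)
    then show ?thesis by simp
  qed
  have out: "\<eta> \<tau> (norm (x - y) / r) *\<^sub>R (x - y) = 0" if "y \<notin> ball x r" for y
    using that cutoff_kernel(3)[OF \<eta> \<tau> r, of x y] by (simp add: dist_norm)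
  show "integrable \<mu> (\<lambda>y. \<eta> \<tau> (norm (x - y) / r) *\<^sub>R (x - y))"
    using integral_bounded_support(1)[OF lf m bd out bounded_ball] by simp
  show "norm (LINT y|\<mu>. \<eta> \<tau> (norm (x - y) / r) *\<^sub>R (x - y)) \<le> r * measure \<mu> (ball x r)"
    using integral_bounded_support(2)[OF lf m bd out bounded_ball] by simp
qed

lemma kernel_limit_of_zero_density:
  fixes \<mu> :: "'a::euclidean_space measure" and x :: 'a
  assumes lf: "locally_finite_borel_measure \<mu>" and \<eta>: "cutoff_family \<eta>" and \<tau>: "0 < \<tau>" "\<tau> < 1"
    and x: "upper_density \<mu> s x = 0"
  shows "((\<lambda>r. (1 / r powr (s + 1)) *\<^sub>R (LINT y|\<mu>. \<eta> \<tau> (norm (x - y) / r) *\<^sub>R (x - y))) \<longlongrightarrow> 0) (at_right 0)"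
proof (rule tendstoI)
  fix e :: real assume e: "0 < e"
  define T where "T r = (LINT y|\<mu>. \<eta> \<tau> (norm (x - y) / r) *\<^sub>R (x - y))" for r
  have "upper_density \<mu> s x < ennreal (e / 2)" unfolding x using e by simp
  from upper_density_lessD[OF this] eventually_at_right_less[of "0::real"]
  have "\<forall>\<^sub>F r in at_right 0. dist ((1 / r powr (s + 1)) *\<^sub>R T r) 0 < e"
  proof eventually_elim
    case (elim r)
    have r: "0 < r" by (rule elim(2))
    have "measure \<mu> (ball x r) \<le> e / 2 * r powr s"
      unfolding measure_def using elim(1) e by (intro enn2real_leI) auto
    then have "r * measure \<mu> (ball x r) \<le> r * (e / 2 * r powr s)" using r by (intro mult_left_mono) auto
    then have "norm (T r) \<le> r * (e / 2 * r powr s)"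
      unfolding T_def by (rule order_trans[OF kernel_integral_bound(2)[OF lf \<eta> \<tau> r]])
    also have "\<dots> = e / 2 * r powr (s + 1)" using r by (simp add: powr_add)
    finally have "norm (T r) / r powr (s + 1) \<le> e / 2" using r by (simp add: pos_divide_le_eq)
    moreover have "dist ((1 / r powr (s + 1)) *\<^sub>R T r) 0 = norm (T r) / r powr (s + 1)" by simp
    ultimately show ?case using e by linarith
  qed
  then show "\<forall>\<^sub>F r in at_right 0. dist ((1 / r powr (s + 1)) *\<^sub>R (LINT y|\<mu>. \<eta> \<tau> (norm (x - y) / r) *\<^sub>R (x - y))) 0 < e"
    unfolding T_def .
qed

text \<open>By the product rule the cut-off kernel has Lipschitz constant at most 1 + 1 / \<tau>:
  the cutoff is bounded by 1, and its slope 1 / (\<tau> r) meets a vector of length at most r. Since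
  this is at most 2 / \<tau>, the factor \<tau> / (2 r) gives the constant 1 / r.\<close>

lemma kernel_test_function:
  fixes x b :: "'a::euclidean_space"
  assumes \<eta>: "cutoff_family \<eta>" and \<tau>: "0 < \<tau>" "\<tau> < 1" and r: "0 < r" and b: "norm b \<le> 1"
  defines "f \<equiv> \<lambda>y. \<tau> / (2 * r) * ((\<eta> \<tau> (norm (x - y) / r) *\<^sub>R (x - y)) \<bullet> b)"
  shows "f \<in> Lip0 (ball x (4 * r))" "(1 / r)-lipschitz_on UNIV f"
proof -
  have near: "\<bar>f y - f z\<bar> \<le> 1 / r * norm (y - z)" if z: "norm (x - z) \<le> r" for y z
  proof -
    define h where "h y = \<eta> \<tau> (norm (x - y) / r)" for y
    have h1: "\<bar>h y\<bar> \<le> 1" unfolding h_def by (rule cutoff_kernel(2)[OF \<eta> \<tau> r])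
    have lip: "(1 / \<tau>)-lipschitz_on {0..} (\<eta> \<tau>)" using \<eta> \<tau> by (simp add: cutoff_family_def)
    have "\<bar>h y - h z\<bar> \<le> 1 / \<tau> * \<bar>norm (x - y) / r - norm (x - z) / r\<bar>"
      using lipschitz_onD[OF lip, of "norm (x - y) / r" "norm (x - z) / r"] r by (simp add: h_def dist_real_def)
    also have "\<bar>norm (x - y) / r - norm (x - z) / r\<bar> = \<bar>norm (x - y) - norm (x - z)\<bar> / r"
      using r by (simp add: diff_divide_distrib[symmetric])
    also have "1 / \<tau> * (\<bar>norm (x - y) - norm (x - z)\<bar> / r) \<le> 1 / \<tau> * (norm (y - z) / r)"
      using norm_triangle_ineq3[of "x - y" "x - z"] \<tau> r by (intro mult_left_mono divide_right_mono) (auto simp: norm_minus_commute)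
    finally have h2: "\<bar>h y - h z\<bar> \<le> norm (y - z) / (\<tau> * r)" by simp
    have i1: "\<bar>(z - y) \<bullet> b\<bar> \<le> norm (y - z)"
      using Cauchy_Schwarz_ineq2[of "z - y" b] mult_left_mono[OF b norm_ge_zero[of "z - y"]] by (simp add: norm_minus_commute)
    have i2: "\<bar>(x - z) \<bullet> b\<bar> \<le> r"
      using Cauchy_Schwarz_ineq2[of "x - z" b] mult_left_mono[OF b norm_ge_zero[of "x - z"]] z by simp
    have "(h y *\<^sub>R (x - y)) \<bullet> b - (h z *\<^sub>R (x - z)) \<bullet> b = h y * ((z - y) \<bullet> b) + (h y - h z) * ((x - z) \<bullet> b)"
      by (simp add: inner_diff_left algebra_simps)
    then have "\<bar>(h y *\<^sub>R (x - y)) \<bullet> b - (h z *\<^sub>R (x - z)) \<bullet> b\<bar> \<le> \<bar>h y\<bar> * \<bar>(z - y) \<bullet> b\<bar> + \<bar>h y - h z\<bar> * \<bar>(x - z) \<bullet> b\<bar>"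
      by (simp only: abs_mult[symmetric] abs_triangle_ineq)
    also have "\<dots> \<le> 1 * norm (y - z) + norm (y - z) / (\<tau> * r) * r"
      using h1 h2 i1 i2 \<tau> r by (intro add_mono mult_mono) auto
    also have "\<dots> = (1 + 1 / \<tau>) * norm (y - z)" using \<tau> r by (simp add: field_simps)
    finally have main: "\<bar>(h y *\<^sub>R (x - y)) \<bullet> b - (h z *\<^sub>R (x - z)) \<bullet> b\<bar> \<le> (1 + 1 / \<tau>) * norm (y - z)" .
    have "f y - f z = \<tau> / (2 * r) * ((h y *\<^sub>R (x - y)) \<bullet> b - (h z *\<^sub>R (x - z)) \<bullet> b)"
      by (simp only: f_def h_def right_diff_distrib)
    then have "\<bar>f y - f z\<bar> = \<tau> / (2 * r) * \<bar>(h y *\<^sub>R (x - y)) \<bullet> b - (h z *\<^sub>R (x - z)) \<bullet> b\<bar>"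
      using \<tau> r by (simp only: abs_mult) simp
    also have "\<dots> \<le> \<tau> / (2 * r) * ((1 + 1 / \<tau>) * norm (y - z))"
      using main \<tau> r by (intro mult_left_mono) auto
    also have "\<dots> = (\<tau> + 1) / 2 * (1 / r * norm (y - z))" using \<tau> r by (simp add: field_simps)
    also have "\<dots> \<le> 1 * (1 / r * norm (y - z))" using \<tau> r by (intro mult_right_mono) auto
    finally show ?thesis by simp
  qed
  have out: "f y = 0" if "r \<le> norm (x - y)" for y
    using cutoff_kernel(3)[OF \<eta> \<tau> r that] by (simp add: f_def)
  show lip: "(1 / r)-lipschitz_on UNIV f"
  proof (rule lipschitz_onI)
    fix y z :: 'a
    consider "norm (x - z) \<le> r" | "norm (x - y) \<le> r" | "r \<le> norm (x - y)" "r \<le> norm (x - z)" by linarith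
    then show "dist (f y) (f z) \<le> 1 / r * dist y z"
    proof cases
      case 1
      then show ?thesis using near[of z y] by (simp add: dist_norm)
    next
      case 2
      then show ?thesis using near[of y z] by (simp add: dist_norm norm_minus_commute abs_minus_commute)
    next
      case 3
      then show ?thesis using r by (simp add: out)
    qed
  qed (use r in simp)
  have "f y = 0" if "y \<notin> cball x r" for y using that by (intro out) (simp add: dist_norm)
  moreover have "cball x r \<subseteq> ball x (4 * r)" using r by auto
  ultimately show "f \<in> Lip0 (ball x (4 * r))" unfolding Lip0_def using lip compact_cball[of x r] by blast
qed

text \<open>The test function is odd about x, so the plane term is 0 whatever the constant
  \<open>flat_const\<close> is, and \<phi> equals 1 where the test function is nonzero. The value is
  the same for all planes and therefore bounds the infimum.\<close>

lemma alpha_flat_ge_kernel: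
  fixes \<mu> :: "'a::euclidean_space measure" and x b :: 'a
  assumes lf: "locally_finite_borel_measure \<mu>" and \<eta>: "cutoff_family \<eta>" and \<phi>: "flat_cutoff \<phi>"
    and \<tau>: "0 < \<tau>" "\<tau> < 1" and r: "0 < r" and s: "0 < s" and b: "norm b \<le> 1"
  shows "ennreal (\<tau> / 2 * \<bar>(1 / r powr (s + 1)) * ((LINT y|\<mu>. \<eta> \<tau> (norm (x - y) / r) *\<^sub>R (x - y)) \<bullet> b)\<bar>) \<le> alpha_flat \<phi> \<mu> s x r"
proof -
  define f where "f = (\<lambda>y. \<tau> / (2 * r) * ((\<eta> \<tau> (norm (x - y) / r) *\<^sub>R (x - y)) \<bullet> b))"
  have f: "f \<in> Lip0 (ball x (4 * r))" "(1 / r)-lipschitz_on UNIV f"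
    unfolding f_def by (rule kernel_test_function[OF \<eta> \<tau> r b])+
  have \<phi>f: "\<phi> (norm (y - x) / r) * f y = f y" for y
  proof (cases "r \<le> norm (x - y)")
    case True
    then show ?thesis using cutoff_kernel(3)[OF \<eta> \<tau> r True] by (simp add: f_def)
  next
    case False
    then have "norm (y - x) / r \<le> 3" using r by (simp add: pos_divide_le_eq norm_minus_commute)
    then show ?thesis using flat_cutoff_inside[OF \<phi>, of "norm (y - x) / r"] r by simp
  qed
  have zero: "(LINT y|hausdorff_on s ((+) x ` L). f y) = 0" if "L \<in> grassmannian s" for L
  proof (rule integral_hausdorff_on_odd)
    show "subspace L" using that by (simp add: grassmannian_def)
    show "f \<in> borel_measurable borel"
      using lipschitz_on_continuous_on[OF f(2)] by (rule borel_measurable_continuous_onI)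
    show "f (2 *\<^sub>R x - y) = - f y" for y
    proof -
      have "x - (2 *\<^sub>R x - y) = - (x - y)" by (simp add: scaleR_2)
      then show ?thesis by (simp only: f_def norm_minus_cancel scaleR_minus_right inner_minus_left mult_minus_right)
    qed
  qed (rule s)
  have int: "(LINT y|\<mu>. f y) = \<tau> / (2 * r) * ((LINT y|\<mu>. \<eta> \<tau> (norm (x - y) / r) *\<^sub>R (x - y)) \<bullet> b)"
    by (simp only: f_def integral_mult_right_zero integral_inner_left[OF kernel_integral_bound(1)[OF lf \<eta> \<tau> r]])
  have val: "(1 / r powr s) * (LINT y|\<mu>. f y) = \<tau> / 2 * ((1 / r powr (s + 1)) * ((LINT y|\<mu>. \<eta> \<tau> (norm (x - y) / r) *\<^sub>R (x - y)) \<bullet> b))"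
    unfolding int using r by (simp add: powr_add)
  have "ennreal \<bar>(1 / r powr s) * (LINT y|\<mu>. f y)\<bar> \<le> alpha_flat \<phi> \<mu> s x r"
    unfolding alpha_flat_def
  proof (rule INF_greatest)
    fix L :: "'a set" assume L: "L \<in> grassmannian s"
    show "ennreal \<bar>(1 / r powr s) * (LINT y|\<mu>. f y)\<bar> \<le> (SUP f\<in>{f \<in> Lip0 (ball x (4 * r)). (1 / r)-lipschitz_on UNIV f}.
          ennreal \<bar>(1 / r powr s) *
            ((LINT y|\<mu>. \<phi> (norm (y - x) / r) * f y) -
             flat_const \<phi> \<mu> s L x r *
               (LINT y|hausdorff_on s ((+) x ` L). \<phi> (norm (y - x) / r) * f y))\<bar>)"
      by (rule SUP_upper2[of f]) (use f in \<open>simp_all only: \<phi>f zero[OF L] mult_zero_right diff_zero mem_Collect_eq simp_thms order_refl\<close>)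
  qed
  then show ?thesis unfolding val using \<tau> by (simp add: abs_mult)
qed

text \<open>It suffices to treat each coordinate. The estimate loses a factor \<tau> / 2, which does
  no harm since \<tau> stays fixed while r tends to 0.\<close>

lemma kernel_limit_of_alpha_flat:
  fixes \<mu> :: "'a::euclidean_space measure" and x :: 'a
  assumes lf: "locally_finite_borel_measure \<mu>" and \<eta>: "cutoff_family \<eta>" and \<phi>: "flat_cutoff \<phi>"
    and \<tau>: "0 < \<tau>" "\<tau> < 1" and s: "0 < s"
    and x: "((\<lambda>r. alpha_flat \<phi> \<mu> s x r) \<longlongrightarrow> 0) (at_right 0)"
  shows "((\<lambda>r. (1 / r powr (s + 1)) *\<^sub>R (LINT y|\<mu>. \<eta> \<tau> (norm (x - y) / r) *\<^sub>R (x - y))) \<longlongrightarrow> 0) (at_right 0)"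
  unfolding tendsto_componentwise_iff[where l="0::'a"]
proof
  fix b :: 'a assume "b \<in> Basis"
  then have b: "norm b \<le> 1" by simp
  define T where "T r = (LINT y|\<mu>. \<eta> \<tau> (norm (x - y) / r) *\<^sub>R (x - y))" for r
  have "((\<lambda>r. (1 / r powr (s + 1)) * (T r \<bullet> b)) \<longlongrightarrow> 0) (at_right 0)"
  proof (rule tendstoI)
    fix e :: real assume e: "0 < e"
    have "\<forall>\<^sub>F r in at_right 0. alpha_flat \<phi> \<mu> s x r < ennreal (\<tau> / 2 * e)"
      using e \<tau> by (intro order_tendstoD(2)[OF x]) simp
    with eventually_at_right_less[of "0::real"]
    show "\<forall>\<^sub>F r in at_right 0. dist ((1 / r powr (s + 1)) * (T r \<bullet> b)) 0 < e"
    proof eventually_elim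
      case (elim r)
      have "ennreal (\<tau> / 2 * \<bar>(1 / r powr (s + 1)) * (T r \<bullet> b)\<bar>) < ennreal (\<tau> / 2 * e)"
        unfolding T_def by (rule order.strict_trans1[OF alpha_flat_ge_kernel[OF lf \<eta> \<phi> \<tau> elim(1) s b] elim(2)])
      then have "\<tau> / 2 * \<bar>(1 / r powr (s + 1)) * (T r \<bullet> b)\<bar> < \<tau> / 2 * e"
        using \<tau> by (subst (asm) ennreal_less_iff) simp_all
      then have "\<bar>(1 / r powr (s + 1)) * (T r \<bullet> b)\<bar> < e"
        by (rule mult_left_less_imp_less) (use \<tau> in simp)
      then show ?case by (simp only: dist_real_def diff_zero)
    qed
  qed
  then show "((\<lambda>r. ((1 / r powr (s + 1)) *\<^sub>R (LINT y|\<mu>. \<eta> \<tau> (norm (x - y) / r) *\<^sub>R (x - y))) \<bullet> b) \<longlongrightarrow> 0 \<bullet> b) (at_right 0)"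
    by (simp only: T_def inner_scaleR_left inner_zero_left)
qed

theorem theorem1p2:
  fixes \<mu> :: "'a::euclidean_space measure"
    and s :: real
    and \<eta> :: "real \<Rightarrow> real \<Rightarrow> real"
    and \<phi> :: "real \<Rightarrow> real"
  assumes "DIM('a) \<ge> 2"
    and "0 < s" and "s < real DIM('a)"
    and "cutoff_family \<eta>"
    and "flat_cutoff \<phi>"
    and "locally_finite_borel_measure \<mu>"
    and "AE x in \<mu>. upper_density \<mu> s x < \<infinity>"
  shows "small_local_action \<eta> (\<lambda>x::'a. x) s \<mu> \<longleftrightarrow>
           (s \<notin> \<int> \<and> (AE x in \<mu>. upper_density \<mu> s x = 0)) \<or>
           (s \<in> \<int> \<and> (AE x in \<mu>. ((\<lambda>r. alpha_flat \<phi> \<mu> s x r) \<longlongrightarrow> 0) (at_right 0)))"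
    (is "?small \<longleftrightarrow> ?zero \<or> ?flat")
proof
  note s = assms(2,3) and \<eta> = assms(4) and \<phi> = assms(5) and lf = assms(6) and fin = assms(7)
  assume ?small
  then have pts: "AE x in \<mu>. flat_point \<mu> s x" by (rule AE_flat_point[OF lf \<eta> s(1) fin])
  show "?zero \<or> ?flat"
  proof (cases "s \<in> \<int>")
    case True
    have "AE x in \<mu>. ((\<lambda>r. alpha_flat \<phi> \<mu> s x r) \<longlongrightarrow> 0) (at_right 0)"
      using pts by eventually_elim (rule flat_point_integer[OF lf \<phi> s True])
    then show ?thesis using True by blast
  next
    case False
    have "AE x in \<mu>. upper_density \<mu> s x = 0"
      using pts by eventually_elim (rule flat_point_non_integer[OF _ False])
    then show ?thesis using False by blast
  qed
next
  note s = assms(2) and \<eta> = assms(4) and \<phi> = assms(5) and lf = assms(6)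
  assume alt: "?zero \<or> ?flat"
  show ?small
    unfolding small_local_action_def
  proof
    fix \<tau> :: real assume "\<tau> \<in> {0<..<1}"
    then have \<tau>: "0 < \<tau>" "\<tau> < 1" by auto
    from alt show "AE x in \<mu>. ((\<lambda>r. (1 / r powr (s + 1)) *\<^sub>R (LINT y|\<mu>. \<eta> \<tau> (norm (x - y) / r) *\<^sub>R (x - y))) \<longlongrightarrow> 0) (at_right 0)"
    proof
      assume ?zero
      then have "AE x in \<mu>. upper_density \<mu> s x = 0" by blast
      then show ?thesis by eventually_elim (rule kernel_limit_of_zero_density[OF lf \<eta> \<tau>])
    next
      assume ?flat
      then have "AE x in \<mu>. ((\<lambda>r. alpha_flat \<phi> \<mu> s x r) \<longlongrightarrow> 0) (at_right 0)" by blast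
      then show ?thesis by eventually_elim (rule kernel_limit_of_alpha_flat[OF lf \<eta> \<phi> \<tau> s])
    qed
  qed
qed

end
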